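(* Let $\kappa,\tilde\mu>0$, $\theta_\pm\in\mathbb{R}$, let $s\ge4$ be an integer, and let $\underline a,\bar a,\underline b,\bar b>0$ be constants independent of $\varepsilon$. Assume the initial data satisfy $0<\underline a\le e^{-\varepsilon p^\varepsilon_{in}}\le\bar a$, $0<\underline b\le e^{\theta^\varepsilon_{in}}\le\bar b$ and $\|(p^\varepsilon_{in},u^\varepsilon_{in},\theta^\varepsilon_{in}-\tilde\theta)\|^2_{H^{s,\varepsilon}}\le\hat C_0<\infty$ for all $\varepsilon\in(0,1]$, with $\hat C_0$ independent of $\varepsilon$. Let $T_0,\varepsilon_0,\tilde C_0>0$ be the constants, depending only on $\hat C_0$ and $|\theta_+-\theta_-|$, such that for $\varepsilon\in(0,\varepsilon_0]$ the system $$\begin{cases}p^\varepsilon_t+u^\varepsilon p^\varepsilon_x+\frac1\varepsilon\left(2u^\varepsilon-\kappa e^{-\varepsilon p^\varepsilon+\theta^\varepsilon}\theta^\varepsilon_x\right)_x=\tilde\mu\varepsilon e^{-\varepsilon p^\varepsilon}|u^\varepsilon_x|^2+\kappa e^{-\varepsilon p^\varepsilon+\theta^\varepsilon}p^\varepsilon_x\theta^\varepsilon_x,\\ e^{-\theta^\varepsilon}[u^\varepsilon_t+u^\varepsilon u^\varepsilon_x]+\frac1\varepsilon p^\varepsilon_x=\tilde\mu e^{-\varepsilon p^\varepsilon}u^\varepsilon_{xx},\\ \theta^\varepsilon_t+u^\varepsilon\theta^\varepsilon_x+u^\varepsilon_x=\kappa e^{-\varepsilon p^\varepsilon}(e^{\theta^\varepsilon}\theta^\varepsilon_x)_x+\tilde\mu\varepsilon^2e^{-\varepsilon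 p^\varepsilon}|u^\varepsilon_x|^2\end{cases}$$ with initial data $(p^\varepsilon_{in},u^\varepsilon_{in},\theta^\varepsilon_{in})$ has a unique smooth solution $(p^\varepsilon,u^\varepsilon,\theta^\varepsilon)$ on $[0,T_0]$ with $\|(p^\varepsilon,u^\varepsilon,\theta^\varepsilon-\tilde\theta)(t)\|^2_{H^{s,\varepsilon}}\le\tilde C_0$ for $t\in[0,T_0]$. Assume further that $$(p^\varepsilon_{in},u^\varepsilon_{in},\theta^\varepsilon_{in}-\tilde\theta)\to(p_{in},u_{in},\theta_{in}-\tilde\theta)\quad\text{in }H^s(\mathbb{R})\text{ as }\varepsilon\to0,$$ and that $$|\theta_{in}(x)-\theta_+|\le Cx^{-1-\sigma}\quad\text{for }x\in[1,+\infty),$$ where $\sigma$ and $C$ are some positive constants. Then the solutions $(p^\varepsilon,u^\varepsilon,\theta^\varepsilon)$ converge strongly in $L^2(0,T_0;H^{s'}_{loc}(\mathbb{R}))$, for all $s'<s$, to $(0,\overline u,\overline\theta)$, where $(\overline u,\overline\theta)$ is the unique solution of $$\begin{cases}(2u-\kappa e^\theta\theta_x)_x=0,\\ e^{-\theta}(u_t+uu_x)+\pi_x=(\tilde\mu u_x)_x,\\ \theta_t+u\theta_x+u_x=(\kappa e^\theta\theta_x)_x,\end{cases}$$ with initial data $(w_{in},\theta_{in})$, where $w_{in}$ is determined by $w_{in}=\frac12\kappa e^{\theta_{in}}\partial_x\theta_{in}$.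
   Context: Put $\rho_\pm=e^{-\theta_\pm}$. $\Xi(\eta)$, $\eta=\frac{x}{\sqrt{1+t}}$, is the unique self-similar solution of $\rho_t=\left(\frac\kappa2\frac{\rho_x}{\rho}\right)_x$ with $\Xi(\pm\infty)=\rho_\pm$, and $\tilde\theta(x,t)=-\ln\Xi(x/\sqrt{1+t})$, so $\tilde\theta\to\theta_\pm$ as $x\to\pm\infty$. The asymptotic states are $p^\varepsilon\to0$, $u^\varepsilon\to0$, $\theta^\varepsilon\to\theta_\pm$ as $x\to\pm\infty$. For $\alpha=(\alpha_0,\alpha_1)$, $\partial^\alpha=(\varepsilon\partial_t)^{\alpha_0}\partial_x^{\alpha_1}$, and $$\begin{aligned}\|(p^\varepsilon,u^\varepsilon,\theta^\varepsilon-\tilde\theta)(t)\|^2_{H^{s,\varepsilon}}=&\sum_{|\alpha|=0}^s\|\partial^\alpha(p^\varepsilon,u^\varepsilon)(t)\|^2_{L^2}+\sum_{|\alpha|=0}^{s+1}\|\partial^\alpha(\varepsilon p^\varepsilon,\varepsilon u^\varepsilon)(t)\|^2_{L^2}+\|(\theta^\varepsilon-\tilde\theta)(t)\|^2_{L^2}+\sum_{|\alpha|=1}^{s+1}\|\partial^\alpha\theta^\varepsilon(t)\|^2_{L^2}\\&+\sum_{|\alpha|=0}^s\int_0^t\|\partial^\alpha(p^\varepsilon_x,u^\varepsilon_x)(\tau)\|^2_{L^2}d\tau+\sum_{|\alpha|=0}^{s+1}\int_0^t\|\partial^\alpha(\varepsilon u^\varepsilon_x,\theta^\varepsilon_x)(\tau)\|^2_{L^2}d\tau.\end{aligned}$$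 For initial data the norm is this expression at $t=0$, with $\tilde\theta=\tilde\theta(\cdot,0)$ and with time derivatives of the initial data defined through the system. In the limit system $\pi$ is an unknown (pressure-like) scalar function. *)

theory Defs
  imports "HOL-Analysis.Analysis"
begin

section \<open>Derivatives and classical regularity\<close>

text \<open>Space-time functions take the time first: f t x.\<close>

type_synonym field = "real \<Rightarrow> real \<Rightarrow> real"

definition dx :: "field \<Rightarrow> field" where
  "dx f = (\<lambda>t x. deriv (f t) x)"

text \<open>On the strip \<open>[0,T] \<times> \<real>\<close>; one-sided at \<open>t = 0\<close> and \<open>t = T\<close>.\<close>

definition dt :: "real \<Rightarrow> field \<Rightarrow> field" where
  "dt T f = (\<lambda>t x. vector_derivative (\<lambda>\<tau>. f \<tau> x) (at t within {0..T}))"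

primrec C_strip :: "nat \<Rightarrow> real \<Rightarrow> field \<Rightarrow> bool" where
  "C_strip 0 T f \<longleftrightarrow> continuous_on ({0..T} \<times> UNIV) (\<lambda>(t, x). f t x)"
| "C_strip (Suc n) T f \<longleftrightarrow>
     continuous_on ({0..T} \<times> UNIV) (\<lambda>(t, x). f t x) \<and>
     (\<forall>t\<in>{0..T}. \<forall>x. f t differentiable (at x) \<and>
        (\<lambda>\<tau>. f \<tau> x) differentiable (at t within {0..T})) \<and>
     C_strip n T (dx f) \<and> C_strip n T (dt T f)"

definition C_line :: "nat \<Rightarrow> (real \<Rightarrow> real) \<Rightarrow> bool" where
  "C_line n f \<longleftrightarrow> (\<forall>j<n. \<forall>x. (deriv ^^ j) f differentiable (at x)) \<and>
     continuous_on UNIV ((deriv ^^ n) f)"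

definition test_function :: "(real \<Rightarrow> real) \<Rightarrow> bool" where
  "test_function \<phi> \<longleftrightarrow> (\<forall>n. C_line n \<phi>) \<and> (\<exists>R. \<forall>x. \<bar>x\<bar> > R \<longrightarrow> \<phi> x = 0)"

section \<open>Sobolev spaces on the line\<close>

definition L2sq :: "(real \<Rightarrow> real) \<Rightarrow> ennreal" where
  "L2sq f = (\<integral>\<^sup>+x. ennreal ((f x)\<^sup>2) \<partial>lborel)"

definition locally_integrable :: "(real \<Rightarrow> real) \<Rightarrow> bool" where
  "locally_integrable f \<longleftrightarrow> (\<forall>K. compact K \<longrightarrow> set_integrable lborel K f)"

definition has_weak_deriv :: "(real \<Rightarrow> real) \<Rightarrow> (real \<Rightarrow> real) \<Rightarrow> bool" where
  "has_weak_deriv f g \<longleftrightarrow> locally_integrable f \<and> locally_integrable g \<and>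
     (\<forall>\<phi>. test_function \<phi> \<longrightarrow>
        (\<integral>x. f x * deriv \<phi> x \<partial>lborel) = - (\<integral>x. g x * \<phi> x \<partial>lborel))"

text \<open>A representative of the weak derivative, which is determined only almost everywhere.\<close>

definition weak_deriv :: "(real \<Rightarrow> real) \<Rightarrow> real \<Rightarrow> real" where
  "weak_deriv f = (SOME g. has_weak_deriv f g)"

text \<open>Squared norm of \<open>H\<^sup>m(\<real>)\<close> for integer m, infinite outside \<open>H\<^sup>m(\<real>)\<close>.\<close>

definition Hsq :: "nat \<Rightarrow> (real \<Rightarrow> real) \<Rightarrow> ennreal" where
  "Hsq m f =
     (if locally_integrable f \<and>
         (\<forall>j<m. has_weak_deriv ((weak_deriv ^^ j) f) ((weak_deriv ^^ Suc j) f))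
      then \<Sum>j\<le>m. L2sq ((weak_deriv ^^ j) f) else \<infinity>)"

text \<open>Convergence in \<open>H\<^sup>m(\<real>)\<close> as \<open>\<epsilon> \<rightarrow> 0+\<close>.\<close>

definition converges_H :: "nat \<Rightarrow> (real \<Rightarrow> real \<Rightarrow> real) \<Rightarrow> (real \<Rightarrow> real) \<Rightarrow> bool" where
  "converges_H m F f \<longleftrightarrow> Hsq m f < \<infinity> \<and>
     ((\<lambda>\<epsilon>. Hsq m (\<lambda>x. F \<epsilon> x - f x)) \<longlongrightarrow> 0) (at_right 0)"

text \<open>For real r, a function lies in \<open>H\<^sup>r\<^sub>l\<^sub>o\<^sub>c(\<real>)\<close> iff its product with every test
  function lies in \<open>H\<^sup>r(\<real>)\<close>. That product has compact support, so its Fourier transform is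
  an ordinary integral; the normalisation of the transform only scales the seminorms.\<close>

definition fourier :: "(real \<Rightarrow> real) \<Rightarrow> real \<Rightarrow> complex" where
  "fourier f \<xi> = (\<integral>x. cis (- (\<xi> * x)) * complex_of_real (f x) \<partial>lborel)"

definition Hloc_sq :: "real \<Rightarrow> (real \<Rightarrow> real) \<Rightarrow> (real \<Rightarrow> real) \<Rightarrow> ennreal" where
  "Hloc_sq r \<phi> f =
     (\<integral>\<^sup>+\<xi>. ennreal ((1 + \<xi>\<^sup>2) powr r * (cmod (fourier (\<lambda>x. \<phi> x * f x) \<xi>))\<^sup>2) \<partial>lborel)"

text \<open>Strong convergence in \<open>L\<^sup>2(0,T; H\<^sup>r\<^sub>l\<^sub>o\<^sub>c(\<real>))\<close> as \<open>\<epsilon> \<rightarrow> 0+\<close>.\<close>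

definition converges_L2_Hloc :: "real \<Rightarrow> real \<Rightarrow> (real \<Rightarrow> field) \<Rightarrow> field \<Rightarrow> bool" where
  "converges_L2_Hloc r T F f \<longleftrightarrow>
     (\<forall>\<phi>. test_function \<phi> \<longrightarrow>
        ((\<lambda>\<epsilon>. \<integral>\<^sup>+t\<in>{0..T}. Hloc_sq r \<phi> (\<lambda>x. F \<epsilon> t x - f t x) \<partial>lborel) \<longlongrightarrow> 0) (at_right 0))"

section \<open>The diffusion wave\<close>

definition self_similar_profile ::
    "real \<Rightarrow> real \<Rightarrow> real \<Rightarrow> (real \<Rightarrow> real) \<Rightarrow> bool" where
  "self_similar_profile \<kappa> \<rho>m \<rho>p \<Xi> \<longleftrightarrow>
     (\<forall>\<eta>. \<Xi> \<eta> > 0) \<and> C_line 2 \<Xi> \<and>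
     (let \<rho> = (\<lambda>t x. \<Xi> (x / sqrt (1 + t))) in
        \<forall>t\<ge>0. \<forall>x. deriv (\<lambda>\<tau>. \<rho> \<tau> x) t = dx (\<lambda>t x. \<kappa> / 2 * (dx \<rho> t x / \<rho> t x)) t x) \<and>
     (\<Xi> \<longlongrightarrow> \<rho>m) at_bot \<and> (\<Xi> \<longlongrightarrow> \<rho>p) at_top"

definition theta_wave :: "(real \<Rightarrow> real) \<Rightarrow> field" where
  "theta_wave \<Xi> = (\<lambda>t x. - ln (\<Xi> (x / sqrt (1 + t))))"

section \<open>The rescaled compressible system\<close>

definition solves_system ::
    "real \<Rightarrow> real \<Rightarrow> real \<Rightarrow> real \<Rightarrow> field \<Rightarrow> field \<Rightarrow> field \<Rightarrow> bool" where
  "solves_system \<epsilon> \<kappa> \<mu> T p u \<theta> \<longleftrightarrow>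
     (\<forall>t\<in>{0..T}. \<forall>x.
        dt T p t x + u t x * dx p t x
          + 1 / \<epsilon> * dx (\<lambda>t x. 2 * u t x - \<kappa> * exp (- \<epsilon> * p t x + \<theta> t x) * dx \<theta> t x) t x
        = \<mu> * \<epsilon> * exp (- \<epsilon> * p t x) * (dx u t x)\<^sup>2
          + \<kappa> * exp (- \<epsilon> * p t x + \<theta> t x) * dx p t x * dx \<theta> t x
      \<and> exp (- \<theta> t x) * (dt T u t x + u t x * dx u t x) + 1 / \<epsilon> * dx p t x
        = \<mu> * exp (- \<epsilon> * p t x) * dx (dx u) t x
      \<and> dt T \<theta> t x + u t x * dx \<theta> t x + dx u t x
        = \<kappa> * exp (- \<epsilon> * p t x) * dx (\<lambda>t x. exp (\<theta> t x) * dx \<theta> t x) t x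
          + \<mu> * \<epsilon>\<^sup>2 * exp (- \<epsilon> * p t x) * (dx u t x)\<^sup>2)"

text \<open>All derivatives that occur in the norm \<open>H\<^sup>s\<^sup>,\<^sup>\<epsilon>\<close> below have order at most \<open>s + 2\<close>;
  a smooth solution is one for which these are classical and continuous up to \<open>t = 0\<close>.\<close>

definition smooth_solution ::
    "nat \<Rightarrow> real \<Rightarrow> real \<Rightarrow> real \<Rightarrow> real \<Rightarrow> real \<Rightarrow> real \<Rightarrow>
     (real \<Rightarrow> real) \<Rightarrow> (real \<Rightarrow> real) \<Rightarrow> (real \<Rightarrow> real) \<Rightarrow> field \<Rightarrow> field \<Rightarrow> field \<Rightarrow> bool" where
  "smooth_solution s \<epsilon> \<kappa> \<mu> \<theta>m \<theta>p T p_in u_in \<theta>_in p u \<theta> \<longleftrightarrow>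
     C_strip (s + 2) T p \<and> C_strip (s + 2) T u \<and> C_strip (s + 2) T \<theta> \<and>
     solves_system \<epsilon> \<kappa> \<mu> T p u \<theta> \<and>
     (\<forall>x. p 0 x = p_in x \<and> u 0 x = u_in x \<and> \<theta> 0 x = \<theta>_in x) \<and>
     (\<forall>t\<in>{0..T}.
        (p t \<longlongrightarrow> 0) at_bot \<and> (p t \<longlongrightarrow> 0) at_top \<and>
        (u t \<longlongrightarrow> 0) at_bot \<and> (u t \<longlongrightarrow> 0) at_top \<and>
        (\<theta> t \<longlongrightarrow> \<theta>m) at_bot \<and> (\<theta> t \<longlongrightarrow> \<theta>p) at_top)"

text \<open>\<open>(\<epsilon>\<partial>\<^sub>t)\<^sup>a \<partial>\<^sub>x\<^sup>b\<close>. The time derivatives are taken first, so that at \<open>t = 0\<close> only the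
  spatial regularity of the a-th time derivative at \<open>t = 0\<close> enters.\<close>

definition D :: "real \<Rightarrow> real \<Rightarrow> nat \<times> nat \<Rightarrow> field \<Rightarrow> field" where
  "D \<epsilon> T \<alpha> f = (\<lambda>t x. \<epsilon> ^ fst \<alpha> * (dx ^^ snd \<alpha>) ((dt T ^^ fst \<alpha>) f) t x)"

definition orders :: "nat \<Rightarrow> nat \<Rightarrow> (nat \<times> nat) set" where
  "orders m n = {(a, b). m \<le> a + b \<and> a + b \<le> n}"

text \<open>The squared norm \<open>H\<^sup>s\<^sup>,\<^sup>\<epsilon>\<close> of \<open>(p, u, \<theta> - \<theta>w)\<close> at time t; \<open>\<theta>w\<close> enters only the term of
  order zero.\<close>

definition Heps_sq ::
    "nat \<Rightarrow> real \<Rightarrow> real \<Rightarrow> field \<Rightarrow> field \<Rightarrow> field \<Rightarrow> field \<Rightarrow> real \<Rightarrow> ennreal" where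
  "Heps_sq s \<epsilon> T \<theta>w p u \<theta> t =
     (\<Sum>\<alpha>\<in>orders 0 s. L2sq (D \<epsilon> T \<alpha> p t) + L2sq (D \<epsilon> T \<alpha> u t))
   + (\<Sum>\<alpha>\<in>orders 0 (s + 1).
        L2sq (\<lambda>x. \<epsilon> * D \<epsilon> T \<alpha> p t x) + L2sq (\<lambda>x. \<epsilon> * D \<epsilon> T \<alpha> u t x))
   + L2sq (\<lambda>x. \<theta> t x - \<theta>w t x)
   + (\<Sum>\<alpha>\<in>orders 1 (s + 1). L2sq (D \<epsilon> T \<alpha> \<theta> t))
   + (\<Sum>\<alpha>\<in>orders 0 s. \<integral>\<^sup>+\<tau>\<in>{0..t}.
        (L2sq (D \<epsilon> T \<alpha> (dx p) \<tau>) + L2sq (D \<epsilon> T \<alpha> (dx u) \<tau>)) \<partial>lborel)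
   + (\<Sum>\<alpha>\<in>orders 0 (s + 1). \<integral>\<^sup>+\<tau>\<in>{0..t}.
        (L2sq (\<lambda>x. \<epsilon> * D \<epsilon> T \<alpha> (dx u) \<tau> x) + L2sq (D \<epsilon> T \<alpha> (dx \<theta>) \<tau>)) \<partial>lborel)"

section \<open>Time derivatives of the initial data\<close>

text \<open>The system solved for \<open>p\<^sub>t\<close>, \<open>u\<^sub>t\<close>, \<open>\<theta>\<^sub>t\<close>.\<close>

definition rhs_p :: "real \<Rightarrow> real \<Rightarrow> real \<Rightarrow> field \<Rightarrow> field \<Rightarrow> field \<Rightarrow> field" where
  "rhs_p \<epsilon> \<kappa> \<mu> p u \<theta> = (\<lambda>t x.
     \<mu> * \<epsilon> * exp (- \<epsilon> * p t x) * (dx u t x)\<^sup>2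
     + \<kappa> * exp (- \<epsilon> * p t x + \<theta> t x) * dx p t x * dx \<theta> t x
     - u t x * dx p t x
     - 1 / \<epsilon> * dx (\<lambda>t x. 2 * u t x - \<kappa> * exp (- \<epsilon> * p t x + \<theta> t x) * dx \<theta> t x) t x)"

definition rhs_u :: "real \<Rightarrow> real \<Rightarrow> real \<Rightarrow> field \<Rightarrow> field \<Rightarrow> field \<Rightarrow> field" where
  "rhs_u \<epsilon> \<kappa> \<mu> p u \<theta> = (\<lambda>t x.
     exp (\<theta> t x) * (\<mu> * exp (- \<epsilon> * p t x) * dx (dx u) t x - 1 / \<epsilon> * dx p t x)
     - u t x * dx u t x)"

definition rhs_theta :: "real \<Rightarrow> real \<Rightarrow> real \<Rightarrow> field \<Rightarrow> field \<Rightarrow> field \<Rightarrow> field" where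
  "rhs_theta \<epsilon> \<kappa> \<mu> p u \<theta> = (\<lambda>t x.
     \<kappa> * exp (- \<epsilon> * p t x) * dx (\<lambda>t x. exp (\<theta> t x) * dx \<theta> t x) t x
     + \<mu> * \<epsilon>\<^sup>2 * exp (- \<epsilon> * p t x) * (dx u t x)\<^sup>2
     - u t x * dx \<theta> t x - dx u t x)"

text \<open>The Taylor polynomial in t, of degree n, that the system prescribes from the initial data.
  The n-th time derivative of the right-hand side at \<open>t = 0\<close> involves only the time derivatives
  of p, u, \<open>\<theta>\<close> of order at most n, hence may be computed from the polynomial of degree n; it is
  the time derivative of order \<open>n + 1\<close> of the initial data.\<close>

primrec taylor ::
    "real \<Rightarrow> real \<Rightarrow> real \<Rightarrow> (real \<Rightarrow> real) \<Rightarrow> (real \<Rightarrow> real) \<Rightarrow> (real \<Rightarrow> real) \<Rightarrow> nat \<Rightarrow>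
     field \<times> field \<times> field" where
  "taylor \<epsilon> \<kappa> \<mu> p_in u_in \<theta>_in 0 = (\<lambda>t. p_in, \<lambda>t. u_in, \<lambda>t. \<theta>_in)"
| "taylor \<epsilon> \<kappa> \<mu> p_in u_in \<theta>_in (Suc n) =
     (case taylor \<epsilon> \<kappa> \<mu> p_in u_in \<theta>_in n of (p, u, \<theta>) \<Rightarrow>
       (\<lambda>t x. p t x + t ^ Suc n / fact (Suc n) * (dt 1 ^^ n) (rhs_p \<epsilon> \<kappa> \<mu> p u \<theta>) 0 x,
        \<lambda>t x. u t x + t ^ Suc n / fact (Suc n) * (dt 1 ^^ n) (rhs_u \<epsilon> \<kappa> \<mu> p u \<theta>) 0 x,
        \<lambda>t x. \<theta> t x + t ^ Suc n / fact (Suc n) * (dt 1 ^^ n) (rhs_theta \<epsilon> \<kappa> \<mu> p u \<theta>) 0 x))"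

text \<open>The bound for the initial data: the norm \<open>H\<^sup>s\<^sup>,\<^sup>\<epsilon>\<close> at \<open>t = 0\<close>, where only the derivatives of
  order at most \<open>s + 1\<close> at \<open>t = 0\<close> matter. Their classical regularity is the one that the
  initial values of a smooth solution have.\<close>

definition initial_bound ::
    "nat \<Rightarrow> real \<Rightarrow> real \<Rightarrow> real \<Rightarrow> field \<Rightarrow>
     (real \<Rightarrow> real) \<Rightarrow> (real \<Rightarrow> real) \<Rightarrow> (real \<Rightarrow> real) \<Rightarrow> real \<Rightarrow> bool" where
  "initial_bound s \<epsilon> \<kappa> \<mu> \<theta>w p_in u_in \<theta>_in C \<longleftrightarrow>
     (case taylor \<epsilon> \<kappa> \<mu> p_in u_in \<theta>_in (s + 1) of (p, u, \<theta>) \<Rightarrow>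
       (\<forall>k\<le>s + 1. C_line (s + 2 - k) ((dt 1 ^^ k) p 0) \<and>
                  C_line (s + 2 - k) ((dt 1 ^^ k) u 0) \<and>
                  C_line (s + 2 - k) ((dt 1 ^^ k) \<theta> 0)) \<and>
       Heps_sq s \<epsilon> 1 \<theta>w p u \<theta> 0 \<le> ennreal C)"

section \<open>The limit system\<close>

definition C12_strip :: "real \<Rightarrow> field \<Rightarrow> bool" where
  "C12_strip T f \<longleftrightarrow> C_strip 1 T f \<and> (\<forall>t\<in>{0..T}. \<forall>x. dx f t differentiable (at x)) \<and>
     C_strip 0 T (dx (dx f))"

definition solves_limit_system ::
    "real \<Rightarrow> real \<Rightarrow> real \<Rightarrow> field \<Rightarrow> field \<Rightarrow> field \<Rightarrow> bool" where
  "solves_limit_system \<kappa> \<mu> T u \<theta> q \<longleftrightarrow>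
     (\<forall>t\<in>{0..T}. \<forall>x.
        q t differentiable (at x)
      \<and> dx (\<lambda>t x. 2 * u t x - \<kappa> * exp (\<theta> t x) * dx \<theta> t x) t x = 0
      \<and> exp (- \<theta> t x) * (dt T u t x + u t x * dx u t x) + dx q t x
        = dx (\<lambda>t x. \<mu> * dx u t x) t x
      \<and> dt T \<theta> t x + u t x * dx \<theta> t x + dx u t x
        = dx (\<lambda>t x. \<kappa> * exp (\<theta> t x) * dx \<theta> t x) t x)"

text \<open>Classical solutions with \<open>(u, \<theta> - \<theta>w)\<close> bounded in \<open>H\<^sup>s(\<real>)\<close> uniformly on \<open>[0,T]\<close>. The
  pressure q is an unknown, but it is determined only up to a function of t and is not counted as
  part of the solution. The data are Sobolev functions, hence attained almost everywhere.\<close>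

definition limit_solution ::
    "nat \<Rightarrow> real \<Rightarrow> real \<Rightarrow> real \<Rightarrow> field \<Rightarrow> (real \<Rightarrow> real) \<Rightarrow> (real \<Rightarrow> real) \<Rightarrow>
     field \<Rightarrow> field \<Rightarrow> bool" where
  "limit_solution s \<kappa> \<mu> T \<theta>w w_in \<theta>_in u \<theta> \<longleftrightarrow>
     C12_strip T u \<and> C12_strip T \<theta> \<and>
     (\<exists>q. solves_limit_system \<kappa> \<mu> T u \<theta> q) \<and>
     (\<exists>M. \<forall>t\<in>{0..T}. Hsq s (u t) \<le> ennreal M \<and> Hsq s (\<lambda>x. \<theta> t x - \<theta>w t x) \<le> ennreal M) \<and>
     (AE x in lborel. u 0 x = w_in x \<and> \<theta> 0 x = \<theta>_in x)"

end

theory Submission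
  imports Defs
begin

text \<open>Write \<open>v = u - (\<kappa>/2) exp (- \<epsilon> p + \<theta>) \<theta>\<^sub>x\<close> for the acoustic part of the velocity. The first equation reads
  \<open>v\<^sub>x = (\<epsilon>/2) (F - p\<^sub>t)\<close> with F bounded, so the time integral W of v has an x-derivative of order \<open>\<epsilon>\<close> and, being
  bounded in \<open>L\<^sup>2\<close>, is uniformly small. Then \<open>z = \<theta> + W \<theta>\<^sub>x - (\<epsilon>/2) p\<close> satisfies the limit equation
  \<open>\<theta>\<^sub>t = (\<kappa>/2) exp \<theta> \<theta>\<^sub>x\<^sub>x\<close> up to a small residual, and the maximum principle makes \<open>\<theta>\<^sup>\<epsilon>\<close>, hence by interpolation also
  its first derivatives, uniformly Cauchy.

  For the strong convergence of v and p to 0, the pair (p, v) solves \<open>p\<^sub>x = - \<epsilon> a v\<^sub>t + O(\<epsilon>)\<close>,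
  \<open>v\<^sub>x = - (\<epsilon>/2) p\<^sub>t + O(\<epsilon>)\<close> with \<open>a = exp (- \<theta>)\<close>. Read with x as the evolution variable, this system has the
  energy \<open>\<integral> a v\<^sup>2 + p\<^sup>2/2 dt\<close>, which varies at the rate \<open>|\<theta>\<^sub>x|\<close> up to terms of order \<open>\<epsilon>\<close>. The decay of the initial
  temperature gives a weighted energy estimate for the limit equation, by which \<open>\<theta>\<^sub>x\<close> is integrable near \<open>+\<infinity>\<close> for most
  times. So the energy at a fixed point is controlled by the energy at any point further to the right, and since it is
  integrable in x, it must tend to 0.\<close>

section \<open>The maximum principle\<close>

text \<open>In the temperature equation, after substituting u = v + (\<kappa>/2) exp (- \<epsilon> p
  + \<theta>) \<theta>_x, the oscillating sources are - v \<theta>_x and - v_x. The time derivatives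
  of W \<theta>_x and of - (\<epsilon>/2) p cancel them up to small terms; this dictates the form of
  z. Two values of \<epsilon> are compared directly, so the whole family converges and not just a
  subsequence. The decay is assumed at +\<infinity> only, hence the energy at a point is compared
  only with points to its right. In that estimate the large time derivatives occur only through -
  \<epsilon> a (v p)_t, and integration by parts leaves a_t, which is bounded because \<theta>_t is.
  With s \<ge> 4 the norm gives sup bounds for four x-derivatives of \<theta>. Interpolation costs
  one of them, and the three that converge uniformly are those needed for u_xx and u_t of the limit
  velocity, which is already of first order in \<theta>.\<close>

lemma second_derivative_nonpos_at_max:
 fixes g g' :: "real \<Rightarrow> real"
 assumes g: "\<And>x. (g has_real_derivative g' x) (at x)"
  and g': "(g' has_real_derivative d) (at x0)"
  and mx: "\<And>x. g x \<le> g x0"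
 shows "d \<le> 0"
proof (rule ccontr)
 assume "\<not> d \<le> 0"
 hence d: "d > 0" by simp
 have z: "g' x0 = 0"
  by (rule DERIV_local_max[OF g, of 1 x0]) (use mx in auto)
 obtain e where e: "e > 0" "\<And>h. 0 < h ==> h < e ==> g' x0 < g' (x0 + h)"
  using DERIV_pos_inc_right[OF g' d] by auto
 obtain y where y: "x0 < y" "y < x0 + e / 2" "g (x0 + e / 2) - g x0 = (x0 + e / 2 - x0) * g' y"
  using MVT2[of x0 "x0 + e / 2" g g'] g e(1) by auto
 have "g' y > 0" using e(2)[of "y - x0"] y(1,2) e(1) z by auto
 hence "(x0 + e / 2 - x0) * g' y > 0" using e(1) by (intro mult_pos_pos) auto
 hence "g (x0 + e / 2) - g x0 > 0" using y(3) by simp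
 thus False using mx[of "x0 + e / 2"] by simp
qed

text \<open>The line is not compact, so the bounded z is penalised by \<eta> times x^2 + (2 A1 + 1)
  t, which confines a positive maximum to a rectangle; there the equation contradicts the signs of
  the derivatives, and afterwards \<eta> becomes small. The damping rate B + 1 exceeds B by 1, and
  this surplus absorbs a source of size \<delta>, so one and the same \<delta> can bound the source
  and the initial values.\<close>

lemma maximum_principle_upper:
 fixes z zt zx zxx A b f :: "real \<Rightarrow> real \<Rightarrow> real"
 assumes cont: "continuous_on ({0..T} \<times> UNIV) (\<lambda>(t, x). z t x)"
  and bd: "\<And>t x. t \<in> {0..T} ==> \<bar>z t x\<bar> \<le> K"
  and zt: "\<And>t x. t \<in> {0..T} ==> ((\<lambda>\<tau>. z \<tau> x) has_real_derivative zt t x) (at t within {0..T})"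
  and zx: "\<And>t x. t \<in> {0..T} ==> (z t has_real_derivative zx t x) (at x)"
  and zxx: "\<And>t x. t \<in> {0..T} ==> (zx t has_real_derivative zxx t x) (at x)"
  and eq: "\<And>t x. t \<in> {0..T} ==> zt t x = A t x * zxx t x + b t x * z t x + f t x"
  and A: "\<And>t x. t \<in> {0..T} ==> 0 \<le> A t x \<and> A t x \<le> A1"
  and b: "\<And>t x. t \<in> {0..T} ==> \<bar>b t x\<bar> \<le> B"
  and f: "\<And>t x. t \<in> {0..T} ==> \<bar>f t x\<bar> \<le> \<delta>"
  and init: "\<And>x. \<bar>z 0 x\<bar> \<le> \<delta>"
  and t1: "t1 \<in> {0..T}"
 shows "z t1 x1 \<le> \<delta> * exp ((B + 1) * t1)"
proof -
 define l where "l = B + 1"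
 have T: "0 \<le> T" using t1 by auto
 have \<delta>0: "\<delta> \<ge> 0" using init[of 0] by linarith
 have A1: "A1 \<ge> 0" using A[OF t1] by (meson order_trans)
 have K0: "K \<ge> 0" using bd[OF t1, of 0] by linarith
 have B0: "B \<ge> 0" using b[OF t1, of 0] by linarith
 have key: "exp (- l * t1) * z t1 x1 - \<delta> - \<eta> * (x1^2 + (2 * A1 + 1) * t1) \<le> 0" if \<eta>: "\<eta> > 0" for \<eta>
 proof (rule ccontr)
  define \<Phi> where "\<Phi> t x = exp (- l * t) * z t x - \<delta> - \<eta> * (x^2 + (2 * A1 + 1) * t)" for t x
  assume "\<not> ?thesis"
  hence pos1: "\<Phi> t1 x1 > 0" by (simp add: \<Phi>_def)
  \<comment> \<open>Outside [-R, R] one has x^2 \<ge> R \<ge> K / \<eta>, so the penalty outweighs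
    |z| \<le> K there; the summand |x1| keeps the assumed bad point inside.\<close>
  define R where "R = \<bar>x1\<bar> + K / \<eta> + 1"
  have R0: "R > 0" unfolding R_def using \<eta> K0 by (smt (verit) divide_nonneg_pos)
  have "continuous_on ({0..T} \<times> {-R..R}) (\<lambda>(t, x). z t x)"
   by (rule continuous_on_subset[OF cont]) auto
  hence "continuous_on ({0..T} \<times> {-R..R}) (\<lambda>p. exp (- l * fst p) * z (fst p) (snd p) - \<delta> - \<eta> * ((snd p)^2 + (2 * A1 + 1) * fst p))"
   by (intro continuous_intros) (simp add: case_prod_unfold)
  moreover have "compact ({0..T} \<times> {-R..R})" by (intro compact_Times) auto
  moreover have "{0..T} \<times> {-R..R} \<noteq> {}" using T R0 by auto
  ultimately obtain p where p: "p \<in> {0..T} \<times> {-R..R}"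
   "\<And>q. q \<in> {0..T} \<times> {-R..R} ==> \<Phi> (fst q) (snd q) \<le> \<Phi> (fst p) (snd p)"
   unfolding \<Phi>_def using continuous_attains_sup by (metis (no_types, lifting))
  define t0 x0 where "t0 = fst p" and "x0 = snd p"
  have t0: "t0 \<in> {0..T}" using p(1) by (auto simp: t0_def)
  have x1R: "x1 \<in> {-R..R}" unfolding R_def using \<eta> K0 by (smt (verit) divide_nonneg_pos atLeastAtMost_iff)
  have mx1: "\<Phi> t1 x1 \<le> \<Phi> t0 x0" using p(2)[of "(t1, x1)"] t1 x1R by (auto simp: t0_def x0_def)
  have outside: "\<Phi> t x \<le> 0" if "t \<in> {0..T}" "x \<notin> {-R..R}" for t x
  proof -
   have "l * t \<ge> 0" using that(1) B0 by (auto simp: l_def)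
   hence e1: "exp (- l * t) \<le> 1" by simp
   have "exp (- l * t) * z t x \<le> exp (- l * t) * K"
    using bd[OF that(1), of x] by (intro mult_left_mono) auto
   also have "\<dots> \<le> K" using e1 K0 mult_right_mono[OF e1 K0] by simp
   finally have 1: "exp (- l * t) * z t x \<le> K" .
   have "\<bar>x\<bar> \<ge> R" using that(2) by auto
   moreover have R1: "R \<ge> 1" "R \<ge> K / \<eta>" unfolding R_def using \<eta> K0 divide_nonneg_pos[of K \<eta>] by linarith+
   ultimately have "\<bar>x\<bar>^2 \<ge> R * 1" unfolding power2_eq_square by (intro mult_mono) auto
   hence "x^2 \<ge> K / \<eta>" using R1 by simp
   hence "\<eta> * x^2 \<ge> K" using \<eta> by (simp add: field_simps)
   moreover have "\<eta> * ((2 * A1 + 1) * t) \<ge> 0" using \<eta> A1 that(1) by auto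
   ultimately show ?thesis using 1 \<delta>0 unfolding \<Phi>_def by (simp add: distrib_left)
  qed
  have mx: "\<Phi> t x \<le> \<Phi> t0 x0" if "t \<in> {0..T}" for t x
   using p(2)[of "(t, x)"] outside[OF that, of x] that mx1 pos1
   by (cases "x \<in> {-R..R}") (auto simp: t0_def x0_def)
  have pos0: "\<Phi> t0 x0 > 0" using mx1 pos1 by simp
  have zpos: "exp (- l * t0) * z t0 x0 > \<delta>"
  proof -
   have "\<eta> * (x0^2 + (2 * A1 + 1) * t0) \<ge> 0" using \<eta> A1 t0 by auto
   thus ?thesis using pos0 unfolding \<Phi>_def by linarith
  qed
  hence zp: "z t0 x0 > 0" using \<delta>0 by (smt (verit) exp_gt_zero mult_nonneg_nonpos)
  have t0pos: "t0 > 0"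
  proof (rule ccontr)
   assume "\<not> t0 > 0" hence "t0 = 0" using t0 by auto
   thus False using zpos init[of x0] by auto
  qed
  have d1: "(\<Phi> t0 has_real_derivative (exp (- l * t0) * zx t0 x - \<eta> * (2 * x))) (at x)" for x
   unfolding \<Phi>_def using zx[OF t0, of x] by (auto intro!: derivative_eq_intros)
  have d2: "((\<lambda>x. exp (- l * t0) * zx t0 x - \<eta> * (2 * x)) has_real_derivative (exp (- l * t0) * zxx t0 x0 - \<eta> * 2)) (at x0)"
   using zxx[OF t0, of x0] by (auto intro!: derivative_eq_intros)
  have "exp (- l * t0) * zxx t0 x0 - \<eta> * 2 \<le> 0"
   by (rule second_derivative_nonpos_at_max[OF d1 d2]) (use mx t0 in auto)
  hence xx: "A t0 x0 * (exp (- l * t0) * zxx t0 x0) \<le> A1 * (2 * \<eta>)"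
   using A[OF t0, of x0] \<eta> by (smt (verit) mult_left_mono mult_right_mono)
  have dt: "((\<lambda>\<tau>. \<Phi> \<tau> x0) has_real_derivative
    (exp (- l * t0) * zt t0 x0 - l * exp (- l * t0) * z t0 x0 - \<eta> * (2 * A1 + 1))) (at t0 within {0..T})"
   unfolding \<Phi>_def using zt[OF t0, of x0] by (auto intro!: derivative_eq_intros simp: algebra_simps)
  \<comment> \<open>The maximum may lie at the final time, so it is compared with earlier times
    only, which gives a sign of the time derivative instead of its vanishing.\<close>
  have "exp (- l * t0) * zt t0 x0 - l * exp (- l * t0) * z t0 x0 - \<eta> * (2 * A1 + 1) \<ge> 0"
  proof (rule ccontr)
   assume "\<not> ?thesis"
   then obtain d where d: "d > 0" "\<And>h. 0 < h ==> t0 - h \<in> {0..T} ==> h < d ==> \<Phi> t0 x0 < \<Phi> (t0 - h) x0"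
    using has_real_derivative_neg_dec_left[OF dt] by fastforce
   have "\<Phi> t0 x0 < \<Phi> (t0 - min (d/2) t0) x0"
    by (rule d(2)) (use d(1) t0pos t0 in auto)
   moreover have "\<Phi> (t0 - min (d/2) t0) x0 \<le> \<Phi> t0 x0" by (rule mx) (use d(1) t0pos t0 in auto)
   ultimately show False by simp
  qed
  moreover have "exp (- l * t0) * zt t0 x0 = A t0 x0 * (exp (- l * t0) * zxx t0 x0) + exp (- l * t0) * (b t0 x0 * z t0 x0 + f t0 x0)"
   unfolding eq[OF t0] by (simp add: algebra_simps)
  \<comment> \<open>Of the factor 2 A1 + 1 in the penalty, 2 A1 pays for the diffusion of \<eta> x^2
    and the remaining 1 leaves the strictly negative - \<eta>.\<close>
  ultimately have "0 \<le> - \<eta> + exp (- l * t0) * (b t0 x0 * z t0 x0 + f t0 x0) - l * exp (- l * t0) * z t0 x0"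
   using xx by (simp add: algebra_simps)
  moreover have "exp (- l * t0) * (b t0 x0 * z t0 x0 + f t0 x0) \<le> exp (- l * t0) * (B * z t0 x0) + \<delta>"
  proof -
   have "l * t0 \<ge> 0" using t0 B0 by (auto simp: l_def)
   hence e1: "exp (- l * t0) \<le> 1" by simp
   have "b t0 x0 * z t0 x0 \<le> B * z t0 x0" using b[OF t0, of x0] zp by (intro mult_right_mono) auto
   hence "exp (- l * t0) * (b t0 x0 * z t0 x0) \<le> exp (- l * t0) * (B * z t0 x0)" by (intro mult_left_mono) auto
   moreover have "exp (- l * t0) * f t0 x0 \<le> \<delta>"
   proof -
    have "exp (- l * t0) * f t0 x0 \<le> exp (- l * t0) * \<delta>" using f[OF t0, of x0] by (intro mult_left_mono) auto
    also have "\<dots> \<le> \<delta>" using mult_right_mono[OF e1 \<delta>0] by simp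
    finally show ?thesis .
   qed
   ultimately show ?thesis by (simp add: algebra_simps)
  qed
  ultimately have "0 \<le> - \<eta> + \<delta> - exp (- l * t0) * z t0 x0" by (simp add: l_def algebra_simps)
  thus False using zpos \<eta> by simp
 qed
 have "exp (- l * t1) * z t1 x1 - \<delta> \<le> 0"
 proof (rule ccontr)
  assume "\<not> ?thesis"
  hence c: "exp (- l * t1) * z t1 x1 - \<delta> > 0" by simp
  define q where "q = x1^2 + (2 * A1 + 1) * t1"
  have q: "q \<ge> 0" unfolding q_def using A1 t1 by auto
  define c0 where "c0 = exp (- l * t1) * z t1 x1 - \<delta>"
  \<comment> \<open>A concrete value of \<eta> replaces the limit \<eta> to 0: the bound c0 \<le> c0
    q / (q + 1) is impossible for c0 > 0.\<close>
  have "c0 / (q + 1) > 0" using c q by (simp add: c0_def)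
  from key[OF this] have "c0 \<le> c0 / (q + 1) * q" by (simp add: c0_def q_def)
  hence "c0 * (q + 1) \<le> c0 * q" using q by (simp add: field_simps)
  thus False using c by (simp add: c0_def algebra_simps)
 qed
 hence "exp (l * t1) * (exp (- l * t1) * z t1 x1) \<le> exp (l * t1) * \<delta>" by (intro mult_left_mono) auto
 moreover have "exp (l * t1) * (exp (- l * t1) * z t1 x1) = z t1 x1"
  by (simp add: mult.assoc[symmetric] exp_add[symmetric])
 ultimately have "z t1 x1 \<le> exp (l * t1) * \<delta>" by (simp only:)
 thus ?thesis unfolding l_def by (simp only: mult.commute)
qed

lemma maximum_principle:
 fixes z zt zx zxx A b f :: "real \<Rightarrow> real \<Rightarrow> real"
 assumes cont: "continuous_on ({0..T} \<times> UNIV) (\<lambda>(t, x). z t x)"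
  and bd: "\<And>t x. t \<in> {0..T} ==> \<bar>z t x\<bar> \<le> K"
  and zt: "\<And>t x. t \<in> {0..T} ==> ((\<lambda>\<tau>. z \<tau> x) has_real_derivative zt t x) (at t within {0..T})"
  and zx: "\<And>t x. t \<in> {0..T} ==> (z t has_real_derivative zx t x) (at x)"
  and zxx: "\<And>t x. t \<in> {0..T} ==> (zx t has_real_derivative zxx t x) (at x)"
  and eq: "\<And>t x. t \<in> {0..T} ==> zt t x = A t x * zxx t x + b t x * z t x + f t x"
  and A: "\<And>t x. t \<in> {0..T} ==> 0 \<le> A t x \<and> A t x \<le> A1"
  and b: "\<And>t x. t \<in> {0..T} ==> \<bar>b t x\<bar> \<le> B"
  and f: "\<And>t x. t \<in> {0..T} ==> \<bar>f t x\<bar> \<le> \<delta>"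
  and init: "\<And>x. \<bar>z 0 x\<bar> \<le> \<delta>"
  and t1: "t1 \<in> {0..T}"
 shows "\<bar>z t1 x1\<bar> \<le> \<delta> * exp ((B + 1) * t1)"
proof -
 have c: "continuous_on ({0..T} \<times> UNIV) (\<lambda>(t, x). - z t x)"
  using continuous_on_minus[OF cont] by (simp add: case_prod_unfold)
 have eq': "- zt t x = A t x * - zxx t x + b t x * - z t x + - f t x" if "t \<in> {0..T}" for t x
  using eq[OF that, of x] by simp
 have bd': "\<bar>- z t x\<bar> \<le> K" if "t \<in> {0..T}" for t x using bd[OF that, of x] by simp
 have f': "\<bar>- f t x\<bar> \<le> \<delta>" if "t \<in> {0..T}" for t x using f[OF that, of x] by simp
 have init': "\<bar>- z 0 x\<bar> \<le> \<delta>" for x using init[of x] by simp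
 have "- z t1 x1 \<le> \<delta> * exp ((B + 1) * t1)"
  by (rule maximum_principle_upper[OF c bd' DERIV_minus[OF zt] DERIV_minus[OF zx] DERIV_minus[OF zxx]
     eq' A b f' init' t1])
 thus ?thesis using maximum_principle_upper[OF assms, of x1] by linarith
qed

section \<open>Quadratic Taylor bounds\<close>

text \<open>Divided by h, the remainder is at most C |h|. A remainder bound with a fixed constant
  survives pointwise limits, so this is the form in which differentiability is handed on to limit
  functions.\<close>

lemma derivative_from_quadratic_bound:
 fixes f :: "real \<Rightarrow> real"
 assumes "\<And>h. \<bar>f (x + h) - f x - h * g\<bar> \<le> C * h^2"
 shows "(f has_real_derivative g) (at x)"
 unfolding DERIV_def
proof (rule LIM_zero_cancel, rule Lim_null_comparison)
 show "\<forall>\<^sub>F h in at 0. norm ((f (x + h) - f x) / h - g) \<le> C * \<bar>h\<bar>"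
 proof (rule eventually_at_filter[THEN iffD2], rule always_eventually, intro allI impI)
  fix h :: real assume h: "h \<noteq> 0"
  have "norm ((f (x + h) - f x) / h - g) = \<bar>f (x + h) - f x - h * g\<bar> / \<bar>h\<bar>"
   using h by (simp add: abs_divide[symmetric] diff_divide_distrib)
  also have "\<dots> \<le> C * h^2 / \<bar>h\<bar>" by (intro divide_right_mono assms) auto
  also have "\<dots> = C * \<bar>h\<bar>" using h by (simp add: power2_eq_square field_simps abs_mult_self_eq)
  finally show "norm ((f (x + h) - f x) / h - g) \<le> C * \<bar>h\<bar>" .
 qed
 show "((\<lambda>h. C * \<bar>h\<bar>) \<longlongrightarrow> 0) (at 0)" by (auto intro!: tendsto_eq_intros)
qed

text \<open>The bound on the second derivative controls the oscillation of f' on the segment from x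
  to x + h, and the mean value bound is applied to f minus its linear part. The factor 1/2 of
  Taylor's formula is not kept.\<close>

lemma taylor_quadratic_bound:
 fixes f f' f'' :: "real \<Rightarrow> real"
 assumes 1: "\<And>x. (f has_real_derivative f' x) (at x)"
  and 2: "\<And>x. (f' has_real_derivative f'' x) (at x)"
  and b: "\<And>x. \<bar>f'' x\<bar> \<le> C"
 shows "\<bar>f (x + h) - f x - h * f' x\<bar> \<le> C * h^2"
proof -
 have lip: "\<bar>f' y - f' x\<bar> \<le> C * \<bar>y - x\<bar>" for y x
 proof -
  have "norm (f' y - f' x) \<le> C * norm (y - x)"
   by (rule field_differentiable_bound[where S = UNIV and f' = f'']) (use 2 b in auto)
  thus ?thesis by simp
 qed
 have C: "C \<ge> 0" using b[of 0] by linarith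
 define S where "S = closed_segment x (x + h)"
 have "norm ((f (x + h) - (x + h) * f' x) - (f x - x * f' x)) \<le> (C * \<bar>h\<bar>) * norm ((x + h) - x)"
 proof (rule field_differentiable_bound[where S = S and f' = "\<lambda>y. f' y - f' x"])
  fix y assume y: "y \<in> S"
  show "((\<lambda>y. f y - y * f' x) has_field_derivative f' y - f' x) (at y within S)"
   by (auto intro!: derivative_eq_intros has_field_derivative_at_within[OF 1])
  have "\<bar>y - x\<bar> \<le> \<bar>h\<bar>" using y by (auto simp: S_def closed_segment_eq_real_ivl split: if_splits)
  hence "C * \<bar>y - x\<bar> \<le> C * \<bar>h\<bar>" using C by (rule mult_left_mono)
  thus "norm (f' y - f' x) \<le> C * \<bar>h\<bar>" using lip[of y x] by simp
 qed (auto simp: S_def)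
 thus ?thesis by (simp add: algebra_simps power2_eq_square abs_mult_self_eq)
qed

section \<open>Test functions\<close>

text \<open>The derivative is an existential witness instead of \<open>deriv\<close>, so that
  closure under sums, products and affine substitutions is a plain induction over the order. The
  equivalence with \<open>C_line\<close> is shown below.\<close>

primrec smooth_upto :: "nat \<Rightarrow> (real \<Rightarrow> real) \<Rightarrow> bool" where
 "smooth_upto 0 f \<longleftrightarrow> continuous_on UNIV f"
| "smooth_upto (Suc n) f \<longleftrightarrow> (\<exists>f'. (\<forall>x. (f has_real_derivative f' x) (at x)) \<and> smooth_upto n f')"

lemma smooth_upto_SucI:
 "(\<And>x. (f has_real_derivative f' x) (at x)) ==> smooth_upto n f' ==> smooth_upto (Suc n) f"
 unfolding smooth_upto.simps by blast

lemma DERIV_continuous_UNIV: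
 "(\<And>x. (f has_real_derivative f' x) (at x)) ==> continuous_on UNIV f"
 by (meson DERIV_isCont continuous_at_imp_continuous_on)

lemma smooth_upto_continuous: "smooth_upto n f ==> continuous_on UNIV f"
 by (cases n) (auto intro: DERIV_continuous_UNIV)

lemma smooth_upto_SucD: "smooth_upto (Suc n) f ==> smooth_upto n f"
proof (induction n arbitrary: f)
 case 0 thus ?case using smooth_upto_continuous[of "Suc 0" f] by simp
next
 case (Suc n)
 then obtain f' where "\<And>x. (f has_real_derivative f' x) (at x)" "smooth_upto (Suc n) f'"
  unfolding smooth_upto.simps(2)[of "Suc n"] by blast
 thus ?case using Suc.IH[of f'] by auto
qed

lemma smooth_upto_const [simp]: "smooth_upto n (\<lambda>x. c)"
 by (induction n arbitrary: c) (auto intro!: exI[of _ "\<lambda>x. 0"])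

lemma smooth_upto_add: "smooth_upto n f ==> smooth_upto n g ==> smooth_upto n (\<lambda>x. f x + g x)"
proof (induction n arbitrary: f g)
 case (Suc n)
 then obtain f' g' where "\<And>x. (f has_real_derivative f' x) (at x)" "smooth_upto n f'"
  "\<And>x. (g has_real_derivative g' x) (at x)" "smooth_upto n g'" by auto
 thus ?case using Suc.IH[of f' g'] by (auto intro!: exI[of _ "\<lambda>x. f' x + g' x"] DERIV_add)
qed (auto intro: continuous_intros)

lemma smooth_upto_mult: "smooth_upto n f ==> smooth_upto n g ==> smooth_upto n (\<lambda>x. f x * g x)"
proof (induction n arbitrary: f g)
 case (Suc n)
 then obtain f' g' where d: "\<And>x. (f has_real_derivative f' x) (at x)" "smooth_upto n f'"
  "\<And>x. (g has_real_derivative g' x) (at x)" "smooth_upto n g'" by auto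
 have "smooth_upto n (\<lambda>x. f' x * g x + g' x * f x)"
  using Suc.IH Suc.prems d smooth_upto_SucD by (intro smooth_upto_add) auto
 moreover have "((\<lambda>x. f x * g x) has_real_derivative f' x * g x + g' x * f x) (at x)" for x
  by (rule DERIV_mult) (use d in auto)
 ultimately show ?case by (intro smooth_upto_SucI)
qed (auto intro: continuous_intros)

lemma smooth_upto_affine: "smooth_upto n f ==> smooth_upto n (\<lambda>x. f (a * x + b))"
proof (induction n arbitrary: f)
 case (Suc n)
 then obtain f' where d: "\<And>x. (f has_real_derivative f' x) (at x)" "smooth_upto n f'" by auto
 have "((\<lambda>x. f (a * x + b)) has_real_derivative f' (a * x + b) * a) (at x)" for x
  by (rule DERIV_chain2[OF d(1)]) (auto intro!: derivative_eq_intros)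
 moreover have "smooth_upto n (\<lambda>x. f' (a * x + b) * a)"
  using Suc.IH[OF d(2)] by (intro smooth_upto_mult) auto
 ultimately show ?case by (intro smooth_upto_SucI)
next
 case 0
 have "continuous_on UNIV (\<lambda>x. a * x + b)" by (intro continuous_intros)
 thus ?case using 0 continuous_on_compose2[of UNIV f UNIV "\<lambda>x. a * x + b"] by simp
qed

lemma smooth_upto_uminus: "smooth_upto n f ==> smooth_upto n (\<lambda>x. - f x)"
 using smooth_upto_mult[of n "\<lambda>x. -1" f] by simp

lemma smooth_upto_diff: "smooth_upto n f ==> smooth_upto n g ==> smooth_upto n (\<lambda>x. f x - g x)"
 using smooth_upto_add[of n f "\<lambda>x. - g x"] smooth_upto_uminus[of n g] by simp

lemma smooth_upto_imp_C_line: "smooth_upto n f ==> C_line n f"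
proof (induction n arbitrary: f)
 case (Suc n)
 then obtain f' where d: "\<And>x. (f has_real_derivative f' x) (at x)" "smooth_upto n f'" by auto
 have f': "deriv f = f'" using d(1) by (auto intro!: ext DERIV_imp_deriv)
 have C: "C_line n f'" using Suc.IH[OF d(2)] .
 have "(deriv ^^ j) f differentiable (at x)" if "j < Suc n" for j x
 proof (cases j)
  case 0 thus ?thesis using d(1)[of x] by (auto simp: real_differentiable_def)
 next
  case (Suc i)
  thus ?thesis using C that by (auto simp: C_line_def funpow_Suc_right f' simp del: funpow.simps)
 qed
 moreover have "continuous_on UNIV ((deriv ^^ Suc n) f)"
  using C by (auto simp: C_line_def funpow_Suc_right f' simp del: funpow.simps)
 ultimately show ?case by (auto simp: C_line_def)
qed (auto simp: C_line_def)

lemma C_line_imp_smooth_upto: "C_line n f ==> smooth_upto n f"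
proof (induction n arbitrary: f)
 case (Suc n)
 have "C_line n (deriv f)"
  unfolding C_line_def
 proof (intro conjI allI impI)
  fix j x assume "j < n"
  hence "(deriv ^^ Suc j) f differentiable (at x)" using Suc.prems unfolding C_line_def by blast
  thus "(deriv ^^ j) (deriv f) differentiable (at x)" by (simp only: funpow_Suc_right o_apply)
 next
  show "continuous_on UNIV ((deriv ^^ n) (deriv f))" using Suc.prems unfolding C_line_def by (simp only: funpow_Suc_right o_apply)
 qed
 moreover have "(f has_real_derivative deriv f x) (at x)" for x
 proof -
  have "(deriv ^^ 0) f differentiable (at x)" using Suc.prems unfolding C_line_def by blast
  thus ?thesis by (simp add: DERIV_deriv_iff_real_differentiable)
 qed
 ultimately show ?case using Suc.IH by auto
qed (auto simp: C_line_def)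

lemma C_line_iff_smooth_upto: "C_line n f \<longleftrightarrow> smooth_upto n f"
 using C_line_imp_smooth_upto smooth_upto_imp_C_line by blast

lemma test_function_iff: "test_function \<phi> \<longleftrightarrow> (\<forall>n. smooth_upto n \<phi>) \<and> (\<exists>R. \<forall>x. \<bar>x\<bar> > R \<longrightarrow> \<phi> x = 0)"
 by (simp add: test_function_def C_line_iff_smooth_upto)

lemma deriv_zero_outside:
 fixes f :: "real \<Rightarrow> real"
 assumes "\<And>x. \<bar>x\<bar> > R ==> f x = 0" "\<bar>x\<bar> > R"
 shows "deriv f x = 0"
proof -
 have "\<forall>\<^sub>F y in nhds x. \<bar>y\<bar> > R"
  using assms(2) by (intro eventually_nhds_in_open[of "{y. \<bar>y\<bar> > R}", simplified] open_Collect_less continuous_intros) auto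
 hence "\<forall>\<^sub>F y in nhds x. f y = 0" by (rule eventually_mono) (use assms in auto)
 hence "deriv f x = deriv (\<lambda>_. 0) x" by (rule deriv_cong_ev) simp
 thus ?thesis by simp
qed

lemma test_function_has_derivative:
 assumes "test_function \<phi>" shows "(\<phi> has_real_derivative deriv \<phi> x) (at x)"
proof -
 have "smooth_upto (Suc 0) \<phi>" using assms unfolding test_function_iff by blast
 then obtain f' where "\<And>x. (\<phi> has_real_derivative f' x) (at x)" by auto
 thus ?thesis using DERIV_imp_deriv by metis
qed

lemma test_function_deriv:
 assumes "test_function \<phi>" shows "test_function (deriv \<phi>)"
proof -
 obtain R where R: "\<And>x. \<bar>x\<bar> > R ==> \<phi> x = 0" using assms by (auto simp: test_function_iff)
 have "smooth_upto n (deriv \<phi>)" for n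
 proof -
  have "smooth_upto (Suc n) \<phi>" using assms unfolding test_function_iff by blast
  then obtain f' where d: "\<And>x. (\<phi> has_real_derivative f' x) (at x)" "smooth_upto n f'" by auto
  have "deriv \<phi> = f'" using d(1) by (auto intro!: ext DERIV_imp_deriv)
  thus ?thesis using d by simp
 qed
 moreover have "deriv \<phi> x = 0" if "\<bar>x\<bar> > R" for x
  using deriv_zero_outside[of R \<phi> x] R that by blast
 ultimately show ?thesis unfolding test_function_iff by blast
qed

lemma test_function_affine:
 assumes "test_function \<phi>" "a \<noteq> 0" shows "test_function (\<lambda>x. \<phi> (a * x + b))"
proof -
 obtain R where R: "\<And>x. \<bar>x\<bar> > R ==> \<phi> x = 0" using assms by (auto simp: test_function_iff)
 have "\<phi> (a * x + b) = 0" if "\<bar>x\<bar> > (\<bar>R\<bar> + \<bar>b\<bar>) / \<bar>a\<bar>" for x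
 proof (rule R)
  have "\<bar>R\<bar> + \<bar>b\<bar> < \<bar>a * x\<bar>" using that assms(2) by (simp add: field_simps abs_mult)
  thus "R < \<bar>a * x + b\<bar>" by linarith
 qed
 thus ?thesis using assms smooth_upto_affine unfolding test_function_iff by blast
qed

section \<open>Flat functions and a smooth step\<close>

definition bump_aux :: "real poly \<Rightarrow> real \<Rightarrow> real" where
 "bump_aux P x = (if x > 0 then poly P (1 / x) * exp (- (1 / x)) else 0)"

lemma bump_aux_tendsto_0: "(bump_aux P \<longlongrightarrow> 0) (at 0)"
proof -
 have "((\<lambda>y::real. poly P y / exp y) \<longlongrightarrow> 0) at_top"
 proof -
  have "((\<lambda>y. coeff P i * (y ^ i / exp y)) \<longlongrightarrow> 0) at_top" for i
   by (rule tendsto_mult_right_zero) (rule tendsto_power_div_exp_0)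
  hence "((\<lambda>y. \<Sum>i\<le>degree P. coeff P i * (y ^ i / exp y)) \<longlongrightarrow> 0) at_top"
   by (intro tendsto_null_sum) auto
  thus ?thesis by (simp add: poly_altdef sum_divide_distrib)
 qed
 hence 1: "((\<lambda>y. poly P y * exp (- y)) \<longlongrightarrow> 0) at_top"
  by (simp add: exp_minus divide_inverse)
 have 2: "filterlim (\<lambda>x. 1 / x :: real) at_top (at_right 0)"
  using filterlim_inverse_at_top_right by (simp add: inverse_eq_divide)
 have "((\<lambda>x. poly P (1 / x) * exp (- (1 / x))) \<longlongrightarrow> 0) (at_right 0)"
  by (rule filterlim_compose[OF 1 2])
 moreover have "\<forall>\<^sub>F x in at_right 0. poly P (1 / x) * exp (- (1 / x)) = bump_aux P x"
  unfolding bump_aux_def eventually_at_right_field by (intro exI[of _ 1]) auto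
 ultimately have r: "(bump_aux P \<longlongrightarrow> 0) (at_right 0)"
  by (rule Lim_transform_eventually)
 have "\<forall>\<^sub>F x in at_left 0. 0 = bump_aux P x"
  unfolding bump_aux_def eventually_at_left_field by (intro exI[of _ "-1"]) auto
 hence "(bump_aux P \<longlongrightarrow> 0) (at_left 0)" by (rule Lim_transform_eventually[OF tendsto_const])
 thus ?thesis using r filterlim_split_at by blast
qed

text \<open>For x > 0 differentiation produces the factor 1/x^2, which is the polynomial X^2
  evaluated at 1/x, times P - P'. At 0 the difference quotient is again a member of the family, with
  X P in place of P, and therefore tends to 0.\<close>

lemma bump_aux_derivative:
 "(bump_aux P has_real_derivative bump_aux ([:0, 0, 1:] * (P - pderiv P)) x) (at x)"
proof -
 consider "x > 0" | "x < 0" | "x = 0" by linarith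
 thus ?thesis
 proof cases
  case 1
  have "((\<lambda>x. poly P (1 / x) * exp (- (1 / x))) has_real_derivative
    (poly (pderiv P) (1 / x) * (- (1 / x^2))) * exp (- (1 / x)) + exp (- (1 / x)) * (1 / x^2) * poly P (1 / x)) (at x)"
   by (rule DERIV_mult DERIV_chain2[OF poly_DERIV] DERIV_chain2[OF DERIV_exp])+
    (use 1 in \<open>auto intro!: derivative_eq_intros simp: power2_eq_square field_simps\<close>)
  also have "(poly (pderiv P) (1 / x) * (- (1 / x^2))) * exp (- (1 / x)) + exp (- (1 / x)) * (1 / x^2) * poly P (1 / x)
   = bump_aux ([:0, 0, 1:] * (P - pderiv P)) x"
   using 1 by (simp add: bump_aux_def power2_eq_square field_simps)
  finally show ?thesis
   by (rule DERIV_cong_ev[OF refl _ refl, THEN iffD1, rotated])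
    (use 1 in \<open>auto simp: bump_aux_def eventually_nhds intro!: exI[of _ "{0<..}"]\<close>)
 next
  case 2
  have "((\<lambda>x. 0) has_real_derivative bump_aux ([:0, 0, 1:] * (P - pderiv P)) x) (at x)"
   using 2 by (simp add: bump_aux_def)
  thus ?thesis
   by (rule DERIV_cong_ev[OF refl _ refl, THEN iffD1, rotated])
    (use 2 in \<open>auto simp: bump_aux_def eventually_nhds intro!: exI[of _ "{..<0}"]\<close>)
 next
  case 3
  have "((\<lambda>h. bump_aux P h / h) \<longlongrightarrow> 0) (at 0)"
  proof (rule Lim_transform_eventually[OF bump_aux_tendsto_0[of "[:0,1:] * P"]])
   show "\<forall>\<^sub>F h in at 0. bump_aux ([:0, 1:] * P) h = bump_aux P h / h"
    by (rule eventually_at_filter[THEN iffD2], rule always_eventually) (auto simp: bump_aux_def field_simps)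
  qed
  thus ?thesis unfolding 3 DERIV_def by (simp add: bump_aux_def)
 qed
qed

lemma bump_aux_smooth: "smooth_upto n (bump_aux P)"
 by (induction n arbitrary: P)
  (use bump_aux_derivative DERIV_continuous_UNIV[OF bump_aux_derivative] in auto)

lemma integral_eq_zero_on:
 fixes f :: "real \<Rightarrow> real"
 assumes "\<And>x. x \<in> S ==> f x = 0" shows "integral S f = 0"
 using integral_cong[of S f "\<lambda>_. 0"] assms by simp

text \<open>H is the antiderivative of a nonnegative bump supported in [0, 1], divided by the total
  mass of the bump.\<close>

lemma smooth_step_exists:
 obtains H :: "real \<Rightarrow> real" where "\<And>n. smooth_upto n H" "\<And>x. x \<le> 0 ==> H x = 0" "\<And>x. x \<ge> 1 ==> H x = 1"
  "\<And>x. 0 \<le> H x \<and> H x \<le> 1" "mono H"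
proof -
 define \<eta> where "\<eta> x = bump_aux 1 x * bump_aux 1 (- 1 * x + 1)" for x
 have \<eta>s: "smooth_upto n \<eta>" for n
  unfolding \<eta>_def by (intro smooth_upto_mult bump_aux_smooth smooth_upto_affine)
 have \<eta>c: "continuous_on A \<eta>" for A
  using smooth_upto_continuous[OF \<eta>s] continuous_on_subset by blast
 have \<eta>0: "\<eta> x \<ge> 0" for x by (auto simp: \<eta>_def bump_aux_def)
 have \<eta>out: "\<eta> x = 0" if "x \<le> 0 \<or> x \<ge> 1" for x using that by (auto simp: \<eta>_def bump_aux_def)
 \<comment> \<open>Integration starts left of the support, so that every x \<ge> 0 is an interior
   point of an interval to which the fundamental theorem applies.\<close>
 define G where "G x = integral {-1..x} \<eta>" for x
 have G: "(G has_real_derivative \<eta> x) (at x)" for x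
 proof (cases "x < 0")
  case True
  have "G y = 0" if "y < 0" for y
   unfolding G_def by (rule integral_eq_zero_on) (use \<eta>out that in auto)
  hence "((\<lambda>x. 0) has_real_derivative \<eta> x) (at x) \<longleftrightarrow> (G has_real_derivative \<eta> x) (at x)"
   using True by (intro DERIV_cong_ev refl) (auto simp: eventually_nhds intro!: exI[of _ "{..<0}"])
  thus ?thesis using \<eta>out[of x] True by simp
 next
  case False
  have "(G has_real_derivative \<eta> x) (at x within {-1..x+1})"
   unfolding G_def by (rule integral_has_real_derivative[OF \<eta>c]) (use False in auto)
  thus ?thesis using False at_within_interior[of x "{-1..x+1}"] by auto
 qed
 have Gs: "smooth_upto n G" for n
  using G \<eta>s DERIV_continuous_UNIV[OF G] by (cases n) auto
 have Gm: "G x \<le> G y" if "x \<le> y" for x y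
  using that G \<eta>0 DERIV_nonneg_imp_nondecreasing[of x y G] by blast
 have Gc: "G x = G 1" if "x \<ge> 1" for x
 proof (cases "x = 1")
  case False
  have "\<exists>z>1. z < x \<and> G x - G 1 = (x - 1) * \<eta> z" by (rule MVT2) (use that False G in auto)
  thus ?thesis using \<eta>out by auto
 qed simp
 have G0: "G x = 0" if "x \<le> 0" for x
  unfolding G_def by (rule integral_eq_zero_on) (use \<eta>out that in auto)
 \<comment> \<open>If the mass vanished, monotonicity would make G constant on [0, 1], and the bump
   would vanish at 1/2.\<close>
 have "G 1 > G 0"
 proof (rule ccontr)
  assume "\<not> ?thesis"
  hence "G y = G 0" if "0 \<le> y" "y \<le> 1" for y
   using Gm[OF that(1)] Gm[OF that(2)] by linarith
  note c = this
  have "\<forall>\<^sub>F x in nhds (1/2::real). x \<in> {0<..<1}" by (rule eventually_nhds_in_open) auto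
  hence "\<forall>\<^sub>F x in nhds (1/2). G 0 = G x"
   by (rule eventually_mono) (metis c greaterThanLessThan_iff less_imp_le)
  hence "((\<lambda>x. G 0) has_real_derivative \<eta> (1/2)) (at (1/2)) \<longleftrightarrow> (G has_real_derivative \<eta> (1/2)) (at (1/2))"
   by (intro DERIV_cong_ev refl)
  hence "((\<lambda>x. G 0) has_real_derivative \<eta> (1/2)) (at (1/2))" using G by simp
  hence "\<eta> (1/2) = 0" using DERIV_unique DERIV_const by blast
  thus False by (simp add: \<eta>_def bump_aux_def)
 qed
 hence G1: "G 1 > 0" using G0[of 0] by simp
 show ?thesis
 proof (rule that[of "\<lambda>x. G x * (1 / G 1)"])
  show "smooth_upto n (\<lambda>x. G x * (1 / G 1))" for n by (intro smooth_upto_mult Gs) auto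
  show "0 \<le> G x * (1 / G 1) \<and> G x * (1 / G 1) \<le> 1" for x
   using G1 Gm[of "min x 0" x] G0[of "min x 0"] Gm[of x "max x 1"] Gc[of "max x 1"] by simp
  show "G x * (1 / G 1) = 0" if "x \<le> 0" for x using G0[OF that] by simp
  show "G x * (1 / G 1) = 1" if "x \<ge> 1" for x using Gc[OF that] G1 by simp
  show "mono (\<lambda>x. G x * (1 / G 1))"
   by (rule monoI, rule mult_right_mono[OF Gm]) (use G1 in auto)
 qed
qed

section \<open>Weak derivatives\<close>

lemma continuous_imp_locally_integrable:
 fixes f :: "real \<Rightarrow> real"
 assumes "continuous_on UNIV f" shows "locally_integrable f"
 unfolding locally_integrable_def set_integrable_def
proof (intro allI impI)
 fix K :: "real set" assume "compact K"
 thus "integrable lborel (\<lambda>x. indicat_real K x *\<^sub>R f x)"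
  by (rule borel_integrable_compact[OF _ continuous_on_subset[OF assms]]) simp
qed

lemma locally_integrable_Icc: "locally_integrable f ==> integrable lborel (\<lambda>x. indicator {a..b} x * f x)"
 using compact_Icc[of a b] unfolding locally_integrable_def set_integrable_def by simp

lemma locally_integrable_iff_Icc:
 "locally_integrable f \<longleftrightarrow> (\<forall>R. integrable lborel (\<lambda>x. indicator {-R..R} x * f x))"
proof
 assume *: "\<forall>R. integrable lborel (\<lambda>x. indicator {-R..R} x * f x)"
 show "locally_integrable f"
  unfolding locally_integrable_def
 proof (intro allI impI)
  fix K :: "real set" assume K: "compact K"
  then obtain R where R: "K \<subseteq> {-R..R}"
   using compact_imp_bounded[OF K] by (auto simp: bounded_iff abs_le_iff) (metis abs_le_iff atLeastAtMost_iff subsetI minus_le_iff)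
  have "set_integrable lborel {-R..R} f" using * by (simp add: set_integrable_def)
  thus "set_integrable lborel K f"
   by (rule set_integrable_subset) (use R K in \<open>auto intro: borel_compact\<close>)
 qed
qed (use locally_integrable_Icc in auto)

text \<open>Measurability is inherited from the integrable truncations to [-n, n], whose pointwise
  limit is f.\<close>

lemma locally_integrable_measurable [measurable_dest]:
 assumes "locally_integrable f" shows "f \<in> borel_measurable borel"
proof (rule borel_measurable_LIMSEQ_real)
 fix x :: real
 obtain N :: nat where N: "\<bar>x\<bar> \<le> real N" using real_arch_simple by blast
 have "\<forall>\<^sub>F n in sequentially. indicator {- real n..real n} x * f x = f x"
  using eventually_ge_at_top[of N] by eventually_elim (use N in \<open>auto simp: indicator_def\<close>)
 thus "(\<lambda>n. indicator {- real n..real n} x * f x) \<longlonglongrightarrow> f x"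
  by (rule tendsto_eventually)
next
 fix n :: nat
 have "integrable lborel (\<lambda>x. indicator {- real n..real n} x * f x)"
  using locally_integrable_Icc[OF assms] .
 thus "(\<lambda>x. indicator {- real n..real n} x * f x) \<in> borel_measurable borel"
  by (auto dest: borel_measurable_integrable)
qed

lemma integrable_mult_compact_support:
 assumes f: "locally_integrable f" and \<phi>: "continuous_on UNIV \<phi>" and R: "\<And>x. \<bar>x\<bar> > R ==> \<phi> x = 0"
 shows "integrable lborel (\<lambda>x. f x * \<phi> x :: real)"
proof -
 have "compact (\<phi> ` {-R..R})" by (intro compact_continuous_image continuous_on_subset[OF \<phi>]) auto
 then obtain B where B: "\<And>x. x \<in> {-R..R} ==> \<bar>\<phi> x\<bar> \<le> B"
  by (meson bounded_real compact_imp_bounded imageI)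
 have [measurable]: "f \<in> borel_measurable borel" "\<phi> \<in> borel_measurable borel"
  using locally_integrable_measurable[OF f] borel_measurable_continuous_onI[OF \<phi>] by auto
 show ?thesis
 proof (rule Bochner_Integration.integrable_bound)
  show "integrable lborel (\<lambda>x. (indicator {-R..R} x * f x) * B)"
   using locally_integrable_Icc[OF f] by (rule integrable_mult_left)
  have "\<bar>f x * \<phi> x\<bar> \<le> \<bar>indicator {-R..R} x * f x * B\<bar>" for x
  proof (cases "x \<in> {-R..R}")
   case True thus ?thesis using B[OF True] by (auto simp: abs_mult intro!: mult_left_mono)
  next
   case False hence "\<bar>x\<bar> > R" by auto
   thus ?thesis using R by simp
  qed
  thus "AE x in lborel. norm (f x * \<phi> x) \<le> norm (indicator {-R..R} x * f x * B)" by simp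
 qed measurable
qed

lemma test_function_continuous: "test_function \<phi> ==> continuous_on UNIV \<phi>"
 using smooth_upto_continuous unfolding test_function_iff by blast

lemma integrable_mult_test:
 assumes "locally_integrable f" "test_function \<phi>" shows "integrable lborel (\<lambda>x. f x * \<phi> x)"
 using integrable_mult_compact_support[OF assms(1) test_function_continuous[OF assms(2)]] assms(2)
 unfolding test_function_iff by blast

lemma locally_integrable_add:
 "locally_integrable f ==> locally_integrable g ==> locally_integrable (\<lambda>x. f x + g x)"
 unfolding locally_integrable_iff_Icc by (auto simp: distrib_left)

lemma locally_integrable_cmult: "locally_integrable f ==> locally_integrable (\<lambda>x. c * f x)"
 unfolding locally_integrable_iff_Icc by (auto simp: mult.left_commute[of _ c])

lemma has_weak_deriv_add:
 assumes "has_weak_deriv f f'" "has_weak_deriv g g'"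
 shows "has_weak_deriv (\<lambda>x. f x + g x) (\<lambda>x. f' x + g' x)"
 using assms unfolding has_weak_deriv_def
 by (auto simp: locally_integrable_add distrib_right integrable_mult_test test_function_deriv)

lemma has_weak_deriv_cmult:
 assumes "has_weak_deriv f f'" shows "has_weak_deriv (\<lambda>x. c * f x) (\<lambda>x. c * f' x)"
 using assms unfolding has_weak_deriv_def
 by (auto simp: locally_integrable_cmult mult.assoc)

lemma has_weak_deriv_diff:
 assumes "has_weak_deriv f f'" "has_weak_deriv g g'"
 shows "has_weak_deriv (\<lambda>x. f x - g x) (\<lambda>x. f' x - g' x)"
 using has_weak_deriv_add[OF assms(1) has_weak_deriv_cmult[OF assms(2), of "-1"]] by simp

text \<open>The integrals against test functions see only classes modulo null sets. Local
  integrability of the new functions is demanded because it carries Borel measurability, which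
  equality almost everywhere does not transfer.\<close>

lemma has_weak_deriv_cong_AE:
 assumes "has_weak_deriv f g" "AE x in lborel. f x = f2 x" "AE x in lborel. g x = g2 x"
  and "locally_integrable f2" "locally_integrable g2"
 shows "has_weak_deriv f2 g2"
proof -
 have [measurable]: "f \<in> borel_measurable borel" "f2 \<in> borel_measurable borel" "g \<in> borel_measurable borel" "g2 \<in> borel_measurable borel"
  using assms by (auto simp: has_weak_deriv_def intro: locally_integrable_measurable)
 have "(\<integral>x. f2 x * deriv \<phi> x \<partial>lborel) = - (\<integral>x. g2 x * \<phi> x \<partial>lborel)" if t: "test_function \<phi>" for \<phi>
 proof -
  have [measurable]: "\<phi> \<in> borel_measurable borel" "deriv \<phi> \<in> borel_measurable borel"
   using test_function_continuous[OF t] test_function_continuous[OF test_function_deriv[OF t]]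
   by (auto intro: borel_measurable_continuous_onI)
  have "(\<integral>x. f2 x * deriv \<phi> x \<partial>lborel) = (\<integral>x. f x * deriv \<phi> x \<partial>lborel)"
   by (rule integral_cong_AE) (use assms(2) in auto)
  moreover have "(\<integral>x. g2 x * \<phi> x \<partial>lborel) = (\<integral>x. g x * \<phi> x \<partial>lborel)"
   by (rule integral_cong_AE) (use assms(3) in auto)
  ultimately show ?thesis using assms(1) t by (simp add: has_weak_deriv_def)
 qed
 thus ?thesis using assms by (simp add: has_weak_deriv_def)
qed

lemma has_weak_deriv_classical:
 assumes f: "\<And>x. (f has_real_derivative f' x) (at x)" and f': "continuous_on UNIV f'"
 shows "has_weak_deriv f f'"
proof -
 have fc: "continuous_on UNIV f" by (rule DERIV_continuous_UNIV[OF f])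
 have l: "locally_integrable f" "locally_integrable f'"
  using fc f' by (auto intro: continuous_imp_locally_integrable)
 have "(\<integral>x. f x * deriv \<phi> x \<partial>lborel) = - (\<integral>x. f' x * \<phi> x \<partial>lborel)" if t: "test_function \<phi>" for \<phi>
 proof -
  obtain R where R: "\<And>x. \<bar>x\<bar> > R ==> \<phi> x = 0" using t by (auto simp: test_function_iff)
  define S where "S = \<bar>R\<bar> + 1"
  have out: "\<phi> x = 0" "deriv \<phi> x = 0" if "\<bar>x\<bar> \<ge> S" for x
   using R[of x] deriv_zero_outside[of R \<phi> x] R that by (auto simp: S_def)
  have i: "integrable lborel (\<lambda>x. f x * deriv \<phi> x)" "integrable lborel (\<lambda>x. f' x * \<phi> x)"
   using l t test_function_deriv integrable_mult_test by blast+
  have "(\<integral>x. f x * deriv \<phi> x \<partial>lborel) + (\<integral>x. f' x * \<phi> x \<partial>lborel) = (\<integral>x. f x * deriv \<phi> x + f' x * \<phi> x \<partial>lborel)"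
   using i by simp
  also have "\<dots> = (\<integral>x. indicator {-S..S} x *\<^sub>R (f x * deriv \<phi> x + f' x * \<phi> x) \<partial>lborel)"
  proof (rule Bochner_Integration.integral_cong)
   fix x
   show "f x * deriv \<phi> x + f' x * \<phi> x = indicat_real {-S..S} x *\<^sub>R (f x * deriv \<phi> x + f' x * \<phi> x)"
   proof (cases "x \<in> {-S..S}")
    case False
    hence "\<bar>x\<bar> \<ge> S" by auto
    thus ?thesis using out[of x] by simp
   qed simp
  qed simp
  also have "\<dots> = f S * \<phi> S - f (-S) * \<phi> (-S)"
  proof (rule integral_FTC_atLeastAtMost)
   show "((\<lambda>x. f x * \<phi> x) has_vector_derivative f x * deriv \<phi> x + f' x * \<phi> x) (at x within {- S..S})" for x
    unfolding has_real_derivative_iff_has_vector_derivative[symmetric]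
    by (rule has_field_derivative_at_within) (auto intro!: derivative_eq_intros f test_function_has_derivative[OF t])
   show "continuous_on {- S..S} (\<lambda>x. f x * deriv \<phi> x + f' x * \<phi> x)"
    by (intro continuous_intros continuous_on_subset[OF fc] continuous_on_subset[OF f'] 
      continuous_on_subset[OF test_function_continuous[OF t]]
      continuous_on_subset[OF test_function_continuous[OF test_function_deriv[OF t]]]) auto
  qed (auto simp: S_def)
  also have "\<dots> = 0" using out[of S] out[of "-S"] by (simp add: S_def)
  finally show ?thesis by simp
 qed
 thus ?thesis using l by (simp add: has_weak_deriv_def)
qed

lemma locally_integrable_scale:
 assumes "locally_integrable f" "a \<noteq> 0" shows "locally_integrable (\<lambda>x. f (a * x))"
 unfolding locally_integrable_iff_Icc
proof
 fix R
 have "integrable lborel (\<lambda>x. indicator {-(\<bar>a\<bar>*R)..\<bar>a\<bar>*R} (0 + a * x) * f (0 + a * x))"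
  using lborel_integrable_real_affine[OF locally_integrable_Icc[OF assms(1)] assms(2)] .
 moreover have "indicator {-(\<bar>a\<bar>*R)..\<bar>a\<bar>*R} (0 + a * x) = (indicator {-R..R} x :: real)" for x
 proof -
  have "\<bar>a * x\<bar> \<le> \<bar>a\<bar> * R \<longleftrightarrow> \<bar>x\<bar> \<le> R" using assms(2) by (simp add: abs_mult)
  hence "a * x \<in> {-(\<bar>a\<bar>*R)..\<bar>a\<bar>*R} \<longleftrightarrow> x \<in> {-R..R}" unfolding atLeastAtMost_iff by linarith
  thus ?thesis by (simp add: indicator_def)
 qed
 ultimately show "integrable lborel (\<lambda>x. indicator {-R..R} x * f (a * x))" by simp
qed

text \<open>The test function \<phi>(x / a) is inserted into the identity for f, and the integrals
  are transformed by the substitution y = a x. The diffusion wave at time t is a dilation of the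
  wave at time 0, which is what the rule serves.\<close>

lemma has_weak_deriv_scale:
 assumes w: "has_weak_deriv f g" and a: "a \<noteq> 0"
 shows "has_weak_deriv (\<lambda>x. f (a * x)) (\<lambda>x. a * g (a * x))"
proof -
 have "(\<integral>x. f (a * x) * deriv \<phi> x \<partial>lborel) = - (\<integral>x. a * g (a * x) * \<phi> x \<partial>lborel)" if t: "test_function \<phi>" for \<phi>
 proof -
  define \<psi> where "\<psi> x = \<phi> (1 / a * x + 0)" for x
  have \<psi>: "test_function \<psi>" unfolding \<psi>_def by (rule test_function_affine[OF t]) (use a in auto)
  have d: "deriv \<psi> y = deriv \<phi> (1 / a * y) * (1 / a)" for y
  proof -
   have "(\<psi> has_real_derivative deriv \<phi> (1 / a * y + 0) * (1 / a)) (at y)"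
    unfolding \<psi>_def by (rule DERIV_chain2[OF test_function_has_derivative[OF t]]) (auto intro!: derivative_eq_intros simp: a)
   thus ?thesis by (simp add: DERIV_imp_deriv)
  qed
  have "(\<integral>x. f x * deriv \<psi> x \<partial>lborel) = \<bar>a\<bar> *\<^sub>R (\<integral>x. f (0 + a * x) * deriv \<psi> (0 + a * x) \<partial>lborel)"
   by (rule lborel_integral_real_affine[OF a])
  also have "(\<integral>x. f (0 + a * x) * deriv \<psi> (0 + a * x) \<partial>lborel) = (\<integral>x. f (a * x) * deriv \<phi> x \<partial>lborel) * (1 / a)"
   using a by (simp add: d mult.assoc[symmetric])
  finally have 1: "(\<integral>x. f x * deriv \<psi> x \<partial>lborel) = \<bar>a\<bar> * ((\<integral>x. f (a * x) * deriv \<phi> x \<partial>lborel) * (1 / a))" by simp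
  have "(\<integral>x. g x * \<psi> x \<partial>lborel) = \<bar>a\<bar> *\<^sub>R (\<integral>x. g (0 + a * x) * \<psi> (0 + a * x) \<partial>lborel)"
   by (rule lborel_integral_real_affine[OF a])
  hence 2: "(\<integral>x. g x * \<psi> x \<partial>lborel) = \<bar>a\<bar> * (\<integral>x. g (a * x) * \<phi> x \<partial>lborel)"
   using a by (simp add: \<psi>_def)
  have "\<bar>a\<bar> * ((\<integral>x. f (a * x) * deriv \<phi> x \<partial>lborel) * (1 / a)) = - (\<bar>a\<bar> * (\<integral>x. g (a * x) * \<phi> x \<partial>lborel))"
   using w \<psi> 1 2 by (simp add: has_weak_deriv_def)
  hence "(\<integral>x. f (a * x) * deriv \<phi> x \<partial>lborel) = - (a * (\<integral>x. g (a * x) * \<phi> x \<partial>lborel))"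
   (is "?I = - (a * ?J)")
  proof -
   have "\<bar>a\<bar> * ?I = \<bar>a\<bar> * (- (a * ?J))"
    using \<open>\<bar>a\<bar> * (?I * (1 / a)) = - (\<bar>a\<bar> * ?J)\<close> a by (simp add: field_simps)
   thus ?thesis using a by (simp only: mult_cancel_left abs_eq_0) simp
  qed
  thus ?thesis by (simp add: mult.assoc)
 qed
 thus ?thesis using w a unfolding has_weak_deriv_def
  by (auto intro: locally_integrable_scale locally_integrable_cmult)
qed

text \<open>The test functions \<open>H(n(x-a)) - H(n(x-b))\<close>, with H a smooth step, approximate the indicator
 function of \<open>(a,b]\<close>.\<close>

lemma interval_integral_zero_if_test_zero:
 assumes gl: "locally_integrable g" and z: "\<And>\<phi>. test_function \<phi> ==> (\<integral>x. g x * \<phi> x \<partial>lborel) = 0" and ab: "a < b"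
 shows "(\<integral>x. indicator {a<..b} x * g x \<partial>lborel) = 0"
proof -
 obtain H :: "real \<Rightarrow> real" where Hs: "\<And>n. smooth_upto n H" and H0: "\<And>x. x \<le> 0 ==> H x = 0"
  and H1: "\<And>x. x \<ge> 1 ==> H x = 1" and Hb: "\<And>x. 0 \<le> H x \<and> H x \<le> 1" and "mono H"
  using smooth_step_exists by metis
 have [measurable]: "g \<in> borel_measurable borel" by (rule locally_integrable_measurable[OF gl])
 have Hc: "continuous_on UNIV H" by (rule smooth_upto_continuous[OF Hs[of 0]])
 hence [measurable]: "H \<in> borel_measurable borel" by (rule borel_measurable_continuous_onI)
 define \<phi> where "\<phi> n x = H (real (Suc n) * x + - real (Suc n) * a) - H (real (Suc n) * x + - real (Suc n) * b)" for n x
 have \<phi>_eq: "\<phi> n x = H (real (Suc n) * (x - a)) - H (real (Suc n) * (x - b))" for n x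
 proof -
  have "real (Suc n) * x + - real (Suc n) * c = real (Suc n) * (x - c)" for c by (simp only: distrib_left mult_minus_left mult_minus_right diff_conv_add_uminus)
  thus ?thesis unfolding \<phi>_def by (simp only:)
 qed
 have \<phi>out: "\<phi> n x = 0" if "x \<notin> {a..b+1}" for n x
 proof -
  have "x \<le> a \<or> x \<ge> b + 1" using that by auto
  thus ?thesis
  proof
   assume x: "x \<le> a"
   have "real (Suc n) * (x - a) \<le> 0" "real (Suc n) * (x - b) \<le> 0"
    using x ab by (auto intro!: mult_nonneg_nonpos)
   thus ?thesis using H0 by (simp only: \<phi>_eq)
  next
   assume x: "x \<ge> b + 1"
   have "1 * 1 \<le> real (Suc n) * (x - a)" "1 * 1 \<le> real (Suc n) * (x - b)"
    by (rule mult_mono; use x ab in simp)+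
   thus ?thesis using H1 by (simp only: \<phi>_eq)
  qed
 qed
 have \<phi>t: "test_function (\<phi> n)" for n
 proof -
  have "\<phi> n x = 0" if "\<bar>x\<bar> > \<bar>a\<bar> + \<bar>b\<bar> + 1" for x
   by (rule \<phi>out) (use that ab in auto)
  moreover have "smooth_upto k (\<phi> n)" for k
   unfolding \<phi>_def by (intro smooth_upto_diff smooth_upto_affine Hs)
  ultimately show ?thesis unfolding test_function_iff by blast
 qed
 have "(\<lambda>n. \<integral>x. g x * \<phi> n x \<partial>lborel) \<longlonglongrightarrow> (\<integral>x. indicator {a<..b} x * g x \<partial>lborel)"
 proof (rule integral_dominated_convergence[where w = "\<lambda>x. \<bar>indicator {a..b+1} x * g x\<bar>"])
  show "integrable lborel (\<lambda>x. \<bar>indicator {a..b+1} x * g x\<bar>)"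
   using locally_integrable_Icc[OF gl] by (rule integrable_abs)
  show "AE x in lborel. norm (g x * \<phi> i x) \<le> \<bar>indicator {a..b+1} x * g x\<bar>" for i
  proof (rule AE_I2)
   fix x
   have "\<phi> i x = 0" if "x \<notin> {a..b+1}" using \<phi>out that .
   moreover have "\<bar>\<phi> i x\<bar> \<le> 1"
    using Hb[of "real (Suc i) * x + - real (Suc i) * a"] Hb[of "real (Suc i) * x + - real (Suc i) * b"]
    unfolding \<phi>_def by linarith
   ultimately show "norm (g x * \<phi> i x) \<le> \<bar>indicator {a..b+1} x * g x\<bar>"
    by (cases "x \<in> {a..b+1}") (auto simp: abs_mult intro!: mult_left_le)
  qed
  show "AE x in lborel. (\<lambda>n. g x * \<phi> n x) \<longlonglongrightarrow> indicator {a<..b} x * g x"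
  proof (rule AE_I2)
   fix x
   \<comment> \<open>At x = c the value is constantly 0, which is why the limit is the indicator of
     the half-open interval (a, b] at every point and not only almost everywhere.\<close>
   have lim1: "(\<lambda>n. H (real (Suc n) * (x - c))) \<longlonglongrightarrow> (if x \<le> c then 0 else 1)" for c
   proof (cases "x \<le> c")
    case True
    hence "H (real (Suc n) * (x - c)) = 0" for n by (intro H0) (auto intro!: mult_nonneg_nonpos)
    thus ?thesis using True by simp
   next
    case False
    obtain N :: nat where N: "1 / (x - c) \<le> real N" using real_arch_simple by blast
    have "\<forall>\<^sub>F n in sequentially. H (real (Suc n) * (x - c)) = 1"
     using eventually_ge_at_top[of N]
    proof eventually_elim
     case (elim n)
     have "1 / (x - c) \<le> real (Suc n)" using N elim by simp
     hence "1 \<le> real (Suc n) * (x - c)" using False by (simp add: field_simps)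
     thus ?case by (rule H1)
    qed
    thus ?thesis using False by (simp add: tendsto_eventually)
   qed
   have "(\<lambda>n. g x * (H (real (Suc n) * (x - a)) - H (real (Suc n) * (x - b)))) \<longlonglongrightarrow> g x * ((if x \<le> a then 0 else 1) - (if x \<le> b then 0 else 1))"
    by (intro tendsto_intros lim1)
   moreover have "g x * ((if x \<le> a then 0 else 1) - (if x \<le> b then 0 else 1)) = indicator {a<..b} x * g x"
    using ab by (auto simp: indicator_def)
   ultimately show "(\<lambda>n. g x * \<phi> n x) \<longlonglongrightarrow> indicator {a<..b} x * g x"
    by (simp only: \<phi>_eq)
  qed
  show "(\<lambda>x. g x * \<phi> i x) \<in> borel_measurable lborel" for i
   unfolding \<phi>_def by measurable
 qed measurable
 thus ?thesis by (simp add: z[OF \<phi>t] LIMSEQ_const_iff)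
qed

text \<open>Restricted to (-R, R], the positive and the negative part of g are densities of two
  finite measures \<open>M 1\<close> and \<open>M (-1)\<close>. These agree on all half-lines, hence
  are equal, hence have the same density almost everywhere; and a number whose positive and negative
  parts coincide is 0.\<close>

lemma AE_zero_if_interval_integrals_zero:
 assumes l: "locally_integrable g" and z: "\<And>a b. a < b ==> (\<integral>x. indicator {a<..b} x * g x \<partial>lborel) = 0"
 shows "AE x in lborel. g x = 0"
proof -
 have [measurable]: "g \<in> borel_measurable borel" by (rule locally_integrable_measurable[OF l])
 have R: "AE x in lborel. x \<in> {-R<..R} \<longrightarrow> g x = 0" if R0: "R > 0" for R
 proof -
  define M where "M s = density lborel (\<lambda>x. ennreal (indicator {-R<..R} x * max 0 (s * g x)))" for s
  have int: "integrable lborel (\<lambda>x. indicator {a<..} x * (indicator {-R<..R} x * max 0 (s * g x)))" for s a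
  proof (rule Bochner_Integration.integrable_bound)
   show "integrable lborel (\<lambda>x. s * (indicator {-R..R} x * g x))"
    by (intro integrable_mult_right locally_integrable_Icc l)
  qed (auto simp: indicator_def)
  have em: "emeasure (M s) {a<..} = ennreal (\<integral>x. indicator {a<..} x * (indicator {-R<..R} x * max 0 (s * g x)) \<partial>lborel)" for s a
  proof -
   have "emeasure (M s) {a<..} = (\<integral>\<^sup>+x. ennreal (indicator {a<..} x * (indicator {-R<..R} x * max 0 (s * g x))) \<partial>lborel)"
    unfolding M_def by (subst emeasure_density) (auto intro!: nn_integral_cong simp: indicator_def)
   also have "\<dots> = ennreal (\<integral>x. indicator {a<..} x * (indicator {-R<..R} x * max 0 (s * g x)) \<partial>lborel)"
    by (rule nn_integral_eq_integral[OF int]) (auto simp: indicator_def)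
   finally show ?thesis .
  qed
  have "M 1 = M (-1)"
  proof (rule measure_eqI_lessThan)
   fix a
   have "(\<integral>x. indicator {a<..} x * (indicator {-R<..R} x * max 0 (1 * g x)) \<partial>lborel) - (\<integral>x. indicator {a<..} x * (indicator {-R<..R} x * max 0 (-1 * g x)) \<partial>lborel)
    = (\<integral>x. indicator {a<..} x * (indicator {-R<..R} x * max 0 (1 * g x)) - indicator {a<..} x * (indicator {-R<..R} x * max 0 (-1 * g x)) \<partial>lborel)"
    using int by (intro Bochner_Integration.integral_diff[symmetric])
   also have "\<dots> = (\<integral>x. indicator {max a (-R)<..R} x * g x \<partial>lborel)"
    by (rule Bochner_Integration.integral_cong) (auto simp: indicator_def)
   also have "\<dots> = 0" by (cases "max a (-R) < R") (auto simp: z)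
   finally show "emeasure (M 1) {a<..} = emeasure (M (-1)) {a<..}" unfolding em by simp
   show "emeasure (M 1) {a<..} < \<infinity>" unfolding em by simp
  qed (auto simp: M_def)
  hence "AE x in lborel. ennreal (indicator {-R<..R} x * max 0 (1 * g x)) = ennreal (indicator {-R<..R} x * max 0 (-1 * g x))"
   unfolding M_def by (intro sigma_finite_measure.density_unique[OF lborel.sigma_finite_measure_axioms]) auto
  thus ?thesis by eventually_elim (auto simp: indicator_def max_def split: if_splits)
 qed
 have "AE x in lborel. \<forall>n::nat. x \<in> {-(real (Suc n))<..real (Suc n)} \<longrightarrow> g x = 0"
  unfolding AE_all_countable using R by (metis of_nat_0_less_iff zero_less_Suc)
 thus ?thesis
 proof eventually_elim
  case (elim x)
  obtain n :: nat where "\<bar>x\<bar> < real n" using reals_Archimedean2 by blast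
  hence "x \<in> {-(real (Suc n))<..real (Suc n)}" by auto
  thus ?case using elim by blast
 qed
qed

lemma weak_deriv_unique:
 assumes "has_weak_deriv f g" "has_weak_deriv f g'" shows "AE x in lborel. g x = g' x"
proof -
 have w: "has_weak_deriv (\<lambda>x. 0) (\<lambda>x. g x - g' x)" using has_weak_deriv_diff[OF assms] by simp
 have "AE x in lborel. g x - g' x = 0"
  by (rule AE_zero_if_interval_integrals_zero; (rule interval_integral_zero_if_test_zero)?)
   (use w in \<open>auto simp: has_weak_deriv_def\<close>)
 thus ?thesis by simp
qed

section \<open>Sobolev norms and weak compactness\<close>

text \<open>\<open>weak_deriv\<close> picks an arbitrary representative, so its iterates are
  compared with the given chain by induction, uniqueness giving equality almost everywhere at each
  order. Thus the Sobolev norm may be computed from any convenient chain of weak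
  derivatives.\<close>

lemma Hsq_weak_chain:
 assumes l0: "locally_integrable (g 0)" and ch: "\<And>j. j < m ==> has_weak_deriv (g j) (g (Suc j))"
 shows "Hsq m (g 0) = (\<Sum>j\<le>m. L2sq (g j))"
proof -
 let ?w = "\<lambda>j. (weak_deriv ^^ j) (g 0)"
 have li: "locally_integrable (g j)" if "j \<le> m" for j
  using that l0 ch[of "j - 1"] by (cases j) (auto simp: has_weak_deriv_def)
 have step: "has_weak_deriv (?w j) (?w (Suc j))"
  if "j < m" "AE x in lborel. ?w j x = g j x" "locally_integrable (?w j)" for j
 proof -
  have "has_weak_deriv (?w j) (g (Suc j))"
   by (rule has_weak_deriv_cong_AE[OF ch[OF that(1)]]) (use that li in auto)
  hence "has_weak_deriv (?w j) (weak_deriv (?w j))"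
   unfolding weak_deriv_def[of "?w j"] by (rule someI[of "has_weak_deriv (?w j)"])
  thus ?thesis by simp
 qed
 have main: "(AE x in lborel. ?w j x = g j x) \<and> locally_integrable (?w j)" if "j \<le> m" for j
  using that
 proof (induction j)
  case (Suc j)
  hence j: "j < m" "AE x in lborel. ?w j x = g j x" "locally_integrable (?w j)" by auto
  have 1: "has_weak_deriv (?w j) (?w (Suc j))" by (rule step[OF j])
  have 2: "has_weak_deriv (?w j) (g (Suc j))"
   by (rule has_weak_deriv_cong_AE[OF ch[OF j(1)]]) (use j li Suc in auto)
  show ?case using weak_deriv_unique[OF 1 2] 1 by (simp add: has_weak_deriv_def)
 qed (use l0 in simp)
 have "L2sq (?w j) = L2sq (g j)" if "j \<le> m" for j
  unfolding L2sq_def by (rule nn_integral_cong_AE) (use main[OF that] in auto)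
 thus ?thesis unfolding Hsq_def using l0 step main by auto
qed

lemma Hsq_finiteD:
 assumes "Hsq m f < \<infinity>"
 obtains g where "g 0 = f" "\<And>j. j < m ==> has_weak_deriv (g j) (g (Suc j))"
  "\<And>j. j \<le> m ==> L2sq (g j) \<le> Hsq m f" "\<And>j. j \<le> m ==> locally_integrable (g j)"
proof -
 have *: "locally_integrable f" "\<And>j. j < m ==> has_weak_deriv ((weak_deriv ^^ j) f) ((weak_deriv ^^ Suc j) f)"
  "Hsq m f = (\<Sum>j\<le>m. L2sq ((weak_deriv ^^ j) f))"
  using assms unfolding Hsq_def by (auto split: if_splits)
 show ?thesis
 proof (rule that[of "\<lambda>j. (weak_deriv ^^ j) f"])
  show "L2sq ((weak_deriv ^^ j) f) \<le> Hsq m f" if "j \<le> m" for j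
   unfolding *(3) by (rule member_le_sum) (use that in auto)
  show "locally_integrable ((weak_deriv ^^ j) f)" if "j \<le> m" for j
   using that *(1) *(2)[of "j - 1"] by (cases j) (auto simp: has_weak_deriv_def)
 qed (use * in auto)
qed

lemma L2sq_le_Hsq: "L2sq f \<le> Hsq m f"
proof (cases "Hsq m f < \<infinity>")
 case True
 then obtain g where "g 0 = f" "\<And>j. j \<le> m ==> L2sq (g j) \<le> Hsq m f" by (rule Hsq_finiteD) blast
 thus ?thesis by blast
next
 case False
 hence "Hsq m f = \<infinity>" by (simp add: less_top[symmetric])
 thus ?thesis by simp
qed

lemma L2sq_integrable_iff:
 assumes [measurable]: "f \<in> borel_measurable borel"
 shows "L2sq f < \<infinity> \<longleftrightarrow> integrable lborel (\<lambda>x. (f x)^2)"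
 unfolding L2sq_def integrable_iff_bounded by simp

lemma L2sq_eq_integral: "integrable lborel (\<lambda>x. (f x)^2) ==> L2sq f = ennreal (\<integral>x. (f x)^2 \<partial>lborel)"
 unfolding L2sq_def by (rule nn_integral_eq_integral) auto

lemma L2sq_imp_locally_integrable:
 assumes [measurable]: "f \<in> borel_measurable borel" and fin: "L2sq f < \<infinity>"
 shows "locally_integrable f"
 unfolding locally_integrable_iff_Icc
proof
 fix R :: real
 have i: "integrable lborel (\<lambda>x. (f x)^2)" using L2sq_integrable_iff assms by blast
 have "integrable lborel (\<lambda>x. indicator {-R..R} x * 1 + (f x)^2)"
  by (intro Bochner_Integration.integrable_add i locally_integrable_Icc continuous_imp_locally_integrable) simp
 thus "integrable lborel (\<lambda>x. indicator {-R..R} x * f x)"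
 proof (rule Bochner_Integration.integrable_bound)
  have "\<bar>f x\<bar> \<le> 1 + (f x)^2" for x
   using sum_squares_bound[of "\<bar>f x\<bar>" 1] by (simp add: power2_eq_square)
  thus "AE x in lborel. norm (indicator {-R..R} x * f x) \<le> norm (indicator {-R..R} x * 1 + (f x)^2)"
   by (auto simp: indicator_def)
 qed measurable
qed

lemma L2sq_add_le:
 assumes [measurable]: "f \<in> borel_measurable borel" "g \<in> borel_measurable borel"
 shows "L2sq (\<lambda>x. f x + g x) \<le> 2 * L2sq f + 2 * L2sq g"
proof -
 have "L2sq (\<lambda>x. f x + g x) \<le> (\<integral>\<^sup>+x. 2 * ennreal ((f x)^2) + 2 * ennreal ((g x)^2) \<partial>lborel)"
  unfolding L2sq_def
 proof (rule nn_integral_mono)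
  fix x
  have "(f x + g x)^2 \<le> 2 * (f x)^2 + 2 * (g x)^2"
   using sum_squares_bound[of "f x" "g x"] by (simp add: power2_sum)
  hence "ennreal ((f x + g x)^2) \<le> ennreal (2 * (f x)^2 + 2 * (g x)^2)" by (rule ennreal_leI)
  thus "ennreal ((f x + g x)^2) \<le> 2 * ennreal ((f x)^2) + 2 * ennreal ((g x)^2)"
   by (simp add: ennreal_mult)
 qed
 also have "\<dots> = 2 * L2sq f + 2 * L2sq g"
  unfolding L2sq_def by (simp add: nn_integral_add nn_integral_cmult)
 finally show ?thesis .
qed

lemma L2sq_cmult:
 assumes [measurable]: "f \<in> borel_measurable borel"
 shows "L2sq (\<lambda>x. c * f x) = ennreal (c^2) * L2sq f"
 unfolding L2sq_def by (simp add: power_mult_distrib ennreal_mult nn_integral_cmult)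

lemma L2sq_diff_le:
 assumes [measurable]: "f \<in> borel_measurable borel" "g \<in> borel_measurable borel"
 shows "L2sq (\<lambda>x. f x - g x) \<le> 2 * L2sq f + 2 * L2sq g"
 using L2sq_add_le[of f "\<lambda>x. -1 * g x"] L2sq_cmult[of g "-1"] by simp

lemma L2sq_scale:
 assumes [measurable]: "f \<in> borel_measurable borel" and a: "a \<noteq> 0"
 shows "L2sq f = \<bar>a\<bar> * L2sq (\<lambda>x. f (a * x))"
 unfolding L2sq_def using nn_integral_real_affine[of "\<lambda>x. ennreal ((f x)^2)" a 0] a by simp

text \<open>Fatou's lemma for the squares. The threshold N allows families for which the bound holds
  only from some index on.\<close>

lemma L2sq_tendsto_le:
 assumes m: "\<And>n. f n \<in> borel_measurable borel" and lim: "AE x in lborel. (\<lambda>n. f n x) \<longlonglongrightarrow> g x"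
  and b: "\<And>n. n \<ge> N ==> L2sq (f n) \<le> B"
 shows "L2sq g \<le> B"
proof -
 note [measurable] = m
 have "L2sq g = (\<integral>\<^sup>+x. liminf (\<lambda>n. ennreal ((f n x)^2)) \<partial>lborel)"
  unfolding L2sq_def
 proof (rule nn_integral_cong_AE)
  show "AE x in lborel. ennreal ((g x)^2) = liminf (\<lambda>n. ennreal ((f n x)^2))"
   using lim
  proof eventually_elim
   case (elim x)
   hence "(\<lambda>n. ennreal ((f n x)^2)) \<longlonglongrightarrow> ennreal ((g x)^2)" by (intro tendsto_ennrealI tendsto_intros)
   from lim_imp_Liminf[OF _ this] show ?case by simp
  qed
 qed
 also have "\<dots> \<le> liminf (\<lambda>n. \<integral>\<^sup>+x. ennreal ((f n x)^2) \<partial>lborel)"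
  by (rule nn_integral_liminf) measurable
 also have "\<dots> \<le> B"
  using b unfolding L2sq_def
  by (intro Liminf_le) (auto intro!: eventually_sequentiallyI)
 finally show ?thesis .
qed

section \<open>Weak sequential compactness in L^2 by averaging\<close>

text \<open>Only midpoints are formed, since the parallelogram law asks for no other convex
  combination, and properties of the hull reduce to a two-case induction.\<close>

inductive_set midpoint_hull :: "(nat \<Rightarrow> real \<Rightarrow> real) \<Rightarrow> nat \<Rightarrow> (real \<Rightarrow> real) set" for f n where
 base: "k \<ge> n ==> f k \<in> midpoint_hull f n"
| mid: "u \<in> midpoint_hull f n ==> v \<in> midpoint_hull f n ==> (\<lambda>x. (u x + v x) / 2) \<in> midpoint_hull f n"

lemma midpoint_hull_antimono: "m \<le> n ==> midpoint_hull f n \<subseteq> midpoint_hull f m"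
proof
 fix u assume "m \<le> n" "u \<in> midpoint_hull f n"
 from this(2) this(1) show "u \<in> midpoint_hull f m"
  by induction (auto intro: midpoint_hull.intros)
qed

lemma four_pow: "((2::real) ^ i)^2 = 4 ^ i"
 by (simp add: power2_eq_square power_mult_distrib[symmetric])

lemma ennreal_le_suminf: "a i \<le> (\<Sum>i. a i :: ennreal)"
proof -
 have "sum a {i} \<le> suminf a" by (rule sum_le_suminf) auto
 thus ?thesis by simp
qed

text \<open>The rate 1/16^i leaves room for the weights 4^i: the sum of 4^i (G i - G (i+1))^2 is
  integrable, hence finite almost everywhere, so the increments are of order 2^-i and the sequence
  converges at almost every point. The L^2 rate of the limit then follows by Fatou.\<close>

lemma L2_Cauchy_limit:
 assumes m: "\<And>i. G i \<in> borel_measurable borel"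
  and c: "\<And>i j. i \<le> j ==> L2sq (\<lambda>x. G i x - G j x) \<le> ennreal ((1 / 16) ^ i)"
 obtains g where "g \<in> borel_measurable borel" "AE x in lborel. (\<lambda>i. G i x) \<longlonglongrightarrow> g x"
  "\<And>i. L2sq (\<lambda>x. G i x - g x) \<le> ennreal ((1 / 16) ^ i)"
proof -
 note [measurable] = m
 have "(\<integral>\<^sup>+x. (\<Sum>i. ennreal (4 ^ i * (G i x - G (Suc i) x)^2)) \<partial>lborel)
   = (\<Sum>i. \<integral>\<^sup>+x. ennreal (4 ^ i * (G i x - G (Suc i) x)^2) \<partial>lborel)"
  by (rule nn_integral_suminf) measurable
 also have "\<dots> \<le> (\<Sum>i. ennreal ((1 / 4) ^ i))"
 proof (rule suminf_le)
  fix i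
  have "(\<integral>\<^sup>+x. ennreal (4 ^ i * (G i x - G (Suc i) x)^2) \<partial>lborel) = ennreal (4 ^ i) * L2sq (\<lambda>x. G i x - G (Suc i) x)"
   unfolding L2sq_def by (simp add: ennreal_mult nn_integral_cmult)
  also have "\<dots> \<le> ennreal (4 ^ i) * ennreal ((1 / 16) ^ i)" by (intro mult_left_mono c) auto
  also have "\<dots> = ennreal ((1 / 4) ^ i)"
   by (simp add: ennreal_mult[symmetric] power_mult_distrib[symmetric])
  finally show "(\<integral>\<^sup>+x. ennreal (4 ^ i * (G i x - G (Suc i) x)^2) \<partial>lborel) \<le> ennreal ((1 / 4) ^ i)" .
 qed auto
 also have "\<dots> < \<infinity>"
 proof -
  have "(\<Sum>i. ennreal ((1 / 4) ^ i)) = ennreal (\<Sum>i. (1 / 4) ^ i)"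
   by (rule suminf_ennreal2) (auto intro: summable_geometric)
  thus ?thesis by simp
 qed
 finally have "(\<integral>\<^sup>+x. (\<Sum>i. ennreal (4 ^ i * (G i x - G (Suc i) x)^2)) \<partial>lborel) \<noteq> \<infinity>" by simp
 hence "AE x in lborel. (\<Sum>i. ennreal (4 ^ i * (G i x - G (Suc i) x)^2)) \<noteq> \<infinity>"
  by (rule nn_integral_PInf_AE[rotated]) measurable
 hence conv: "AE x in lborel. convergent (\<lambda>i. G i x)"
 proof eventually_elim
  case (elim x)
  define S where "S = (\<Sum>i. ennreal (4 ^ i * (G i x - G (Suc i) x)^2))"
  have bd: "\<bar>G (Suc i) x - G i x\<bar> \<le> sqrt (enn2real S) * (1 / 2) ^ i" for i
  proof -
   have "ennreal (4 ^ i * (G i x - G (Suc i) x)^2) \<le> S"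
    unfolding S_def by (rule ennreal_le_suminf)
   hence "4 ^ i * (G i x - G (Suc i) x)^2 \<le> enn2real S"
   proof -
    have "S < top" using elim by (simp add: S_def less_top)
    from enn2real_mono[OF \<open>ennreal (4 ^ i * (G i x - G (Suc i) x)^2) \<le> S\<close> this] show ?thesis by simp
   qed
   hence "(2 ^ i * \<bar>G (Suc i) x - G i x\<bar>)^2 \<le> enn2real S"
    by (simp add: power_mult_distrib power2_commute four_pow)
   hence "2 ^ i * \<bar>G (Suc i) x - G i x\<bar> \<le> sqrt (enn2real S)" by (rule real_le_rsqrt)
   hence "2 ^ i * \<bar>G (Suc i) x - G i x\<bar> * (1 / 2) ^ i \<le> sqrt (enn2real S) * (1 / 2) ^ i" by (rule mult_right_mono) simp
   moreover have "2 ^ i * \<bar>G (Suc i) x - G i x\<bar> * (1 / 2) ^ i = \<bar>G (Suc i) x - G i x\<bar>"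
    by (simp add: power_divide)
   ultimately show ?thesis by simp
  qed
  have "summable (\<lambda>i. G (Suc i) x - G i x)"
  proof (rule summable_comparison_test')
   show "summable (\<lambda>i. sqrt (enn2real S) * (1 / 2 :: real) ^ i)" by (intro summable_mult summable_geometric) simp
  qed (use bd in auto)
  hence "convergent (\<lambda>n. \<Sum>i<n. G (Suc i) x - G i x)" by (simp add: summable_iff_convergent)
  hence "convergent (\<lambda>n. G n x - G 0 x)" using sum_lessThan_telescope[of "\<lambda>i. G i x"] by (simp only:)
  hence "convergent (\<lambda>n. (G n x - G 0 x) + G 0 x)" by (intro convergent_add convergent_const)
  thus ?case by simp
 qed
 define g where "g x = lim (\<lambda>i. G i x)" for x
 have gm [measurable]: "g \<in> borel_measurable borel" unfolding g_def by (intro borel_measurable_lim_metric m)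
 have lim: "AE x in lborel. (\<lambda>i. G i x) \<longlonglongrightarrow> g x"
  using conv by eventually_elim (simp add: g_def convergent_LIMSEQ_iff)
 have "L2sq (\<lambda>x. G i x - g x) \<le> ennreal ((1 / 16) ^ i)" for i
 proof (rule L2sq_tendsto_le[where f = "\<lambda>j x. G i x - G j x" and N = i])
  show "AE x in lborel. (\<lambda>j. G i x - G j x) \<longlonglongrightarrow> G i x - g x"
   using lim by eventually_elim (intro tendsto_intros)
 qed (use c in auto)
 thus ?thesis using that[OF gm lim] by blast
qed

text \<open>The midpoint-convex hulls of the tails play the role of Mazur's lemma: almost minimisers of the norm
 in them form a Cauchy sequence by the parallelogram law.\<close>

lemma weak_L2_compactness:
 fixes f :: "nat \<Rightarrow> real \<Rightarrow> real"
 assumes m: "\<And>n. f n \<in> borel_measurable borel" and b: "\<And>n. L2sq (f n) \<le> ennreal M"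
  and conv: "\<And>\<phi>. test_function \<phi> ==> (\<lambda>n. \<integral>x. f n x * \<phi> x \<partial>lborel) \<longlonglongrightarrow> l \<phi>"
 obtains g where "g \<in> borel_measurable borel" "L2sq g \<le> ennreal M"
  "\<And>\<phi>. test_function \<phi> ==> (\<integral>x. g x * \<phi> x \<partial>lborel) = l \<phi>"
proof -
 define N where "N u = (\<integral>x. (u x)^2 \<partial>lborel)" for u :: "real \<Rightarrow> real"
 define H where "H = midpoint_hull f"
 have Hmeas: "u \<in> borel_measurable borel" if "u \<in> H n" for u n
  using that unfolding H_def by induction (auto simp: m)
 have Hint: "integrable lborel (\<lambda>x. (u x)^2)" if "u \<in> H n" for u n
  using that unfolding H_def
 proof induction
  case (base k)
  show ?case using b[of k] m[of k] L2sq_integrable_iff[of "f k"] by (simp add: le_less_trans[of _ "ennreal M"])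
 next
  case (mid u v)
  have [measurable]: "u \<in> borel_measurable borel" "v \<in> borel_measurable borel"
   using mid Hmeas unfolding H_def by auto
  have "integrable lborel (\<lambda>x. (u x)^2 + (v x)^2)" using mid by simp
  thus ?case
  proof (rule Bochner_Integration.integrable_bound)
   have "((u x + v x) / 2)^2 \<le> (u x)^2 + (v x)^2" for x
   proof -
    have "(u x + v x)^2 \<le> 2 * (u x)^2 + 2 * (v x)^2"
     using sum_squares_bound[of "u x" "v x"] unfolding power2_sum by linarith
    moreover have "((u x + v x) / 2)^2 = (u x + v x)^2 / 4" by (simp add: power_divide)
    ultimately show ?thesis using zero_le_power2[of "u x"] zero_le_power2[of "v x"] by linarith
   qed
   thus "AE x in lborel. norm (((u x + v x) / 2)^2) \<le> norm ((u x)^2 + (v x)^2)" by simp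
  qed measurable
 qed
 have Huv: "integrable lborel (\<lambda>x. u x * v x)" if "u \<in> H n" "v \<in> H k" for u v n k
 proof -
  have [measurable]: "u \<in> borel_measurable borel" "v \<in> borel_measurable borel"
   using that Hmeas by auto
  have "integrable lborel (\<lambda>x. (u x)^2 + (v x)^2)" using Hint that by simp
  thus ?thesis
  proof (rule Bochner_Integration.integrable_bound)
   have "\<bar>u x * v x\<bar> \<le> (u x)^2 + (v x)^2" for x
    using sum_squares_bound[of "\<bar>u x\<bar>" "\<bar>v x\<bar>"] mult_nonneg_nonneg[OF abs_ge_zero[of "u x"] abs_ge_zero[of "v x"]]
    unfolding abs_mult power2_abs by linarith
   thus "AE x in lborel. norm (u x * v x) \<le> norm ((u x)^2 + (v x)^2)" by simp
  qed measurable
 qed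
 have sq_mid: "N (\<lambda>x. (u x + v x) / 2) = (N u + N v + 2 * (\<integral>x. u x * v x \<partial>lborel)) / 4"
  if "u \<in> H n" "v \<in> H k" for u v n k
 proof -
  have "N (\<lambda>x. (u x + v x) / 2) = (\<integral>x. ((u x)^2 + (v x)^2 + 2 * (u x * v x)) / 4 \<partial>lborel)"
   unfolding N_def by (rule Bochner_Integration.integral_cong) (auto simp: power2_sum power_divide)
  thus ?thesis using Hint[OF that(1)] Hint[OF that(2)] Huv[OF that] by (simp add: N_def)
 qed
 have sq_diff: "N (\<lambda>x. u x - v x) = N u + N v - 2 * (\<integral>x. u x * v x \<partial>lborel)"
  and int_diff: "integrable lborel (\<lambda>x. (u x - v x)^2)"
  if "u \<in> H n" "v \<in> H k" for u v n k
 proof -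
  have *: "(\<lambda>x. (u x - v x)^2) = (\<lambda>x. (u x)^2 + (v x)^2 - 2 * (u x * v x))"
   by (auto simp: power2_diff)
  show "N (\<lambda>x. u x - v x) = N u + N v - 2 * (\<integral>x. u x * v x \<partial>lborel)" "integrable lborel (\<lambda>x. (u x - v x)^2)"
   using Hint[OF that(1)] Hint[OF that(2)] Huv[OF that] unfolding N_def * by simp_all
 qed
 have cs: "2 * (\<integral>x. u x * v x \<partial>lborel) \<le> N u + N v" if "u \<in> H n" "v \<in> H k" for u v n k
 proof -
  have "0 \<le> N (\<lambda>x. u x - v x)" unfolding N_def by simp
  thus ?thesis using sq_diff[OF that] by simp
 qed
 have M0: "M \<ge> 0 \<or> (\<forall>n. L2sq (f n) = 0)" using b by (metis ennreal_neg le_zero_eq linear)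
 \<comment> \<open>For negative M the bound \<open>ennreal M\<close> means 0, so the corresponding
   real bound is max M 0.\<close>
 define M' where "M' = max M 0"
 have HN: "N u \<le> M'" if "u \<in> H n" for u n
  using that unfolding H_def
 proof induction
  case (base k)
  hence "f k \<in> H n" unfolding H_def by (rule midpoint_hull.base)
  hence "L2sq (f k) = ennreal (N (f k))" unfolding N_def by (intro L2sq_eq_integral Hint)
  hence "ennreal (N (f k)) \<le> ennreal M'" using b[of k] unfolding M'_def by (metis ennreal_leI max.cobounded1 order_trans)
  thus ?case by (auto simp: M'_def ennreal_le_iff2)
 next
  case (mid u v)
  thus ?case using sq_mid[of u n v n] cs[of u n v n] unfolding H_def by simp
 qed
 have Hf: "f n \<in> H n" for n unfolding H_def by (rule midpoint_hull.base) simp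
 define d where "d n = Inf (N ` H n)" for n
 have bb: "bdd_below (N ` H n)" for n by (rule bdd_belowI[of _ 0]) (auto simp: N_def)
 have d_le: "d n \<le> N u" if "u \<in> H n" for n u unfolding d_def by (rule cInf_lower) (use that bb in auto)
 have d_mono: "incseq d"
 proof (rule incseq_SucI)
  fix n
  have "H (Suc n) \<subseteq> H n" unfolding H_def by (rule midpoint_hull_antimono) simp
  thus "d n \<le> d (Suc n)" unfolding d_def using Hf[of "Suc n"] by (intro cInf_superset_mono bb) auto
 qed
 have "d n \<le> M'" for n using d_le[OF Hf[of n]] HN[OF Hf[of n]] by simp
 then obtain Dl where Dl: "d \<longlonglongrightarrow> Dl" using incseq_convergent[OF d_mono] by metis
 have d_Dl: "d n \<le> Dl" for n by (rule incseq_le[OF d_mono Dl])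
 have "\<exists>u\<in>H n. N u < d n + 1 / real (Suc n)" for n
 proof -
  have "Inf (N ` H n) < d n + 1 / real (Suc n)" unfolding d_def by simp
  thus ?thesis using cInf_less_iff[of "N ` H n"] Hf[of n] bb by auto
 qed
 then obtain g where g: "\<And>n. g n \<in> H n" "\<And>n. N (g n) < d n + 1 / real (Suc n)" by metis
 \<comment> \<open>By the parallelogram law the squared distance of g n and g k is 2 N (g n) + 2 N
   (g k) minus four times the value of N at the midpoint. The midpoint contributes at least d n,
   while g n and g k exceed d n and d k \<le> Dl by at most 1/(n+1).\<close>
 define r where "r n = 2 * (Dl - d n) + 4 / real (Suc n)" for n
 have Nr: "N (\<lambda>x. g n x - g k x) \<le> r n" if "n \<le> k" for n k
 proof -
  have gk: "g k \<in> H n" using g(1)[of k] midpoint_hull_antimono[OF that] unfolding H_def by blast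
  have "(\<lambda>x. (g n x + g k x) / 2) \<in> H n"
   using g(1)[of n] gk unfolding H_def by (rule midpoint_hull.mid)
  from d_le[OF this] have 1: "d n \<le> (N (g n) + N (g k) + 2 * (\<integral>x. g n x * g k x \<partial>lborel)) / 4"
   using sq_mid[OF g(1) g(1)] by simp
  have 2: "N (\<lambda>x. g n x - g k x) = N (g n) + N (g k) - 2 * (\<integral>x. g n x * g k x \<partial>lborel)"
   by (rule sq_diff[OF g(1) g(1)])
  have 3: "1 / real (Suc k) \<le> 1 / real (Suc n)" using that by (simp add: field_simps)
  show ?thesis using 1 2 3 g(2)[of n] g(2)[of k] d_Dl[of k] unfolding r_def by simp
 qed
 have "r \<longlonglongrightarrow> 2 * (Dl - Dl) + 4 * 0"
  unfolding r_def divide_inverse by (intro tendsto_intros Dl LIMSEQ_inverse_real_of_nat)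
 hence "r \<longlonglongrightarrow> 0" by simp
 hence "\<exists>K. \<forall>n\<ge>K. r n < (1 / 16) ^ i" for i :: nat
  using order_tendstoD(2)[of r 0 sequentially "(1 / 16) ^ i"] by (simp add: eventually_sequentially)
 then obtain K where K: "\<And>i n. n \<ge> K i ==> r n < (1 / 16) ^ i" by metis
 \<comment> \<open>The sum makes k monotone and at least K i; the summand i pushes the index of the
   hull to infinity, which the convergence of the test integrals below relies on.\<close>
 define k where "k i = (\<Sum>j\<le>i. K j) + i" for i
 have k1: "k i \<ge> K i" for i unfolding k_def using member_le_sum[of i "{..i}" K] by simp
 have k2: "k i \<le> k j" if "i \<le> j" for i j unfolding k_def using that by (intro add_mono sum_mono2) auto
 define G where "G i = g (k i)" for i
 have GH: "G i \<in> H (k i)" for i unfolding G_def by (rule g(1))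
 have Gm: "G i \<in> borel_measurable borel" for i by (rule Hmeas[OF GH])
 have Gc: "L2sq (\<lambda>x. G i x - G j x) \<le> ennreal ((1 / 16) ^ i)" if "i \<le> j" for i j
 proof -
  have "L2sq (\<lambda>x. G i x - G j x) = ennreal (N (\<lambda>x. G i x - G j x))"
   unfolding N_def by (intro L2sq_eq_integral int_diff[OF GH GH])
  also have "\<dots> \<le> ennreal ((1 / 16) ^ i)"
   using Nr[OF k2[OF that]] K[OF k1[of i]] unfolding G_def by (intro ennreal_leI) simp
  finally show ?thesis .
 qed
 obtain gl where gl: "gl \<in> borel_measurable borel" "AE x in lborel. (\<lambda>i. G i x) \<longlonglongrightarrow> gl x"
  "\<And>i. L2sq (\<lambda>x. G i x - gl x) \<le> ennreal ((1 / 16) ^ i)"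
  using L2_Cauchy_limit[OF Gm Gc] by blast
 have L2G: "L2sq u \<le> ennreal M" if "u \<in> H n" for u n
 proof -
  have "L2sq u = ennreal (N u)" unfolding N_def by (intro L2sq_eq_integral Hint[OF that])
  moreover have "ennreal M' = ennreal M" unfolding M'_def by (simp add: max_def ennreal_neg)
  ultimately show ?thesis using HN[OF that] by (metis ennreal_leI)
 qed
 have L2gl: "L2sq gl \<le> ennreal M"
  by (rule L2sq_tendsto_le[OF Gm gl(2), of 0]) (use L2G[OF GH] in auto)
 have li: "locally_integrable u" if "u \<in> H n" for u n
  by (rule L2sq_imp_locally_integrable[OF Hmeas[OF that]]) (use L2G[OF that] in \<open>simp add: le_less_trans[of _ "ennreal M"]\<close>)
 have ligl: "locally_integrable gl"
  by (rule L2sq_imp_locally_integrable[OF gl(1)]) (use L2gl in \<open>simp add: le_less_trans[of _ "ennreal M"]\<close>)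
 have "(\<integral>x. gl x * \<phi> x \<partial>lborel) = l \<phi>" if t: "test_function \<phi>" for \<phi>
 proof -
  \<comment> \<open>An estimate for the test integrals of all members of a tail is inherited by
    midpoints and hence by the whole hull: averaging within the tails does not change the weak
    limit.\<close>
  have near: "\<bar>(\<integral>x. u x * \<phi> x \<partial>lborel) - l \<phi>\<bar> \<le> e"
   if "u \<in> H n" "\<And>k. k \<ge> n ==> \<bar>(\<integral>x. f k x * \<phi> x \<partial>lborel) - l \<phi>\<bar> \<le> e" for u n e
   using that unfolding H_def
  proof induction
   case (mid u v)
   have "integrable lborel (\<lambda>x. u x * \<phi> x)" "integrable lborel (\<lambda>x. v x * \<phi> x)"
    using mid(1,2) li t integrable_mult_test unfolding H_def by blast+
   hence "(\<integral>x. (u x + v x) / 2 * \<phi> x \<partial>lborel) = ((\<integral>x. u x * \<phi> x \<partial>lborel) + (\<integral>x. v x * \<phi> x \<partial>lborel)) / 2"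
    by (simp add: distrib_right)
   moreover have "\<bar>(\<integral>x. u x * \<phi> x \<partial>lborel) - l \<phi>\<bar> \<le> e" "\<bar>(\<integral>x. v x * \<phi> x \<partial>lborel) - l \<phi>\<bar> \<le> e"
    using mid by auto
   ultimately show ?case unfolding abs_le_iff by (simp add: field_simps)
  qed auto
  have 1: "(\<lambda>i. \<integral>x. G i x * \<phi> x \<partial>lborel) \<longlonglongrightarrow> l \<phi>"
  proof (rule LIMSEQ_I)
   fix e :: real assume e: "e > 0"
   obtain n0 where n0: "\<And>n. n \<ge> n0 ==> norm ((\<integral>x. f n x * \<phi> x \<partial>lborel) - l \<phi>) < e / 2"
    using LIMSEQ_D[OF conv[OF t], of "e / 2"] e by auto
   have "norm ((\<integral>x. G i x * \<phi> x \<partial>lborel) - l \<phi>) < e" if "i \<ge> n0" for i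
   proof -
    have "k i \<ge> n0" using that unfolding k_def by simp
    hence "\<bar>(\<integral>x. G i x * \<phi> x \<partial>lborel) - l \<phi>\<bar> \<le> e / 2"
     using n0 by (intro near[OF GH[of i]]) (auto simp: less_imp_le)
    thus ?thesis using e by simp
   qed
   thus "\<exists>no. \<forall>n\<ge>no. norm ((\<integral>x. G n x * \<phi> x \<partial>lborel) - l \<phi>) < e" by blast
  qed
  have \<phi>i: "integrable lborel (\<lambda>x. (\<phi> x)^2)"
   using integrable_mult_test[OF continuous_imp_locally_integrable[OF test_function_continuous[OF t]] t]
   by (simp add: power2_eq_square)
  \<comment> \<open>Young's inequality with weights 4^i and 4^-i takes the place of Cauchy-Schwarz;
    the squared distance 16^-i turns into the rate 4^-i.\<close>
  have bd: "norm ((\<integral>x. G i x * \<phi> x \<partial>lborel) - (\<integral>x. gl x * \<phi> x \<partial>lborel)) \<le> (1 / 4) ^ i * (1 + (\<integral>x. (\<phi> x)^2 \<partial>lborel))" for i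
  proof -
   have m1: "(\<lambda>x. G i x - gl x) \<in> borel_measurable borel" using Gm gl(1) by measurable
   have "L2sq (\<lambda>x. G i x - gl x) < \<infinity>" using gl(3)[of i] by (simp add: le_less_trans)
   hence di: "integrable lborel (\<lambda>x. (G i x - gl x)^2)" using L2sq_integrable_iff[OF m1] by blast
   hence dN: "(\<integral>x. (G i x - gl x)^2 \<partial>lborel) \<le> (1 / 16) ^ i"
    using gl(3)[of i] L2sq_eq_integral[OF di] by (simp add: ennreal_le_iff)
   have i12: "integrable lborel (\<lambda>x. G i x * \<phi> x)" "integrable lborel (\<lambda>x. gl x * \<phi> x)"
    using li[OF GH] ligl t integrable_mult_test by blast+
   have "norm ((\<integral>x. G i x * \<phi> x \<partial>lborel) - (\<integral>x. gl x * \<phi> x \<partial>lborel)) = norm (\<integral>x. (G i x - gl x) * \<phi> x \<partial>lborel)"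
    using i12 by (simp add: left_diff_distrib)
   also have "\<dots> \<le> (\<integral>x. 4 ^ i * (G i x - gl x)^2 + (1 / 4) ^ i * (\<phi> x)^2 \<partial>lborel)"
   proof (rule Bochner_Integration.integral_norm_bound_integral)
    show "integrable lborel (\<lambda>x. (G i x - gl x) * \<phi> x)" using i12 by (simp add: left_diff_distrib)
    show "integrable lborel (\<lambda>x. 4 ^ i * (G i x - gl x)^2 + (1 / 4) ^ i * (\<phi> x)^2)"
     using di \<phi>i by simp
    show "norm ((G i x - gl x) * \<phi> x) \<le> 4 ^ i * (G i x - gl x)^2 + (1 / 4) ^ i * (\<phi> x)^2" for x
    proof -
     have "2 * (2 ^ i * \<bar>G i x - gl x\<bar>) * ((1/2) ^ i * \<bar>\<phi> x\<bar>) \<le> (2 ^ i * \<bar>G i x - gl x\<bar>)^2 + ((1/2) ^ i * \<bar>\<phi> x\<bar>)^2"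
      by (rule sum_squares_bound)
     moreover have "(2 ^ i * \<bar>G i x - gl x\<bar>) * ((1/2) ^ i * \<bar>\<phi> x\<bar>) = \<bar>(G i x - gl x) * \<phi> x\<bar>"
      by (simp add: abs_mult power_divide)
     moreover have "(2 ^ i * \<bar>G i x - gl x\<bar>)^2 = 4 ^ i * (G i x - gl x)^2"
      by (simp add: power_mult_distrib four_pow)
     moreover have "((1/2) ^ i * \<bar>\<phi> x\<bar>)^2 = (1 / 4) ^ i * (\<phi> x)^2"
      by (simp add: power_mult_distrib power_divide four_pow)
     ultimately show ?thesis by simp
    qed
   qed
   also have "\<dots> = 4 ^ i * (\<integral>x. (G i x - gl x)^2 \<partial>lborel) + (1 / 4) ^ i * (\<integral>x. (\<phi> x)^2 \<partial>lborel)"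
    using di \<phi>i by simp
   also have "\<dots> \<le> 4 ^ i * (1 / 16) ^ i + (1 / 4) ^ i * (\<integral>x. (\<phi> x)^2 \<partial>lborel)"
    using dN by (intro add_right_mono mult_left_mono) auto
   also have "4 ^ i * (1 / 16) ^ i = (1 / 4 :: real) ^ i" by (simp add: power_mult_distrib[symmetric])
   finally show ?thesis by (simp add: distrib_left)
  qed
  have "(\<lambda>i. (1 / 4 :: real) ^ i * (1 + (\<integral>x. (\<phi> x)^2 \<partial>lborel))) \<longlonglongrightarrow> 0"
   by (intro tendsto_mult_left_zero LIMSEQ_power_zero) simp
  hence "(\<lambda>i. (\<integral>x. G i x * \<phi> x \<partial>lborel) - (\<integral>x. gl x * \<phi> x \<partial>lborel)) \<longlonglongrightarrow> 0"
   by (rule Lim_null_comparison[rotated]) (use bd in auto)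
  hence "(\<lambda>i. \<integral>x. G i x * \<phi> x \<partial>lborel) \<longlonglongrightarrow> (\<integral>x. gl x * \<phi> x \<partial>lborel)"
   by (rule LIM_zero_cancel)
  thus ?thesis using 1 LIMSEQ_unique by blast
 qed
 thus ?thesis using that gl(1) L2gl by blast
qed

text \<open>The test integrals of the j-th derivatives converge because each derivative can be moved
  to the test function; \<open>l j\<close> is the limit functional, and weak compactness represents
  it by an L^2 function for each j \<ge> 1. Order 0 is kept as the given f, since f itself need not
  be square integrable: the temperature has nonzero limits at infinity.\<close>

lemma weak_chain_limit:
 fixes G :: "nat \<Rightarrow> nat \<Rightarrow> real \<Rightarrow> real"
 assumes f: "locally_integrable f"
  and conv: "\<And>\<phi>. test_function \<phi> ==> (\<lambda>n. \<integral>x. G n 0 x * \<phi> x \<partial>lborel) \<longlonglongrightarrow> (\<integral>x. f x * \<phi> x \<partial>lborel)"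
  and ch: "\<And>n j. j < m ==> has_weak_deriv (G n j) (G n (Suc j))"
  and b: "\<And>n j. 1 \<le> j ==> j \<le> m ==> L2sq (G n j) \<le> ennreal M"
 obtains h where "h 0 = f" "\<And>j. j < m ==> has_weak_deriv (h j) (h (Suc j))"
  "\<And>j. 1 \<le> j ==> j \<le> m ==> L2sq (h j) \<le> ennreal M"
proof -
 define l where "l j = rec_nat (\<lambda>\<phi>. \<integral>x. f x * \<phi> x \<partial>lborel) (\<lambda>j L \<phi>. - L (deriv \<phi>)) j" for j
 have l0: "l 0 \<phi> = (\<integral>x. f x * \<phi> x \<partial>lborel)" and lS: "l (Suc j) \<phi> = - l j (deriv \<phi>)" for j \<phi>
  by (simp_all add: l_def)
 have lim: "(\<lambda>n. \<integral>x. G n j x * \<phi> x \<partial>lborel) \<longlonglongrightarrow> l j \<phi>" if "j \<le> m" "test_function \<phi>" for j \<phi>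
  using that
 proof (induction j arbitrary: \<phi>)
  case (Suc j)
  have "(\<integral>x. G n (Suc j) x * \<phi> x \<partial>lborel) = - (\<integral>x. G n j x * deriv \<phi> x \<partial>lborel)" for n
   using ch[of j n] Suc.prems by (simp add: has_weak_deriv_def)
  thus ?case using Suc test_function_deriv by (auto simp: lS intro!: tendsto_minus)
 qed (simp add: l0 conv)
 have "\<exists>h. h \<in> borel_measurable borel \<and> L2sq h \<le> ennreal M \<and> (\<forall>\<phi>. test_function \<phi> \<longrightarrow> (\<integral>x. h x * \<phi> x \<partial>lborel) = l j \<phi>)"
  if "1 \<le> j" "j \<le> m" for j
 proof -
  have "G n j \<in> borel_measurable borel" for n
   using ch[of "j - 1" n] that by (auto simp: has_weak_deriv_def intro: locally_integrable_measurable)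
  from weak_L2_compactness[OF this b[OF that] lim[OF that(2)]] show ?thesis by blast
 qed
 then obtain h where h: "\<And>j. 1 \<le> j ==> j \<le> m ==> h j \<in> borel_measurable borel \<and> L2sq (h j) \<le> ennreal M \<and> (\<forall>\<phi>. test_function \<phi> \<longrightarrow> (\<integral>x. h j x * \<phi> x \<partial>lborel) = l j \<phi>)"
  by metis
 define h' where "h' = h(0 := f)"
 have h'l: "locally_integrable (h' j) \<and> (\<forall>\<phi>. test_function \<phi> \<longrightarrow> (\<integral>x. h' j x * \<phi> x \<partial>lborel) = l j \<phi>)" if "j \<le> m" for j
 proof (cases "j = 0")
  case False
  hence j: "1 \<le> j" by simp
  have "L2sq (h j) < \<infinity>" using h[OF j that] by (simp add: le_less_trans[of _ "ennreal M"])
  hence "locally_integrable (h j)" using h[OF j that] L2sq_imp_locally_integrable by blast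
  thus ?thesis using h[OF j that] False by (simp add: h'_def)
 qed (simp add: h'_def f l0)
 show ?thesis
 proof (rule that[of h'])
  show "has_weak_deriv (h' j) (h' (Suc j))" if "j < m" for j
   using h'l[of j] h'l[of "Suc j"] that test_function_deriv by (simp add: has_weak_deriv_def lS)
 qed (use h in \<open>auto simp: h'_def\<close>)
qed

section \<open>Calculus on the strip\<close>

lemma C0_iff: "C_strip 0 T f \<longleftrightarrow> continuous_on ({0..T} \<times> UNIV) (\<lambda>p. f (fst p) (snd p))"
 by (simp add: case_prod_unfold)

lemma C0_add: "C_strip 0 T f ==> C_strip 0 T g ==> C_strip 0 T (\<lambda>t x. f t x + g t x)"
 unfolding C0_iff by (intro continuous_intros)

lemma C0_diff: "C_strip 0 T f ==> C_strip 0 T g ==> C_strip 0 T (\<lambda>t x. f t x - g t x)"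
 unfolding C0_iff by (intro continuous_intros)

lemma C0_minus: "C_strip 0 T f ==> C_strip 0 T (\<lambda>t x. - f t x)"
 unfolding C0_iff by (intro continuous_intros)

lemma C0_mult: "C_strip 0 T f ==> C_strip 0 T g ==> C_strip 0 T (\<lambda>t x. f t x * g t x)"
 unfolding C0_iff by (intro continuous_intros)

lemma C0_power: "C_strip 0 T f ==> C_strip 0 T (\<lambda>t x. f t x ^ n)"
 unfolding C0_iff by (intro continuous_intros)

lemma C0_exp: "C_strip 0 T f ==> C_strip 0 T (\<lambda>t x. exp (f t x))"
 unfolding C0_iff by (intro continuous_intros)

lemma C0_const: "C_strip 0 T (\<lambda>t x. c)"
 unfolding C0_iff by (intro continuous_intros)

lemma C0_space: "continuous_on UNIV g ==> C_strip 0 T (\<lambda>t x. g x)"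
 unfolding C0_iff by (rule continuous_on_compose2[of UNIV g]) (auto intro: continuous_intros)

lemmas C0_intros = C0_add C0_diff C0_minus C0_mult C0_power C0_exp C0_const

lemma C0_cong: "C_strip 0 T f ==> (\<And>t x. t \<in> {0..T} ==> f t x = g t x) ==> C_strip 0 T g"
 unfolding C0_iff
 by (rule continuous_on_cong[THEN iffD1, of "{0..T} \<times> UNIV" _ "\<lambda>p. f (fst p) (snd p)"]) auto

lemma C0_compose:
 assumes "C_strip 0 T f" "continuous_on S g" "continuous_on S h" "\<And>y. y \<in> S ==> g y \<in> {0..T}"
 shows "continuous_on S (\<lambda>y. f (g y) (h y))"
proof -
 have "(\<lambda>y. (g y, h y)) ` S \<subseteq> {0..T} \<times> UNIV" using assms(4) by auto
 from continuous_on_compose2[OF assms(1)[unfolded C0_iff] continuous_on_Pair[OF assms(2,3)] this]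
 show ?thesis by simp
qed

lemma C0_slice_x: "C_strip 0 T f ==> t \<in> {0..T} ==> continuous_on S (f t)"
 by (rule C0_compose[of T f S "\<lambda>_. t" "\<lambda>x. x"]) (auto intro: continuous_intros)

lemma C0_slice_t: "C_strip 0 T f ==> S \<subseteq> {0..T} ==> continuous_on S (\<lambda>t. f t x)"
 by (rule C0_compose[of T f S "\<lambda>t. t" "\<lambda>_. x"]) (auto intro: continuous_intros)

lemma C0_swap: "C_strip 0 T f ==> S \<subseteq> {0..T} ==> continuous_on (U \<times> S) (\<lambda>(x, t). f t x)"
 unfolding case_prod_unfold
 by (rule C0_compose[of T f "U \<times> S" snd fst]) (auto intro!: continuous_on_fst continuous_on_snd continuous_on_id)

lemma C0_rect: "C_strip 0 T f ==> S \<subseteq> {0..T} ==> continuous_on (S \<times> U) (\<lambda>(t, x). f t x)"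
 unfolding C_strip.simps by (rule continuous_on_subset) auto

lemma C0_lipschitz:
 assumes t: "\<And>t s x. t \<in> {0..T} ==> s \<in> {0..T} ==> \<bar>f t x - f s x\<bar> \<le> L * \<bar>t - s\<bar>"
  and x: "\<And>t x y. t \<in> {0..T} ==> \<bar>f t x - f t y\<bar> \<le> L * \<bar>x - y\<bar>"
 shows "C_strip 0 T f"
 unfolding C0_iff continuous_on_iff
proof (intro ballI allI impI)
 fix p :: "real \<times> real" and e :: real assume p: "p \<in> {0..T} \<times> UNIV" and e: "e > 0"
 define K where "K = 2 * \<bar>L\<bar> + 1"
 have K: "K > 0" unfolding K_def by simp
 show "\<exists>d>0. \<forall>q\<in>{0..T} \<times> UNIV. dist q p < d \<longrightarrow> dist (f (fst q) (snd q)) (f (fst p) (snd p)) < e"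
 proof (intro exI[of _ "e / K"] conjI ballI impI)
  fix q assume q: "q \<in> {0..T} \<times> (UNIV :: real set)" "dist q p < e / K"
  have "dist (fst q) (fst p) < e / K" "dist (snd q) (snd p) < e / K"
   using q(2) dist_fst_le[of q p] dist_snd_le[of q p] by linarith+
  hence d: "\<bar>fst q - fst p\<bar> < e / K" "\<bar>snd q - snd p\<bar> < e / K" by (simp_all add: dist_real_def)
  have "\<bar>f (fst q) (snd q) - f (fst p) (snd p)\<bar> \<le> \<bar>f (fst q) (snd q) - f (fst p) (snd q)\<bar> + \<bar>f (fst p) (snd q) - f (fst p) (snd p)\<bar>"
   by linarith
  also have "\<dots> \<le> L * \<bar>fst q - fst p\<bar> + L * \<bar>snd q - snd p\<bar>"
   using p q(1) by (intro add_mono t x) auto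
  also have "\<dots> \<le> \<bar>L\<bar> * (e / K) + \<bar>L\<bar> * (e / K)"
   using d by (intro add_mono mult_mono) auto
  also have "\<dots> = (K - 1) * (e / K)" by (simp add: K_def)
  also have "\<dots> < K * (e / K)" using K e by (intro mult_strict_right_mono) auto
  also have "\<dots> = e" using K by simp
  finally show "dist (f (fst q) (snd q)) (f (fst p) (snd p)) < e" by (simp add: dist_real_def)
 qed (use K e in simp)
qed

lemma has_real_derivative_lipschitz:
 fixes f :: "real \<Rightarrow> real"
 assumes "convex S" "\<And>x. x \<in> S ==> (f has_real_derivative f' x) (at x within S)"
  and "\<And>x. x \<in> S ==> \<bar>f' x\<bar> \<le> B" and "x \<in> S" "y \<in> S"
 shows "\<bar>f x - f y\<bar> \<le> B * \<bar>x - y\<bar>"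
 using field_differentiable_bound[of S f f' B x y] assms by simp

lemma FTC_within:
 fixes f :: "real \<Rightarrow> real"
 assumes "a \<le> b" "{a..b} \<subseteq> S" "\<And>t. t \<in> {a..b} ==> (f has_real_derivative f' t) (at t within S)"
 shows "(f' has_integral (f b - f a)) {a..b}"
proof (rule fundamental_theorem_of_calculus[OF assms(1)])
 fix t assume "t \<in> {a..b}"
 thus "(f has_vector_derivative f' t) (at t within {a..b})"
  unfolding has_real_derivative_iff_has_vector_derivative[symmetric]
  by (rule DERIV_subset[OF assms(3) assms(2)])
qed

lemma FTC_integral:
 fixes f :: "real \<Rightarrow> real"
 assumes "a \<le> b" "{a..b} \<subseteq> S" "\<And>t. t \<in> {a..b} ==> (f has_real_derivative f' t) (at t within S)"
 shows "integral {a..b} f' = f b - f a"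
 using FTC_within[OF assms] by (rule integral_unique)

lemma integral_deriv_upper:
 fixes f :: "real \<Rightarrow> real"
 assumes "continuous_on {0..T} f" "t \<in> {0..T}"
 shows "((\<lambda>t. integral {0..t} f) has_real_derivative f t) (at t within {0..T})"
 using integral_has_real_derivative[of 0 T f t] assms by simp

lemma time_integral_derivative_x:
 assumes f: "C_strip 0 T f" "C_strip 0 T fx"
  and d: "\<And>t x. t \<in> {0..T} ==> (f t has_real_derivative fx t x) (at x)" and t: "0 \<le> s" "t \<le> T"
 shows "((\<lambda>x. integral {s..t} (\<lambda>\<tau>. f \<tau> x)) has_real_derivative integral {s..t} (\<lambda>\<tau>. fx \<tau> x)) (at x)"
proof -
 have sub: "{s..t} \<subseteq> {0..T}" using t by auto
 have "((\<lambda>x. integral (cbox s t) (\<lambda>\<tau>. f \<tau> x)) has_field_derivative integral (cbox s t) (\<lambda>\<tau>. fx \<tau> x)) (at x within UNIV)"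
 proof (rule leibniz_rule_field_derivative)
  show "((\<lambda>x. f \<tau> x) has_real_derivative fx \<tau> y) (at y within UNIV)" if "\<tau> \<in> cbox s t" for \<tau> y
   using d[of \<tau> y] that sub by auto
  show "(\<lambda>\<tau>. f \<tau> y) integrable_on cbox s t" for y
   using C0_slice_t[OF f(1) sub] by (auto intro: integrable_continuous_real)
  show "continuous_on (UNIV \<times> cbox s t) (\<lambda>(y, \<tau>). fx \<tau> y)"
   using C0_swap[OF f(2) sub, of UNIV] by simp
 qed auto
 thus ?thesis by simp
qed

lemma space_integral_derivative_t:
 assumes f: "C_strip 0 T f" "C_strip 0 T ft"
  and d: "\<And>t x. t \<in> {0..T} ==> ((\<lambda>t. f t x) has_real_derivative ft t x) (at t within {0..T})"
  and t: "t \<in> {0..T}"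
 shows "((\<lambda>t. integral {a..b} (f t)) has_real_derivative integral {a..b} (ft t)) (at t within {0..T})"
proof -
 have "((\<lambda>t. integral (cbox a b) (f t)) has_field_derivative integral (cbox a b) (ft t)) (at t within {0..T})"
 proof (rule leibniz_rule_field_derivative)
  show "((\<lambda>t. f t x) has_real_derivative ft \<tau> x) (at \<tau> within {0..T})" if "\<tau> \<in> {0..T}" for \<tau> x
   using d[OF that] .
  show "f \<tau> integrable_on cbox a b" if "\<tau> \<in> {0..T}" for \<tau>
   using C0_slice_x[OF f(1) that] by (auto intro: integrable_continuous_real)
  show "continuous_on ({0..T} \<times> cbox a b) (\<lambda>(t, x). ft t x)" using C0_rect[OF f(2)] by auto
 qed (use t in auto)
 thus ?thesis by simp
qed

lemma C0_space_integral:
 assumes "C_strip 0 T f" shows "continuous_on {0..T} (\<lambda>t. integral {a..b} (f t))"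
 using integral_continuous_on_param[of "{0..T}" a b "\<lambda>t x. f t x"] C0_rect[OF assms, of "{0..T}" "{a..b}"] by simp

lemma C0_time_integral:
 assumes "C_strip 0 T f" "0 \<le> s" "t \<le> T" shows "continuous_on UNIV (\<lambda>x. integral {s..t} (\<lambda>t. f t x))"
 using integral_continuous_on_param[of UNIV s t "\<lambda>x t. f t x"] C0_swap[OF assms(1), of "{s..t}" UNIV] assms by simp

lemma integral_swap_strip:
 assumes "C_strip 0 T f" "0 \<le> s" "t \<le> T"
 shows "integral {s..t} (\<lambda>\<tau>. integral {a..b} (f \<tau>)) = integral {a..b} (\<lambda>x. integral {s..t} (\<lambda>\<tau>. f \<tau> x))"
proof -
 have "continuous_on (cbox (s, a) (t, b)) (\<lambda>(\<tau>, x). f \<tau> x)"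
  using C0_rect[OF assms(1), of "{s..t}" "{a..b}"] assms by (simp add: cbox_Pair_eq)
 from integral_swap_continuous[OF this] show ?thesis by simp
qed

text \<open>Writing f at time \<tau> as its initial value plus the time integral of f_t and
  differentiating under the integral gives f_x as its initial value plus the time integral of f_tx,
  which is visibly differentiable in time. In this way the time derivative of f_x need not be known
  in advance.\<close>

lemma mixed_derivative:
 assumes c: "C_strip 0 T ft" "C_strip 0 T ftx"
  and dt: "\<And>t x. t \<in> {0..T} ==> ((\<lambda>\<tau>. f \<tau> x) has_real_derivative ft t x) (at t within {0..T})"
  and dx: "\<And>t x. t \<in> {0..T} ==> (f t has_real_derivative fx t x) (at x)"
  and dtx: "\<And>t x. t \<in> {0..T} ==> (ft t has_real_derivative ftx t x) (at x)"
  and t: "t \<in> {0..T}"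
 shows "((\<lambda>\<tau>. fx \<tau> x) has_real_derivative ftx t x) (at t within {0..T})"
proof -
 have eq: "fx \<tau> x = fx 0 x + integral {0..\<tau>} (\<lambda>r. ftx r x)" if \<tau>: "\<tau> \<in> {0..T}" for \<tau>
 proof -
  have e: "f \<tau> y = f 0 y + integral {0..\<tau>} (\<lambda>r. ft r y)" for y
   using FTC_integral[of 0 \<tau> "{0..T}" "\<lambda>r. f r y" "\<lambda>r. ft r y"] \<tau> dt by auto
  have "((\<lambda>y. f 0 y + integral {0..\<tau>} (\<lambda>r. ft r y)) has_real_derivative fx 0 x + integral {0..\<tau>} (\<lambda>r. ftx r x)) (at x)"
   by (intro DERIV_add dx time_integral_derivative_x[OF c dtx]) (use \<tau> in auto)
  hence "(f \<tau> has_real_derivative fx 0 x + integral {0..\<tau>} (\<lambda>r. ftx r x)) (at x)" using e by presburger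
  thus ?thesis using dx[OF \<tau>] DERIV_unique by blast
 qed
 have "((\<lambda>\<tau>. fx 0 x + integral {0..\<tau>} (\<lambda>r. ftx r x)) has_real_derivative ftx t x) (at t within {0..T})"
  using DERIV_add[OF DERIV_const integral_deriv_upper[OF C0_slice_t[OF c(2)] t]] by simp
 thus ?thesis
  by (rule has_field_derivative_transform_within[where d = 1]) (simp, rule t, rule eq[symmetric])
qed

lemma C_strip_derivatives:
 assumes "C_strip (Suc n) T f" "t \<in> {0..T}"
 shows "(f t has_real_derivative dx f t x) (at x)"
  and "((\<lambda>\<tau>. f \<tau> x) has_real_derivative dt T f t x) (at t within {0..T})"
proof -
 have "f t differentiable (at x)" using assms by simp
 thus "(f t has_real_derivative dx f t x) (at x)" by (simp add: dx_def DERIV_deriv_iff_real_differentiable)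
 have "(\<lambda>\<tau>. f \<tau> x) differentiable (at t within {0..T})" using assms by simp
 thus "((\<lambda>\<tau>. f \<tau> x) has_real_derivative dt T f t x) (at t within {0..T})"
  by (simp add: dt_def vector_derivative_works has_real_derivative_iff_has_vector_derivative)
qed

lemma C_strip_dx_pow: "C_strip (n + j) T f ==> C_strip n T ((dx ^^ j) f)"
 by (induction j arbitrary: f) (auto simp: funpow_Suc_right simp del: funpow.simps)

lemma C_strip_mono: "C_strip n T f ==> m \<le> n ==> C_strip m T f"
proof (induction n arbitrary: f m)
 case (Suc n)
 thus ?case by (cases m) auto
qed simp

section \<open>Integrals of continuous functions, and sup bounds from L^2 bounds\<close>

lemma nn_integral_Icc_continuous:
 fixes g :: "real \<Rightarrow> real"
 assumes c: "continuous_on {a..b} g" and p: "\<And>x. x \<in> {a..b} ==> g x \<ge> 0"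
 shows "(\<integral>\<^sup>+x\<in>{a..b}. ennreal (g x) \<partial>lborel) = ennreal (integral {a..b} g)"
proof -
 have i: "set_integrable lborel {a..b} g" by (rule borel_integrable_atLeastAtMost'[OF c])
 have "(\<integral>\<^sup>+x\<in>{a..b}. ennreal (g x) \<partial>lborel) = (\<integral>\<^sup>+x. ennreal (indicator {a..b} x * g x) \<partial>lborel)"
  by (rule nn_integral_cong) (auto simp: indicator_def)
 also have "\<dots> = ennreal (\<integral>x. indicator {a..b} x * g x \<partial>lborel)"
  by (rule nn_integral_eq_integral) (use i p in \<open>auto simp: set_integrable_def indicator_def\<close>)
 also have "(\<integral>x. indicator {a..b} x * g x \<partial>lborel) = integral {a..b} g"
  using set_borel_integral_eq_integral(2)[OF i] by (simp add: set_lebesgue_integral_def)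
 finally show ?thesis .
qed

lemma integral_square_le_L2sq:
 assumes c: "continuous_on UNIV g" shows "ennreal (integral {a..b} (\<lambda>x. (g x)^2)) \<le> L2sq g"
proof -
 have "ennreal (integral {a..b} (\<lambda>x. (g x)^2)) = (\<integral>\<^sup>+x\<in>{a..b}. ennreal ((g x)^2) \<partial>lborel)"
  by (rule nn_integral_Icc_continuous[symmetric]) (auto intro!: continuous_intros continuous_on_subset[OF c])
 also have "\<dots> \<le> L2sq g" unfolding L2sq_def by (rule nn_integral_mono) (auto simp: indicator_def)
 finally show ?thesis .
qed

lemma integral_square_le:
 assumes "continuous_on UNIV g" "L2sq g \<le> ennreal C" "C \<ge> 0"
 shows "integral {a..b} (\<lambda>x. (g x)^2) \<le> C"
 using order_trans[OF integral_square_le_L2sq[OF assms(1)] assms(2)] assms(3) by (simp add: ennreal_le_iff)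

lemma L2sq_le_if_integrals:
 assumes c: "continuous_on UNIV g" and b: "\<And>R. integral {-R..R} (\<lambda>x. (g x)^2) \<le> C"
 shows "L2sq g \<le> ennreal C"
proof -
 define F where "F n x = indicator {- real n..real n} x * g x" for n x
 have [measurable]: "g \<in> borel_measurable borel" by (rule borel_measurable_continuous_onI[OF c])
 show ?thesis
 proof (rule L2sq_tendsto_le[where f = F and N = 0])
  show "F n \<in> borel_measurable borel" for n unfolding F_def by measurable
  show "AE x in lborel. (\<lambda>n. F n x) \<longlonglongrightarrow> g x"
  proof (rule AE_I2)
   fix x
   obtain N :: nat where N: "\<bar>x\<bar> \<le> real N" using real_arch_simple by blast
   have "\<forall>\<^sub>F n in sequentially. F n x = g x"
    using eventually_ge_at_top[of N] unfolding F_def by eventually_elim (use N in \<open>auto simp: indicator_def\<close>)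
   thus "(\<lambda>n. F n x) \<longlonglongrightarrow> g x" by (rule tendsto_eventually)
  qed
  show "L2sq (F n) \<le> ennreal C" for n
  proof -
   have "L2sq (F n) = (\<integral>\<^sup>+x\<in>{-real n..real n}. ennreal ((g x)^2) \<partial>lborel)"
    unfolding L2sq_def F_def by (rule nn_integral_cong) (auto simp: indicator_def)
   also have "\<dots> = ennreal (integral {-real n..real n} (\<lambda>x. (g x)^2))"
    by (rule nn_integral_Icc_continuous) (auto intro!: continuous_intros continuous_on_subset[OF c])
   also have "\<dots> \<le> ennreal C" by (rule ennreal_leI[OF b])
   finally show ?thesis .
  qed
 qed
qed

lemma integral_mono_continuous:
 fixes f g :: "real \<Rightarrow> real"
 assumes "continuous_on {a..b} f" "continuous_on {a..b} g" "\<And>x. x \<in> {a..b} ==> f x \<le> g x"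
 shows "integral {a..b} f \<le> integral {a..b} g"
 using assms by (intro integral_le integrable_continuous_real) auto

text \<open>The function (y - x - 1) f(y)^2 vanishes at y = x + 1 and equals - f(x)^2 at y = x; its
  derivative on this unit interval is at most 2 f^2 + f'^2.\<close>

lemma sup_bound_from_L2:
 fixes f f' :: "real \<Rightarrow> real"
 assumes d: "\<And>x. (f has_real_derivative f' x) (at x)" and c: "continuous_on UNIV f'"
  and A: "\<And>a b. integral {a..b} (\<lambda>x. (f x)^2) \<le> A" and B: "\<And>a b. integral {a..b} (\<lambda>x. (f' x)^2) \<le> B"
 shows "(f x)^2 \<le> 2 * A + B"
proof -
 have fc: "continuous_on S f" for S using continuous_on_subset[OF DERIV_continuous_UNIV[OF d]] by blast
 have f'c: "continuous_on S f'" for S using continuous_on_subset[OF c] by blast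
 define h where "h y = (y - x - 1) * (f y)^2" for y
 define h' where "h' y = (f y)^2 + (y - x - 1) * (2 * f y * f' y)" for y
 have "(h has_real_derivative h' y) (at y within UNIV)" for y
  unfolding h_def h'_def by (auto intro!: derivative_eq_intros d)
 from FTC_integral[OF _ _ this, of x "x + 1"] have "integral {x..x+1} h' = h (x + 1) - h x" by simp
 hence "(f x)^2 = integral {x..x+1} h'" by (simp add: h_def)
 also have "\<dots> \<le> integral {x..x+1} (\<lambda>y. 2 * (f y)^2 + (f' y)^2)"
 proof (rule integral_mono_continuous)
  fix y assume y: "y \<in> {x..x+1}"
  have "(y - x - 1) * (2 * f y * f' y) \<le> \<bar>y - x - 1\<bar> * \<bar>2 * f y * f' y\<bar>"
   by (metis abs_ge_self abs_mult)
  also have "\<dots> \<le> 1 * \<bar>2 * f y * f' y\<bar>" using y by (intro mult_right_mono) auto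
  also have "\<dots> \<le> (f y)^2 + (f' y)^2" using sum_squares_bound[of "\<bar>f y\<bar>" "\<bar>f' y\<bar>"] by (simp add: abs_mult)
  finally show "h' y \<le> 2 * (f y)^2 + (f' y)^2" unfolding h'_def by simp
 qed (auto simp: h'_def intro!: continuous_intros fc f'c)
 also have "\<dots> = 2 * integral {x..x+1} (\<lambda>y. (f y)^2) + integral {x..x+1} (\<lambda>y. (f' y)^2)"
  by (subst integral_add) (auto intro!: integrable_continuous_real continuous_intros fc f'c)
 also have "\<dots> \<le> 2 * A + B" using A[of x "x+1"] B[of x "x+1"] by simp
 finally show ?thesis .
qed

text \<open>Expanding the nonnegative integral of (f - m)^2, where m is the mean of f, gives the
  inequality with the constant function 1.\<close>

lemma integral_Cauchy_Schwarz:
 fixes f :: "real \<Rightarrow> real"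
 assumes c: "continuous_on {a..b} f" and ab: "a \<le> b" and A: "integral {a..b} (\<lambda>x. (f x)^2) \<le> A"
 shows "\<bar>integral {a..b} f\<bar> \<le> sqrt (A * (b - a))"
proof (cases "a = b")
 case False
 define m where "m = integral {a..b} f / (b - a)"
 have i: "f integrable_on {a..b}" "(\<lambda>x. (f x)^2) integrable_on {a..b}"
  by (auto intro!: integrable_continuous_real continuous_intros c)
 have "0 \<le> integral {a..b} (\<lambda>x. (f x - m)^2)"
  by (rule integral_nonneg) (auto intro!: integrable_continuous_real continuous_intros c)
 also have "integral {a..b} (\<lambda>x. (f x - m)^2) = integral {a..b} (\<lambda>x. ((f x)^2 + m^2) - (2 * m) * f x)"
  by (simp add: power2_diff algebra_simps)
 also have "\<dots> = integral {a..b} (\<lambda>x. (f x)^2 + m^2) - integral {a..b} (\<lambda>x. (2 * m) * f x)"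
  by (rule integral_diff) (auto intro!: integrable_continuous_real continuous_intros c)
 also have "integral {a..b} (\<lambda>x. (f x)^2 + m^2) = integral {a..b} (\<lambda>x. (f x)^2) + integral {a..b} (\<lambda>x. m^2)"
  by (rule integral_add) (auto intro!: i)
 also have "\<dots> - integral {a..b} (\<lambda>x. (2 * m) * f x) = integral {a..b} (\<lambda>x. (f x)^2) + m^2 * (b - a) - 2 * m * integral {a..b} f"
  using ab by simp
 finally have 1: "0 \<le> integral {a..b} (\<lambda>x. (f x)^2) + m^2 * (b - a) - 2 * m * integral {a..b} f" .
 have mI: "integral {a..b} f = m * (b - a)" using False ab by (simp add: m_def)
 have "m^2 * (b - a) \<le> A" using 1 A unfolding mI power2_eq_square by (simp add: algebra_simps)
 hence "m^2 * (b - a) * (b - a) \<le> A * (b - a)" using ab by (intro mult_right_mono) auto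
 hence "(integral {a..b} f)^2 \<le> A * (b - a)" unfolding mI by (simp add: power2_eq_square algebra_simps)
 thus ?thesis using real_le_rsqrt[of "\<bar>integral {a..b} f\<bar>"] by simp
qed simp

section \<open>Local Sobolev convergence by Fourier transform\<close>

lemma fourier_eq_integral:
 assumes c: "continuous_on UNIV g" and R: "\<And>x. \<bar>x\<bar> > R ==> g x = 0"
 shows "fourier g \<xi> = integral {-R..R} (\<lambda>x. cis (- (\<xi> * x)) * complex_of_real (g x))"
proof -
 have i: "set_integrable lborel {-R..R} (\<lambda>x. cis (- (\<xi> * x)) * complex_of_real (g x))"
  by (rule borel_integrable_atLeastAtMost') (intro continuous_intros continuous_on_subset[OF c], auto)
 have "fourier g \<xi> = (\<integral>x. indicator {-R..R} x *\<^sub>R (cis (- (\<xi> * x)) * complex_of_real (g x)) \<partial>lborel)"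
  unfolding fourier_def
 proof (rule Bochner_Integration.integral_cong)
  fix x
  show "cis (- (\<xi> * x)) * complex_of_real (g x) = indicat_real {-R..R} x *\<^sub>R (cis (- (\<xi> * x)) * complex_of_real (g x))"
  proof (cases "x \<in> {-R..R}")
   case False
   hence "\<bar>x\<bar> > R" by auto
   thus ?thesis using R by simp
  qed simp
 qed simp
 also have "\<dots> = integral {-R..R} (\<lambda>x. cis (- (\<xi> * x)) * complex_of_real (g x))"
  using set_borel_integral_eq_integral(2)[OF i] by (simp add: set_lebesgue_integral_def)
 finally show ?thesis .
qed

lemma fourier_add:
 assumes "continuous_on UNIV g" "\<And>x. \<bar>x\<bar> > R ==> g x = 0" "continuous_on UNIV h" "\<And>x. \<bar>x\<bar> > R ==> h x = 0"
 shows "fourier (\<lambda>x. g x + h x) \<xi> = fourier g \<xi> + fourier h \<xi>"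
proof -
 have "fourier (\<lambda>x. g x + h x) \<xi> = integral {-R..R} (\<lambda>x. cis (- (\<xi> * x)) * complex_of_real (g x + h x))"
  by (rule fourier_eq_integral) (use assms in \<open>auto intro!: continuous_intros\<close>)
 also have "\<dots> = integral {-R..R} (\<lambda>x. cis (- (\<xi> * x)) * complex_of_real (g x) + cis (- (\<xi> * x)) * complex_of_real (h x))"
  by (simp add: distrib_left)
 also have "\<dots> = integral {-R..R} (\<lambda>x. cis (- (\<xi> * x)) * complex_of_real (g x)) + integral {-R..R} (\<lambda>x. cis (- (\<xi> * x)) * complex_of_real (h x))"
  by (rule integral_add) (intro integrable_continuous_real continuous_intros continuous_on_subset[OF assms(1)] continuous_on_subset[OF assms(3)], auto)+
 finally show ?thesis using fourier_eq_integral[OF assms(1,2)] fourier_eq_integral[OF assms(3,4)] by simp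
qed

text \<open>Cauchy-Schwarz on the support of \<phi>. The constant depends on \<phi> and R alone, so
  the bound can be integrated in time and used for a whole family.\<close>

lemma fourier_bound:
 assumes \<phi>: "continuous_on UNIV \<phi>" "\<And>x. \<bar>x\<bar> > R ==> \<phi> x = 0"
 obtains K where "K \<ge> 0"
  "\<And>g \<xi>. continuous_on UNIV g ==> (cmod (fourier (\<lambda>x. \<phi> x * g x) \<xi>))^2 \<le> K * integral {-R..R} (\<lambda>x. (g x)^2)"
proof (cases "R \<ge> 0")
 case True
 have "compact (\<phi> ` {-R..R})" by (intro compact_continuous_image continuous_on_subset[OF \<phi>(1)]) auto
 then obtain B where B: "\<And>x. x \<in> {-R..R} ==> \<bar>\<phi> x\<bar> \<le> B"
  by (meson bounded_real compact_imp_bounded imageI)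
 have B0: "B \<ge> 0" using B[of 0] True by (meson abs_ge_zero atLeastAtMost_iff neg_le_0_iff_le order_trans)
 show ?thesis
 proof (rule that[of "B^2 * (2 * R)"])
  show "B^2 * (2 * R) \<ge> 0" using True by simp
  fix g :: "real \<Rightarrow> real" and \<xi> :: real assume g: "continuous_on UNIV g"
  have gc: "continuous_on S g" "continuous_on S \<phi>" for S using g \<phi>(1) continuous_on_subset by blast+
  have "cmod (fourier (\<lambda>x. \<phi> x * g x) \<xi>) = cmod (integral {-R..R} (\<lambda>x. cis (- (\<xi> * x)) * complex_of_real (\<phi> x * g x)))"
   by (subst fourier_eq_integral[where R = R]) (use \<phi> in \<open>auto intro!: continuous_intros gc\<close>)
  also have "\<dots> \<le> integral {-R..R} (\<lambda>x. B * \<bar>g x\<bar>)"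
   by (rule integral_norm_bound_integral)
    (use B in \<open>auto simp: norm_mult abs_mult intro!: integrable_continuous_real continuous_intros gc mult_right_mono\<close>)
  also have "\<dots> = B * integral {-R..R} (\<lambda>x. \<bar>g x\<bar>)" by simp
  also have "\<dots> \<le> B * sqrt (integral {-R..R} (\<lambda>x. (g x)^2) * (R - (- R)))"
  proof (rule mult_left_mono[OF _ B0])
   have "\<bar>integral {-R..R} (\<lambda>x. \<bar>g x\<bar>)\<bar> \<le> sqrt (integral {-R..R} (\<lambda>x. (g x)^2) * (R - (- R)))"
    by (rule integral_Cauchy_Schwarz) (use True in \<open>auto intro!: continuous_intros gc\<close>)
   thus "integral {-R..R} (\<lambda>x. \<bar>g x\<bar>) \<le> sqrt (integral {-R..R} (\<lambda>x. (g x)^2) * (R - (- R)))" by linarith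
  qed
  finally have "(cmod (fourier (\<lambda>x. \<phi> x * g x) \<xi>))^2 \<le> (B * sqrt (integral {-R..R} (\<lambda>x. (g x)^2) * (R - (- R))))^2"
   by (rule power_mono) simp
  also have "\<dots> = B^2 * (2 * R) * integral {-R..R} (\<lambda>x. (g x)^2)"
  proof -
   have "integral {-R..R} (\<lambda>x. (g x)^2) \<ge> 0"
    by (rule integral_nonneg) (auto intro!: integrable_continuous_real continuous_intros gc)
   thus ?thesis using True by (simp add: power_mult_distrib)
  qed
  finally show "(cmod (fourier (\<lambda>x. \<phi> x * g x) \<xi>))^2 \<le> B^2 * (2 * R) * integral {-R..R} (\<lambda>x. (g x)^2)" .
 qed
next
 case False
 hence "\<phi> x = 0" for x using \<phi>(2)[of x] by auto
 thus ?thesis by (intro that[of 0]) (auto simp: fourier_def)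
qed

lemma fourier_deriv:
 assumes d: "\<And>x. (g has_real_derivative g' x) (at x)" and c: "continuous_on UNIV g'"
  and R: "\<And>x. \<bar>x\<bar> > R ==> g x = 0" "\<And>x. \<bar>x\<bar> > R ==> g' x = 0"
 shows "\<bar>\<xi>\<bar> * cmod (fourier g \<xi>) = cmod (fourier g' \<xi>)"
proof -
 define S where "S = \<bar>R\<bar> + 1"
 have S: "\<And>x. \<bar>x\<bar> \<ge> S ==> g x = 0" "\<And>x. \<bar>x\<bar> > S ==> g' x = 0" "\<And>x. \<bar>x\<bar> > S ==> g x = 0"
  using R unfolding S_def by auto
 have gc: "continuous_on UNIV g" by (rule DERIV_continuous_UNIV[OF d])
 have cs: "continuous_on A g" "continuous_on A g'" for A using gc c continuous_on_subset by blast+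
 have "((\<lambda>x. cis (- (\<xi> * x)) * complex_of_real (g' x) - \<i> * complex_of_real \<xi> * (cis (- (\<xi> * x)) * complex_of_real (g x)))
   has_integral cis (- (\<xi> * S)) * complex_of_real (g S) - cis (- (\<xi> * (- S))) * complex_of_real (g (- S))) {-S..S}"
 proof (rule fundamental_theorem_of_calculus)
  fix x assume "x \<in> {-S..S}"
  have "(g has_vector_derivative g' x) (at x within {-S..S})"
   using d[of x] by (simp add: has_real_derivative_iff_has_vector_derivative has_vector_derivative_at_within)
  hence 1: "((\<lambda>x. complex_of_real (g x)) has_vector_derivative complex_of_real (g' x)) (at x within {-S..S})"
   by (rule bounded_linear.has_vector_derivative[OF bounded_linear_of_real])
  have 2: "((\<lambda>x. cis (- (\<xi> * x))) has_vector_derivative - \<i> * complex_of_real \<xi> * cis (- (\<xi> * x))) (at x within {-S..S})"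
   unfolding has_vector_derivative_def
   by (auto intro!: derivative_eq_intros simp: scaleR_conv_of_real algebra_simps)
  show "((\<lambda>x. cis (- (\<xi> * x)) * complex_of_real (g x)) has_vector_derivative
    cis (- (\<xi> * x)) * complex_of_real (g' x) - \<i> * complex_of_real \<xi> * (cis (- (\<xi> * x)) * complex_of_real (g x))) (at x within {-S..S})"
   using has_vector_derivative_mult[OF 2 1] by (simp add: algebra_simps)
 qed (simp add: S_def)
 moreover have "g S = 0" "g (- S) = 0" by (auto intro!: S(1))
 ultimately have "integral {-S..S} (\<lambda>x. cis (- (\<xi> * x)) * complex_of_real (g' x) - \<i> * complex_of_real \<xi> * (cis (- (\<xi> * x)) * complex_of_real (g x))) = 0"
  using integral_unique by force
 moreover have "integral {-S..S} (\<lambda>x. cis (- (\<xi> * x)) * complex_of_real (g' x) - \<i> * complex_of_real \<xi> * (cis (- (\<xi> * x)) * complex_of_real (g x)))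
  = integral {-S..S} (\<lambda>x. cis (- (\<xi> * x)) * complex_of_real (g' x)) - integral {-S..S} (\<lambda>x. \<i> * complex_of_real \<xi> * (cis (- (\<xi> * x)) * complex_of_real (g x)))"
  by (rule integral_diff) (intro integrable_continuous_real continuous_intros cs)+
 ultimately have "fourier g' \<xi> = \<i> * complex_of_real \<xi> * fourier g \<xi>"
  using fourier_eq_integral[OF c S(2)] fourier_eq_integral[OF gc S(3)] by simp
 thus ?thesis by (simp add: norm_mult)
qed

text \<open>One factor |\<xi>| replaces \<phi> h 0 by \<phi>' h 0 + \<phi> h 1: the derivative falls
  either on the cutoff or on the chain. The induction therefore runs over all test functions
  supported in [-R, R], and K is quantified before h and \<xi> so as to be uniform.\<close>

lemma fourier_decay:
 assumes "test_function \<phi>" "\<And>x. \<bar>x\<bar> > R ==> \<phi> x = 0"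
 shows "\<exists>K\<ge>0. \<forall>h \<xi>. (\<forall>j<k. \<forall>x. (h j has_real_derivative h (Suc j) x) (at x)) \<longrightarrow> (\<forall>j\<le>k. continuous_on UNIV (h j)) \<longrightarrow>
  (\<bar>\<xi>\<bar> ^ k * cmod (fourier (\<lambda>x. \<phi> x * h 0 x) \<xi>))^2 \<le> K * (\<Sum>j\<le>k. integral {-R..R} (\<lambda>x. (h j x)^2))"
 using assms
proof (induction k arbitrary: \<phi>)
 case 0
 obtain K where "K \<ge> 0" "\<And>g \<xi>. continuous_on UNIV g ==> (cmod (fourier (\<lambda>x. \<phi> x * g x) \<xi>))^2 \<le> K * integral {-R..R} (\<lambda>x. (g x)^2)"
  using fourier_bound[OF test_function_continuous[OF 0(1)] 0(2)] by blast
 thus ?case by (intro exI[of _ K]) auto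
next
 case (Suc k)
 have \<phi>': "test_function (deriv \<phi>)" "\<And>x. \<bar>x\<bar> > R ==> deriv \<phi> x = 0"
  using test_function_deriv[OF Suc.prems(1)] deriv_zero_outside[of R \<phi>] Suc.prems(2) by blast+
 note \<phi>c = test_function_continuous[OF Suc.prems(1)] test_function_continuous[OF \<phi>'(1)]
 obtain K1 where K1: "K1 \<ge> 0" "\<And>h \<xi>. (\<forall>j<k. \<forall>x. (h j has_real_derivative h (Suc j) x) (at x)) ==> (\<forall>j\<le>k. continuous_on UNIV (h j)) ==>
  (\<bar>\<xi>\<bar> ^ k * cmod (fourier (\<lambda>x. \<phi> x * h 0 x) \<xi>))^2 \<le> K1 * (\<Sum>j\<le>k. integral {-R..R} (\<lambda>x. (h j x)^2))"
  using Suc.IH[OF Suc.prems] by blast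
 obtain K2 where K2: "K2 \<ge> 0" "\<And>h \<xi>. (\<forall>j<k. \<forall>x. (h j has_real_derivative h (Suc j) x) (at x)) ==> (\<forall>j\<le>k. continuous_on UNIV (h j)) ==>
  (\<bar>\<xi>\<bar> ^ k * cmod (fourier (\<lambda>x. deriv \<phi> x * h 0 x) \<xi>))^2 \<le> K2 * (\<Sum>j\<le>k. integral {-R..R} (\<lambda>x. (h j x)^2))"
  using Suc.IH[OF \<phi>'] by blast
 show ?case
 proof (intro exI[of _ "2 * K1 + 2 * K2"] conjI allI impI)
  fix h :: "nat \<Rightarrow> real \<Rightarrow> real" and \<xi> :: real
  assume d: "\<forall>j<Suc k. \<forall>x. (h j has_real_derivative h (Suc j) x) (at x)" and c: "\<forall>j\<le>Suc k. continuous_on UNIV (h j)"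
  define I where "I j = integral {-R..R} (\<lambda>x. (h j x)^2)" for j
  have I0: "I j \<ge> 0" if "j \<le> Suc k" for j unfolding I_def
   by (rule integral_nonneg) (auto intro!: integrable_continuous_real continuous_intros continuous_on_subset[OF c[rule_format, OF that]])
  have hc: "continuous_on UNIV (h 0)" "continuous_on UNIV (h (Suc 0))" using c by auto
  have "\<bar>\<xi>\<bar> * cmod (fourier (\<lambda>x. \<phi> x * h 0 x) \<xi>) = cmod (fourier (\<lambda>x. deriv \<phi> x * h 0 x + \<phi> x * h (Suc 0) x) \<xi>)"
  proof (rule fourier_deriv)
   show "((\<lambda>x. \<phi> x * h 0 x) has_real_derivative deriv \<phi> x * h 0 x + \<phi> x * h (Suc 0) x) (at x)" for x
    using DERIV_mult[OF test_function_has_derivative[OF Suc.prems(1)], of "h 0" "h (Suc 0) x" x] d by (simp add: mult.commute)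
  qed (use Suc.prems \<phi>' in \<open>auto intro!: continuous_intros \<phi>c hc\<close>)
  also have "\<dots> = cmod (fourier (\<lambda>x. deriv \<phi> x * h 0 x) \<xi> + fourier (\<lambda>x. \<phi> x * h (Suc 0) x) \<xi>)"
   by (subst fourier_add[where R = R]) (use Suc.prems \<phi>' in \<open>auto intro!: continuous_intros \<phi>c hc\<close>)
  also have "\<dots> \<le> cmod (fourier (\<lambda>x. deriv \<phi> x * h 0 x) \<xi>) + cmod (fourier (\<lambda>x. \<phi> x * h (Suc 0) x) \<xi>)"
   by (rule norm_triangle_ineq)
  finally have "\<bar>\<xi>\<bar> ^ k * (\<bar>\<xi>\<bar> * cmod (fourier (\<lambda>x. \<phi> x * h 0 x) \<xi>)) \<le>
    \<bar>\<xi>\<bar> ^ k * (cmod (fourier (\<lambda>x. deriv \<phi> x * h 0 x) \<xi>) + cmod (fourier (\<lambda>x. \<phi> x * h (Suc 0) x) \<xi>))"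
   by (rule mult_left_mono) simp
  hence "\<bar>\<xi>\<bar> ^ Suc k * cmod (fourier (\<lambda>x. \<phi> x * h 0 x) \<xi>) \<le>
    \<bar>\<xi>\<bar> ^ k * cmod (fourier (\<lambda>x. deriv \<phi> x * h 0 x) \<xi>) + \<bar>\<xi>\<bar> ^ k * cmod (fourier (\<lambda>x. \<phi> x * h (Suc 0) x) \<xi>)" (is "?L \<le> ?A + ?B")
   by (simp add: distrib_left mult.assoc mult.left_commute)
  hence "?L^2 \<le> (?A + ?B)^2" by (rule power_mono) simp
  also have "\<dots> \<le> 2 * ?A^2 + 2 * ?B^2" using sum_squares_bound[of ?A ?B] by (simp add: power2_sum)
  finally have 1: "?L^2 \<le> 2 * ?A^2 + 2 * ?B^2" .
  define S where "S = (\<Sum>j\<le>Suc k. I j)"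
  have "?A^2 \<le> K2 * (\<Sum>j\<le>k. I j)" unfolding I_def by (rule K2(2)) (use d c in auto)
  also have "\<dots> \<le> K2 * S" unfolding S_def using I0 by (intro mult_left_mono K2(1)) simp
  finally have 2: "?A^2 \<le> K2 * S" .
  have "?B^2 \<le> K1 * (\<Sum>j\<le>k. I (Suc j))"
   unfolding I_def by (rule K1(2)[of "\<lambda>j. h (Suc j)"]) (use d c in auto)
  also have "\<dots> \<le> K1 * S"
   using I0[of 0] unfolding S_def sum.atMost_Suc_shift[of I k] by (intro mult_left_mono K1(1)) simp
  finally have "2 * ?A^2 + 2 * ?B^2 \<le> (2 * K1 + 2 * K2) * S" using 2 by (simp add: algebra_simps)
  thus "?L^2 \<le> (2 * K1 + 2 * K2) * (\<Sum>j\<le>Suc k. integral {-R..R} (\<lambda>x. (h j x)^2))"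
   using 1 unfolding S_def I_def by linarith
 qed (use K1 K2 in auto)
qed

text \<open>Combines the decay of order k with the plain bound, using that (1 + \<xi>^2)^k is at
  most 2^k (1 + \<xi>^(2k)).\<close>

lemma fourier_decay_Bessel:
 assumes t: "test_function \<phi>" and R: "\<And>x. \<bar>x\<bar> > R ==> \<phi> x = 0"
 shows "\<exists>K\<ge>0. \<forall>h \<xi>. (\<forall>j<k. \<forall>x. (h j has_real_derivative h (Suc j) x) (at x)) \<longrightarrow> (\<forall>j\<le>k. continuous_on UNIV (h j)) \<longrightarrow>
  (1 + \<xi>^2) ^ k * (cmod (fourier (\<lambda>x. \<phi> x * h 0 x) \<xi>))^2 \<le> K * (\<Sum>j\<le>k. integral {-R..R} (\<lambda>x. (h j x)^2))"
proof -
 obtain K1 where K1': "K1 \<ge> 0 \<and> (\<forall>h \<xi>. (\<forall>j<k. \<forall>x. (h j has_real_derivative h (Suc j) x) (at x)) \<longrightarrow> (\<forall>j\<le>k. continuous_on UNIV (h j)) \<longrightarrow>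
  (\<bar>\<xi>\<bar> ^ k * cmod (fourier (\<lambda>x. \<phi> x * h 0 x) \<xi>))^2 \<le> K1 * (\<Sum>j\<le>k. integral {-R..R} (\<lambda>x. (h j x)^2)))"
  using fourier_decay[OF t R, where k = k] by (rule exE)
 note K1 = conjunct1[OF K1'] conjunct2[OF K1', rule_format]
 obtain K2 where K2: "K2 \<ge> 0" "\<And>g \<xi>. continuous_on UNIV g ==> (cmod (fourier (\<lambda>x. \<phi> x * g x) \<xi>))^2 \<le> K2 * integral {-R..R} (\<lambda>x. (g x)^2)"
  using fourier_bound[OF test_function_continuous[OF t] R] by blast
 show ?thesis
 proof (intro exI[of _ "2 ^ k * (K1 + K2)"] conjI allI impI)
  fix h :: "nat \<Rightarrow> real \<Rightarrow> real" and \<xi> :: real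
  assume d: "\<forall>j<k. \<forall>x. (h j has_real_derivative h (Suc j) x) (at x)" and c': "\<forall>j\<le>k. continuous_on UNIV (h j)"
  note c = c'[rule_format]
  define S where "S = (\<Sum>j\<le>k. integral {-R..R} (\<lambda>x. (h j x)^2))"
  have I0: "integral {-R..R} (\<lambda>x. (h j x)^2) \<ge> 0" if "j \<le> k" for j
   by (rule integral_nonneg) (auto intro!: integrable_continuous_real continuous_intros continuous_on_subset[OF c[OF that]])
  define f where "f = (cmod (fourier (\<lambda>x. \<phi> x * h 0 x) \<xi>))^2"
  have 1: "(\<xi>^2) ^ k * f \<le> K1 * S"
  proof -
   have "(\<bar>\<xi>\<bar> ^ k)^2 = (\<xi>^2) ^ k" by (metis power2_abs power_mult mult.commute)
   thus ?thesis using K1(2)[of h \<xi>] d c unfolding f_def S_def by (simp add: power_mult_distrib)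
  qed
  have 2: "f \<le> K2 * S"
  proof -
   have "f \<le> K2 * integral {-R..R} (\<lambda>x. (h 0 x)^2)" unfolding f_def by (rule K2(2)) (use c in auto)
   also have "\<dots> \<le> K2 * S" unfolding S_def using K2(1) I0 by (intro mult_left_mono member_le_sum) auto
   finally show ?thesis .
  qed
  have "(1 + \<xi>^2) ^ k \<le> 2 ^ k * (1 + (\<xi>^2) ^ k)"
  proof (cases "\<xi>^2 \<le> 1")
   case True
   hence "(1 + \<xi>^2) ^ k \<le> 2 ^ k" by (intro power_mono) auto
   also have "\<dots> \<le> 2 ^ k * (1 + (\<xi>^2) ^ k)" by simp
   finally show ?thesis .
  next
   case False
   hence "(1 + \<xi>^2) ^ k \<le> (2 * \<xi>^2) ^ k" by (intro power_mono) auto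
   also have "\<dots> \<le> 2 ^ k * (1 + (\<xi>^2) ^ k)" by (simp add: power_mult_distrib)
   finally show ?thesis .
  qed
  hence "(1 + \<xi>^2) ^ k * f \<le> 2 ^ k * (1 + (\<xi>^2) ^ k) * f" by (rule mult_right_mono) (simp add: f_def)
  also have "\<dots> = 2 ^ k * (f + (\<xi>^2) ^ k * f)" by (simp add: algebra_simps)
  also have "\<dots> \<le> 2 ^ k * (K2 * S + K1 * S)" using 1 2 by (intro mult_left_mono add_mono) auto
  finally show "(1 + \<xi>^2) ^ k * (cmod (fourier (\<lambda>x. \<phi> x * h 0 x) \<xi>))^2 \<le> 2 ^ k * (K1 + K2) * (\<Sum>j\<le>k. integral {-R..R} (\<lambda>x. (h j x)^2))"
   unfolding S_def f_def by (simp add: algebra_simps)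
 qed (use K1 K2 in auto)
qed

text \<open>On symmetric intervals the antiderivative arctan gives at most \<pi>. This is the
  integral that the surplus decay in \<xi> has to make finite.\<close>

lemma nn_integral_inverse_1_plus_square: "(\<integral>\<^sup>+\<xi>. ennreal (1 / (1 + \<xi>^2)) \<partial>lborel) \<le> ennreal pi"
proof -
 have p: "1 + x^2 > 0" for x :: real by (smt (verit) zero_le_power2)
 have "L2sq (\<lambda>x. 1 / sqrt (1 + x^2)) \<le> ennreal pi"
 proof (rule L2sq_le_if_integrals)
  show "continuous_on UNIV (\<lambda>x. 1 / sqrt (1 + x^2))"
   using p by (intro continuous_intros) (auto simp: less_imp_neq[symmetric])
  show "integral {-R..R} (\<lambda>x. (1 / sqrt (1 + x^2))^2) \<le> pi" for R :: real
  proof (cases "R \<ge> 0")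
   case True
   have "integral {-R..R} (\<lambda>x. 1 / (1 + x^2)) = arctan R - arctan (-R)"
    by (rule FTC_integral[where S = UNIV]) (use True in \<open>auto intro!: derivative_eq_intros simp: inverse_eq_divide\<close>)
   also have "\<dots> \<le> pi" using arctan_bounded[of R] by (simp add: arctan_minus)
   finally show ?thesis using p by (simp add: power_divide less_imp_le)
  qed simp
 qed
 thus ?thesis using p unfolding L2sq_def by (simp add: power_divide less_imp_le)
qed

lemma interpolate_bounds:
 fixes x y z l :: real
 assumes "0 \<le> z" "z \<le> x" "z \<le> y" "0 < l" "l \<le> 1"
 shows "z \<le> x powr l * y powr (1 - l)"
proof (cases "z = 0")
 case False
 hence "z = z powr l * z powr (1 - l)" using assms by (simp add: powr_add[symmetric])
 also have "\<dots> \<le> x powr l * y powr (1 - l)" using assms by (intro mult_mono powr_mono2) auto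
 finally show ?thesis .
qed simp


text \<open>Pointwise in \<open>\<xi>\<close>, the time integral of the squared Fourier transform is interpolated between the \<open>L^2\<close>
 convergence and the bound of order m; integrating in \<open>\<xi>\<close> afterwards loses one order but avoids Plancherel.\<close>

lemma converges_L2_Hloc_criterion:
 fixes F :: "real \<Rightarrow> field" and f :: field and G :: "real \<Rightarrow> nat \<Rightarrow> field"
 assumes e1: "e1 > 0" and T: "T \<ge> 0" and r: "r < real m - 1"
  and f: "C_strip 0 T f"
  and G0: "\<And>e t x. e \<in> {0<..e1} ==> t \<in> {0..T} ==> G e 0 t x = F e t x"
  and Gc: "\<And>e j. e \<in> {0<..e1} ==> j \<le> m ==> C_strip 0 T (G e j)"
  and Gd: "\<And>e j t x. e \<in> {0<..e1} ==> j < m ==> t \<in> {0..T} ==> (G e j t has_real_derivative G e (Suc j) t x) (at x)"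
  and Gb: "\<And>R. \<exists>C. \<forall>e\<in>{0<..e1}. \<forall>j\<le>m. integral {0..T} (\<lambda>t. integral {-R..R} (\<lambda>x. (G e j t x)^2)) \<le> C"
  and conv: "\<And>R. ((\<lambda>e. integral {0..T} (\<lambda>t. integral {-R..R} (\<lambda>x. (F e t x - f t x)^2))) \<longlongrightarrow> 0) (at_right 0)"
 shows "converges_L2_Hloc r T F f"
 unfolding converges_L2_Hloc_def
proof (intro allI impI)
 fix \<phi> assume t: "test_function \<phi>"
 then obtain R where R: "\<And>x. \<bar>x\<bar> > R ==> \<phi> x = 0" by (auto simp: test_function_iff)
 have \<phi>c: "continuous_on S \<phi>" for S using test_function_continuous[OF t] continuous_on_subset by blast
 obtain K where K: "K \<ge> 0" "\<And>g \<xi>. continuous_on UNIV g ==> (cmod (fourier (\<lambda>x. \<phi> x * g x) \<xi>))^2 \<le> K * integral {-R..R} (\<lambda>x. (g x)^2)"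
  by (rule fourier_bound[where R = R, OF test_function_continuous[OF t] R], assumption) (rule that)
 obtain K' where K'': "K' \<ge> 0 \<and> (\<forall>h \<xi>. (\<forall>j<m. \<forall>x. (h j has_real_derivative h (Suc j) x) (at x)) \<longrightarrow> (\<forall>j\<le>m. continuous_on UNIV (h j)) \<longrightarrow>
  (1 + \<xi>^2) ^ m * (cmod (fourier (\<lambda>x. \<phi> x * h 0 x) \<xi>))^2 \<le> K' * (\<Sum>j\<le>m. integral {-R..R} (\<lambda>x. (h j x)^2)))"
  using fourier_decay_Bessel[where R = R and k = m, OF t R] by (rule exE)
 note K' = conjunct1[OF K''] conjunct2[OF K'', rule_format]
 obtain C where C: "\<And>e j. e \<in> {0<..e1} ==> j \<le> m ==> integral {0..T} (\<lambda>t. integral {-R..R} (\<lambda>x. (G e j t x)^2)) \<le> C"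
  using Gb[of R] by blast
 define \<Phi> where "\<Phi> g t \<xi> = (cmod (fourier (\<lambda>x. \<phi> x * g t x) \<xi>))^2" for g :: field and t \<xi>
 have \<Phi>c: "continuous_on ({0..T} \<times> UNIV) (\<lambda>p. \<Phi> g (fst p) (snd p))" if g: "C_strip 0 T g" for g
 proof -
  have "continuous_on ({0..T} \<times> UNIV) (\<lambda>p. integral (cbox (-R) R) (\<lambda>x. cis (- (snd p * x)) * complex_of_real (\<phi> x * g (fst p) x)))"
  proof (rule integral_continuous_on_param, unfold case_prod_unfold, intro continuous_intros)
   show "continuous_on (({0..T} \<times> UNIV) \<times> cbox (-R) R) (\<lambda>q. \<phi> (snd q))"
    by (rule continuous_on_compose2[OF \<phi>c[of UNIV]]) (auto intro: continuous_intros)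
   show "continuous_on (({0..T} \<times> UNIV) \<times> cbox (-R) R) (\<lambda>q. g (fst (fst q)) (snd q))"
    by (rule C0_compose[OF g]) (auto intro!: continuous_intros)
  qed
  hence "continuous_on ({0..T} \<times> UNIV) (\<lambda>p. (cmod (integral (cbox (-R) R) (\<lambda>x. cis (- (snd p * x)) * complex_of_real (\<phi> x * g (fst p) x))))^2)"
   by (intro continuous_intros)
  moreover have "\<Phi> g (fst p) (snd p) = (cmod (integral (cbox (-R) R) (\<lambda>x. cis (- (snd p * x)) * complex_of_real (\<phi> x * g (fst p) x))))^2"
   if "p \<in> {0..T} \<times> UNIV" for p
  proof -
   have "fst p \<in> {0..T}" using that by auto
   thus ?thesis unfolding \<Phi>_def
    by (subst fourier_eq_integral[where R = R]) (auto intro!: continuous_intros \<phi>c C0_slice_x[OF g] simp: R)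
  qed
  ultimately show ?thesis by (simp cong: continuous_on_cong_simp)
 qed
 have \<Phi>ct: "continuous_on {0..T} (\<lambda>t. \<Phi> g t \<xi>)" if g: "C_strip 0 T g" for g \<xi>
  by (rule C0_slice_t[OF C0_iff[THEN iffD2, OF \<Phi>c[OF g]]]) simp
 have \<Phi>0: "\<Phi> g t \<xi> \<ge> 0" for g t \<xi> by (simp add: \<Phi>_def)
 define J where "J g \<xi> = integral {0..T} (\<lambda>t. \<Phi> g t \<xi>)" for g \<xi>
 have J0: "J g \<xi> \<ge> 0" if "C_strip 0 T g" for g \<xi>
  unfolding J_def by (rule integral_nonneg) (auto intro!: integrable_continuous_real \<Phi>ct that \<Phi>0)
 have F: "C_strip 0 T (F e)" if "e \<in> {0<..e1}" for e
  using C0_cong[OF Gc[OF that, of 0]] G0[OF that] by simp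
 define \<eta> where "\<eta> e = integral {0..T} (\<lambda>t. integral {-R..R} (\<lambda>x. (F e t x - f t x)^2))" for e
 have \<eta>_lim: "(\<eta> \<longlongrightarrow> 0) (at_right 0)" unfolding \<eta>_def by (rule conv)
 have diff: "C_strip 0 T (\<lambda>t x. F e t x - f t x)" if "e \<in> {0<..e1}" for e by (intro C0_diff F that f)
 have J\<eta>: "J (\<lambda>t x. F e t x - f t x) \<xi> \<le> K * \<eta> e" if "e \<in> {0<..e1}" for e \<xi>
 proof -
  note d = diff[OF that]
  have "J (\<lambda>t x. F e t x - f t x) \<xi> \<le> integral {0..T} (\<lambda>t. K * integral {-R..R} (\<lambda>x. (F e t x - f t x)^2))"
   unfolding J_def
  proof (rule integral_mono_continuous[OF \<Phi>ct[OF d]])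
   show "continuous_on {0..T} (\<lambda>t. K * integral {-R..R} (\<lambda>x. (F e t x - f t x)^2))"
    by (intro continuous_intros C0_space_integral C0_power d)
   show "\<Phi> (\<lambda>t x. F e t x - f t x) t \<xi> \<le> K * integral {-R..R} (\<lambda>x. (F e t x - f t x)^2)" if "t \<in> {0..T}" for t
    unfolding \<Phi>_def by (rule K(2)) (rule C0_slice_x[OF d that])
  qed
  thus ?thesis by (simp add: \<eta>_def)
 qed
 \<comment> \<open>The maximum with 0 secures nonnegativity, which the real powers of A below
   presuppose.\<close>
 define A where "A = max 0 (K' * ((1 + real m) * C))"
 have JF: "(1 + \<xi>^2) ^ m * J (F e) \<xi> \<le> A" if e: "e \<in> {0<..e1}" for e \<xi>
 proof -
  have Gi: "continuous_on {0..T} (\<lambda>t. integral {-R..R} (\<lambda>x. (G e j t x)^2))" if "j \<le> m" for j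
   by (intro C0_space_integral C0_power Gc e that)
  have "(1 + \<xi>^2) ^ m * J (F e) \<xi> = integral {0..T} (\<lambda>t. (1 + \<xi>^2) ^ m * \<Phi> (F e) t \<xi>)"
   by (simp add: J_def)
  also have "\<dots> \<le> integral {0..T} (\<lambda>t. K' * (\<Sum>j\<le>m. integral {-R..R} (\<lambda>x. (G e j t x)^2)))"
  proof (rule integral_mono_continuous)
   fix t assume tt: "t \<in> {0..T}"
   have "F e t = G e 0 t" using G0[OF e tt] by auto
   thus "(1 + \<xi>^2) ^ m * \<Phi> (F e) t \<xi> \<le> K' * (\<Sum>j\<le>m. integral {-R..R} (\<lambda>x. (G e j t x)^2))"
    unfolding \<Phi>_def using K'(2)[of "\<lambda>j. G e j t" \<xi>] Gd[OF e _ tt] C0_slice_x[OF Gc[OF e] tt] by simp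
  next
   show "continuous_on {0..T} (\<lambda>t. (1 + \<xi>^2) ^ m * \<Phi> (F e) t \<xi>)"
    by (rule continuous_on_mult_left[OF \<Phi>ct[OF F[OF e]]])
   show "continuous_on {0..T} (\<lambda>t. K' * (\<Sum>j\<le>m. integral {-R..R} (\<lambda>x. (G e j t x)^2)))"
    by (rule continuous_on_mult_left, rule continuous_on_sum, rule Gi) simp
  qed
  also have "\<dots> = K' * (\<Sum>j\<le>m. integral {0..T} (\<lambda>t. integral {-R..R} (\<lambda>x. (G e j t x)^2)))"
   by (subst integral_sum[symmetric]) (auto intro!: integrable_continuous_real Gi)
  also have "\<dots> \<le> K' * (\<Sum>j\<le>m. C)" by (intro mult_left_mono sum_mono C e K'(1)) simp
  also have "\<dots> \<le> A" by (simp add: A_def)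
  finally show ?thesis .
 qed
 have \<Phi>2: "\<Phi> (\<lambda>t x. g t x - h t x) t \<xi> \<le> 2 * \<Phi> g t \<xi> + 2 * \<Phi> h t \<xi>"
  if g: "C_strip 0 T g" "C_strip 0 T h" and tt: "t \<in> {0..T}" for g h t \<xi>
 proof -
  have c: "continuous_on UNIV (g t)" "continuous_on UNIV (h t)" using C0_slice_x g tt by blast+
  have "fourier (\<lambda>x. \<phi> x * (g t x - h t x)) \<xi> = fourier (\<lambda>x. \<phi> x * g t x + \<phi> x * (- h t x)) \<xi>"
   by (simp add: algebra_simps)
  also have "\<dots> = fourier (\<lambda>x. \<phi> x * g t x) \<xi> + fourier (\<lambda>x. \<phi> x * (- h t x)) \<xi>"
   by (rule fourier_add[where R = R]) (auto intro!: continuous_intros \<phi>c c simp: R)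
  also have "fourier (\<lambda>x. \<phi> x * (- h t x)) \<xi> = - fourier (\<lambda>x. \<phi> x * h t x) \<xi>"
   by (simp add: fourier_def)
  finally have "cmod (fourier (\<lambda>x. \<phi> x * (g t x - h t x)) \<xi>) \<le> cmod (fourier (\<lambda>x. \<phi> x * g t x) \<xi>) + cmod (fourier (\<lambda>x. \<phi> x * h t x) \<xi>)"
   using norm_triangle_ineq4 by simp
  hence "(cmod (fourier (\<lambda>x. \<phi> x * (g t x - h t x)) \<xi>))^2 \<le> (cmod (fourier (\<lambda>x. \<phi> x * g t x) \<xi>) + cmod (fourier (\<lambda>x. \<phi> x * h t x) \<xi>))^2"
   by (rule power_mono) simp
  also have "\<dots> \<le> 2 * \<Phi> g t \<xi> + 2 * \<Phi> h t \<xi>"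
   using sum_squares_bound[of "cmod (fourier (\<lambda>x. \<phi> x * g t x) \<xi>)" "cmod (fourier (\<lambda>x. \<phi> x * h t x) \<xi>)"]
   by (simp add: power2_sum \<Phi>_def)
  finally show ?thesis by (simp add: \<Phi>_def)
 qed
 have J2: "J (\<lambda>t x. g t x - h t x) \<xi> \<le> 2 * J g \<xi> + 2 * J h \<xi>" if g: "C_strip 0 T g" "C_strip 0 T h" for g h \<xi>
 proof -
  have "J (\<lambda>t x. g t x - h t x) \<xi> \<le> integral {0..T} (\<lambda>t. 2 * \<Phi> g t \<xi> + 2 * \<Phi> h t \<xi>)"
   unfolding J_def by (intro integral_mono_continuous \<Phi>2 continuous_intros \<Phi>ct C0_diff g)
  also have "\<dots> = 2 * J g \<xi> + 2 * J h \<xi>"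
   unfolding J_def by (subst integral_add) (auto intro!: integrable_continuous_real continuous_intros \<Phi>ct g)
  finally show ?thesis .
 qed
 have pos: "(1 + \<xi>^2) ^ m > 0" for \<xi> :: real by (rule zero_less_power) (smt (verit) zero_le_power2)
 \<comment> \<open>For the limit f only continuity is known. Its decay in \<xi> is obtained by
   comparison with the family at fixed \<xi>, where the difference tends to 0 even after
   multiplication by (1 + \<xi>^2)^m.\<close>
 have Jf: "(1 + \<xi>^2) ^ m * J f \<xi> \<le> 2 * A" for \<xi>
 proof (rule tendsto_lowerbound)
  have "((\<lambda>e. 2 * A + (1 + \<xi>^2) ^ m * (2 * (K * \<eta> e))) \<longlongrightarrow> 2 * A + (1 + \<xi>^2) ^ m * (2 * (K * 0))) (at_right 0)"
   by (intro tendsto_intros \<eta>_lim)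
  thus "((\<lambda>e. 2 * A + (1 + \<xi>^2) ^ m * (2 * (K * \<eta> e))) \<longlongrightarrow> 2 * A) (at_right 0)" by simp
  have "\<forall>\<^sub>F e in at_right 0. e \<in> {0<..e1}"
   unfolding eventually_at_right_field using e1 by (intro exI[of _ e1]) auto
  thus "\<forall>\<^sub>F e in at_right 0. (1 + \<xi>^2) ^ m * J f \<xi> \<le> 2 * A + (1 + \<xi>^2) ^ m * (2 * (K * \<eta> e))"
  proof eventually_elim
   case (elim e)
   have "J f \<xi> \<le> 2 * J (F e) \<xi> + 2 * J (\<lambda>t x. F e t x - f t x) \<xi>"
    using J2[OF F[OF elim] diff[OF elim], of \<xi>] by simp
   also have "\<dots> \<le> 2 * J (F e) \<xi> + 2 * (K * \<eta> e)" using J\<eta>[OF elim, of \<xi>] by simp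
   finally have "(1 + \<xi>^2) ^ m * J f \<xi> \<le> (1 + \<xi>^2) ^ m * (2 * J (F e) \<xi> + 2 * (K * \<eta> e))"
    using pos[of \<xi>] by (intro mult_left_mono) auto
   thus ?case using JF[OF elim, of \<xi>] by (simp add: algebra_simps)
  qed
 qed simp
 \<comment> \<open>The share l of the interpolation given to the small quantity is so small that (1
   + \<xi>^2) keeps an exponent of at most -1. The denominator m + 1 instead of m avoids a case
   distinction at m = 0.\<close>
 define l where "l = min 1 ((real m - 1 - r) / (real m + 1))"
 have l: "0 < l" "l \<le> 1" "r + l * real m - real m \<le> - 1"
 proof -
  show "0 < l" "l \<le> 1" using r by (auto simp: l_def)
  have "l * real m \<le> l * (real m + 1)" using \<open>0 < l\<close> by simp
  also have "\<dots> \<le> (real m - 1 - r) / (real m + 1) * (real m + 1)" by (intro mult_right_mono) (auto simp: l_def)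
  also have "\<dots> = real m - 1 - r" by simp
  finally show "r + l * real m - real m \<le> - 1" by simp
 qed
 define B where "B e = (K * \<eta> e) powr l * (6 * A) powr (1 - l)" for e
 have main: "(\<integral>\<^sup>+t\<in>{0..T}. Hloc_sq r \<phi> (\<lambda>x. F e t x - f t x) \<partial>lborel) \<le> ennreal (B e * pi)" if e: "e \<in> {0<..e1}" for e
 proof -
  define g where "g = (\<lambda>t x. F e t x - f t x)"
  have g: "C_strip 0 T g" unfolding g_def by (rule diff[OF e])
  \<comment> \<open>The decay bound 6 A (1 + \<xi>^2)^-m, made of 2 A from the family and 4 A from
    the limit, is interpolated with the bound K \<eta>, which is small uniformly in \<xi>.\<close>
  have Jg: "(1 + \<xi>^2) powr r * J g \<xi> \<le> B e * (1 / (1 + \<xi>^2))" for \<xi>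
  proof -
   define b where "b = 1 + \<xi>^2"
   have b: "b \<ge> 1" by (simp add: b_def)
   have "b ^ m * J g \<xi> \<le> b ^ m * (2 * J (F e) \<xi> + 2 * J f \<xi>)"
    unfolding g_def using J2[OF F[OF e] f, of \<xi>] b by (intro mult_left_mono) auto
   also have "\<dots> \<le> 6 * A" using JF[OF e, of \<xi>] Jf[of \<xi>] unfolding b_def by (simp add: algebra_simps)
   finally have "J g \<xi> \<le> 6 * A * b powr (- real m)"
    using b by (simp add: powr_minus powr_realpow field_simps)
   hence "J g \<xi> \<le> (K * \<eta> e) powr l * (6 * A * b powr (- real m)) powr (1 - l)"
    using J\<eta>[OF e, of \<xi>] J0[OF g, of \<xi>] l unfolding g_def by (intro interpolate_bounds) auto
   also have "\<dots> = B e * b powr (- real m * (1 - l))"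
    unfolding B_def using b by (subst powr_mult) (auto simp: A_def powr_powr)
   finally have "b powr r * J g \<xi> \<le> b powr r * (B e * b powr (- real m * (1 - l)))"
    by (intro mult_left_mono) auto
   also have "\<dots> = B e * b powr (r + (- real m * (1 - l)))" by (simp only: powr_add mult.left_commute)
   also have "\<dots> \<le> B e * b powr (- 1)"
    using l(3) b by (intro mult_left_mono powr_mono) (auto simp: B_def right_diff_distrib mult.commute)
   also have "b powr (- 1) = 1 / b" using b by (simp add: powr_minus_divide)
   finally show ?thesis by (simp add: b_def)
  qed
  \<comment> \<open>Joint measurability for exchanging the integrals in t and \<xi>; it comes from
    the continuity of the Fourier integral in both variables on the closed strip.\<close>
  have meas: "(\<lambda>(t, \<xi>). ennreal (indicator {0..T} t * ((1 + \<xi>^2) powr r * \<Phi> g t \<xi>))) \<in> borel_measurable (lborel \<Otimes>\<^sub>M lborel)"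
  proof -
   have "(\<lambda>p. indicator ({0..T} \<times> UNIV) p *\<^sub>R ((1 + (snd p)^2) powr r * \<Phi> g (fst p) (snd p))) \<in> borel_measurable borel"
   proof (rule borel_measurable_continuous_on_indicator)
    show "{0..T} \<times> (UNIV :: real set) \<in> sets borel"
     by (intro borel_closed closed_Times) auto
    have "1 + (snd p)^2 \<noteq> 0" for p :: "real \<times> real" by (smt (verit) zero_le_power2)
    thus "continuous_on ({0..T} \<times> UNIV) (\<lambda>p. (1 + (snd p)^2) powr r * \<Phi> g (fst p) (snd p))"
     by (intro continuous_intros \<Phi>c g) auto
   qed
   moreover have "(\<lambda>p. indicator ({0..T} \<times> UNIV) p *\<^sub>R ((1 + (snd p)^2) powr r * \<Phi> g (fst p) (snd p))) =
     (\<lambda>(t, \<xi>). indicator {0..T} t * ((1 + \<xi>^2) powr r * \<Phi> g t \<xi>))"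
    by (auto simp: indicator_def)
   ultimately have "(\<lambda>(t, \<xi>). indicator {0..T} t * ((1 + \<xi>^2) powr r * \<Phi> g t \<xi>)) \<in> borel_measurable (borel \<Otimes>\<^sub>M borel)"
    by (simp add: borel_prod)
   hence "(\<lambda>p. ennreal (indicator {0..T} (fst p) * ((1 + (snd p)^2) powr r * \<Phi> g (fst p) (snd p)))) \<in> borel_measurable (borel \<Otimes>\<^sub>M borel)"
    unfolding case_prod_unfold by measurable
   thus ?thesis by (simp add: case_prod_unfold cong: measurable_cong_sets)
  qed
  have "(\<integral>\<^sup>+t\<in>{0..T}. Hloc_sq r \<phi> (\<lambda>x. F e t x - f t x) \<partial>lborel)
    = (\<integral>\<^sup>+t. (\<integral>\<^sup>+\<xi>. ennreal (indicator {0..T} t * ((1 + \<xi>^2) powr r * \<Phi> g t \<xi>)) \<partial>lborel) \<partial>lborel)"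
   unfolding Hloc_sq_def \<Phi>_def g_def by (rule nn_integral_cong) (auto simp: indicator_def)
  also have "\<dots> = (\<integral>\<^sup>+\<xi>. (\<integral>\<^sup>+t. ennreal (indicator {0..T} t * ((1 + \<xi>^2) powr r * \<Phi> g t \<xi>)) \<partial>lborel) \<partial>lborel)"
   using lborel_pair.Fubini'[OF meas] by simp
  also have "\<dots> = (\<integral>\<^sup>+\<xi>. ennreal ((1 + \<xi>^2) powr r * J g \<xi>) \<partial>lborel)"
  proof (rule nn_integral_cong)
   fix \<xi>
   have "(\<integral>\<^sup>+t. ennreal (indicator {0..T} t * ((1 + \<xi>^2) powr r * \<Phi> g t \<xi>)) \<partial>lborel)
    = (\<integral>\<^sup>+t\<in>{0..T}. ennreal ((1 + \<xi>^2) powr r * \<Phi> g t \<xi>) \<partial>lborel)"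
    by (rule nn_integral_cong) (auto simp: indicator_def)
   also have "\<dots> = ennreal (integral {0..T} (\<lambda>t. (1 + \<xi>^2) powr r * \<Phi> g t \<xi>))"
    by (rule nn_integral_Icc_continuous) (auto intro!: continuous_intros \<Phi>ct g mult_nonneg_nonneg \<Phi>0)
   finally show "(\<integral>\<^sup>+t. ennreal (indicator {0..T} t * ((1 + \<xi>^2) powr r * \<Phi> g t \<xi>)) \<partial>lborel) = ennreal ((1 + \<xi>^2) powr r * J g \<xi>)"
    by (simp add: J_def)
  qed
  also have "\<dots> \<le> (\<integral>\<^sup>+\<xi>. ennreal (B e) * ennreal (1 / (1 + \<xi>^2)) \<partial>lborel)"
  proof (rule nn_integral_mono)
   fix \<xi>
   have "B e \<ge> 0" by (simp add: B_def)
   thus "ennreal ((1 + \<xi>^2) powr r * J g \<xi>) \<le> ennreal (B e) * ennreal (1 / (1 + \<xi>^2))"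
    using Jg[of \<xi>] by (subst ennreal_mult[symmetric]) (auto intro!: ennreal_leI)
  qed
  also have "\<dots> = ennreal (B e) * (\<integral>\<^sup>+\<xi>. ennreal (1 / (1 + \<xi>^2)) \<partial>lborel)"
   by (rule nn_integral_cmult) measurable
  also have "\<dots> \<le> ennreal (B e) * ennreal pi" by (intro mult_left_mono nn_integral_inverse_1_plus_square) simp
  also have "\<dots> = ennreal (B e * pi)" by (rule ennreal_mult[symmetric]) (auto simp: B_def)
  finally show ?thesis .
 qed
 have "((\<lambda>e. (K * \<eta> e) powr l) \<longlongrightarrow> 0) (at_right 0)"
 proof (rule tendsto_zero_powrI)
  show "((\<lambda>e. K * \<eta> e) \<longlongrightarrow> 0) (at_right 0)" by (rule tendsto_mult_right_zero[OF \<eta>_lim])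
  have "\<forall>\<^sub>F e in at_right 0. e \<in> {0<..e1}"
   unfolding eventually_at_right_field using e1 by (intro exI[of _ e1]) auto
  thus "\<forall>\<^sub>F e in at_right 0. 0 \<le> K * \<eta> e"
   by eventually_elim (use J\<eta> J0 diff order_trans in blast)
 qed (use l in auto)
 hence "((\<lambda>e. B e * pi) \<longlongrightarrow> 0) (at_right 0)"
  unfolding B_def by (intro tendsto_mult_left_zero)
 hence lim: "((\<lambda>e. ennreal (B e * pi)) \<longlongrightarrow> 0) (at_right 0)"
  using tendsto_ennrealI by fastforce
 show "((\<lambda>e. \<integral>\<^sup>+t\<in>{0..T}. Hloc_sq r \<phi> (\<lambda>x. F e t x - f t x) \<partial>lborel) \<longlongrightarrow> 0) (at_right 0)"
 proof (rule tendsto_sandwich[OF _ _ tendsto_const lim])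
  have "\<forall>\<^sub>F e in at_right 0. e \<in> {0<..e1}"
   unfolding eventually_at_right_field using e1 by (intro exI[of _ e1]) auto
  thus "\<forall>\<^sub>F e in at_right 0. (\<integral>\<^sup>+t\<in>{0..T}. Hloc_sq r \<phi> (\<lambda>x. F e t x - f t x) \<partial>lborel) \<le> ennreal (B e * pi)"
   by eventually_elim (rule main)
 qed simp
qed

section \<open>The singular family\<close>

lemma exp_diff_bound: "\<bar>a\<bar> \<le> M ==> \<bar>b\<bar> \<le> M ==> \<bar>exp a - exp b\<bar> \<le> exp M * \<bar>a - b\<bar>" for a b M :: real
 by (rule has_real_derivative_lipschitz[where S = "{-M..M}" and f' = exp])
  (auto intro!: derivative_eq_intros)

text \<open>The natural number argument of p, u, \<open>\<theta>\<close> counts x-derivatives; e stands for \<open>\<epsilon>\<close>.\<close>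

locale singular_family =
 fixes \<kappa> \<mu> T e1 M :: real
  and p u \<theta> :: "real \<Rightarrow> nat \<Rightarrow> field" and pt ut \<theta>t :: "real \<Rightarrow> field"
 assumes pos: "\<kappa> > 0" "\<mu> > 0" "T > 0" "0 < e1" "e1 \<le> 1"
  and p_C0: "\<And>e j. e \<in> {0<..e1} ==> j \<le> 4 ==> C_strip 0 T (p e j)"
  and u_C0: "\<And>e j. e \<in> {0<..e1} ==> j \<le> 4 ==> C_strip 0 T (u e j)"
  and \<theta>_C0: "\<And>e j. e \<in> {0<..e1} ==> j \<le> 4 ==> C_strip 0 T (\<theta> e j)"
  and pt_C0: "\<And>e. e \<in> {0<..e1} ==> C_strip 0 T (pt e)"
  and ut_C0: "\<And>e. e \<in> {0<..e1} ==> C_strip 0 T (ut e)"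
  and \<theta>t_C0: "\<And>e. e \<in> {0<..e1} ==> C_strip 0 T (\<theta>t e)"
  and p_dx: "\<And>e j t x. e \<in> {0<..e1} ==> j < 4 ==> t \<in> {0..T} ==> (p e j t has_real_derivative p e (Suc j) t x) (at x)"
  and u_dx: "\<And>e j t x. e \<in> {0<..e1} ==> j < 4 ==> t \<in> {0..T} ==> (u e j t has_real_derivative u e (Suc j) t x) (at x)"
  and \<theta>_dx: "\<And>e j t x. e \<in> {0<..e1} ==> j < 4 ==> t \<in> {0..T} ==> (\<theta> e j t has_real_derivative \<theta> e (Suc j) t x) (at x)"
  and p_dt: "\<And>e t x. e \<in> {0<..e1} ==> t \<in> {0..T} ==> ((\<lambda>\<tau>. p e 0 \<tau> x) has_real_derivative pt e t x) (at t within {0..T})"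
  and u_dt: "\<And>e t x. e \<in> {0<..e1} ==> t \<in> {0..T} ==> ((\<lambda>\<tau>. u e 0 \<tau> x) has_real_derivative ut e t x) (at t within {0..T})"
  and \<theta>_dt: "\<And>e t x. e \<in> {0<..e1} ==> t \<in> {0..T} ==> ((\<lambda>\<tau>. \<theta> e 0 \<tau> x) has_real_derivative \<theta>t e t x) (at t within {0..T})"
  and p_bound: "\<And>e j t x. e \<in> {0<..e1} ==> j \<le> 2 ==> t \<in> {0..T} ==> \<bar>p e j t x\<bar> \<le> M"
  and u_bound: "\<And>e j t x. e \<in> {0<..e1} ==> j \<le> 2 ==> t \<in> {0..T} ==> \<bar>u e j t x\<bar> \<le> M"
  and \<theta>_bound: "\<And>e j t x. e \<in> {0<..e1} ==> j \<le> 4 ==> t \<in> {0..T} ==> \<bar>\<theta> e j t x\<bar> \<le> M"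
  and p_L2: "\<And>e t a b. e \<in> {0<..e1} ==> t \<in> {0..T} ==> integral {a..b} (\<lambda>x. (p e 0 t x)^2) \<le> M"
  and u_L2: "\<And>e t a b. e \<in> {0<..e1} ==> t \<in> {0..T} ==> integral {a..b} (\<lambda>x. (u e 0 t x)^2) \<le> M"
  and \<theta>_L2: "\<And>e t a b. e \<in> {0<..e1} ==> t \<in> {0..T} ==> integral {a..b} (\<lambda>x. (\<theta> e 1 t x)^2) \<le> M"
  and p_eq: "\<And>e t x. e \<in> {0<..e1} ==> t \<in> {0..T} ==>
    pt e t x + u e 0 t x * p e 1 t x
     + 1 / e * (2 * u e 1 t x - \<kappa> * exp (- e * p e 0 t x + \<theta> e 0 t x) * ((\<theta> e 1 t x - e * p e 1 t x) * \<theta> e 1 t x + \<theta> e 2 t x))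
    = \<mu> * e * exp (- e * p e 0 t x) * (u e 1 t x)^2 + \<kappa> * exp (- e * p e 0 t x + \<theta> e 0 t x) * p e 1 t x * \<theta> e 1 t x"
  and u_eq: "\<And>e t x. e \<in> {0<..e1} ==> t \<in> {0..T} ==>
    exp (- \<theta> e 0 t x) * (ut e t x + u e 0 t x * u e 1 t x) + 1 / e * p e 1 t x
    = \<mu> * exp (- e * p e 0 t x) * u e 2 t x"
  and \<theta>_eq: "\<And>e t x. e \<in> {0<..e1} ==> t \<in> {0..T} ==>
    \<theta>t e t x + u e 0 t x * \<theta> e 1 t x + u e 1 t x
    = \<kappa> * exp (- e * p e 0 t x) * (exp (\<theta> e 0 t x) * ((\<theta> e 1 t x)^2 + \<theta> e 2 t x))
     + \<mu> * e^2 * exp (- e * p e 0 t x) * (u e 1 t x)^2"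
begin

section \<open>Quantities bounded uniformly in e, t and x\<close>

declare One_nat_def [simp del]

abbreviation "E \<equiv> {0<..e1}"
abbreviation "I \<equiv> {0..T}"

text \<open>Boundedness uniform in e, t and x is made a predicate with closure rules, so that the
  size of long expressions is decided by their syntax and no constants have to be tracked.\<close>

definition UB :: "(real \<Rightarrow> real \<Rightarrow> real \<Rightarrow> real) \<Rightarrow> bool" where
 "UB f \<longleftrightarrow> (\<exists>C. \<forall>e\<in>E. \<forall>t\<in>I. \<forall>x. \<bar>f e t x\<bar> \<le> C)"

lemma UBI: "(\<And>e t x. e \<in> E ==> t \<in> I ==> \<bar>f e t x\<bar> \<le> C) ==> UB f"
 unfolding UB_def by blast

lemma UBE:
 assumes "UB f"
 obtains C where "C > 0" "\<And>e t x. e \<in> E ==> t \<in> I ==> \<bar>f e t x\<bar> \<le> C"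
proof -
 obtain C where C: "\<forall>e\<in>E. \<forall>t\<in>I. \<forall>x. \<bar>f e t x\<bar> \<le> C" using assms unfolding UB_def by blast
 show ?thesis
 proof (rule that[of "max C 1"])
  show "\<bar>f e t x\<bar> \<le> max C 1" if "e \<in> E" "t \<in> I" for e t x
   using C that by (simp add: le_max_iff_disj)
 qed simp
qed

lemma UB_cong: "UB f ==> (\<And>e t x. e \<in> E ==> t \<in> I ==> f e t x = g e t x) ==> UB g"
 unfolding UB_def by simp

lemma UB_add: "UB f ==> UB g ==> UB (\<lambda>e t x. f e t x + g e t x)"
proof -
 assume "UB f" "UB g"
 then obtain A B where "\<And>e t x. e \<in> E ==> t \<in> I ==> \<bar>f e t x\<bar> \<le> A"
  "\<And>e t x. e \<in> E ==> t \<in> I ==> \<bar>g e t x\<bar> \<le> B" unfolding UB_def by blast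
 thus ?thesis by (intro UBI[of _ "A + B"]) (meson abs_triangle_ineq add_mono order_trans)
qed

lemma UB_mult: "UB f ==> UB g ==> UB (\<lambda>e t x. f e t x * g e t x)"
proof -
 assume f: "UB f" and g: "UB g"
 obtain A where A: "A > 0" "\<And>e t x. e \<in> E ==> t \<in> I ==> \<bar>f e t x\<bar> \<le> A" using UBE[OF f] by blast
 obtain B where B: "B > 0" "\<And>e t x. e \<in> E ==> t \<in> I ==> \<bar>g e t x\<bar> \<le> B" using UBE[OF g] by blast
 show ?thesis
 proof (rule UBI[of _ "A * B"])
  fix e t x assume "e \<in> E" "t \<in> I"
  thus "\<bar>f e t x * g e t x\<bar> \<le> A * B"
   unfolding abs_mult using A B by (intro mult_mono) auto
 qed
qed

lemma UB_const: "UB (\<lambda>e t x. c)"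
 by (rule UBI[of _ "\<bar>c\<bar>"]) simp

lemma UB_eps: "UB (\<lambda>e t x. e)"
 by (rule UBI[of _ 1]) (use pos in auto)

lemma UB_minus: "UB f ==> UB (\<lambda>e t x. - f e t x)"
 unfolding UB_def by simp

lemma UB_diff: "UB f ==> UB g ==> UB (\<lambda>e t x. f e t x - g e t x)"
 using UB_add[OF _ UB_minus] by fastforce

lemma UB_power: "UB f ==> UB (\<lambda>e t x. f e t x ^ n)"
 by (induction n) (auto intro: UB_const UB_mult)

lemma UB_exp: "UB f ==> UB (\<lambda>e t x. exp (f e t x))"
proof -
 assume "UB f"
 then obtain C where C: "\<And>e t x. e \<in> E ==> t \<in> I ==> \<bar>f e t x\<bar> \<le> C" unfolding UB_def by blast
 show ?thesis by (rule UBI[of _ "exp C"]) (use C in \<open>simp add: abs_le_iff\<close>)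
qed

lemma UB_p: "j \<le> 2 ==> UB (\<lambda>e t x. p e j t x)" by (rule UBI[of _ M]) (rule p_bound)
lemma UB_u: "j \<le> 2 ==> UB (\<lambda>e t x. u e j t x)" by (rule UBI[of _ M]) (rule u_bound)
lemma UB_\<theta>: "j \<le> 4 ==> UB (\<lambda>e t x. \<theta> e j t x)" by (rule UBI[of _ M]) (rule \<theta>_bound)

lemmas UB_intros = UB_add UB_mult UB_const UB_eps UB_minus UB_diff UB_power UB_exp UB_p UB_u UB_\<theta>

lemma UB_time_integral:
 assumes f: "UB f" and c: "\<And>e. e \<in> E ==> C_strip 0 T (f e)"
 shows "UB (\<lambda>e t x. integral {0..t} (\<lambda>\<tau>. f e \<tau> x))"
proof -
 obtain C where C: "C > 0" "\<And>e t x. e \<in> E ==> t \<in> I ==> \<bar>f e t x\<bar> \<le> C" using UBE[OF f] by blast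
 show ?thesis
 proof (rule UBI[of _ "C * T"])
  fix e t x assume e: "e \<in> E" and t: "t \<in> I"
  have "norm (integral {0..t} (\<lambda>\<tau>. f e \<tau> x)) \<le> C * (t - 0)"
   by (rule integral_bound) (use t e C(2) in \<open>auto intro!: C0_slice_t c\<close>)
  also have "\<dots> \<le> C * T" using C(1) t by simp
  finally show "\<bar>integral {0..t} (\<lambda>\<tau>. f e \<tau> x)\<bar> \<le> C * T" by simp
 qed
qed

section \<open>The acoustic part, its time integral, and their derivatives\<close>

definition P where "P e t x = exp (- e * p e 0 t x)"
definition Q where "Q e t x = exp (- e * p e 0 t x + \<theta> e 0 t x)"
definition v where "v e t x = u e 0 t x - \<kappa> / 2 * (Q e t x * \<theta> e 1 t x)"
definition vx where "vx e t x = u e 1 t x - \<kappa> / 2 * (Q e t x * ((\<theta> e 1 t x - e * p e 1 t x) * \<theta> e 1 t x + \<theta> e 2 t x))"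
text \<open>The terms of the pressure equation without the prefactor 1/e, the transport term moved
  to the right-hand side; with it the equation reads v_x = (e/2) (F - p_t).\<close>

definition F where "F e t x = \<mu> * e * (P e t x * (u e 1 t x)^2) + \<kappa> * (Q e t x * (p e 1 t x * \<theta> e 1 t x)) - u e 0 t x * p e 1 t x"
definition Fx where "Fx e t x = \<mu> * e * (P e t x * (2 * u e 1 t x * u e 2 t x - e * p e 1 t x * (u e 1 t x)^2))
 + \<kappa> * (Q e t x * ((\<theta> e 1 t x - e * p e 1 t x) * (p e 1 t x * \<theta> e 1 t x) + (p e 2 t x * \<theta> e 1 t x + p e 1 t x * \<theta> e 2 t x)))
 - (u e 1 t x * p e 1 t x + u e 0 t x * p e 2 t x)"
text \<open>The x-derivative of the temperature equation solved for \<theta>_t. It contains no time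
  derivative, hence is bounded, and it is later identified with the time derivative of
  \<theta>_x.\<close>

definition \<theta>tx where "\<theta>tx e t x = - (u e 1 t x * \<theta> e 1 t x + u e 0 t x * \<theta> e 2 t x) - u e 2 t x
 + \<kappa> * (Q e t x * ((\<theta> e 1 t x - e * p e 1 t x) * ((\<theta> e 1 t x)^2 + \<theta> e 2 t x) + (2 * \<theta> e 1 t x * \<theta> e 2 t x + \<theta> e 3 t x)))
 + \<mu> * e^2 * (P e t x * (2 * u e 1 t x * u e 2 t x - e * p e 1 t x * (u e 1 t x)^2))"
definition vt where "vt e t x = ut e t x - \<kappa> / 2 * (Q e t x * ((\<theta>t e t x - e * pt e t x) * \<theta> e 1 t x + \<theta>tx e t x))"
definition W where "W e t x = integral {0..t} (\<lambda>\<tau>. v e \<tau> x)"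
text \<open>The time integral of v_x after p_t has been integrated explicitly: the large p_t is gone
  and the factor e stands in front.\<close>

definition Wx where "Wx e t x = e / 2 * (integral {0..t} (\<lambda>\<tau>. F e \<tau> x) - (p e 0 t x - p e 0 0 x))"
definition Wxx where "Wxx e t x = e / 2 * (integral {0..t} (\<lambda>\<tau>. Fx e \<tau> x) - (p e 1 t x - p e 1 0 x))"

context
 fixes e assumes e: "e \<in> E"
begin

lemma e0: "e > 0" "e \<le> 1" using e pos by auto

lemma dx012:
 assumes t: "t \<in> I"
 shows "(p e 0 t has_real_derivative p e 1 t x) (at x)" "(p e 1 t has_real_derivative p e 2 t x) (at x)"
  "(u e 0 t has_real_derivative u e 1 t x) (at x)" "(u e 1 t has_real_derivative u e 2 t x) (at x)"
  "(\<theta> e 0 t has_real_derivative \<theta> e 1 t x) (at x)" "(\<theta> e 1 t has_real_derivative \<theta> e 2 t x) (at x)"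
  "(\<theta> e 2 t has_real_derivative \<theta> e 3 t x) (at x)" "(\<theta> e 3 t has_real_derivative \<theta> e 4 t x) (at x)"
 using p_dx[OF e _ t, of 0 x] p_dx[OF e _ t, of 1 x] u_dx[OF e _ t, of 0 x] u_dx[OF e _ t, of 1 x]
  \<theta>_dx[OF e _ t, of 0 x] \<theta>_dx[OF e _ t, of 1 x] \<theta>_dx[OF e _ t, of 2 x] \<theta>_dx[OF e _ t, of 3 x]
 by (simp_all add: One_nat_def[symmetric] numeral_2_eq_2[symmetric] numeral_3_eq_3[symmetric])

lemma C0s: "C_strip 0 T (P e)" "C_strip 0 T (Q e)" "C_strip 0 T (v e)" "C_strip 0 T (vx e)" "C_strip 0 T (F e)" "C_strip 0 T (Fx e)" "C_strip 0 T (\<theta>tx e)" "C_strip 0 T (vt e)"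
proof -
 show 1: "C_strip 0 T (P e)" "C_strip 0 T (Q e)"
  unfolding P_def[abs_def] Q_def[abs_def] by (intro C0_intros p_C0 \<theta>_C0 e; simp)+
 show "C_strip 0 T (v e)" "C_strip 0 T (vx e)" "C_strip 0 T (F e)" "C_strip 0 T (Fx e)"
  unfolding v_def[abs_def] vx_def[abs_def] F_def[abs_def] Fx_def[abs_def]
  by (intro C0_intros p_C0 u_C0 \<theta>_C0 e 1; simp)+
 show 2: "C_strip 0 T (\<theta>tx e)" unfolding \<theta>tx_def[abs_def] by (intro C0_intros p_C0 u_C0 \<theta>_C0 e 1; simp)
 show "C_strip 0 T (vt e)" unfolding vt_def[abs_def] by (intro C0_intros p_C0 u_C0 \<theta>_C0 pt_C0 ut_C0 \<theta>t_C0 e 1 2; simp)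
qed

lemma P_dx: "t \<in> I ==> (P e t has_real_derivative - e * p e 1 t x * P e t x) (at x)"
 unfolding P_def[abs_def] by (auto intro!: derivative_eq_intros dx012)

lemma Q_dx: "t \<in> I ==> (Q e t has_real_derivative (\<theta> e 1 t x - e * p e 1 t x) * Q e t x) (at x)"
 unfolding Q_def[abs_def] by (auto intro!: derivative_eq_intros dx012)

lemma v_dx: "t \<in> I ==> (v e t has_real_derivative vx e t x) (at x)"
 unfolding v_def[abs_def] vx_def by (auto intro!: derivative_eq_intros dx012 Q_dx simp: field_simps)

lemma F_dx: "t \<in> I ==> (F e t has_real_derivative Fx e t x) (at x)"
 unfolding F_def[abs_def] Fx_def by (auto intro!: derivative_eq_intros dx012 Q_dx P_dx simp: field_simps power2_eq_square)

lemma vx_eq: "t \<in> I ==> vx e t x = e / 2 * (F e t x - pt e t x)"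
 using p_eq[OF e, of t x] e0 unfolding vx_def F_def P_def[symmetric] Q_def[symmetric]
 by (simp add: field_simps)

lemma Q_eq: "Q e t x = exp (\<theta> e 0 t x) * P e t x"
 unfolding Q_def P_def by (simp add: exp_add[symmetric])

lemma \<theta>t_eq: "t \<in> I ==> \<theta>t e t x = - (u e 0 t x * \<theta> e 1 t x) - u e 1 t x + \<kappa> * (Q e t x * ((\<theta> e 1 t x)^2 + \<theta> e 2 t x))
  + \<mu> * e^2 * (P e t x * (u e 1 t x)^2)"
 using \<theta>_eq[OF e, of t x] unfolding Q_eq P_def[symmetric] by (simp add: algebra_simps)

lemma \<theta>t_dx: assumes t: "t \<in> I" shows "(\<theta>t e t has_real_derivative \<theta>tx e t x) (at x)"
proof -
 have "\<theta>t e t = (\<lambda>x. - (u e 0 t x * \<theta> e 1 t x) - u e 1 t x + \<kappa> * (Q e t x * ((\<theta> e 1 t x)^2 + \<theta> e 2 t x))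
  + \<mu> * e^2 * (P e t x * (u e 1 t x)^2))"
  using \<theta>t_eq[OF t] by blast
 moreover have "((\<lambda>x. - (u e 0 t x * \<theta> e 1 t x) - u e 1 t x + \<kappa> * (Q e t x * ((\<theta> e 1 t x)^2 + \<theta> e 2 t x))
  + \<mu> * e^2 * (P e t x * (u e 1 t x)^2)) has_real_derivative \<theta>tx e t x) (at x)"
  unfolding \<theta>tx_def using t by (auto intro!: derivative_eq_intros dx012 Q_dx P_dx simp: field_simps power2_eq_square)
 ultimately show ?thesis by simp
qed

lemma \<theta>1_dt: "t \<in> I ==> ((\<lambda>\<tau>. \<theta> e 1 \<tau> x) has_real_derivative \<theta>tx e t x) (at t within I)"
 by (rule mixed_derivative[OF \<theta>t_C0[OF e] C0s(7) \<theta>_dt[OF e] dx012(5) \<theta>t_dx])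

lemma Q_dt: "t \<in> I ==> ((\<lambda>\<tau>. Q e \<tau> x) has_real_derivative (\<theta>t e t x - e * pt e t x) * Q e t x) (at t within I)"
 unfolding Q_def[abs_def] using p_dt[OF e, of t x] \<theta>_dt[OF e, of t x]
 by (auto intro!: derivative_eq_intros)

lemma v_dt: "t \<in> I ==> ((\<lambda>\<tau>. v e \<tau> x) has_real_derivative vt e t x) (at t within I)"
 unfolding v_def[abs_def] vt_def using u_dt[OF e, of t x] Q_dt[of t x] \<theta>1_dt[of t x]
 by (auto intro!: derivative_eq_intros simp: field_simps)

text \<open>The momentum equation with u_t expressed through v_t. What remains besides v_t is e
  times bounded terms, since p_t enters the bracket only in the combination e p_t.\<close>

lemma p1_eq: "t \<in> I ==> p e 1 t x = - (e * (exp (- \<theta> e 0 t x) * vt e t x))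
  + e * (\<mu> * (P e t x * u e 2 t x) - exp (- \<theta> e 0 t x) * (u e 0 t x * u e 1 t x
   + \<kappa> / 2 * (Q e t x * ((\<theta>t e t x - e * pt e t x) * \<theta> e 1 t x + \<theta>tx e t x))))"
 using u_eq[OF e, of t x] e0 unfolding vt_def P_def[symmetric] by (simp add: field_simps)

lemma W_dt: "t \<in> I ==> ((\<lambda>\<tau>. W e \<tau> x) has_real_derivative v e t x) (at t within I)"
 unfolding W_def by (rule integral_deriv_upper[OF C0_slice_t[OF C0s(3)]]) auto

lemma W_dx: assumes t: "t \<in> I" shows "(W e t has_real_derivative Wx e t x) (at x)"
proof -
 have "(W e t has_real_derivative integral {0..t} (\<lambda>\<tau>. vx e \<tau> x)) (at x)"
  unfolding W_def[abs_def] by (rule time_integral_derivative_x[OF C0s(3,4) v_dx]) (use t in auto)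
 also have "integral {0..t} (\<lambda>\<tau>. vx e \<tau> x) = integral {0..t} (\<lambda>\<tau>. e / 2 * (F e \<tau> x - pt e \<tau> x))"
  by (rule Henstock_Kurzweil_Integration.integral_cong) (use t vx_eq in auto)
 also have "\<dots> = e / 2 * (integral {0..t} (\<lambda>\<tau>. F e \<tau> x) - integral {0..t} (\<lambda>\<tau>. pt e \<tau> x))"
  by (subst integral_diff[symmetric])
   (use t in \<open>auto intro!: integrable_continuous_real C0_slice_t C0s pt_C0 e\<close>)
 also have "integral {0..t} (\<lambda>\<tau>. pt e \<tau> x) = p e 0 t x - p e 0 0 x"
  by (rule FTC_integral[where S = "I"]) (use t p_dt[OF e] in auto)
 finally show ?thesis by (simp add: Wx_def)
qed

lemma Wx_dx: assumes t: "t \<in> I" shows "(Wx e t has_real_derivative Wxx e t x) (at x)"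
proof -
 have "((\<lambda>x. integral {0..t} (\<lambda>\<tau>. F e \<tau> x)) has_real_derivative integral {0..t} (\<lambda>\<tau>. Fx e \<tau> x)) (at x)"
  by (rule time_integral_derivative_x[OF C0s(5,6) F_dx]) (use t in auto)
 thus ?thesis unfolding Wx_def[abs_def] Wxx_def using t pos
  by (auto intro!: derivative_eq_intros dx012)
qed

end

lemma UB_P: "UB P" unfolding P_def[abs_def] by (intro UB_intros) simp
lemma UB_Q: "UB Q" unfolding Q_def[abs_def] by (intro UB_intros; simp)
lemma UB_v: "UB v" unfolding v_def[abs_def] by (intro UB_intros UB_Q; simp)
lemma UB_vx: "UB vx" unfolding vx_def[abs_def] by (intro UB_intros UB_Q; simp)
lemma UB_F: "UB F" unfolding F_def[abs_def] by (intro UB_intros UB_Q UB_P; simp)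
lemma UB_Fx: "UB Fx" unfolding Fx_def[abs_def] by (intro UB_intros UB_Q UB_P; simp)
lemma UB_\<theta>tx: "UB \<theta>tx" unfolding \<theta>tx_def[abs_def] by (intro UB_intros UB_Q UB_P; simp)

lemma UB_\<theta>t: "UB \<theta>t"
proof (rule UB_cong[OF _ \<theta>t_eq[symmetric]])
 show "UB (\<lambda>e t x. - (u e 0 t x * \<theta> e 1 t x) - u e 1 t x + \<kappa> * (Q e t x * ((\<theta> e 1 t x)^2 + \<theta> e 2 t x))
  + \<mu> * e^2 * (P e t x * (u e 1 t x)^2))"
  by (intro UB_intros UB_Q UB_P; simp)
qed

text \<open>The equation for v_x gives e p_t = e F - 2 v_x, and the right-hand side contains only
  bounded quantities, although p_t alone may be of order 1/e.\<close>

lemma UB_eps_pt: "UB (\<lambda>e t x. e * pt e t x)"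
proof (rule UB_cong)
 show "UB (\<lambda>e t x. e * F e t x - 2 * vx e t x)" by (intro UB_intros UB_F UB_vx)
qed (simp add: vx_eq algebra_simps)

lemma UB_P_minus_1: "UB (\<lambda>e t x. (P e t x - 1) / e)"
proof (rule UBI[of _ "exp M * M"])
 fix e t x assume e: "e \<in> {0<..e1}" and t: "t \<in> {0..T}"
 have b: "\<bar>p e 0 t x\<bar> \<le> M" by (rule p_bound[OF e _ t]) simp
 have M0: "M \<ge> 0" using b by linarith
 have "\<bar>- e * p e 0 t x\<bar> \<le> 1 * M" unfolding abs_mult using b e pos by (intro mult_mono) auto
 hence "\<bar>exp (- e * p e 0 t x) - exp 0\<bar> \<le> exp M * \<bar>- e * p e 0 t x - 0\<bar>"
  using M0 by (intro exp_diff_bound) auto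
 also have "\<dots> = e * (exp M * \<bar>p e 0 t x\<bar>)" using e by (simp add: abs_mult)
 also have "\<dots> \<le> e * (exp M * M)" using b e by (intro mult_left_mono) auto
 finally show "\<bar>(P e t x - 1) / e\<bar> \<le> exp M * M" using e by (simp add: P_def field_simps)
qed

lemma UB_Wx: "UB (\<lambda>e t x. Wx e t x / e)"
proof (rule UB_cong)
 have "UB (\<lambda>e t x. p e 0 0 x)" by (rule UBI[of _ M]) (use pos in \<open>auto intro: p_bound\<close>)
 thus "UB (\<lambda>e t x. 1 / 2 * (integral {0..t} (\<lambda>\<tau>. F e \<tau> x) - (p e 0 t x - p e 0 0 x)))"
  by (intro UB_intros UB_time_integral UB_F C0s) auto
qed (auto simp: Wx_def)

lemma UB_Wxx: "UB (\<lambda>e t x. Wxx e t x / e)"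
proof (rule UB_cong)
 have "UB (\<lambda>e t x. p e 1 0 x)" by (rule UBI[of _ M]) (use pos in \<open>auto intro: p_bound\<close>)
 thus "UB (\<lambda>e t x. 1 / 2 * (integral {0..t} (\<lambda>\<tau>. Fx e \<tau> x) - (p e 1 t x - p e 1 0 x)))"
  by (intro UB_intros UB_time_integral UB_Fx C0s) auto
qed (auto simp: Wxx_def)

lemma v_L2: "\<exists>C>0. \<forall>e\<in>{0<..e1}. \<forall>t\<in>{0..T}. \<forall>a b. integral {a..b} (\<lambda>x. (v e t x)^2) \<le> C"
proof -
 obtain B where B: "B > 0" "\<And>e t x. e \<in> {0<..e1} ==> t \<in> {0..T} ==> \<bar>\<kappa> / 2 * Q e t x\<bar> \<le> B"
  using UBE[OF UB_mult[OF UB_const UB_Q]] by blast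
 have "integral {a..b} (\<lambda>x. (v e t x)^2) \<le> 2 * M + 2 * B^2 * M" if e: "e \<in> {0<..e1}" and t: "t \<in> {0..T}" for e t a b
 proof -
  have c: "continuous_on S (u e 0 t)" "continuous_on S (\<theta> e 1 t)" "continuous_on S (v e t)" for S
   by (intro C0_slice_x[OF _ t] u_C0 \<theta>_C0 C0s e; simp)+
  have "integral {a..b} (\<lambda>x. (v e t x)^2) \<le> integral {a..b} (\<lambda>x. 2 * (u e 0 t x)^2 + 2 * B^2 * (\<theta> e 1 t x)^2)"
  proof (rule integral_mono_continuous)
   fix x
   define w where "w = \<kappa> / 2 * Q e t x * \<theta> e 1 t x"
   have "w^2 = \<bar>\<kappa> / 2 * Q e t x\<bar>^2 * (\<theta> e 1 t x)^2" unfolding w_def power2_abs by (rule power_mult_distrib)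
   also have "\<dots> \<le> B^2 * (\<theta> e 1 t x)^2" using B(2)[OF e t, of x] by (intro mult_right_mono power_mono) auto
   finally have "w^2 \<le> B^2 * (\<theta> e 1 t x)^2" .
   moreover have "(v e t x)^2 \<le> 2 * (u e 0 t x)^2 + 2 * w^2"
    using sum_squares_bound[of "u e 0 t x" "- w"] unfolding v_def w_def by (simp add: power2_diff mult.assoc)
   ultimately show "(v e t x)^2 \<le> 2 * (u e 0 t x)^2 + 2 * B^2 * (\<theta> e 1 t x)^2" by simp
  qed (intro continuous_intros c)+
  also have "\<dots> = 2 * integral {a..b} (\<lambda>x. (u e 0 t x)^2) + 2 * B^2 * integral {a..b} (\<lambda>x. (\<theta> e 1 t x)^2)"
   by (subst integral_add) (auto intro!: integrable_continuous_real continuous_intros c)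
  also have "\<dots> \<le> 2 * M + 2 * B^2 * M"
   using u_L2[OF e t, of a b] \<theta>_L2[OF e t, of a b] by (intro add_mono mult_left_mono) auto
  finally show ?thesis .
 qed
 thus ?thesis by (intro exI[of _ "max 1 (2 * M + 2 * B^2 * M)"]) (auto simp: le_max_iff_disj)
qed

text \<open>The fourth root of e is the rate that averaging over a length 1 / sqrt e yields for W.
  The other errors are of order e and are measured against the same rate.\<close>

definition \<omega> :: "real \<Rightarrow> real" where "\<omega> e = sqrt (sqrt e)"

lemma \<omega>_bounds: "e \<in> {0<..e1} ==> 0 < \<omega> e \<and> e \<le> \<omega> e \<and> sqrt e \<le> \<omega> e \<and> \<omega> e \<le> 1"
proof -
 assume e: "e \<in> {0<..e1}"
 have s: "x \<le> sqrt x" if "0 \<le> x" "x \<le> 1" for x :: real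
  using that by (intro real_le_rsqrt) (simp add: power2_eq_square mult_left_le)
 have e: "0 < e" "e \<le> 1" using e pos by auto
 have 1: "e \<le> sqrt e" by (rule s) (use e in auto)
 have 2: "sqrt e \<le> sqrt (sqrt e)" by (rule real_sqrt_le_mono[OF 1])
 have "e \<le> sqrt (sqrt e)" by (rule order_trans[OF 1 2])
 thus ?thesis using e 2 unfolding \<omega>_def by auto
qed

lemma UB_eps_\<omega>: "UB (\<lambda>e t x. e / \<omega> e)"
proof (rule UBI[of _ 1])
 fix e assume e: "e \<in> {0<..e1}"
 show "\<bar>e / \<omega> e\<bar> \<le> 1" using \<omega>_bounds[OF e] e by (simp add: field_simps)
qed

lemma UB_over_\<omega>: "UB (\<lambda>e t x. f e t x / e) ==> UB (\<lambda>e t x. f e t x / \<omega> e)"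
proof -
 assume "UB (\<lambda>e t x. f e t x / e)"
 hence "UB (\<lambda>e t x. f e t x / e * (e / \<omega> e))" by (rule UB_mult) (rule UB_eps_\<omega>)
 thus ?thesis by (rule UB_cong) simp
qed

text \<open>W is small because its x-derivative is of order \<open>e\<close> while its local averages are controlled by the
 \<open>L^2\<close> norm of v; the averaging length \<open>e powr (-1/2)\<close> balances the two.\<close>

lemma UB_W: "UB (\<lambda>e t x. W e t x / \<omega> e)"
proof -
 obtain C1 where C1: "C1 > 0" "\<And>e t x. e \<in> {0<..e1} ==> t \<in> {0..T} ==> \<bar>Wx e t x / e\<bar> \<le> C1"
  using UBE[OF UB_Wx] by blast
 obtain C2 where C2: "C2 > 0" "\<And>e t a b. e \<in> {0<..e1} ==> t \<in> {0..T} ==> integral {a..b} (\<lambda>x. (v e t x)^2) \<le> C2"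
  using v_L2 by blast
 show ?thesis
 proof (rule UBI[of _ "C1 + T * sqrt C2"])
  fix e t x assume e: "e \<in> {0<..e1}" and t: "t \<in> {0..T}"
  have e0: "e > 0" "e \<le> 1" using e pos by auto
  define L where "L = 1 / sqrt e"
  have L: "L > 0" using e0 by (simp add: L_def)
  have Wc: "continuous_on S (W e t)" for S
   using continuous_on_subset[OF DERIV_continuous_UNIV[OF W_dx[OF e t]]] by blast
  have lip: "\<bar>W e t y - W e t x\<bar> \<le> C1 * e * L" if "y \<in> {x..x+L}" for y
  proof -
   have "\<bar>W e t y - W e t x\<bar> \<le> (C1 * e) * \<bar>y - x\<bar>"
   proof (rule has_real_derivative_lipschitz[where S = UNIV and f' = "Wx e t"])
    show "\<bar>Wx e t y\<bar> \<le> C1 * e" for y using C1(2)[OF e t, of y] e0 by (simp add: field_simps)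
   qed (use W_dx[OF e t] in auto)
   also have "\<dots> \<le> (C1 * e) * L" using that C1 e0 by (intro mult_left_mono) auto
   finally show ?thesis .
  qed
  \<comment> \<open>After exchanging the integrals the spatial average acts on v at a fixed time,
    where Cauchy-Schwarz gives order sqrt L instead of L.\<close>
  have "integral {x..x+L} (W e t) = integral {0..t} (\<lambda>\<tau>. integral {x..x+L} (v e \<tau>))"
   unfolding W_def[abs_def] by (rule integral_swap_strip[OF C0s(3)[OF e], symmetric]) (use t in auto)
  also have "norm \<dots> \<le> sqrt (C2 * L) * (t - 0)"
  proof (rule integral_bound)
   show "continuous_on {0..t} (\<lambda>\<tau>. integral {x..x+L} (v e \<tau>))"
    by (rule continuous_on_subset[OF C0_space_integral[OF C0s(3)[OF e]]]) (use t in auto)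
   show "norm (integral {x..x+L} (v e \<tau>)) \<le> sqrt (C2 * L)" if "\<tau> \<in> {0..t}" for \<tau>
   proof -
    have \<tau>: "\<tau> \<in> {0..T}" using that t by auto
    have "\<bar>integral {x..x+L} (v e \<tau>)\<bar> \<le> sqrt (C2 * (x + L - x))"
     by (rule integral_Cauchy_Schwarz[OF C0_slice_x[OF C0s(3)[OF e] \<tau>] _ C2(2)[OF e \<tau>]]) (use L in simp)
    thus ?thesis by simp
   qed
  qed (use t in auto)
  also have "\<dots> \<le> sqrt (C2 * L) * T" using t L C2 by (intro mult_left_mono) auto
  finally have 1: "\<bar>integral {x..x+L} (W e t)\<bar> \<le> sqrt (C2 * L) * T" by simp
  have "integral {x..x+L} (\<lambda>y. W e t x) - integral {x..x+L} (W e t) = integral {x..x+L} (\<lambda>y. W e t x - W e t y)"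
   by (rule integral_diff[symmetric]) (auto intro!: integrable_continuous_real Wc)
  also have "norm \<dots> \<le> (C1 * e * L) * (x + L - x)"
   by (rule integral_bound) (use L lip in \<open>auto intro!: continuous_intros Wc simp: abs_minus_commute\<close>)
  finally have 2: "\<bar>L * W e t x - integral {x..x+L} (W e t)\<bar> \<le> C1 * e * L * L" using L by simp
  have "L * \<bar>W e t x\<bar> = \<bar>L * W e t x\<bar>" using L by (simp add: abs_mult)
  also have "\<dots> \<le> C1 * e * L * L + sqrt (C2 * L) * T" using 1 2 by linarith
  also have "\<dots> = L * (C1 * sqrt e + T * sqrt C2 * \<omega> e)"
  proof -
   have "e * L = sqrt e" using e0 by (simp add: L_def real_div_sqrt)
   moreover have "sqrt L = L * \<omega> e"
   proof -
    have "sqrt L = 1 / \<omega> e" unfolding L_def \<omega>_def by (simp add: real_sqrt_divide)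
    moreover have "\<omega> e * \<omega> e = sqrt e" using e0 unfolding \<omega>_def by simp
    hence "L = 1 / (\<omega> e * \<omega> e)" unfolding L_def by simp
    ultimately show ?thesis using \<omega>_bounds[OF e] by simp
   qed
   moreover have "C1 * e * L * L + sqrt (C2 * L) * T = L * (C1 * (e * L)) + sqrt C2 * sqrt L * T"
    by (simp add: real_sqrt_mult algebra_simps)
   ultimately show ?thesis by (simp add: algebra_simps)
  qed
  finally have "\<bar>W e t x\<bar> \<le> C1 * sqrt e + T * sqrt C2 * \<omega> e" using L by simp
  also have "\<dots> \<le> C1 * \<omega> e + T * sqrt C2 * \<omega> e" using C1 \<omega>_bounds[OF e] by simp
  finally show "\<bar>W e t x / \<omega> e\<bar> \<le> C1 + T * sqrt C2" using \<omega>_bounds[OF e] by (simp add: field_simps)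
 qed
qed

section \<open>The corrected temperature and its residual\<close>

definition z where "z e t x = \<theta> e 0 t x + W e t x * \<theta> e 1 t x - e / 2 * p e 0 t x"
definition zt where "zt e t x = \<theta>t e t x + (v e t x * \<theta> e 1 t x + W e t x * \<theta>tx e t x) - e / 2 * pt e t x"
definition zx where "zx e t x = \<theta> e 1 t x + (Wx e t x * \<theta> e 1 t x + W e t x * \<theta> e 2 t x) - e / 2 * p e 1 t x"
definition zxx where "zxx e t x = \<theta> e 2 t x + (Wxx e t x * \<theta> e 1 t x + 2 * (Wx e t x * \<theta> e 2 t x) + W e t x * \<theta> e 3 t x) - e / 2 * p e 2 t x"
definition res where "res e t x = zt e t x - \<kappa> / 2 * exp (\<theta> e 0 t x) * zxx e t x"

lemma z_derivs:
 assumes e: "e \<in> {0<..e1}" and t: "t \<in> {0..T}"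
 shows "((\<lambda>\<tau>. z e \<tau> x) has_real_derivative zt e t x) (at t within {0..T})"
  "(z e t has_real_derivative zx e t x) (at x)"
  "(zx e t has_real_derivative zxx e t x) (at x)"
 unfolding z_def[abs_def] zt_def zx_def[abs_def] zxx_def
 by (auto intro!: derivative_eq_intros dx012[OF e t] W_dx[OF e t] Wx_dx[OF e t] W_dt[OF e t] p_dt[OF e t] \<theta>_dt[OF e t] \<theta>1_dt[OF e t])

lemma UB_zxx_diff: "UB (\<lambda>e t x. (zxx e t x - \<theta> e 2 t x) / \<omega> e)"
proof (rule UB_cong)
 show "UB (\<lambda>e t x. Wxx e t x / \<omega> e * \<theta> e 1 t x + 2 * (Wx e t x / \<omega> e * \<theta> e 2 t x) + W e t x / \<omega> e * \<theta> e 3 t x - e / \<omega> e * (1 / 2 * p e 2 t x))"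
  by (intro UB_intros UB_eps_\<omega> UB_W UB_over_\<omega>[OF UB_Wx] UB_over_\<omega>[OF UB_Wxx]; simp)
qed (simp add: zxx_def add_divide_distrib diff_divide_distrib)

lemma UB_z_diff: "UB (\<lambda>e t x. (z e t x - \<theta> e 0 t x) / \<omega> e)"
proof (rule UB_cong)
 show "UB (\<lambda>e t x. W e t x / \<omega> e * \<theta> e 1 t x - e / \<omega> e * (1 / 2 * p e 0 t x))"
  by (intro UB_intros UB_eps_\<omega> UB_W; simp)
qed (simp add: z_def add_divide_distrib diff_divide_distrib)

text \<open>The singular terms cancel in z: it satisfies the limit equation up to a small residual.\<close>

lemma zt_eq:
 assumes e: "e \<in> {0<..e1}" and t: "t \<in> {0..T}"
 shows "zt e t x = \<kappa> / 2 * exp (\<theta> e 0 t x) * \<theta> e 2 t x + \<kappa> / 2 * exp (\<theta> e 0 t x) * (P e t x - 1) * \<theta> e 2 t x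
  + e * (\<kappa> / 2 * (Q e t x * (p e 1 t x * \<theta> e 1 t x)) + \<mu> * (e * (P e t x * (u e 1 t x)^2)) - 1 / 2 * F e t x) + W e t x * \<theta>tx e t x"
proof -
 have 1: "e / 2 * pt e t x = e / 2 * F e t x - vx e t x" using vx_eq[OF e t, of x] by (simp add: algebra_simps)
 have 2: "\<kappa> / 2 * exp (\<theta> e 0 t x) * \<theta> e 2 t x + \<kappa> / 2 * exp (\<theta> e 0 t x) * (P e t x - 1) * \<theta> e 2 t x = \<kappa> / 2 * (Q e t x * \<theta> e 2 t x)"
  unfolding Q_eq[OF e] by (simp add: field_simps)
 show ?thesis unfolding 2 unfolding zt_def 1 \<theta>t_eq[OF e t] v_def vx_def
  by (simp add: field_simps power2_eq_square)
qed

text \<open>Once the singular terms have cancelled, every remaining term has a factor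
  \<open>P - 1\<close>, e, W or the difference of z_xx and \<theta>_xx, and each of these is at most
  of order \<omega>.\<close>

lemma UB_res: "UB (\<lambda>e t x. res e t x / \<omega> e)"
proof (rule UB_cong)
 show "UB (\<lambda>e t x. \<kappa> / 2 * exp (\<theta> e 0 t x) * ((P e t x - 1) / \<omega> e) * \<theta> e 2 t x
  + e / \<omega> e * (\<kappa> / 2 * (Q e t x * (p e 1 t x * \<theta> e 1 t x)) + \<mu> * (e * (P e t x * (u e 1 t x)^2)) - 1 / 2 * F e t x)
  + W e t x / \<omega> e * \<theta>tx e t x - \<kappa> / 2 * exp (\<theta> e 0 t x) * ((zxx e t x - \<theta> e 2 t x) / \<omega> e))"
  by (intro UB_intros UB_eps_\<omega> UB_W UB_over_\<omega>[OF UB_P_minus_1] UB_zxx_diff UB_\<theta>tx UB_P UB_Q UB_F; simp)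
next
 fix e t x assume e: "e \<in> {0<..e1}" and t: "t \<in> {0..T}"
 have "\<omega> e \<noteq> 0" using \<omega>_bounds[OF e] by simp
 thus "\<kappa> / 2 * exp (\<theta> e 0 t x) * ((P e t x - 1) / \<omega> e) * \<theta> e 2 t x
  + e / \<omega> e * (\<kappa> / 2 * (Q e t x * (p e 1 t x * \<theta> e 1 t x)) + \<mu> * (e * (P e t x * (u e 1 t x)^2)) - 1 / 2 * F e t x)
  + W e t x / \<omega> e * \<theta>tx e t x - \<kappa> / 2 * exp (\<theta> e 0 t x) * ((zxx e t x - \<theta> e 2 t x) / \<omega> e) = res e t x / \<omega> e"
  unfolding res_def zt_eq[OF e t] by (simp add: field_simps)
qed

end

section \<open>Uniform convergence of the temperature\<close>

text \<open>An inequality of Landau type: with a Taylor step of length \<eta>, a difference of size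
  \<eta>^2 costs \<eta> after division by the step, and so does the second-order remainder.\<close>

lemma derivative_interpolation:
 fixes f g f' g' f'' g'' :: "real \<Rightarrow> real"
 assumes f: "\<And>x. (f has_real_derivative f' x) (at x)" "\<And>x. (f' has_real_derivative f'' x) (at x)" "\<And>x. \<bar>f'' x\<bar> \<le> M"
  and g: "\<And>x. (g has_real_derivative g' x) (at x)" "\<And>x. (g' has_real_derivative g'' x) (at x)" "\<And>x. \<bar>g'' x\<bar> \<le> M"
  and d: "\<And>x. \<bar>f x - g x\<bar> \<le> \<eta>^2" and \<eta>: "\<eta> > 0"
 shows "\<bar>f' x - g' x\<bar> \<le> 2 * (1 + M) * \<eta>"
proof -
 have 1: "\<bar>f (x + \<eta>) - f x - \<eta> * f' x\<bar> \<le> M * \<eta>^2" by (rule taylor_quadratic_bound[OF f])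
 have 2: "\<bar>g (x + \<eta>) - g x - \<eta> * g' x\<bar> \<le> M * \<eta>^2" by (rule taylor_quadratic_bound[OF g])
 have "\<eta> * \<bar>f' x - g' x\<bar> = \<bar>\<eta> * f' x - \<eta> * g' x\<bar>" using \<eta> by (simp add: abs_mult right_diff_distrib[symmetric])
 also have "\<dots> \<le> 2 * \<eta>^2 + 2 * (M * \<eta>^2)" using 1 2 d[of "x + \<eta>"] d[of x] by linarith
 also have "\<dots> = \<eta> * (2 * (1 + M) * \<eta>)" by (simp add: power2_eq_square algebra_simps)
 finally show ?thesis using \<eta> by simp
qed

context singular_family
begin

lemma W_C0:
 assumes e: "e \<in> E" shows "C_strip 0 T (W e)"
proof -
 obtain A where A: "A > 0" "\<And>e t x. e \<in> E ==> t \<in> I ==> \<bar>v e t x\<bar> \<le> A" using UBE[OF UB_v] by blast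
 obtain B where B: "B > 0" "\<And>e t x. e \<in> E ==> t \<in> I ==> \<bar>Wx e t x / e\<bar> \<le> B" using UBE[OF UB_Wx] by blast
 have e0: "e > 0" using e by auto
 have B': "\<bar>Wx e t x\<bar> \<le> B * e" if "t \<in> I" for t x using B(2)[OF e that, of x] e0 by (simp add: field_simps)
 show ?thesis
 proof (rule C0_lipschitz[where L = "max A (B * e)"])
  fix t s x assume ts: "t \<in> I" "s \<in> I"
  have "\<bar>W e t x - W e s x\<bar> \<le> A * \<bar>t - s\<bar>"
   by (rule has_real_derivative_lipschitz[of "I", OF _ W_dt[OF e]]) (use ts A(2)[OF e] in auto)
  also have "\<dots> \<le> max A (B * e) * \<bar>t - s\<bar>" by (intro mult_right_mono) auto
  finally show "\<bar>W e t x - W e s x\<bar> \<le> max A (B * e) * \<bar>t - s\<bar>" .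
 next
  fix t x y assume t: "t \<in> I"
  have "\<bar>W e t x - W e t y\<bar> \<le> (B * e) * \<bar>x - y\<bar>"
   by (rule has_real_derivative_lipschitz[of UNIV, OF _ W_dx[OF e t]]) (use B'[OF t] in auto)
  also have "\<dots> \<le> max A (B * e) * \<bar>x - y\<bar>" by (intro mult_right_mono) auto
  finally show "\<bar>W e t x - W e t y\<bar> \<le> max A (B * e) * \<bar>x - y\<bar>" .
 qed
qed

lemma z_C0: "e \<in> E ==> C_strip 0 T (z e)"
 unfolding z_def[abs_def] by (intro C0_intros W_C0 \<theta>_C0 p_C0; simp)

lemma UB_z: "UB z"
proof (rule UB_cong)
 have "UB (\<lambda>e t x. \<omega> e)" by (rule UBI[of _ 1]) (use \<omega>_bounds in force)
 thus "UB (\<lambda>e t x. \<theta> e 0 t x + (z e t x - \<theta> e 0 t x) / \<omega> e * \<omega> e)"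
  by (intro UB_intros UB_z_diff; simp)
next
 fix e t x assume "e \<in> E" "t \<in> I"
 thus "\<theta> e 0 t x + (z e t x - \<theta> e 0 t x) / \<omega> e * \<omega> e = z e t x" using \<omega>_bounds[of e] by simp
qed

lemma UB_zxx: "UB zxx"
proof (rule UB_cong)
 have "UB (\<lambda>e t x. \<omega> e)" by (rule UBI[of _ 1]) (use \<omega>_bounds in force)
 thus "UB (\<lambda>e t x. \<theta> e 2 t x + (zxx e t x - \<theta> e 2 t x) / \<omega> e * \<omega> e)"
  by (intro UB_intros UB_zxx_diff; simp)
next
 fix e t x assume "e \<in> E" "t \<in> I"
 thus "\<theta> e 2 t x + (zxx e t x - \<theta> e 2 t x) / \<omega> e * \<omega> e = zxx e t x" using \<omega>_bounds[of e] by simp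
qed

text \<open>The difference of two corrected temperatures solves a linear parabolic equation with
  bounded coefficients and a source of order \<omega> e + \<omega> e', so the maximum principle
  applies. The final summand A in C pays for returning from z to \<theta>.\<close>

lemma Cauchy_estimate:
 obtains C where "C > 0" "\<And>e e' D t x. e \<in> E ==> e' \<in> E ==> (\<And>x. \<bar>\<theta> e 0 0 x - \<theta> e' 0 0 x\<bar> \<le> D) ==>
  t \<in> I ==> \<bar>\<theta> e 0 t x - \<theta> e' 0 t x\<bar> \<le> C * (\<omega> e + \<omega> e' + D)"
proof -
 obtain Z where Z: "Z > 0" "\<And>e t x. e \<in> E ==> t \<in> I ==> \<bar>z e t x\<bar> \<le> Z" using UBE[OF UB_z] by blast
 obtain Z2 where Z2: "Z2 > 0" "\<And>e t x. e \<in> E ==> t \<in> I ==> \<bar>zxx e t x\<bar> \<le> Z2" using UBE[OF UB_zxx] by blast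
 obtain A where A: "A > 0" "\<And>e t x. e \<in> E ==> t \<in> I ==> \<bar>(z e t x - \<theta> e 0 t x) / \<omega> e\<bar> \<le> A" using UBE[OF UB_z_diff] by blast
 obtain B where B: "B > 0" "\<And>e t x. e \<in> E ==> t \<in> I ==> \<bar>res e t x / \<omega> e\<bar> \<le> B" using UBE[OF UB_res] by blast
 have A': "\<bar>z e t x - \<theta> e 0 t x\<bar> \<le> A * \<omega> e" if "e \<in> E" "t \<in> I" for e t x
  using A(2)[OF that, of x] \<omega>_bounds[OF that(1)] by (simp add: field_simps)
 have B': "\<bar>res e t x\<bar> \<le> B * \<omega> e" if "e \<in> E" "t \<in> I" for e t x
  using B(2)[OF that, of x] \<omega>_bounds[OF that(1)] by (simp add: field_simps)
 \<comment> \<open>N bounds the coefficient b of order zero, which arises from the difference of the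
   two diffusion coefficients exp \<theta>.\<close>
 define N where "N = \<kappa> / 2 * (exp M * Z2)"
 have N: "N > 0" unfolding N_def using pos Z2 by simp
 define C where "C = (1 + A + B + N * A) * exp ((N + 1) * T) + A"
 have N1: "1 \<le> exp ((N + 1) * T)" using N pos by simp
 have C: "C > 0" unfolding C_def using N A B by (intro add_pos_pos mult_pos_pos) auto
 show ?thesis
 proof (rule that[OF C])
  fix e e' D t x
  assume e: "e \<in> E" and e': "e' \<in> E" and D: "\<And>x. \<bar>\<theta> e 0 0 x - \<theta> e' 0 0 x\<bar> \<le> D" and t: "t \<in> I"
  note w = \<omega>_bounds[OF e] \<omega>_bounds[OF e']
  have D0: "D \<ge> 0" using D[of 0] by linarith
  have T0: "0 \<in> I" using pos by auto
  define s where "s = \<omega> e + \<omega> e' + D"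
  \<comment> \<open>The difference quotient of exp. Where both temperatures coincide the value is
    immaterial, because it is multiplied by 0; 0 keeps it bounded.\<close>
  define bb where "bb t x = (if \<theta> e 0 t x = \<theta> e' 0 t x then 0 else (exp (\<theta> e 0 t x) - exp (\<theta> e' 0 t x)) / (\<theta> e 0 t x - \<theta> e' 0 t x))" for t x
  have bb1: "exp (\<theta> e 0 t x) - exp (\<theta> e' 0 t x) = bb t x * (\<theta> e 0 t x - \<theta> e' 0 t x)" for t x
   by (simp add: bb_def)
  have bb2: "\<bar>bb t x\<bar> \<le> exp M" if t: "t \<in> I" for t x
  proof (cases "\<theta> e 0 t x = \<theta> e' 0 t x")
   case False
   have "\<bar>exp (\<theta> e 0 t x) - exp (\<theta> e' 0 t x)\<bar> \<le> exp M * \<bar>\<theta> e 0 t x - \<theta> e' 0 t x\<bar>"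
    by (rule exp_diff_bound) (use \<theta>_bound[OF e _ t] \<theta>_bound[OF e' _ t] in auto)
   thus ?thesis using False by (simp add: bb_def field_simps)
  qed (simp add: bb_def)
  define b where "b t x = \<kappa> / 2 * bb t x * zxx e' t x" for t x
  have bN: "\<bar>b t x\<bar> \<le> N" if t: "t \<in> I" for t x
  proof -
   have "\<bar>b t x\<bar> = \<kappa> / 2 * (\<bar>bb t x\<bar> * \<bar>zxx e' t x\<bar>)" using pos by (simp add: b_def abs_mult)
   also have "\<dots> \<le> N" unfolding N_def using pos bb2[OF t, of x] Z2(2)[OF e' t, of x] by (intro mult_left_mono mult_mono) auto
   finally show ?thesis .
  qed
  \<comment> \<open>The coefficient b naturally multiplies the difference of the temperatures;
    replacing it by the difference of the z leaves the first term of the source.\<close>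
  define f where "f t x = b t x * ((z e' t x - \<theta> e' 0 t x) - (z e t x - \<theta> e 0 t x)) + (res e t x - res e' t x)" for t x
  have "\<bar>z e t x - z e' t x\<bar> \<le> ((1 + A + B + N * A) * s) * exp ((N + 1) * t)"
  proof (rule maximum_principle[where z = "\<lambda>t x. z e t x - z e' t x" and zt = "\<lambda>t x. zt e t x - zt e' t x"
     and zx = "\<lambda>t x. zx e t x - zx e' t x" and zxx = "\<lambda>t x. zxx e t x - zxx e' t x"
     and A = "\<lambda>t x. \<kappa> / 2 * exp (\<theta> e 0 t x)" and b = b and f = f, OF _ _ _ _ _ _ _ bN _ _ t])
   show "continuous_on (I \<times> UNIV) (\<lambda>(t, x). z e t x - z e' t x)"
    using C0_diff[OF z_C0[OF e] z_C0[OF e']] by simp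
   fix t x assume t: "t \<in> I"
   show "\<bar>z e t x - z e' t x\<bar> \<le> 2 * Z" using Z(2)[OF e t, of x] Z(2)[OF e' t, of x] by linarith
   show "((\<lambda>\<tau>. z e \<tau> x - z e' \<tau> x) has_real_derivative zt e t x - zt e' t x) (at t within I)"
    by (intro DERIV_diff z_derivs e e' t)
   show "((\<lambda>x. z e t x - z e' t x) has_real_derivative zx e t x - zx e' t x) (at x)"
    by (intro DERIV_diff z_derivs e e' t)
   show "((\<lambda>x. zx e t x - zx e' t x) has_real_derivative zxx e t x - zxx e' t x) (at x)"
    by (intro DERIV_diff z_derivs e e' t)
   show "zt e t x - zt e' t x = \<kappa> / 2 * exp (\<theta> e 0 t x) * (zxx e t x - zxx e' t x) + b t x * (z e t x - z e' t x) + f t x"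
   proof -
    have "\<kappa> / 2 * (exp (\<theta> e 0 t x) - exp (\<theta> e' 0 t x)) * zxx e' t x = b t x * (\<theta> e 0 t x - \<theta> e' 0 t x)"
     unfolding bb1 b_def by simp
    thus ?thesis unfolding f_def res_def by (simp add: algebra_simps)
   qed
   show "0 \<le> \<kappa> / 2 * exp (\<theta> e 0 t x) \<and> \<kappa> / 2 * exp (\<theta> e 0 t x) \<le> \<kappa> / 2 * exp M"
    using pos \<theta>_bound[OF e _ t, of 0 x] by auto
   show "\<bar>f t x\<bar> \<le> (1 + A + B + N * A) * s"
   proof -
    have "\<bar>(z e' t x - \<theta> e' 0 t x) - (z e t x - \<theta> e 0 t x)\<bar> \<le> A * \<omega> e' + A * \<omega> e"
     using A'[OF e t, of x] A'[OF e' t, of x] by linarith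
    also have "\<dots> \<le> A * s" unfolding s_def using A D0 by (simp add: algebra_simps)
    finally have "\<bar>b t x\<bar> * \<bar>(z e' t x - \<theta> e' 0 t x) - (z e t x - \<theta> e 0 t x)\<bar> \<le> N * (A * s)"
     using bN[OF t, of x] N by (intro mult_mono) auto
    moreover have "\<bar>res e t x - res e' t x\<bar> \<le> B * \<omega> e + B * \<omega> e'" using B'[OF e t, of x] B'[OF e' t, of x] by linarith
    moreover have "B * \<omega> e + B * \<omega> e' \<le> B * s" unfolding s_def using B D0 by (simp add: algebra_simps)
    moreover have "0 \<le> s" "0 \<le> A * s" unfolding s_def using w D0 A by auto
    ultimately show ?thesis unfolding f_def abs_mult[symmetric] by (simp add: algebra_simps) 
   qed
  next
   fix x
   have "\<bar>z e 0 x - z e' 0 x\<bar> \<le> A * \<omega> e + A * \<omega> e' + D"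
    using A'[OF e T0, of x] A'[OF e' T0, of x] D[of x] by linarith
   also have "\<dots> \<le> A * s + 1 * s" unfolding s_def using A D0 w by (simp add: algebra_simps)
   also have "\<dots> \<le> (1 + A + B + N * A) * s"
   proof -
    have "0 \<le> s" unfolding s_def using w D0 by auto
    hence "0 \<le> (B + N * A) * s" using B N A by simp
    thus ?thesis by (simp add: algebra_simps)
   qed
   finally show "\<bar>z e 0 x - z e' 0 x\<bar> \<le> (1 + A + B + N * A) * s" .
  qed
  also have "\<dots> \<le> ((1 + A + B + N * A) * s) * exp ((N + 1) * T)"
  proof (rule mult_left_mono)
   show "exp ((N + 1) * t) \<le> exp ((N + 1) * T)" using t N by simp
   show "0 \<le> (1 + A + B + N * A) * s" using A B N w D0 unfolding s_def by (intro mult_nonneg_nonneg) auto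
  qed
  finally have "\<bar>\<theta> e 0 t x - \<theta> e' 0 t x\<bar> \<le> (1 + A + B + N * A) * s * exp ((N + 1) * T) + (A * \<omega> e + A * \<omega> e')"
   using A'[OF e t, of x] A'[OF e' t, of x] by linarith
  also have "A * \<omega> e + A * \<omega> e' \<le> A * s" unfolding s_def using A D0 by (simp add: algebra_simps)
  finally show "\<bar>\<theta> e 0 t x - \<theta> e' 0 t x\<bar> \<le> C * (\<omega> e + \<omega> e' + D)"
   unfolding s_def[symmetric] C_def by (simp add: algebra_simps)
 qed
qed

lemma \<omega>_small: assumes "\<eta> > 0" obtains e2 where "e2 \<in> E" "\<And>e. e \<in> {0<..e2} ==> \<omega> e \<le> \<eta>"
proof (rule that[of "min e1 (\<eta> ^ 4)"])
 show "min e1 (\<eta> ^ 4) \<in> E" using assms pos by auto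
 fix e assume "e \<in> {0<..min e1 (\<eta> ^ 4)}"
 hence "sqrt (sqrt e) \<le> sqrt (sqrt (\<eta> ^ 4))" by simp
 also have "\<eta> ^ 4 = (\<eta>^2)^2" by simp
 also have "sqrt (sqrt ((\<eta>^2)^2)) = \<eta>" using assms by (simp only: real_sqrt_abs abs_power2 abs_of_pos)
 finally show "\<omega> e \<le> \<eta>" by (simp add: \<omega>_def)
qed

end

text \<open>The Cauchy form speaks about the family alone, so that the limit temperature can be
  constructed at all times including 0; its agreement with the prescribed data is a separate
  question and holds almost everywhere.\<close>

locale singular_limit = singular_family +
 assumes init_Cauchy: "\<And>\<eta>. \<eta> > 0 ==> \<exists>e2\<in>{0<..e1}. \<forall>e\<in>{0<..e2}. \<forall>e'\<in>{0<..e2}. \<forall>x. \<bar>\<theta> e 0 0 x - \<theta> e' 0 0 x\<bar> \<le> \<eta>"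
begin

text \<open>Order 0 is the maximum principle estimate, and each further order follows by
  interpolation with the bounded derivative two orders above the previous one. Four bounded
  derivatives therefore give three uniformly Cauchy ones.\<close>

lemma \<theta>_Cauchy:
 "j \<le> 3 ==> \<eta> > 0 ==> \<exists>e2\<in>E. \<forall>e\<in>{0<..e2}. \<forall>e'\<in>{0<..e2}. \<forall>t\<in>I. \<forall>x. \<bar>\<theta> e j t x - \<theta> e' j t x\<bar> \<le> \<eta>"
proof (induction j arbitrary: \<eta>)
 case 0
 obtain C where C: "C > 0" "\<And>e e' D t x. e \<in> E ==> e' \<in> E ==> (\<And>x. \<bar>\<theta> e 0 0 x - \<theta> e' 0 0 x\<bar> \<le> D) ==>
  t \<in> I ==> \<bar>\<theta> e 0 t x - \<theta> e' 0 t x\<bar> \<le> C * (\<omega> e + \<omega> e' + D)" using Cauchy_estimate by metis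
 define d where "d = \<eta> / (3 * C)"
 have d: "d > 0" unfolding d_def using 0 C by simp
 obtain e2 where e2: "e2 \<in> E" "\<And>e. e \<in> {0<..e2} ==> \<omega> e \<le> d" using \<omega>_small[OF d] by metis
 obtain e3 where e3: "e3 \<in> E" "\<forall>e\<in>{0<..e3}. \<forall>e'\<in>{0<..e3}. \<forall>x. \<bar>\<theta> e 0 0 x - \<theta> e' 0 0 x\<bar> \<le> d" using init_Cauchy[OF d] by blast
 show ?case
 proof (intro bexI[of _ "min e2 e3"] ballI allI)
  fix e e' t x assume e: "e \<in> {0<..min e2 e3}" "e' \<in> {0<..min e2 e3}" and t: "t \<in> I"
  have "\<bar>\<theta> e 0 t x - \<theta> e' 0 t x\<bar> \<le> C * (\<omega> e + \<omega> e' + d)"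
   by (rule C(2)) (use e e2 e3 t in auto)
  also have "\<dots> \<le> C * (d + d + d)" using e e2 C by (intro mult_left_mono add_mono) auto
  also have "\<dots> = \<eta>" using C by (simp add: d_def)
  finally show "\<bar>\<theta> e 0 t x - \<theta> e' 0 t x\<bar> \<le> \<eta>" .
 qed (use e2 e3 in auto)
next
 case (Suc j)
 have M0: "M \<ge> 0" using \<theta>_bound[of e1 0 0 0] pos by force
 define d where "d = \<eta> / (2 * (1 + M))"
 have d: "d > 0" unfolding d_def using Suc.prems M0 by simp
 obtain e2 where e2: "e2 \<in> E" "\<forall>e\<in>{0<..e2}. \<forall>e'\<in>{0<..e2}. \<forall>t\<in>I. \<forall>x. \<bar>\<theta> e j t x - \<theta> e' j t x\<bar> \<le> d^2"
  using Suc.IH[of "d^2"] Suc.prems d by auto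
 show ?case
 proof (intro bexI[of _ e2] ballI allI)
  fix e e' t x assume e: "e \<in> {0<..e2}" "e' \<in> {0<..e2}" and t: "t \<in> I"
  have e': "e \<in> E" "e' \<in> E" using e e2 by auto
  have "\<bar>\<theta> e (Suc j) t x - \<theta> e' (Suc j) t x\<bar> \<le> 2 * (1 + M) * d"
  proof (rule derivative_interpolation[where f = "\<theta> e j t" and g = "\<theta> e' j t" and f' = "\<theta> e (Suc j) t" and g' = "\<theta> e' (Suc j) t"
     and f'' = "\<theta> e (Suc (Suc j)) t" and g'' = "\<theta> e' (Suc (Suc j)) t"])
   show "(\<theta> e j t has_real_derivative \<theta> e (Suc j) t x) (at x)" "(\<theta> e' j t has_real_derivative \<theta> e' (Suc j) t x) (at x)"
    "(\<theta> e (Suc j) t has_real_derivative \<theta> e (Suc (Suc j)) t x) (at x)" "(\<theta> e' (Suc j) t has_real_derivative \<theta> e' (Suc (Suc j)) t x) (at x)" for x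
    by (rule \<theta>_dx; use e' t Suc.prems in simp)+
   show "\<bar>\<theta> e (Suc (Suc j)) t x\<bar> \<le> M" "\<bar>\<theta> e' (Suc (Suc j)) t x\<bar> \<le> M" for x
    by (rule \<theta>_bound; use e' t Suc.prems in simp)+
   show "\<bar>\<theta> e j t x - \<theta> e' j t x\<bar> \<le> d^2" for x using e2 e t by blast
  qed (rule d)
  thus "\<bar>\<theta> e (Suc j) t x - \<theta> e' (Suc j) t x\<bar> \<le> \<eta>" using M0 by (simp add: d_def)
 qed (use e2 in auto)
qed

text \<open>A concrete sequence defines the limit; the Cauchy property then makes the entire family
  converge to it, uniformly in t and x.\<close>

definition \<Theta> :: "nat \<Rightarrow> field" where "\<Theta> j t x = lim (\<lambda>n. \<theta> (e1 / real (Suc n)) j t x)"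

lemma seq_in: "e1 / real (Suc n) \<in> E"
 using pos by (simp add: field_simps)

lemma seq_small: "e2 > 0 ==> \<forall>\<^sub>F n in sequentially. e1 / real (Suc n) \<in> {0<..e2}"
proof -
 assume e2: "e2 > 0"
 have "(\<lambda>n. e1 * inverse (real (Suc n))) \<longlonglongrightarrow> e1 * 0" by (intro tendsto_intros LIMSEQ_inverse_real_of_nat)
 hence "(\<lambda>n. e1 / real (Suc n)) \<longlonglongrightarrow> 0" by (simp add: divide_inverse)
 hence "\<forall>\<^sub>F n in sequentially. e1 / real (Suc n) < e2" by (rule order_tendstoD) (rule e2)
 thus ?thesis by eventually_elim (use seq_in in auto)
qed

lemma \<Theta>_conv:
 assumes j: "j \<le> 3" and \<eta>: "\<eta> > 0"
 obtains e2 where "e2 \<in> E" "\<And>e t x. e \<in> {0<..e2} ==> t \<in> I ==> \<bar>\<theta> e j t x - \<Theta> j t x\<bar> \<le> \<eta>"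
proof -
 obtain e2 where e2: "e2 \<in> E" "\<forall>e\<in>{0<..e2}. \<forall>e'\<in>{0<..e2}. \<forall>t\<in>I. \<forall>x. \<bar>\<theta> e j t x - \<theta> e' j t x\<bar> \<le> \<eta>"
  using \<theta>_Cauchy[OF j \<eta>] by blast
 show ?thesis
 proof (rule that[OF e2(1)])
  fix e t x assume e: "e \<in> {0<..e2}" and t: "t \<in> I"
  have "Cauchy (\<lambda>n. \<theta> (e1 / real (Suc n)) j t x)"
  proof (rule metric_CauchyI)
   fix h :: real assume h: "h > 0"
   obtain e3 where e3: "e3 \<in> E" "\<forall>e\<in>{0<..e3}. \<forall>e'\<in>{0<..e3}. \<forall>t\<in>I. \<forall>x. \<bar>\<theta> e j t x - \<theta> e' j t x\<bar> \<le> h / 2"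
    using \<theta>_Cauchy[OF j, of "h / 2"] h by auto
   have "e3 > 0" using e3(1) by simp
   from seq_small[OF this] obtain N where N: "\<And>n. n \<ge> N ==> e1 / real (Suc n) \<in> {0<..e3}"
    unfolding eventually_sequentially by blast
   have "dist (\<theta> (e1 / real (Suc m)) j t x) (\<theta> (e1 / real (Suc n)) j t x) < h" if "m \<ge> N" "n \<ge> N" for m n
   proof -
    have "e1 / real (Suc m) \<in> {0<..e3}" "e1 / real (Suc n) \<in> {0<..e3}" using N that by blast+
    hence "\<bar>\<theta> (e1 / real (Suc m)) j t x - \<theta> (e1 / real (Suc n)) j t x\<bar> \<le> h / 2" using e3(2) t by blast
    thus ?thesis using h by (simp add: dist_real_def)
   qed
   thus "\<exists>N. \<forall>m\<ge>N. \<forall>n\<ge>N. dist (\<theta> (e1 / real (Suc m)) j t x) (\<theta> (e1 / real (Suc n)) j t x) < h" by blast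
  qed
  hence lim: "(\<lambda>n. \<theta> (e1 / real (Suc n)) j t x) \<longlonglongrightarrow> \<Theta> j t x"
   unfolding \<Theta>_def by (simp add: Cauchy_convergent_iff convergent_LIMSEQ_iff)
  have "(\<lambda>n. \<bar>\<theta> e j t x - \<theta> (e1 / real (Suc n)) j t x\<bar>) \<longlonglongrightarrow> \<bar>\<theta> e j t x - \<Theta> j t x\<bar>"
   by (intro tendsto_intros lim)
  thus "\<bar>\<theta> e j t x - \<Theta> j t x\<bar> \<le> \<eta>"
  proof (rule tendsto_upperbound)
   have "e2 > 0" using e2 by simp
   from seq_small[OF this]
   show "\<forall>\<^sub>F n in sequentially. \<bar>\<theta> e j t x - \<theta> (e1 / real (Suc n)) j t x\<bar> \<le> \<eta>"
    by eventually_elim (use e2 e t in blast)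
  qed simp
 qed
qed

lemma \<Theta>_tendsto:
 assumes "j \<le> 3" "t \<in> I" shows "((\<lambda>e. \<theta> e j t x) \<longlongrightarrow> \<Theta> j t x) (at_right 0)"
proof (rule tendstoI)
 fix \<eta> :: real assume \<eta>: "\<eta> > 0"
 obtain e2 where e2: "e2 \<in> E" "\<And>e t x. e \<in> {0<..e2} ==> t \<in> I ==> \<bar>\<theta> e j t x - \<Theta> j t x\<bar> \<le> \<eta> / 2"
  using \<Theta>_conv[OF assms(1), of "\<eta> / 2"] \<eta> by (metis half_gt_zero)
 show "\<forall>\<^sub>F e in at_right 0. dist (\<theta> e j t x) (\<Theta> j t x) < \<eta>"
  unfolding eventually_at_right_field
 proof (intro exI[of _ e2] conjI allI impI)
  fix e assume "0 < e" "e < e2"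
  thus "dist (\<theta> e j t x) (\<Theta> j t x) < \<eta>" using e2(2)[of e t x] assms(2) \<eta> by (simp add: dist_real_def)
 qed (use e2 in auto)
qed

lemma eventually_in: "\<forall>\<^sub>F e in at_right 0. e \<in> E"
 unfolding eventually_at_right_field using pos by (intro exI[of _ e1]) auto

lemma \<Theta>_C0:
 assumes j: "j \<le> 3" shows "C_strip 0 T (\<Theta> j)"
 unfolding C0_iff
proof (rule uniform_limit_theorem[where F = "at_right 0" and f = "\<lambda>e q. \<theta> e j (fst q) (snd q)"])
 show "\<forall>\<^sub>F e in at_right 0. continuous_on (I \<times> UNIV) (\<lambda>q. \<theta> e j (fst q) (snd q))"
  using eventually_in by eventually_elim (use \<theta>_C0 j in \<open>simp only: C0_iff[symmetric]\<close>)
 show "uniform_limit (I \<times> UNIV) (\<lambda>e q. \<theta> e j (fst q) (snd q)) (\<lambda>q. \<Theta> j (fst q) (snd q)) (at_right 0)"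
  unfolding uniform_limit_iff
 proof (intro allI impI)
  fix \<eta> :: real assume \<eta>: "\<eta> > 0"
  obtain e2 where e2: "e2 \<in> E" "\<And>e t x. e \<in> {0<..e2} ==> t \<in> I ==> \<bar>\<theta> e j t x - \<Theta> j t x\<bar> \<le> \<eta> / 2"
   using \<Theta>_conv[OF j, of "\<eta> / 2"] \<eta> by (metis half_gt_zero)
  show "\<forall>\<^sub>F e in at_right 0. \<forall>q\<in>I \<times> UNIV. dist (\<theta> e j (fst q) (snd q)) (\<Theta> j (fst q) (snd q)) < \<eta>"
   unfolding eventually_at_right_field
  proof (intro exI[of _ e2] conjI allI impI ballI)
   fix e q assume "0 < e" "e < e2" "q \<in> I \<times> (UNIV :: real set)"
   thus "dist (\<theta> e j (fst q) (snd q)) (\<Theta> j (fst q) (snd q)) < \<eta>"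
    using e2(2)[of e "fst q" "snd q"] \<eta> by (auto simp: dist_real_def)
  qed (use e2 in auto)
 qed
qed simp

lemma \<Theta>_bound: assumes "j \<le> 3" "t \<in> I" shows "\<bar>\<Theta> j t x\<bar> \<le> M"
proof (rule tendsto_upperbound[OF tendsto_rabs[OF \<Theta>_tendsto[OF assms]]])
 show "\<forall>\<^sub>F e in at_right 0. \<bar>\<theta> e j t x\<bar> \<le> M"
  using eventually_in by eventually_elim (use assms \<theta>_bound in auto)
qed simp

text \<open>The quadratic Taylor bound with the fixed constant M passes to the limit pointwise, and
  it characterises the derivative.\<close>

lemma \<Theta>_dx: assumes "j < 3" "t \<in> I" shows "(\<Theta> j t has_real_derivative \<Theta> (Suc j) t x) (at x)"
proof (rule derivative_from_quadratic_bound[where C = M])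
 fix h
 have "((\<lambda>e. \<bar>\<theta> e j t (x + h) - \<theta> e j t x - h * \<theta> e (Suc j) t x\<bar>) \<longlongrightarrow> \<bar>\<Theta> j t (x + h) - \<Theta> j t x - h * \<Theta> (Suc j) t x\<bar>) (at_right 0)"
  using assms by (intro tendsto_intros \<Theta>_tendsto) auto
 thus "\<bar>\<Theta> j t (x + h) - \<Theta> j t x - h * \<Theta> (Suc j) t x\<bar> \<le> M * h^2"
 proof (rule tendsto_upperbound)
  show "\<forall>\<^sub>F e in at_right 0. \<bar>\<theta> e j t (x + h) - \<theta> e j t x - h * \<theta> e (Suc j) t x\<bar> \<le> M * h^2"
   using eventually_in
  proof eventually_elim
   case (elim e)
   show ?case
    by (rule taylor_quadratic_bound[where f'' = "\<theta> e (Suc (Suc j)) t"]; (rule \<theta>_dx \<theta>_bound)?; use elim assms in auto)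
  qed
 qed simp
qed

definition \<Theta>t :: field where "\<Theta>t t x = \<kappa> / 2 * exp (\<Theta> 0 t x) * \<Theta> 2 t x"
definition \<Theta>tx :: field where "\<Theta>tx t x = \<kappa> / 2 * exp (\<Theta> 0 t x) * (\<Theta> 1 t x * \<Theta> 2 t x + \<Theta> 3 t x)"

lemma \<Theta>t_C0: "C_strip 0 T \<Theta>t" "C_strip 0 T \<Theta>tx"
 unfolding \<Theta>t_def[abs_def] \<Theta>tx_def[abs_def] by (intro C0_intros \<Theta>_C0; simp)+

text \<open>The time derivative of \<theta> oscillates together with v, so the limit is taken in the
  integrated equation of z instead: z converges uniformly to \<Theta>, and z_t converges uniformly
  to the right-hand side of the limit equation.\<close>

lemma \<Theta>_integral:
 assumes t: "t \<in> I" shows "\<Theta> 0 t x - \<Theta> 0 0 x = integral {0..t} (\<lambda>\<tau>. \<Theta>t \<tau> x)"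
proof -
 obtain Z2 where Z2: "Z2 > 0" "\<And>e t x. e \<in> E ==> t \<in> I ==> \<bar>(zxx e t x - \<theta> e 2 t x) / \<omega> e\<bar> \<le> Z2" using UBE[OF UB_zxx_diff] by blast
 obtain A where A: "A > 0" "\<And>e t x. e \<in> E ==> t \<in> I ==> \<bar>(z e t x - \<theta> e 0 t x) / \<omega> e\<bar> \<le> A" using UBE[OF UB_z_diff] by blast
 obtain B where B: "B > 0" "\<And>e t x. e \<in> E ==> t \<in> I ==> \<bar>res e t x / \<omega> e\<bar> \<le> B" using UBE[OF UB_res] by blast
 have M0: "M \<ge> 0" using \<theta>_bound[of e1 0 0 0] pos by force
 \<comment> \<open>2 (1 + A) is the error of replacing \<Theta> by z at the two times t and 0, the
   rest that of replacing the integrand, multiplied by the length T.\<close>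
 define K where "K = 2 + 2 * A + T * (\<kappa> / 2 * exp M * (M + 1 + Z2) + B)"
 have K: "K > 0" unfolding K_def using A pos M0 Z2 B by (intro add_pos_nonneg mult_nonneg_nonneg add_nonneg_nonneg) auto
 have "\<bar>\<Theta> 0 t x - \<Theta> 0 0 x - integral {0..t} (\<lambda>\<tau>. \<Theta>t \<tau> x)\<bar> \<le> K * \<eta>" if \<eta>: "\<eta> > 0" for \<eta>
 proof -
  obtain a where a: "a \<in> E" "\<And>e. e \<in> {0<..a} ==> \<omega> e \<le> \<eta>" using \<omega>_small[OF \<eta>] by metis
  obtain b where b: "b \<in> E" "\<And>e t x. e \<in> {0<..b} ==> t \<in> I ==> \<bar>\<theta> e 0 t x - \<Theta> 0 t x\<bar> \<le> \<eta>" using \<Theta>_conv[OF _ \<eta>, of 0] by auto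
  obtain c where c: "c \<in> E" "\<And>e t x. e \<in> {0<..c} ==> t \<in> I ==> \<bar>\<theta> e 2 t x - \<Theta> 2 t x\<bar> \<le> \<eta>" using \<Theta>_conv[OF _ \<eta>, of 2] by auto
  define e where "e = min a (min b c)"
  have e: "e \<in> E" "e \<in> {0<..a}" "e \<in> {0<..b}" "e \<in> {0<..c}" using a b c unfolding e_def by auto
  note w = \<omega>_bounds[OF e(1)] a(2)[OF e(2)]
  have zz: "\<bar>z e s y - \<Theta> 0 s y\<bar> \<le> (1 + A) * \<eta>" if s: "s \<in> I" for s y
  proof -
   have "\<bar>z e s y - \<theta> e 0 s y\<bar> \<le> A * \<omega> e" using A(2)[OF e(1) s, of y] w by (simp add: field_simps)
   also have "\<dots> \<le> A * \<eta>" using w A by (intro mult_left_mono) auto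
   finally show ?thesis using b(2)[OF e(3) s, of y] by (simp add: algebra_simps)
  qed
  have ztt: "\<bar>zt e s y - \<Theta>t s y\<bar> \<le> (\<kappa> / 2 * exp M * (M + 1 + Z2) + B) * \<eta>" if s: "s \<in> I" for s y
  proof -
   have 1: "\<bar>res e s y\<bar> \<le> B * \<eta>"
   proof -
    have "\<bar>res e s y\<bar> \<le> B * \<omega> e" using B(2)[OF e(1) s, of y] w by (simp add: field_simps)
    also have "\<dots> \<le> B * \<eta>" using w B by (intro mult_left_mono) auto
    finally show ?thesis .
   qed
   have 2: "\<bar>zxx e s y - \<Theta> 2 s y\<bar> \<le> (1 + Z2) * \<eta>"
   proof -
    have "\<bar>zxx e s y - \<theta> e 2 s y\<bar> \<le> Z2 * \<omega> e" using Z2(2)[OF e(1) s, of y] w by (simp add: field_simps)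
    also have "\<dots> \<le> Z2 * \<eta>" using w Z2 by (intro mult_left_mono) auto
    finally show ?thesis using c(2)[OF e(4) s, of y] by (simp add: algebra_simps)
   qed
   have bb: "\<bar>\<theta> e 0 s y\<bar> \<le> M" "\<bar>\<Theta> 0 s y\<bar> \<le> M" "\<bar>\<Theta> 2 s y\<bar> \<le> M"
    using \<theta>_bound[OF e(1) _ s, of 0 y] \<Theta>_bound[OF _ s, of 0 y] \<Theta>_bound[OF _ s, of 2 y] by auto
   have 3: "\<bar>exp (\<theta> e 0 s y) - exp (\<Theta> 0 s y)\<bar> \<le> exp M * \<eta>"
   proof -
    have "\<bar>exp (\<theta> e 0 s y) - exp (\<Theta> 0 s y)\<bar> \<le> exp M * \<bar>\<theta> e 0 s y - \<Theta> 0 s y\<bar>" by (rule exp_diff_bound) (use bb in auto)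
    also have "\<dots> \<le> exp M * \<eta>" using b(2)[OF e(3) s, of y] by (intro mult_left_mono) auto
    finally show ?thesis .
   qed
   have "zt e s y - \<Theta>t s y = \<kappa> / 2 * (exp (\<theta> e 0 s y) * (zxx e s y - \<Theta> 2 s y) + (exp (\<theta> e 0 s y) - exp (\<Theta> 0 s y)) * \<Theta> 2 s y) + res e s y"
    unfolding res_def \<Theta>t_def by (simp add: algebra_simps)
   hence "\<bar>zt e s y - \<Theta>t s y\<bar> \<le> \<bar>\<kappa> / 2 * (exp (\<theta> e 0 s y) * (zxx e s y - \<Theta> 2 s y) + (exp (\<theta> e 0 s y) - exp (\<Theta> 0 s y)) * \<Theta> 2 s y)\<bar> + \<bar>res e s y\<bar>"
    by simp
   also have "\<dots> \<le> \<kappa> / 2 * (exp M * ((1 + Z2) * \<eta>) + (exp M * \<eta>) * M) + B * \<eta>"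
   proof (intro add_mono 1)
    have "\<bar>exp (\<theta> e 0 s y) * (zxx e s y - \<Theta> 2 s y) + (exp (\<theta> e 0 s y) - exp (\<Theta> 0 s y)) * \<Theta> 2 s y\<bar>
     \<le> exp (\<theta> e 0 s y) * \<bar>zxx e s y - \<Theta> 2 s y\<bar> + \<bar>exp (\<theta> e 0 s y) - exp (\<Theta> 0 s y)\<bar> * \<bar>\<Theta> 2 s y\<bar>"
     by (rule order_trans[OF abs_triangle_ineq]) (simp add: abs_mult)
    also have "\<dots> \<le> exp M * ((1 + Z2) * \<eta>) + (exp M * \<eta>) * M"
     using 2 3 bb \<eta> Z2 by (intro add_mono mult_mono) auto
    finally show "\<bar>\<kappa> / 2 * (exp (\<theta> e 0 s y) * (zxx e s y - \<Theta> 2 s y) + (exp (\<theta> e 0 s y) - exp (\<Theta> 0 s y)) * \<Theta> 2 s y)\<bar>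
     \<le> \<kappa> / 2 * (exp M * ((1 + Z2) * \<eta>) + (exp M * \<eta>) * M)"
     unfolding abs_mult using pos by (simp add: mult_left_mono)
   qed
   finally show ?thesis by (simp add: field_simps)
  qed
  have cz: "continuous_on {0..t} (\<lambda>\<tau>. zt e \<tau> x - \<Theta>t \<tau> x)"
   unfolding zt_def by (intro continuous_intros C0_slice_t[where T = T] \<theta>t_C0 pt_C0 C0s W_C0 \<theta>_C0 \<Theta>t_C0 e; use t in simp)
  have "norm (integral {0..t} (\<lambda>\<tau>. zt e \<tau> x - \<Theta>t \<tau> x)) \<le> ((\<kappa> / 2 * exp M * (M + 1 + Z2) + B) * \<eta>) * (t - 0)"
   by (rule integral_bound[OF _ cz]) (use t ztt in auto)
  also have "\<dots> \<le> ((\<kappa> / 2 * exp M * (M + 1 + Z2) + B) * \<eta>) * T"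
   using t pos M0 Z2 B \<eta> by (intro mult_left_mono) auto
  also have "integral {0..t} (\<lambda>\<tau>. zt e \<tau> x - \<Theta>t \<tau> x) = (z e t x - z e 0 x) - integral {0..t} (\<lambda>\<tau>. \<Theta>t \<tau> x)"
  proof -
   have "integral {0..t} (\<lambda>\<tau>. zt e \<tau> x) = z e t x - z e 0 x"
    by (rule FTC_integral[where S = "I"]) (use t z_derivs(1)[OF e(1)] in auto)
   moreover have "continuous_on {0..t} (\<lambda>\<tau>. zt e \<tau> x)" "continuous_on {0..t} (\<lambda>\<tau>. \<Theta>t \<tau> x)"
    unfolding zt_def by (intro continuous_intros C0_slice_t[where T = T] \<theta>t_C0 pt_C0 C0s W_C0 \<theta>_C0 \<Theta>t_C0 e; use t in simp)+
   ultimately show ?thesis by (subst integral_diff) (auto intro: integrable_continuous_real)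
  qed
  finally have "\<bar>(z e t x - z e 0 x) - integral {0..t} (\<lambda>\<tau>. \<Theta>t \<tau> x)\<bar> \<le> T * ((\<kappa> / 2 * exp M * (M + 1 + Z2) + B) * \<eta>)"
   by (simp add: mult.commute)
  moreover have "\<bar>z e t x - \<Theta> 0 t x\<bar> \<le> (1 + A) * \<eta>" "\<bar>z e 0 x - \<Theta> 0 0 x\<bar> \<le> (1 + A) * \<eta>"
   using zz[OF t, of x] zz[of 0 x] pos by auto
  ultimately show ?thesis unfolding K_def by (simp add: algebra_simps)
 qed
 note key = this
 have "\<bar>\<Theta> 0 t x - \<Theta> 0 0 x - integral {0..t} (\<lambda>\<tau>. \<Theta>t \<tau> x)\<bar> \<le> 0"
 proof (rule field_le_epsilon)
  fix h :: real assume h: "h > 0"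
  show "\<bar>\<Theta> 0 t x - \<Theta> 0 0 x - integral {0..t} (\<lambda>\<tau>. \<Theta>t \<tau> x)\<bar> \<le> 0 + h"
   using key[of "h / K"] h K by simp
 qed
 thus ?thesis by simp
qed

lemma \<Theta>_dt: assumes t: "t \<in> I" shows "((\<lambda>\<tau>. \<Theta> 0 \<tau> x) has_real_derivative \<Theta>t t x) (at t within I)"
proof -
 have "((\<lambda>\<tau>. \<Theta> 0 0 x + integral {0..\<tau>} (\<lambda>r. \<Theta>t r x)) has_real_derivative 0 + \<Theta>t t x) (at t within I)"
  by (intro DERIV_add DERIV_const integral_deriv_upper[OF C0_slice_t[OF \<Theta>t_C0(1)] t]) simp
 hence "((\<lambda>\<tau>. \<Theta> 0 0 x + integral {0..\<tau>} (\<lambda>r. \<Theta>t r x)) has_real_derivative \<Theta>t t x) (at t within I)" by simp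
 thus ?thesis
 proof (rule has_field_derivative_transform_within[where d = 1])
  fix \<tau> assume "\<tau> \<in> I"
  from \<Theta>_integral[OF this, of x] show "\<Theta> 0 0 x + integral {0..\<tau>} (\<lambda>r. \<Theta>t r x) = \<Theta> 0 \<tau> x" by linarith
 qed (use t in auto)
qed

lemma \<Theta>_dx012:
 assumes "t \<in> I"
 shows "(\<Theta> 0 t has_real_derivative \<Theta> 1 t x) (at x)" "(\<Theta> 1 t has_real_derivative \<Theta> 2 t x) (at x)" "(\<Theta> 2 t has_real_derivative \<Theta> 3 t x) (at x)"
 using \<Theta>_dx[OF _ assms, of 0 x] \<Theta>_dx[OF _ assms, of 1 x] \<Theta>_dx[OF _ assms, of 2 x]
 by (simp_all add: One_nat_def[symmetric] numeral_2_eq_2[symmetric] numeral_3_eq_3[symmetric])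

lemma \<Theta>1_dt: assumes t: "t \<in> I" shows "((\<lambda>\<tau>. \<Theta> 1 \<tau> x) has_real_derivative \<Theta>tx t x) (at t within I)"
proof (rule mixed_derivative[OF \<Theta>t_C0 \<Theta>_dt \<Theta>_dx012(1) _ t])
 show "(\<Theta>t t has_real_derivative \<Theta>tx t x) (at x)" if "t \<in> I" for t x
  unfolding \<Theta>t_def[abs_def] \<Theta>tx_def using that
  by (auto intro!: derivative_eq_intros \<Theta>_dx012 simp: field_simps)
qed

end

section \<open>Weighted energy of the limit\<close>

lemma continuous_on_lipschitz_product:
 fixes f :: "real \<Rightarrow> real \<Rightarrow> real"
 assumes t: "\<And>t s x. t \<in> A ==> s \<in> A ==> x \<in> B ==> \<bar>f t x - f s x\<bar> \<le> L * \<bar>t - s\<bar>"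
  and x: "\<And>t x y. t \<in> A ==> x \<in> B ==> y \<in> B ==> \<bar>f t x - f t y\<bar> \<le> L * \<bar>x - y\<bar>"
 shows "continuous_on (A \<times> B) (\<lambda>p. f (fst p) (snd p))"
 unfolding continuous_on_iff
proof (intro ballI allI impI)
 fix p :: "real \<times> real" and e :: real assume p: "p \<in> A \<times> B" and e: "e > 0"
 define K where "K = 2 * \<bar>L\<bar> + 1"
 have K: "K > 0" unfolding K_def by simp
 show "\<exists>d>0. \<forall>q\<in>A \<times> B. dist q p < d \<longrightarrow> dist (f (fst q) (snd q)) (f (fst p) (snd p)) < e"
 proof (intro exI[of _ "e / K"] conjI ballI impI)
  fix q assume q: "q \<in> A \<times> B" "dist q p < e / K"
  have "dist (fst q) (fst p) < e / K" "dist (snd q) (snd p) < e / K"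
   using q(2) dist_fst_le[of q p] dist_snd_le[of q p] by linarith+
  hence d: "\<bar>fst q - fst p\<bar> < e / K" "\<bar>snd q - snd p\<bar> < e / K" by (simp_all add: dist_real_def)
  have "\<bar>f (fst q) (snd q) - f (fst p) (snd p)\<bar> \<le> \<bar>f (fst q) (snd q) - f (fst p) (snd q)\<bar> + \<bar>f (fst p) (snd q) - f (fst p) (snd p)\<bar>"
   by linarith
  also have "\<dots> \<le> L * \<bar>fst q - fst p\<bar> + L * \<bar>snd q - snd p\<bar>"
   using p q(1) by (intro add_mono t x) auto
  also have "\<dots> \<le> \<bar>L\<bar> * (e / K) + \<bar>L\<bar> * (e / K)"
   using d by (intro add_mono mult_mono) auto
  also have "\<dots> = (K - 1) * (e / K)" by (simp add: K_def)
  also have "\<dots> < K * (e / K)" using K e by (intro mult_strict_right_mono) auto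
  also have "\<dots> = e" using K by simp
  finally show "dist (f (fst q) (snd q)) (f (fst p) (snd p)) < e" by (simp add: dist_real_def)
 qed (use K e in simp)
qed

lemma square_mono_abs: "\<bar>x\<bar> \<le> y ==> x^2 \<le> y^2" for x y :: real
 using power_mono[of "\<bar>x\<bar>" y 2] by simp

lemma integral_powr_bound:
 fixes \<delta> b :: real
 assumes "\<delta> > 0" "1 \<le> b" shows "integral {1..b} (\<lambda>x. x powr (- 1 - \<delta>)) \<le> 1 / \<delta>"
proof -
 define G where "G x = - (x powr (- \<delta>) / \<delta>)" for x
 have "integral {1..b} (\<lambda>x. x powr (- 1 - \<delta>)) = G b - G 1"
 proof (rule FTC_integral[where S = "{1..b}" and f = G])
  fix x assume "x \<in> {1..b}"
  hence "x > 0" by simp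
  from has_field_derivative_at_within[OF DERIV_minus[OF DERIV_cdivide[OF has_real_derivative_powr[OF this, of "- \<delta>"], of \<delta>]], of "{1..b}"]
  have "(G has_real_derivative - ((- \<delta> * x powr (- \<delta> - 1)) / \<delta>)) (at x within {1..b})"
   unfolding G_def .
  moreover have "- ((- \<delta> * x powr (- \<delta> - 1)) / \<delta>) = x powr (- 1 - \<delta>)"
  proof -
   have "- \<delta> - 1 = - 1 - \<delta>" by simp
   hence "x powr (- \<delta> - 1) = x powr (- 1 - \<delta>)" by (rule arg_cong)
   thus ?thesis using assms(1) by simp
  qed
  ultimately show "(G has_real_derivative x powr (- 1 - \<delta>)) (at x within {1..b})" by (simp only:)
 qed (use assms in auto)
 also have "\<dots> = 1 / \<delta> - b powr (- \<delta>) / \<delta>" by (simp add: G_def)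
 also have "\<dots> \<le> 1 / \<delta>"
 proof -
  have "0 \<le> b powr (- \<delta>) / \<delta>" using assms(1) by (intro divide_nonneg_pos powr_ge_zero)
  thus ?thesis by linarith
 qed
 finally show ?thesis .
qed

text \<open>Pointwise decay is available at time 0 only. At later times it is replaced by an L^2
  bound on the right half-line that is uniform in t and in the end point b.\<close>

locale singular_decay = singular_limit +
 fixes \<theta>p \<sigma> Cd :: real
 assumes \<sigma>: "\<sigma> > 0"
  and decay: "\<And>x. x \<ge> 1 ==> \<bar>\<Theta> 0 0 x - \<theta>p\<bar> \<le> Cd * x powr (- 1 - \<sigma>)"
  and decay_L2: "\<And>t b. t \<in> {0..T} ==> integral {1..b} (\<lambda>x. (\<Theta> 0 t x - \<theta>p)^2) \<le> Cd"
begin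

lemma Cd: "Cd \<ge> 0"
proof -
 have "0 \<le> Cd * 1 powr (- 1 - \<sigma>)" by (rule order_trans[OF abs_ge_zero decay]) simp
 thus ?thesis by simp
qed

text \<open>The cap 1 keeps the exponent (1 + s') / 2 of the weight at most 1, so that the weight
  has a bounded derivative. The inequality s' \<le> \<sigma> makes the weighted initial energy
  finite, and s' > 0 makes the reciprocal of the squared weight integrable.\<close>

definition s' where "s' = min \<sigma> 1"

lemma s': "0 < s'" "s' \<le> 1" "s' \<le> \<sigma>" using \<sigma> by (auto simp: s'_def)

definition M2 where "M2 = max M \<bar>\<theta>p\<bar>"

text \<open>For \<rho> = exp (- \<Theta>) the limit equation becomes the conservation law \<rho>_t =
  ((\<kappa>/2) \<rho>_x / \<rho>)_x. The energy estimate is made for the deviation of \<rho> from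
  its limit at +\<infinity>, since then integration by parts leaves no lower-order term.\<close>

definition w where "w t x = exp (- \<Theta> 0 t x) - exp (- \<theta>p)"

lemma M_le_M2: "M \<le> M2" "\<bar>\<theta>p\<bar> \<le> M2" by (auto simp: M2_def)

lemma w_bound: assumes t: "t \<in> I" shows "\<bar>w t x\<bar> \<le> exp M2 * \<bar>\<Theta> 0 t x - \<theta>p\<bar>"
proof -
 have "\<bar>exp (- \<Theta> 0 t x) - exp (- \<theta>p)\<bar> \<le> exp M2 * \<bar>- \<Theta> 0 t x - - \<theta>p\<bar>"
  by (rule exp_diff_bound) (use \<Theta>_bound[OF _ t, of 0 x] M_le_M2 in auto)
 thus ?thesis unfolding w_def by (simp add: abs_minus_commute)
qed

lemma w_bound_const: assumes t: "t \<in> I" shows "\<bar>w t x\<bar> \<le> exp M2 * (2 * M2)"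
 using \<Theta>_bound[OF _ t, of 0 x] M_le_M2 by (intro order_trans[OF w_bound[OF t]] mult_left_mono) auto

lemma w_C0: "C_strip 0 T w"
 unfolding w_def[abs_def] by (intro C0_intros \<Theta>_C0) simp

lemma w_sq_integral:
 assumes t: "t \<in> I" and a: "a \<le> 1" and b: "1 \<le> b"
 shows "integral {a..b} (\<lambda>x. (w t x)^2) \<le> (exp M2 * (2 * M2))^2 * (1 - a) + (exp M2)^2 * Cd"
proof -
 have wc: "continuous_on S (\<lambda>x. (w t x)^2)" "continuous_on S (\<lambda>x. (\<Theta> 0 t x - \<theta>p)^2)" for S
  by (intro continuous_intros C0_slice_x[OF w_C0 t] C0_slice_x[OF \<Theta>_C0 t]; simp)+
 have "integral {a..b} (\<lambda>x. (w t x)^2) = integral {a..1} (\<lambda>x. (w t x)^2) + integral {1..b} (\<lambda>x. (w t x)^2)"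
  by (rule Henstock_Kurzweil_Integration.integral_combine[symmetric]) (use a b wc in \<open>auto intro: integrable_continuous_real\<close>)
 also have "integral {a..1} (\<lambda>x. (w t x)^2) \<le> integral {a..1} (\<lambda>x. (exp M2 * (2 * M2))^2)"
  by (rule integral_mono_continuous[OF wc(1) continuous_on_const]) (rule square_mono_abs[OF w_bound_const[OF t]])
 also have "integral {1..b} (\<lambda>x. (w t x)^2) \<le> integral {1..b} (\<lambda>x. (exp M2)^2 * (\<Theta> 0 t x - \<theta>p)^2)"
 proof (rule integral_mono_continuous[OF wc(1)])
  show "continuous_on {1..b} (\<lambda>x. (exp M2)^2 * (\<Theta> 0 t x - \<theta>p)^2)" by (intro continuous_on_mult_left wc)
  fix x
  have "\<bar>w t x\<bar>^2 \<le> (exp M2 * \<bar>\<Theta> 0 t x - \<theta>p\<bar>)^2" by (rule power_mono[OF w_bound[OF t]]) simp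
  thus "(w t x)^2 \<le> (exp M2)^2 * (\<Theta> 0 t x - \<theta>p)^2" by (simp add: power_mult_distrib)
 qed
 also have "\<dots> = (exp M2)^2 * integral {1..b} (\<lambda>x. (\<Theta> 0 t x - \<theta>p)^2)" by simp
 also have "\<dots> \<le> (exp M2)^2 * Cd" by (intro mult_left_mono decay_L2 t) simp
 finally show ?thesis using a by (simp add: mult.commute)
qed

text \<open>The weight \<open>\<phi>\<close> is comparable to \<open>x powr ((1 + s') / 2)\<close> on the region of interest, but it vanishes at both
 ends of the interval and has a bounded derivative, so the boundary and flux terms are harmless.\<close>

lemma weighted_energy:
 assumes R: "R \<ge> 0"
 obtains C where "C \<ge> 0" "\<And>X. X \<ge> 1 ==>
  integral I (\<lambda>t. integral {-R..X} (\<lambda>x. (max 1 (x + R + 2)) powr (1 + s') * (\<Theta> 1 t x)^2)) \<le> C"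
proof -
 define r where "r = R + 2"
 have r: "r \<ge> 2" using R by (simp add: r_def)
 \<comment> \<open>At this left end point x + r equals 1, which makes the weight vanish
   there.\<close>
 define a where "a = 1 - r"
 define g where "g = (1 + s') / 2"
 have g2: "2 * g = 1 + s'" by (simp add: g_def)
 have g: "1 / 2 \<le> g" "g \<le> 1" using s' by (auto simp: g_def)
 define CW where "CW = (exp M2 * (2 * M2))^2 * (1 - a) + (exp M2)^2 * Cd"
 have CW: "CW \<ge> 0" unfolding CW_def using Cd r by (auto simp: a_def)
 \<comment> \<open>Bounds the weighted energy at time 0: sup bounds on [a, 1], and on [1, b] the
   decay of the data, where the powers combine to 1 + s' - 2 (1 + \<sigma>) = - 1 - (2 \<sigma> -
   s').\<close>
 define CJ where "CJ = (1 + r) powr (1 + s') * (exp M2 * (2 * M2))^2 * (1 - a) + (1 + r) powr (1 + s') * (exp M2 * Cd)^2 * (1 / (2 * \<sigma> - s'))"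
 have \<delta>: "2 * \<sigma> - s' > 0" using s' \<sigma> by linarith
 have CJ: "CJ \<ge> 0" unfolding CJ_def using \<delta> r by (auto simp: a_def)
 define C0 where "C0 = (CJ + T * (\<kappa> * (2 * exp M * CW))) / (\<kappa> / 2 * exp (- M))"
 have C00: "C0 \<ge> 0" unfolding C0_def using CJ CW pos by auto
 have main: "integral I (\<lambda>t. integral {-R..X} (\<lambda>x. (max 1 (x + R + 2)) powr (1 + s') * (\<Theta> 1 t x)^2)) \<le> 64 * C0"
  if X: "X \<ge> 1" for X
 proof -
  \<comment> \<open>This length makes the linear cutoff at least 1/2 on all of [-R, X].\<close>
  define Y where "Y = 2 * (X + r - 1)"
  have Y: "Y > 0" "Y \<ge> 4" using X r by (auto simp: Y_def)
  define b where "b = a + Y"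
  have ab: "a \<le> 1" "1 \<le> b" "X \<le> b" using X r by (auto simp: a_def b_def Y_def)
  \<comment> \<open>The first factor is the power weight lowered by 1 so as to vanish at a; the
    second is a linear cutoff vanishing at b. Near b the cutoff has slope - 1/Y, and the weight is
    at most of linear size, so the product of both stays bounded.\<close>
  define \<phi> where "\<phi> x = (max 1 (x + r) powr g - 1) * (1 - (x + r - 1) / Y)" for x
  define \<phi>' where "\<phi>' x = g * max 1 (x + r) powr (g - 1) * (1 - (x + r - 1) / Y) - (max 1 (x + r) powr g - 1) / Y" for x
  have \<phi>c: "continuous_on UNIV \<phi>" "continuous_on UNIV \<phi>'"
   unfolding \<phi>_def \<phi>'_def by (intro continuous_intros; (use Y in auto)?)+
  have \<phi>cS: "continuous_on S \<phi>" "continuous_on S \<phi>'" for S using \<phi>c continuous_on_subset by blast+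
  have \<phi>d: "(\<phi> has_real_derivative \<phi>' x) (at x within {a..b})" if x: "x \<in> {a..b}" for x
  proof -
   have x1: "x + r \<ge> 1" using x by (simp add: a_def)
   have "((\<lambda>x. (x + r) powr g) has_real_derivative g * (x + r) powr (g - 1)) (at x)"
    using DERIV_powr[of "\<lambda>x. x + r" 1 x "\<lambda>_. g" 0] x1 by (auto intro!: derivative_eq_intros simp: powr_diff)
   hence d1: "((\<lambda>x. (x + r) powr g - 1) has_real_derivative g * (x + r) powr (g - 1) - 0) (at x)"
    by (intro DERIV_diff DERIV_const)
   have d2: "((\<lambda>x. 1 - (x + r - 1) / Y) has_real_derivative - (1 / Y)) (at x)"
    using Y by (auto intro!: derivative_eq_intros)
   have eq: "max 1 (x + r) = x + r" using x1 by simp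
   have "(g * (x + r) powr (g - 1) - 0) * (1 - (x + r - 1) / Y) + - (1 / Y) * ((x + r) powr g - 1) = \<phi>' x"
    unfolding \<phi>'_def eq by simp
   hence "((\<lambda>x. ((x + r) powr g - 1) * (1 - (x + r - 1) / Y)) has_real_derivative \<phi>' x) (at x within {a..b})"
    using has_field_derivative_at_within[OF DERIV_mult[OF d1 d2]] by (simp only:)
   thus ?thesis
    by (rule has_field_derivative_transform_within[where d = 1]) (use x in \<open>auto simp: \<phi>_def a_def\<close>)
  qed
  have y: "0 \<le> (x + r - 1) / Y" "(x + r - 1) / Y \<le> 1" if x: "x \<in> {a..b}" for x
   using x Y by (auto simp: a_def b_def field_simps)
  have pg: "1 \<le> max 1 (x + r) powr g" "max 1 (x + r) powr g \<le> max 1 (x + r)" for x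
   using g powr_mono[of g 1 "max 1 (x + r)"] ge_one_powr_ge_zero[of "max 1 (x + r)" g] by auto
  have \<phi>'b: "\<bar>\<phi>' x\<bar> \<le> 1" if x: "x \<in> {a..b}" for x
  proof -
   have p1: "0 \<le> max 1 (x + r) powr (g - 1)" "max 1 (x + r) powr (g - 1) \<le> 1"
    using g powr_mono[of "g - 1" 0 "max 1 (x + r)"] by (auto simp: max_def split: if_splits)
   have A: "0 \<le> g * max 1 (x + r) powr (g - 1) * (1 - (x + r - 1) / Y)"
    using g y[OF x] p1 by (intro mult_nonneg_nonneg) auto
   have A': "g * max 1 (x + r) powr (g - 1) * (1 - (x + r - 1) / Y) \<le> 1 * 1 * 1"
    using g y[OF x] p1 by (intro mult_mono mult_nonneg_nonneg) auto
   have B: "0 \<le> (max 1 (x + r) powr g - 1) / Y" using pg[of x] Y by auto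
   have "(max 1 (x + r) powr g - 1) / Y \<le> (x + r - 1) / Y"
    using pg[of x] x Y by (intro divide_right_mono) (auto simp: a_def max_def)
   hence B': "(max 1 (x + r) powr g - 1) / Y \<le> 1" using y[OF x] by linarith
   show ?thesis using A A' B B' unfolding \<phi>'_def by linarith
  qed
  have \<phi>0: "\<phi> a = 0" "\<phi> b = 0" using Y by (auto simp: \<phi>_def a_def b_def)
  have \<phi>up: "(\<phi> x)^2 \<le> max 1 (x + r) powr (1 + s')" if x: "x \<in> {a..b}" for x
  proof -
   have "0 \<le> \<phi> x" unfolding \<phi>_def using pg[of x] y[OF x] by auto
   moreover have "\<phi> x \<le> max 1 (x + r) powr g * 1"
    unfolding \<phi>_def using pg[of x] y[OF x] by (intro mult_mono) auto
   ultimately have "(\<phi> x)^2 \<le> (max 1 (x + r) powr g)^2" by (intro power_mono) auto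
   also have "\<dots> = max 1 (x + r) powr (1 + s')" by (simp add: powr_power g2)
   finally show ?thesis .
  qed
  have \<phi>low: "max 1 (x + r) powr (1 + s') / 64 \<le> (\<phi> x)^2" if x: "x \<in> {-R..X}" for x
  proof -
   have m: "max 1 (x + r) \<ge> 2" using x by (auto simp: r_def)
   \<comment> \<open>The region starts at x + r \<ge> 2 so that the power weight is at least 7/5 >
     4/3; then subtracting 1 leaves at least a quarter of it. With the cutoff factor 1/2 the total
     loss is 1/8, and 1/64 after squaring.\<close>
   have "(7/5 :: real) \<le> sqrt 2" by (rule real_le_rsqrt) (simp add: power2_eq_square)
   also have "\<dots> = 2 powr (1 / 2)" by (simp add: powr_half_sqrt)
   also have "\<dots> \<le> 2 powr g" using g by (intro powr_mono) auto
   also have "\<dots> \<le> max 1 (x + r) powr g" using m g by (intro powr_mono2) auto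
   finally have "max 1 (x + r) powr g - 1 \<ge> max 1 (x + r) powr g / 4" by simp
   moreover have "1 - (x + r - 1) / Y \<ge> 1 / 2" using x Y by (simp add: Y_def field_simps)
   ultimately have "max 1 (x + r) powr g / 4 * (1 / 2) \<le> \<phi> x" unfolding \<phi>_def by (intro mult_mono) auto
   hence "(max 1 (x + r) powr g / 4 * (1 / 2))^2 \<le> (\<phi> x)^2" by (rule power_mono) simp
   moreover have "(max 1 (x + r) powr g / 4 * (1 / 2))^2 = max 1 (x + r) powr (1 + s') / 64"
    by (simp add: power_divide powr_power g2)
   ultimately show ?thesis by simp
  qed
  define J where "J t = integral {a..b} (\<lambda>x. (\<phi> x)^2 * (w t x)^2)" for t
  define J' where "J' t = integral {a..b} (\<lambda>x. (\<phi> x)^2 * (2 * w t x * (- (\<kappa> / 2) * \<Theta> 2 t x)))" for t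
  have wt: "((\<lambda>\<tau>. w \<tau> x) has_real_derivative - (\<kappa> / 2) * \<Theta> 2 t x) (at t within I)" if t: "t \<in> I" for t x
  proof -
   have "((\<lambda>\<tau>. w \<tau> x) has_real_derivative - (exp (- \<Theta> 0 t x) * \<Theta>t t x)) (at t within I)"
    unfolding w_def using \<Theta>_dt[OF t, of x] by (auto intro!: derivative_eq_intros)
   moreover have "exp (- \<Theta> 0 t x) * \<Theta>t t x = (\<kappa> / 2) * \<Theta> 2 t x"
    unfolding \<Theta>t_def by (simp add: exp_minus)
   ultimately show ?thesis by simp
  qed
  have wx: "(w t has_real_derivative - (exp (- \<Theta> 0 t x) * \<Theta> 1 t x)) (at x)" if t: "t \<in> I" for t x
   unfolding w_def[abs_def] using \<Theta>_dx012(1)[OF t, of x] by (auto intro!: derivative_eq_intros)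
  have \<phi>C: "C_strip 0 T (\<lambda>t x. \<phi> x)" "C_strip 0 T (\<lambda>t x. \<phi>' x)" by (intro C0_space \<phi>c)+
  have JC: "C_strip 0 T (\<lambda>t x. (\<phi> x)^2 * (w t x)^2)" "C_strip 0 T (\<lambda>t x. (\<phi> x)^2 * (2 * w t x * (- (\<kappa> / 2) * \<Theta> 2 t x)))"
   by (intro C0_intros \<phi>C w_C0 \<Theta>_C0; simp)+
  have Jd: "(J has_real_derivative J' t) (at t within I)" if t: "t \<in> I" for t
   unfolding J_def J'_def
   by (rule space_integral_derivative_t[OF JC _ t]) (use wt in \<open>auto intro!: derivative_eq_intros simp: power2_eq_square\<close>)
  define In where "In t = integral {a..b} (\<lambda>x. (\<phi> x)^2 * (\<Theta> 1 t x)^2)" for t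
  have IC: "C_strip 0 T (\<lambda>t x. (\<phi> x)^2 * (\<Theta> 1 t x)^2)" by (intro C0_intros \<phi>C \<Theta>_C0; simp)
  have J'b: "J' t \<le> \<kappa> * (2 * exp M * CW) - \<kappa> / 2 * exp (- M) * In t" if t: "t \<in> I" for t
  proof -
   have cs: "continuous_on S (w t)" "continuous_on S (\<Theta> 0 t)" "continuous_on S (\<Theta> 1 t)" "continuous_on S (\<Theta> 2 t)" for S
    by (intro C0_slice_x[OF _ t] w_C0 \<Theta>_C0; simp)+
   \<comment> \<open>h is the derivative of \<phi>^2 w \<Theta>_x, which vanishes at both ends.
     Adding \<kappa> times its zero integral carries out the integration by parts.\<close>
   define h where "h x = (2 * \<phi> x * \<phi>' x * w t x * \<Theta> 1 t x - (\<phi> x)^2 * exp (- \<Theta> 0 t x) * (\<Theta> 1 t x)^2) + (\<phi> x)^2 * w t x * \<Theta> 2 t x" for x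
   have "integral {a..b} h = (\<phi> b)^2 * w t b * \<Theta> 1 t b - (\<phi> a)^2 * w t a * \<Theta> 1 t a"
   proof (rule FTC_integral[where S = "{a..b}"])
    fix x assume x: "x \<in> {a..b}"
    show "((\<lambda>x. (\<phi> x)^2 * w t x * \<Theta> 1 t x) has_real_derivative h x) (at x within {a..b})"
     unfolding h_def using \<phi>d[OF x] has_field_derivative_at_within[OF wx[OF t, of x], of "{a..b}"] has_field_derivative_at_within[OF \<Theta>_dx012(2)[OF t, of x], of "{a..b}"]
     by (auto intro!: derivative_eq_intros simp: algebra_simps power2_eq_square)
   qed (use ab in auto)
   hence h0: "integral {a..b} h = 0" using \<phi>0 by simp
   have hc: "continuous_on {a..b} h" unfolding h_def by (intro continuous_intros cs \<phi>cS)
   have "J' t = J' t + \<kappa> * integral {a..b} h" using h0 by simp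
   also have "\<dots> = integral {a..b} (\<lambda>x. (\<phi> x)^2 * (2 * w t x * (- (\<kappa> / 2) * \<Theta> 2 t x)) + \<kappa> * h x)"
    unfolding J'_def by (subst integral_add) (auto intro!: integrable_continuous_real continuous_intros cs \<phi>cS hc)
   also have "\<dots> \<le> integral {a..b} (\<lambda>x. \<kappa> * (2 * exp M) * (w t x)^2 - \<kappa> / 2 * exp (- M) * ((\<phi> x)^2 * (\<Theta> 1 t x)^2))"
   proof (rule integral_mono_continuous)
    fix x assume x: "x \<in> {a..b}"
    define A where "A = exp (- \<Theta> 0 t x)"
    have AM: "exp (- M) \<le> A" "A > 0" unfolding A_def using \<Theta>_bound[OF _ t, of 0 x] by auto
    have AM': "1 / A \<le> exp M"
    proof -
     have "1 / A = exp (\<Theta> 0 t x)" unfolding A_def by (simp add: exp_minus inverse_eq_divide)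
     also have "\<dots> \<le> exp M" using \<Theta>_bound[OF _ t, of 0 x] by auto
     finally show ?thesis .
    qed
    \<comment> \<open>Young's inequality, weighted so that exactly half of the dissipation is spent
      on the cross term and half of it remains.\<close>
    have "2 * (\<phi> x * \<Theta> 1 t x * sqrt (A / 2)) * (\<phi>' x * w t x * sqrt (2 / A)) \<le> (\<phi> x * \<Theta> 1 t x * sqrt (A / 2))^2 + (\<phi>' x * w t x * sqrt (2 / A))^2"
     by (rule sum_squares_bound)
    moreover have "sqrt (A / 2) * sqrt (2 / A) = 1" using AM by (simp add: real_sqrt_mult[symmetric])
    hence "2 * (\<phi> x * \<Theta> 1 t x * sqrt (A / 2)) * (\<phi>' x * w t x * sqrt (2 / A)) = 2 * \<phi> x * \<phi>' x * w t x * \<Theta> 1 t x"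
     by (simp add: ac_simps)
    moreover have "(\<phi> x * \<Theta> 1 t x * sqrt (A / 2))^2 = A / 2 * ((\<phi> x)^2 * (\<Theta> 1 t x)^2)"
     using AM by (simp add: power_mult_distrib)
    moreover have "(\<phi>' x * w t x * sqrt (2 / A))^2 = (\<phi>' x)^2 * (2 * (1 / A) * (w t x)^2)"
     using AM by (simp add: power_mult_distrib)
    moreover have "(\<phi>' x)^2 * (2 * (1 / A) * (w t x)^2) \<le> 1 * (2 * exp M * (w t x)^2)"
     using \<phi>'b[OF x] AM AM' by (intro mult_mono) (auto simp: abs_square_le_1)
    ultimately have "2 * \<phi> x * \<phi>' x * w t x * \<Theta> 1 t x \<le> A / 2 * ((\<phi> x)^2 * (\<Theta> 1 t x)^2) + 2 * exp M * (w t x)^2" by linarith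
    moreover have "exp (- M) / 2 * ((\<phi> x)^2 * (\<Theta> 1 t x)^2) \<le> A / 2 * ((\<phi> x)^2 * (\<Theta> 1 t x)^2)"
     using AM by (intro mult_right_mono) auto
    ultimately have "2 * \<phi> x * \<phi>' x * w t x * \<Theta> 1 t x - A * ((\<phi> x)^2 * (\<Theta> 1 t x)^2)
      \<le> 2 * exp M * (w t x)^2 - exp (- M) / 2 * ((\<phi> x)^2 * (\<Theta> 1 t x)^2)" by linarith
    hence "\<kappa> * (2 * \<phi> x * \<phi>' x * w t x * \<Theta> 1 t x - A * ((\<phi> x)^2 * (\<Theta> 1 t x)^2))
      \<le> \<kappa> * (2 * exp M * (w t x)^2 - exp (- M) / 2 * ((\<phi> x)^2 * (\<Theta> 1 t x)^2))" using pos by (intro mult_left_mono) auto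
    thus "(\<phi> x)^2 * (2 * w t x * (- (\<kappa> / 2) * \<Theta> 2 t x)) + \<kappa> * h x
      \<le> \<kappa> * (2 * exp M) * (w t x)^2 - \<kappa> / 2 * exp (- M) * ((\<phi> x)^2 * (\<Theta> 1 t x)^2)"
     unfolding h_def A_def[symmetric] by (simp add: algebra_simps)
   qed (intro continuous_intros cs \<phi>cS hc)+
   also have "\<dots> = \<kappa> * (2 * exp M) * integral {a..b} (\<lambda>x. (w t x)^2) - \<kappa> / 2 * exp (- M) * In t"
    unfolding In_def by (subst integral_diff) (auto intro!: integrable_continuous_real continuous_intros cs \<phi>cS)
   also have "\<dots> \<le> \<kappa> * (2 * exp M) * CW - \<kappa> / 2 * exp (- M) * In t"
    unfolding CW_def using w_sq_integral[OF t ab(1,2)] pos by (intro diff_right_mono mult_left_mono) auto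
   finally show ?thesis by (simp add: mult.assoc)
  qed
  have J'c: "continuous_on I J'" unfolding J'_def by (rule C0_space_integral[OF JC(2)])
  have Ic: "continuous_on I In" unfolding In_def by (rule C0_space_integral[OF IC])
  have "J T - J 0 = integral I J'"
   by (rule FTC_integral[where S = "I", symmetric]) (use Jd pos in auto)
  also have "\<dots> \<le> integral I (\<lambda>t. \<kappa> * (2 * exp M * CW) - \<kappa> / 2 * exp (- M) * In t)"
   by (rule integral_mono_continuous[OF J'c _ J'b]) (intro continuous_intros Ic, simp)
  also have "\<dots> = T * (\<kappa> * (2 * exp M * CW)) - \<kappa> / 2 * exp (- M) * integral I In"
   using pos by (subst integral_diff) (auto intro!: integrable_continuous_real continuous_intros Ic)
  finally have "\<kappa> / 2 * exp (- M) * integral I In \<le> J 0 - J T + T * (\<kappa> * (2 * exp M * CW))" by simp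
  moreover have "J T \<ge> 0"
   unfolding J_def by (rule integral_nonneg) (use pos in \<open>auto intro!: integrable_continuous_real C0_slice_x[OF JC(1)]\<close>)
  moreover have "J 0 \<le> CJ"
  proof -
   have T0: "0 \<in> I" using pos by auto
   have Jc: "continuous_on S (\<lambda>x. (\<phi> x)^2 * (w 0 x)^2)" for S by (rule C0_slice_x[OF JC(1) T0])
   have "J 0 = integral {a..1} (\<lambda>x. (\<phi> x)^2 * (w 0 x)^2) + integral {1..b} (\<lambda>x. (\<phi> x)^2 * (w 0 x)^2)"
    unfolding J_def by (rule Henstock_Kurzweil_Integration.integral_combine[symmetric]) (use ab Jc in \<open>auto intro: integrable_continuous_real\<close>)
   also have "integral {a..1} (\<lambda>x. (\<phi> x)^2 * (w 0 x)^2) \<le> integral {a..1} (\<lambda>x. (1 + r) powr (1 + s') * (exp M2 * (2 * M2))^2)"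
   proof (rule integral_mono_continuous[OF Jc continuous_on_const])
    fix x assume x: "x \<in> {a..1}"
    have "(\<phi> x)^2 \<le> max 1 (x + r) powr (1 + s')" by (rule \<phi>up) (use x ab in auto)
    also have "\<dots> \<le> (1 + r) powr (1 + s')" using x r s' by (intro powr_mono2) auto
    finally have "(\<phi> x)^2 \<le> (1 + r) powr (1 + s')" .
    moreover have "(w 0 x)^2 \<le> (exp M2 * (2 * M2))^2" by (rule square_mono_abs[OF w_bound_const[OF T0]])
    ultimately show "(\<phi> x)^2 * (w 0 x)^2 \<le> (1 + r) powr (1 + s') * (exp M2 * (2 * M2))^2" by (intro mult_mono) auto
   qed
   also have "integral {1..b} (\<lambda>x. (\<phi> x)^2 * (w 0 x)^2) \<le> integral {1..b} (\<lambda>x. (1 + r) powr (1 + s') * (exp M2 * Cd)^2 * x powr (- 1 - (2 * \<sigma> - s')))"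
   proof (rule integral_mono_continuous[OF Jc])
    show "continuous_on {1..b} (\<lambda>x. (1 + r) powr (1 + s') * (exp M2 * Cd)^2 * x powr (- 1 - (2 * \<sigma> - s')))"
     by (intro continuous_intros) auto
    fix x assume x: "x \<in> {1..b}"
    have "(\<phi> x)^2 \<le> max 1 (x + r) powr (1 + s')" by (rule \<phi>up) (use x ab in auto)
    also have "\<dots> \<le> ((1 + r) * x) powr (1 + s')"
    proof -
     have "r * 1 \<le> r * x" using x r by (intro mult_left_mono) auto
     hence "max 1 (x + r) \<le> (1 + r) * x" using x r by (auto simp: distrib_right)
     thus ?thesis using s' by (intro powr_mono2) auto
    qed
    also have "\<dots> = (1 + r) powr (1 + s') * x powr (1 + s')" using x r by (simp add: powr_mult)
    finally have 1: "(\<phi> x)^2 \<le> (1 + r) powr (1 + s') * x powr (1 + s')" .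
    have "\<bar>w 0 x\<bar> \<le> exp M2 * (Cd * x powr (- 1 - \<sigma>))"
     using x by (intro order_trans[OF w_bound[OF T0]] mult_left_mono decay) auto
    hence "\<bar>w 0 x\<bar>^2 \<le> (exp M2 * (Cd * x powr (- 1 - \<sigma>)))^2" by (rule power_mono) simp
    also have "\<dots> = (exp M2 * Cd)^2 * (x powr (- 1 - \<sigma>))^2" by (simp add: power_mult_distrib)
    also have "(x powr (- 1 - \<sigma>))^2 = x powr (- 2 - 2 * \<sigma>)"
    proof -
     have "(- 1 - \<sigma>) + (- 1 - \<sigma>) = - 2 - 2 * \<sigma>" by simp
     thus ?thesis unfolding power2_eq_square by (simp only: powr_add[symmetric])
    qed
    finally have 2: "(w 0 x)^2 \<le> (exp M2 * Cd)^2 * x powr (- 2 - 2 * \<sigma>)" by simp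
    have "(\<phi> x)^2 * (w 0 x)^2 \<le> ((1 + r) powr (1 + s') * x powr (1 + s')) * ((exp M2 * Cd)^2 * x powr (- 2 - 2 * \<sigma>))"
     by (rule mult_mono[OF 1 2]) auto
    also have "\<dots> = (1 + r) powr (1 + s') * (exp M2 * Cd)^2 * (x powr (1 + s') * x powr (- 2 - 2 * \<sigma>))" by simp
    also have "x powr (1 + s') * x powr (- 2 - 2 * \<sigma>) = x powr (- 1 - (2 * \<sigma> - s'))"
    proof -
     have "(1 + s') + (- 2 - 2 * \<sigma>) = - 1 - (2 * \<sigma> - s')" by simp
     thus ?thesis by (simp only: powr_add[symmetric])
    qed
    finally show "(\<phi> x)^2 * (w 0 x)^2 \<le> (1 + r) powr (1 + s') * (exp M2 * Cd)^2 * x powr (- 1 - (2 * \<sigma> - s'))" .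
   qed
   also have "\<dots> = (1 + r) powr (1 + s') * (exp M2 * Cd)^2 * integral {1..b} (\<lambda>x. x powr (- 1 - (2 * \<sigma> - s')))" by simp
   also have "\<dots> \<le> (1 + r) powr (1 + s') * (exp M2 * Cd)^2 * (1 / (2 * \<sigma> - s'))"
    by (intro mult_left_mono integral_powr_bound \<delta> ab) auto
   finally show ?thesis unfolding CJ_def using ab by (simp add: mult.commute[of "1 - a"] mult.left_commute[of "1 - a"] mult.assoc)
  qed
  ultimately have "\<kappa> / 2 * exp (- M) * integral I In \<le> CJ + T * (\<kappa> * (2 * exp M * CW))" by linarith
  hence I1f: "integral I In \<le> C0" unfolding C0_def using pos by (simp add: field_simps)
  have "integral I (\<lambda>t. integral {-R..X} (\<lambda>x. (max 1 (x + R + 2)) powr (1 + s') * (\<Theta> 1 t x)^2)) \<le> integral I (\<lambda>t. 64 * In t)"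
  proof (rule integral_mono_continuous)
   have mc: "continuous_on UNIV (\<lambda>x. (max 1 (x + R + 2)) powr (1 + s'))" by (intro continuous_intros) auto
   show "continuous_on I (\<lambda>t. integral {-R..X} (\<lambda>x. (max 1 (x + R + 2)) powr (1 + s') * (\<Theta> 1 t x)^2))"
    by (intro C0_space_integral C0_intros C0_space[OF mc] \<Theta>_C0) simp
   show "continuous_on I (\<lambda>t. 64 * In t)" by (intro continuous_intros Ic)
   fix t assume t: "t \<in> I"
   have cs: "continuous_on S (\<Theta> 1 t)" for S by (intro C0_slice_x[OF _ t] \<Theta>_C0) simp
   have "integral {-R..X} (\<lambda>x. (max 1 (x + R + 2)) powr (1 + s') * (\<Theta> 1 t x)^2) \<le> integral {-R..X} (\<lambda>x. 64 * ((\<phi> x)^2 * (\<Theta> 1 t x)^2))"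
   proof (rule integral_mono_continuous)
    fix x assume x: "x \<in> {-R..X}"
    have "(max 1 (x + R + 2)) powr (1 + s') \<le> 64 * (\<phi> x)^2" using \<phi>low[OF x] by (simp add: r_def add.assoc)
    hence "(max 1 (x + R + 2)) powr (1 + s') * (\<Theta> 1 t x)^2 \<le> 64 * (\<phi> x)^2 * (\<Theta> 1 t x)^2" by (rule mult_right_mono) simp
    thus "(max 1 (x + R + 2)) powr (1 + s') * (\<Theta> 1 t x)^2 \<le> 64 * ((\<phi> x)^2 * (\<Theta> 1 t x)^2)" by (simp add: mult.assoc)
   qed (intro continuous_intros continuous_on_subset[OF mc] cs \<phi>cS; simp)+
   also have "\<dots> = 64 * integral {-R..X} (\<lambda>x. (\<phi> x)^2 * (\<Theta> 1 t x)^2)" by simp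
   also have "\<dots> \<le> 64 * In t"
   proof -
    have "integral {-R..X} (\<lambda>x. (\<phi> x)^2 * (\<Theta> 1 t x)^2) \<le> integral {a..b} (\<lambda>x. (\<phi> x)^2 * (\<Theta> 1 t x)^2)"
     by (rule integral_subset_le) (use ab R in \<open>auto simp: a_def r_def intro!: integrable_continuous_real continuous_intros cs \<phi>cS\<close>)
    thus ?thesis unfolding In_def by simp
   qed
   finally show "integral {-R..X} (\<lambda>x. (max 1 (x + R + 2)) powr (1 + s') * (\<Theta> 1 t x)^2) \<le> 64 * In t" .
  qed
  also have "\<dots> \<le> 64 * C0" using I1f by simp
  finally show ?thesis .
 qed
 show ?thesis by (rule that[of "64 * C0"]) (use C00 main in auto)
qed

end

section \<open>Decay of the acoustic part\<close>

text \<open>The Leibniz rule relative to a convex set of positions; the integrating factor of the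
  sideways estimate is considered on the interval [A, X] only.\<close>

lemma time_integral_derivative_on:
 fixes f fx :: field
 assumes f: "\<And>x. x \<in> U ==> continuous_on {s..t} (\<lambda>\<tau>. f \<tau> x)" "continuous_on ({s..t} \<times> U) (\<lambda>q. fx (fst q) (snd q))"
  and d: "\<And>\<tau> x. \<tau> \<in> {s..t} ==> x \<in> U ==> (f \<tau> has_real_derivative fx \<tau> x) (at x within U)"
  and U: "convex U" "x \<in> U"
 shows "((\<lambda>x. integral {s..t} (\<lambda>\<tau>. f \<tau> x)) has_real_derivative integral {s..t} (\<lambda>\<tau>. fx \<tau> x)) (at x within U)"
proof -
 have "((\<lambda>x. integral (cbox s t) (\<lambda>\<tau>. f \<tau> x)) has_field_derivative integral (cbox s t) (\<lambda>\<tau>. fx \<tau> x)) (at x within U)"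
 proof (rule leibniz_rule_field_derivative)
  show "((\<lambda>x. f \<tau> x) has_real_derivative fx \<tau> y) (at y within U)" if "y \<in> U" "\<tau> \<in> cbox s t" for \<tau> y
   using d[of \<tau> y] that by auto
  show "(\<lambda>\<tau>. f \<tau> y) integrable_on cbox s t" if "y \<in> U" for y
   using f(1)[OF that] by (auto intro: integrable_continuous_real)
  have "continuous_on (U \<times> {s..t}) (\<lambda>q. fx (fst (snd q, fst q)) (snd (snd q, fst q)))"
   by (rule continuous_on_compose2[OF f(2), of _ "\<lambda>q. (snd q, fst q)"])
    (auto intro!: continuous_on_Pair continuous_on_fst continuous_on_snd continuous_on_id)
  thus "continuous_on (U \<times> cbox s t) (\<lambda>(y, \<tau>). fx \<tau> y)" by (simp add: case_prod_unfold)
 qed (use U in auto)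
 thus ?thesis by simp
qed

lemma integral_has_real_derivative_lower:
 fixes g :: "real \<Rightarrow> real"
 assumes c: "continuous_on {a..b} g" and x: "x \<in> {a..b}"
 shows "((\<lambda>x. integral {x..b} g) has_real_derivative - g x) (at x within {a..b})"
proof -
 have i: "g integrable_on {a..b}" by (rule integrable_continuous_real[OF c])
 have "((\<lambda>x. integral {a..b} g - integral {a..x} g) has_real_derivative 0 - g x) (at x within {a..b})"
  by (intro DERIV_diff DERIV_const integral_has_real_derivative[OF c x])
 hence "((\<lambda>x. integral {a..b} g - integral {a..x} g) has_real_derivative - g x) (at x within {a..b})" by simp
 thus ?thesis
 proof (rule has_field_derivative_transform_within[where d = 1])
  fix y assume "y \<in> {a..b}"
  thus "integral {a..b} g - integral {a..y} g = integral {y..b} g"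
   using Henstock_Kurzweil_Integration.integral_combine[of a y b g] i by auto
 qed (use x in auto)
qed

lemma continuous_on_slice:
 "continuous_on (S \<times> U) (\<lambda>p. f (fst p) (snd p)) ==> y \<in> U ==> continuous_on S (\<lambda>t. f t y)"
 using continuous_on_compose2[of "S \<times> U" "\<lambda>p. f (fst p) (snd p)" S "\<lambda>t. (t, y)"]
 by (simp add: continuous_on_Pair image_subset_iff)

context singular_family
begin

definition a where "a e t x = exp (- \<theta> e 0 t x)"
text \<open>Chosen such that p_x = - e a v_t + e G. Since p_t occurs in it only multiplied by e, it
  is bounded.\<close>

definition G where "G e t x = \<mu> * (P e t x * u e 2 t x) - a e t x * (u e 0 t x * u e 1 t x
   + \<kappa> / 2 * (Q e t x * ((\<theta>t e t x - e * pt e t x) * \<theta> e 1 t x + \<theta>tx e t x)))"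
text \<open>The factor 1/2 balances the two equations: 2 a v v_x contributes - e a v p_t and p p_x
  contributes - e a p v_t, and together these form - e a times the time derivative of v p.\<close>

definition q where "q e t x = a e t x * (v e t x)^2 + 1 / 2 * (p e 0 t x)^2"

lemma UB_a: "UB a" unfolding a_def[abs_def] by (intro UB_intros) simp
lemma UB_G: "UB G" unfolding G_def[abs_def] by (intro UB_intros UB_a UB_P UB_Q UB_\<theta>t UB_\<theta>tx UB_eps_pt; simp)
lemma UB_q: "UB q" unfolding q_def[abs_def] by (intro UB_intros UB_a UB_v; simp)

lemma a_C0: "e \<in> E ==> C_strip 0 T (a e)"
 unfolding a_def[abs_def] by (intro C0_intros \<theta>_C0) auto

lemma G_C0: "e \<in> E ==> C_strip 0 T (G e)"
 unfolding G_def[abs_def] by (intro C0_intros a_C0 C0s u_C0 p_C0 \<theta>_C0 \<theta>t_C0 pt_C0; simp)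

lemma q_C0: "e \<in> E ==> C_strip 0 T (q e)"
 unfolding q_def[abs_def] by (intro C0_intros a_C0 C0s u_C0 p_C0; simp)

lemma a_pos: "a e t x > 0" by (simp add: a_def)
lemma q_nonneg: "q e t x \<ge> 0" using a_pos[of e t x] by (simp add: q_def)

lemma a_bounds: assumes "e \<in> E" "t \<in> I" shows "exp (- M) \<le> a e t x" "a e t x \<le> exp M"
 using \<theta>_bound[OF assms(1) _ assms(2), of 0 x] by (auto simp: a_def)

lemma a_dx: "e \<in> E ==> t \<in> I ==> (a e t has_real_derivative - (a e t x * \<theta> e 1 t x)) (at x)"
 unfolding a_def[abs_def] by (auto intro!: derivative_eq_intros dx012)

lemma a_dt: "e \<in> E ==> t \<in> I ==> ((\<lambda>\<tau>. a e \<tau> x) has_real_derivative - (a e t x * \<theta>t e t x)) (at t within I)"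
 unfolding a_def[abs_def] by (auto intro!: derivative_eq_intros \<theta>_dt)

lemma p1_eq_G: "e \<in> E ==> t \<in> I ==> p e 1 t x = - (e * (a e t x * vt e t x)) + e * G e t x"
 using p1_eq[of e t x] unfolding G_def a_def by simp

definition qx where "qx e t x = - (a e t x * \<theta> e 1 t x * (v e t x)^2) - e * (a e t x * (vt e t x * p e 0 t x + v e t x * pt e t x))
 + e * (a e t x * v e t x * F e t x + p e 0 t x * G e t x)"

lemma q_dx:
 assumes e: "e \<in> E" and t: "t \<in> I"
 shows "(q e t has_real_derivative qx e t x) (at x)"
proof -
 have "(q e t has_real_derivative - (a e t x * \<theta> e 1 t x) * (v e t x)^2 + a e t x * (2 * v e t x * vx e t x) + p e 0 t x * p e 1 t x) (at x)"
  unfolding q_def[abs_def] by (auto intro!: derivative_eq_intros a_dx[OF e t] v_dx[OF e t] dx012[OF e t] simp: field_simps power2_eq_square)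
 also have "- (a e t x * \<theta> e 1 t x) * (v e t x)^2 + a e t x * (2 * v e t x * vx e t x) + p e 0 t x * p e 1 t x = qx e t x"
  unfolding vx_eq[OF e t] p1_eq_G[OF e t] qx_def by (simp add: field_simps)
 finally show ?thesis .
qed

lemma qx_C0: "e \<in> E ==> C_strip 0 T (qx e)"
 unfolding qx_def[abs_def] by (intro C0_intros a_C0 C0s G_C0 u_C0 p_C0 \<theta>_C0 pt_C0; simp)

text \<open>A majorant of |\<theta>_x| by Young's inequality with weight b. Unlike the absolute
  value it is differentiable in time, and its x-integral is controlled by a weighted L^2 bound of
  \<theta>_x together with the integral of 1/b.\<close>

definition m where "m b e t y = 1 / 2 * (b y * (\<theta> e 1 t y)^2 + 1 / b y)" for b :: "real \<Rightarrow> real"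

lemma m_ge: assumes "b y > 0" shows "\<bar>\<theta> e 1 t y\<bar> \<le> m b e t y"
proof -
 have "0 \<le> (b y * \<bar>\<theta> e 1 t y\<bar> - 1)^2" by simp
 also have "\<dots> = b y * (b y * (\<theta> e 1 t y)^2 - 2 * \<bar>\<theta> e 1 t y\<bar>) + 1"
  by (simp add: power2_eq_square algebra_simps)
 finally show ?thesis using assms unfolding m_def by (simp add: field_simps power2_eq_square)
qed

lemma m_C0:
 assumes "e \<in> E" "continuous_on UNIV b" "\<And>y. b y > 0"
 shows "C_strip 0 T (m b e)"
proof -
 have "\<And>y. b y \<noteq> 0" using assms(3) by (metis less_irrefl)
 hence "continuous_on UNIV (\<lambda>y. 1 / b y)" using assms(2) by (intro continuous_intros) auto
 thus ?thesis unfolding m_def[abs_def] using assms by (intro C0_intros C0_space \<theta>_C0) auto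
qed

lemma m_dt:
 assumes "e \<in> E" "t \<in> I"
 shows "((\<lambda>\<tau>. m b e \<tau> y) has_real_derivative b y * (\<theta> e 1 t y * \<theta>tx e t y)) (at t within I)"
 unfolding m_def[abs_def] by (auto intro!: derivative_eq_intros \<theta>1_dt assms)

lemma q_L2: "\<exists>C>0. \<forall>e\<in>E. \<forall>t\<in>I. \<forall>a b. integral {a..b} (q e t) \<le> C"
proof -
 obtain C2 where C2: "C2 > 0" "\<And>e t a b. e \<in> E ==> t \<in> I ==> integral {a..b} (\<lambda>x. (v e t x)^2) \<le> C2"
  using v_L2 by blast
 have M: "M \<ge> 0" using \<theta>_bound[of e1 0 0 0] pos by force
 have "integral {c..d} (q e t) \<le> exp M * C2 + M" if e: "e \<in> E" and t: "t \<in> I" for e t c d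
 proof -
  have cont: "continuous_on S (p e 0 t)" "continuous_on S (v e t)" for S
   by (intro C0_slice_x[OF _ t] p_C0 C0s e; simp)+
  have "integral {c..d} (q e t) \<le> integral {c..d} (\<lambda>x. exp M * (v e t x)^2 + (p e 0 t x)^2)"
  proof (rule integral_mono_continuous)
   show "continuous_on {c..d} (q e t)" by (rule C0_slice_x[OF q_C0[OF e] t])
   show "q e t x \<le> exp M * (v e t x)^2 + (p e 0 t x)^2" for x
    unfolding q_def using a_bounds(2)[OF e t, of x] by (intro add_mono mult_right_mono) auto
  qed (intro continuous_intros cont)+
  also have "\<dots> = exp M * integral {c..d} (\<lambda>x. (v e t x)^2) + integral {c..d} (\<lambda>x. (p e 0 t x)^2)"
   by (subst integral_add) (auto intro!: integrable_continuous_real continuous_intros cont)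
  also have "\<dots> \<le> exp M * C2 + M" using p_L2[OF e t, of c d] C2(2)[OF e t, of c d] by (intro add_mono mult_left_mono) auto
  finally show ?thesis .
 qed
 thus ?thesis using C2 M by (intro exI[of _ "exp M * C2 + M"]) (auto intro!: add_pos_nonneg)
qed

text \<open>An energy estimate in which x plays the role of time. The integrating factor \<open>\<psi>\<close> absorbs the term
 \<open>a\<^sub>x v^2\<close>, and the remaining term \<open>e a (v p)\<^sub>t\<close> is integrated by parts in t.\<close>

lemma sidewise_energy:
 assumes AB: "A \<le> B" "B < X" and b: "continuous_on UNIV b" "\<And>y. b y > 0"
  and C: "\<And>e t c d. e \<in> E ==> t \<in> I ==> integral {c..d} (q e t) \<le> C"
 obtains K where "K \<ge> 0" "\<And>e x. e \<in> E ==> x \<in> {A..B} ==>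
  integral I (\<lambda>t. exp (- integral {x..X} (m b e t)) * q e t x) \<le> T * C / (X - B) + K * e"
proof -
 obtain b1 where b1: "b1 > 0" "\<And>y. y \<in> {A..X} ==> b y \<le> b1"
 proof -
  have "bounded (b ` {A..X})" by (intro compact_imp_bounded compact_continuous_image continuous_on_subset[OF b(1)]) auto
  then obtain c where "\<And>y. y \<in> {A..X} ==> norm (b y) \<le> c" unfolding bounded_iff by blast
  hence "\<And>y. y \<in> {A..X} ==> b y \<le> max c 1" by fastforce
  thus ?thesis using that[of "max c 1"] by simp
 qed
 obtain K1 where K1: "K1 > 0" "\<And>e t x. e \<in> E ==> t \<in> I ==> \<bar>\<theta> e 1 t x * \<theta>tx e t x\<bar> \<le> K1"
  using UBE[OF UB_mult[OF UB_\<theta>[of 1] UB_\<theta>tx]] by auto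
 obtain K2 where K2: "K2 > 0" "\<And>e t x. e \<in> E ==> t \<in> I ==> \<bar>a e t x * v e t x * F e t x + p e 0 t x * G e t x\<bar> \<le> K2"
  using UBE[OF UB_add[OF UB_mult[OF UB_mult[OF UB_a UB_v] UB_F] UB_mult[OF UB_p[of 0] UB_G]]] by auto
 obtain K3 where K3: "K3 > 0" "\<And>e t x. e \<in> E ==> t \<in> I ==> \<bar>a e t x * (v e t x * p e 0 t x)\<bar> \<le> K3"
  using UBE[OF UB_mult[OF UB_a UB_mult[OF UB_v UB_p[of 0]]]] by auto
 obtain K4 where K4: "K4 > 0" "\<And>e t x. e \<in> E ==> t \<in> I ==> \<bar>\<theta>t e t x\<bar> \<le> K4"
  using UBE[OF UB_\<theta>t] by auto
 define J1 where "J1 = b1 * K1 * (X - A)"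
 have J1: "J1 \<ge> 0" using b1 K1 AB by (simp add: J1_def)
 \<comment> \<open>2 K3 bounds the boundary values of the integration by parts in t, K2 the forcing,
   and (J1 + K4) K3 the terms in which the time derivative falls on the integrating factor or on
   a.\<close>
 define K where "K = 2 * K3 + T * (K2 + (J1 + K4) * K3)"
 have K0: "K \<ge> 0" unfolding K_def using K2 K3 K4 J1 pos by (intro add_nonneg_nonneg mult_nonneg_nonneg) auto
 have main: "integral I (\<lambda>t. exp (- integral {x..X} (m b e t)) * q e t x) \<le> T * C / (X - B) + K * (X - A) * e"
  if e: "e \<in> E" and x0: "x \<in> {A..B}" for e x
 proof -
  have e0: "e > 0" using e by simp
  let ?U = "{A..X}"
  define J where "J t y = integral {y..X} (m b e t)" for t y
  define Jt where "Jt t y = integral {y..X} (\<lambda>y. b y * (\<theta> e 1 t y * \<theta>tx e t y))" for t y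
  \<comment> \<open>J integrates from y to the right end X, so the x-derivative of \<psi> is + m
    \<psi>: the weighted energy is nondecreasing in x up to an error of order e, and the energy at a
    point is bounded by the energies to its right.\<close>
  define \<psi> where "\<psi> t y = exp (- J t y)" for t y
  have mC: "C_strip 0 T (m b e)" by (rule m_C0[OF e b])
  have mtC: "C_strip 0 T (\<lambda>t y. b y * (\<theta> e 1 t y * \<theta>tx e t y))"
   by (intro C0_intros C0_space b C0s \<theta>_C0 e) simp
  have mi: "m b e t integrable_on {c..d}" if "t \<in> I" for t c d
   by (rule integrable_continuous_real[OF C0_slice_x[OF mC that]])
  have m0: "m b e t y \<ge> 0" for t y using m_ge[of b y e t] b(2)[of y] by linarith
  have J0: "J t y \<ge> 0" if "t \<in> I" for t y unfolding J_def by (rule integral_nonneg[OF mi[OF that]]) (simp add: m0)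
  have \<psi>: "0 < \<psi> t y" "t \<in> I ==> \<psi> t y \<le> 1" for t y using J0[of t y] by (auto simp: \<psi>_def)
  have Jt_bound: "\<bar>Jt t y\<bar> \<le> J1" if t: "t \<in> I" and y: "y \<in> ?U" for t y
  proof -
   have "norm (Jt t y) \<le> (b1 * K1) * (X - y)" unfolding Jt_def
   proof (rule integral_bound)
    fix z assume "z \<in> {y..X}"
    hence "b z \<le> b1" "b z > 0" using b1(2)[of z] b(2)[of z] y by auto
    thus "norm (b z * (\<theta> e 1 t z * \<theta>tx e t z)) \<le> b1 * K1"
     using K1(2)[OF e t, of z] unfolding real_norm_def abs_mult[of "b z"] by (intro mult_mono) auto
   qed (use y C0_slice_x[OF mtC t] in auto)
   also have "\<dots> \<le> J1" unfolding J1_def using b1 K1 y by (intro mult_left_mono) auto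
   finally show ?thesis by simp
  qed
  have J_dt: "((\<lambda>\<tau>. J \<tau> y) has_real_derivative Jt t y) (at t within I)" if "t \<in> I" for t y
   unfolding J_def Jt_def by (rule space_integral_derivative_t[OF mC mtC m_dt[OF e] that])
  have J_dx: "(J t has_real_derivative - m b e t y) (at y within ?U)" if t: "t \<in> I" and y: "y \<in> ?U" for t y
   unfolding J_def[abs_def] by (rule integral_has_real_derivative_lower[OF C0_slice_x[OF mC t] y])
  obtain m1 where m1: "\<And>t y. t \<in> I ==> y \<in> ?U ==> \<bar>m b e t y\<bar> \<le> m1"
  proof -
   have "bounded ((\<lambda>p. m b e (fst p) (snd p)) ` (I \<times> ?U))"
    by (intro compact_imp_bounded compact_continuous_image compact_Times continuous_on_subset[OF mC[unfolded C0_iff]]) auto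
   then obtain c where "\<forall>x\<in>(\<lambda>p. m b e (fst p) (snd p)) ` (I \<times> ?U). norm x \<le> c" unfolding bounded_iff by blast
   hence "\<bar>m b e t y\<bar> \<le> c" if "t \<in> I" "y \<in> ?U" for t y using that by force
   thus ?thesis by (rule that)
  qed
  have JC: "continuous_on (I \<times> ?U) (\<lambda>p. J (fst p) (snd p))"
  proof (rule continuous_on_lipschitz_product[where L = "max m1 J1"])
   fix t s y assume ts: "t \<in> I" "s \<in> I" and y: "y \<in> ?U"
   have "\<bar>J t y - J s y\<bar> \<le> J1 * \<bar>t - s\<bar>"
    by (rule has_real_derivative_lipschitz[where S = "I" and f' = "\<lambda>t. Jt t y"]) (use ts y J_dt Jt_bound in auto)
   also have "\<dots> \<le> max m1 J1 * \<bar>t - s\<bar>" by (intro mult_right_mono) auto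
   finally show "\<bar>J t y - J s y\<bar> \<le> max m1 J1 * \<bar>t - s\<bar>" .
  next
   fix t y z assume t: "t \<in> I" and yz: "y \<in> ?U" "z \<in> ?U"
   have "\<bar>J t y - J t z\<bar> \<le> m1 * \<bar>y - z\<bar>"
    by (rule has_real_derivative_lipschitz[where S = "?U" and f' = "\<lambda>y. - m b e t y"]) (use t yz J_dx m1 in auto)
   also have "\<dots> \<le> max m1 J1 * \<bar>y - z\<bar>" by (intro mult_right_mono) auto
   finally show "\<bar>J t y - J t z\<bar> \<le> max m1 J1 * \<bar>y - z\<bar>" .
  qed
  have \<psi>C: "continuous_on (I \<times> ?U) (\<lambda>p. \<psi> (fst p) (snd p))"
   unfolding \<psi>_def by (intro continuous_intros JC)
  have \<psi>t: "continuous_on I (\<lambda>t. \<psi> t y)" if "y \<in> ?U" for y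
   by (rule continuous_on_slice[OF \<psi>C that])
  have sub: "I \<times> ?U \<subseteq> I \<times> UNIV" by auto
  note rect = continuous_on_subset[OF _ sub]
  have rC: "continuous_on (I \<times> ?U) (\<lambda>p. \<psi> (fst p) (snd p) * q e (fst p) (snd p))"
   by (intro continuous_intros \<psi>C rect q_C0[OF e, unfolded C0_iff])
  define En where "En y = integral I (\<lambda>t. \<psi> t y * q e t y)" for y
  define Ex where "Ex t y = \<psi> t y * m b e t y * q e t y + \<psi> t y * qx e t y" for t y
  have ExC: "continuous_on (I \<times> ?U) (\<lambda>p. Ex (fst p) (snd p))"
   unfolding Ex_def by (intro continuous_intros \<psi>C rect[OF q_C0[OF e, unfolded C0_iff]] rect[OF qx_C0[OF e, unfolded C0_iff]] rect[OF mC[unfolded C0_iff]])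
  have \<psi>q_t: "continuous_on I (\<lambda>t. \<psi> t y * q e t y)" if "y \<in> ?U" for y
   by (intro continuous_intros \<psi>t[OF that] C0_slice_t[OF q_C0[OF e]]) simp
  have E_dx: "(En has_real_derivative integral I (\<lambda>t. Ex t y)) (at y within ?U)" if "y \<in> ?U" for y
   unfolding En_def[abs_def]
  proof (rule time_integral_derivative_on[OF \<psi>q_t ExC _ _ that])
   fix t y assume t: "t \<in> I" and y: "y \<in> ?U"
   have "(q e t has_real_derivative qx e t y) (at y within ?U)" by (rule has_field_derivative_at_within[OF q_dx[OF e t]])
   thus "((\<lambda>y. \<psi> t y * q e t y) has_real_derivative Ex t y) (at y within ?U)"
    unfolding Ex_def \<psi>_def using J_dx[OF t y] by (auto intro!: derivative_eq_intros simp: algebra_simps)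
  qed auto
  have E'_lower: "- (e * K) \<le> integral I (\<lambda>t. Ex t y)" if y: "y \<in> ?U" for y
  proof -
   \<comment> \<open>The time derivative of H contains the singular term of the energy identity;
     integrated over the time interval it leaves boundary values, while r collects the derivatives
     of \<psi> and a.\<close>
   define H where "H t = \<psi> t y * (a e t y * (v e t y * p e 0 t y))" for t
   define r where "r t = \<psi> t y * ((- Jt t y - \<theta>t e t y) * (a e t y * (v e t y * p e 0 t y)))" for t
   define H' where "H' t = r t + \<psi> t y * (a e t y * (vt e t y * p e 0 t y + v e t y * pt e t y))" for t
   have "(H has_real_derivative H' t) (at t within I)" if t: "t \<in> I" for t
    unfolding H_def[abs_def] H'_def r_def \<psi>_def using J_dt[OF t] a_dt[OF e t] v_dt[OF e t] p_dt[OF e t]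
    by (auto intro!: derivative_eq_intros simp: algebra_simps)
   hence H': "(H' has_integral H T - H 0) I" using pos by (intro FTC_within[where S = "I"]) auto
   have Hb: "\<bar>H t\<bar> \<le> K3" if t: "t \<in> I" for t
   proof -
    have "\<bar>H t\<bar> \<le> 1 * K3" unfolding H_def abs_mult[of "\<psi> t y"] using K3(2)[OF e t, of y] \<psi>[of t y] t by (intro mult_mono) auto
    thus ?thesis by simp
   qed
   have Exi: "((\<lambda>t. Ex t y) has_integral integral I (\<lambda>t. Ex t y)) I"
   proof (rule integrable_integral, rule integrable_continuous_real)
    show "continuous_on I (\<lambda>t. Ex t y)"
     by (rule continuous_on_slice[OF ExC y])
   qed
   have "((\<lambda>t. - e * H' t - e * (K2 + (J1 + K4) * K3)) has_integral (- e * (H T - H 0) - e * (K2 + (J1 + K4) * K3) * (T - 0))) I"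
    using has_integral_diff[OF has_integral_mult_right[OF H', of "- e"] has_integral_const_real[of "e * (K2 + (J1 + K4) * K3)" 0 T]] pos
    by (simp add: mult.commute mult.left_commute)
   from has_integral_le[OF this Exi]
   have "- e * (H T - H 0) - e * (K2 + (J1 + K4) * K3) * (T - 0) \<le> integral I (\<lambda>t. Ex t y)"
   proof -
    assume *: "(\<And>t. t \<in> I ==> - e * H' t - e * (K2 + (J1 + K4) * K3) \<le> Ex t y) ==>
     - e * (H T - H 0) - e * (K2 + (J1 + K4) * K3) * (T - 0) \<le> integral I (\<lambda>t. Ex t y)"
    show ?thesis
    proof (rule *)
     fix t assume t: "t \<in> I"
     have "\<bar>r t\<bar> \<le> 1 * ((J1 + K4) * K3)"
     proof -
      have "\<bar>- Jt t y - \<theta>t e t y\<bar> \<le> J1 + K4" using Jt_bound[OF t y] K4(2)[OF e t, of y] by linarith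
      thus ?thesis unfolding r_def abs_mult[of "\<psi> t y"] abs_mult[of "- Jt t y - \<theta>t e t y"]
       using K3(2)[OF e t, of y] \<psi>[of t y] t J1 K4 K3 by (intro mult_mono) auto
     qed
     hence r: "\<bar>e * r t\<bar> \<le> e * ((J1 + K4) * K3)" using e0 by (simp add: abs_mult)
     define f where "f = a e t y * v e t y * F e t y + p e 0 t y * G e t y"
     have "\<bar>\<psi> t y * f\<bar> \<le> 1 * K2" unfolding abs_mult f_def using K2(2)[OF e t, of y] \<psi>[of t y] t by (intro mult_mono) auto
     hence f: "\<bar>e * (\<psi> t y * f)\<bar> \<le> e * K2" using e0 by (simp add: abs_mult)
     \<comment> \<open>Here the integrating factor does its work: m dominates |\<theta>_x| and
       thereby absorbs the variation of a.\<close>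
     have "a e t y * \<theta> e 1 t y * (v e t y)^2 \<le> m b e t y * (a e t y * (v e t y)^2)"
      using m_ge[of b y e t, OF b(2)] a_pos[of e t y] mult_right_mono[of "\<theta> e 1 t y" "m b e t y" "a e t y * (v e t y)^2"]
      by (simp add: mult.assoc mult.left_commute)
     also have "\<dots> \<le> m b e t y * q e t y" unfolding q_def by (intro mult_left_mono m0) simp
     finally have "\<psi> t y * (a e t y * \<theta> e 1 t y * (v e t y)^2) \<le> \<psi> t y * (m b e t y * q e t y)"
      using \<psi>(1)[of t y] by (intro mult_left_mono) auto
     moreover have "Ex t y = \<psi> t y * (m b e t y * q e t y) - \<psi> t y * (a e t y * \<theta> e 1 t y * (v e t y)^2)
      - e * H' t + e * r t + e * (\<psi> t y * f)"
      unfolding Ex_def qx_def H'_def f_def by (simp add: algebra_simps)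
     ultimately show "- e * H' t - e * (K2 + (J1 + K4) * K3) \<le> Ex t y" using r f by (simp add: algebra_simps)
    qed
   qed
   moreover have "e * (H T - H 0) \<le> e * (2 * K3)" using Hb[of T] Hb[of 0] pos e0 by (intro mult_left_mono) auto
   ultimately show ?thesis unfolding K_def by (simp add: algebra_simps)
  qed
  have E_le: "En x \<le> En y + e * K * (X - A)" if "y \<in> {x..X}" for y
  proof -
   have sub: "{x..y} \<subseteq> ?U" using that x0 AB by auto
   have "((\<lambda>y. integral I (\<lambda>t. Ex t y)) has_integral (En y - En x)) {x..y}"
    by (rule FTC_within[where S = "?U"]) (use that sub E_dx in auto)
   from has_integral_le[OF has_integral_const_real[of "- (e * K)" x y] this]
   have "(y - x) * - (e * K) \<le> En y - En x" using E'_lower sub that by fastforce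
   moreover have "e * K * (y - x) \<le> e * K * (X - A)" using that x0 e0 K0 by (intro mult_left_mono) auto
   ultimately show ?thesis by (simp add: algebra_simps)
  qed
  have Ec: "continuous_on ?U En" using E_dx by (intro DERIV_continuous_on) auto
  have BX: "{B..X} \<subseteq> ?U" using AB by auto
  \<comment> \<open>No single point to the right is known to have small energy, so the comparison is
    averaged over [B, X]: the total energy there is at most T C, which gives the factor 1 / (X -
    B).\<close>
  have "(En x - e * K * (X - A)) * (X - B) = integral {B..X} (\<lambda>y. En x - e * K * (X - A))" using AB by simp
  also have "\<dots> \<le> integral {B..X} En"
   by (rule integral_mono_continuous) (use E_le x0 BX in \<open>auto intro!: continuous_on_subset[OF Ec] simp: algebra_simps\<close>)
  also have "\<dots> \<le> integral {B..X} (\<lambda>y. integral I (\<lambda>t. q e t y))"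
  proof (rule integral_mono_continuous[OF continuous_on_subset[OF Ec BX]])
   show "continuous_on {B..X} (\<lambda>y. integral I (\<lambda>t. q e t y))"
    by (rule continuous_on_subset[OF C0_time_integral[OF q_C0[OF e]]]) auto
   fix y assume "y \<in> {B..X}"
   hence "y \<in> ?U" using BX by auto
   thus "En y \<le> integral I (\<lambda>t. q e t y)" unfolding En_def
    by (intro integral_mono_continuous \<psi>q_t C0_slice_t[OF q_C0[OF e]])
     (use \<psi>(2) q_nonneg in \<open>auto intro: mult_left_le_one_le simp: less_imp_le[OF \<psi>(1)]\<close>)
  qed
  also have "\<dots> = integral I (\<lambda>t. integral {B..X} (q e t))"
   by (rule integral_swap_strip[OF q_C0[OF e], symmetric]) auto
  also have "\<dots> \<le> integral I (\<lambda>t. C)"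
   by (rule integral_mono_continuous[OF C0_space_integral[OF q_C0[OF e]]]) (use C[OF e] in auto)
  also have "\<dots> = T * C" using pos by simp
  finally have "En x - e * K * (X - A) \<le> T * C / (X - B)" using AB by (simp add: field_simps)
  thus ?thesis unfolding En_def \<psi>_def J_def by (simp add: algebra_simps)
 qed
 show ?thesis by (rule that[of "K * (X - A)"]) (use main K0 AB in auto)
qed

end

context singular_decay
begin

text \<open>The weight of the energy estimate for the limit. The exponent 1 + s' exceeds 1, so that
  1/\<beta> is integrable at +\<infinity>.\<close>

definition \<beta> :: "real \<Rightarrow> real \<Rightarrow> real" where "\<beta> R y = max 1 (y + R + 2) powr (1 + s')"

lemma \<beta>_pos: "\<beta> R y \<ge> 1" "\<beta> R y > 0"
proof -
 show "\<beta> R y \<ge> 1" unfolding \<beta>_def using s' by (intro ge_one_powr_ge_zero) auto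
 thus "\<beta> R y > 0" by linarith
qed

lemma \<beta>_cont: "continuous_on S (\<beta> R)" unfolding \<beta>_def by (intro continuous_intros) auto

lemma integral_inverse_\<beta>:
 assumes "R \<ge> 0" "X \<ge> - R" shows "integral {-R..X} (\<lambda>y. 1 / \<beta> R y) \<le> 1 / s'"
proof -
 have "integral {-R..X} (\<lambda>y. 1 / \<beta> R y) = integral {-R..X} (\<lambda>y. (y + (R + 2)) powr (- 1 - s'))"
 proof (rule Henstock_Kurzweil_Integration.integral_cong)
  fix y assume "y \<in> {-R..X}"
  hence "max 1 (y + R + 2) = y + (R + 2)" by auto
  thus "1 / \<beta> R y = (y + (R + 2)) powr (- 1 - s')"
   unfolding \<beta>_def using powr_minus_divide[of "y + (R + 2)" "1 + s'"] by simp
 qed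
 also have "\<dots> = integral {2..X + (R + 2)} (\<lambda>x. x powr (- 1 - s'))"
  using integral_shift_real_ivl[of 2 "R + 2" "X + (R + 2)" "\<lambda>x. x powr (- 1 - s')"] by simp
 also have "\<dots> \<le> integral {1..X + (R + 2)} (\<lambda>x. x powr (- 1 - s'))"
  by (rule integral_subset_le) (auto intro!: integrable_continuous_real continuous_intros)
 also have "\<dots> \<le> 1 / s'" by (rule integral_powr_bound) (use s' assms in auto)
 finally show ?thesis .
qed

text \<open>The bound must not depend on X, whereas the threshold e2 may. For fixed X, uniform
  convergence of \<theta>_x on [-R, X] makes the weighted error contribute at most 1 at each time,
  however large the weight has become there.\<close>

lemma weighted_energy_family:
 assumes R: "R \<ge> 0"
 obtains C where "C \<ge> 0" "\<And>X. X \<ge> 1 ==> \<exists>e2\<in>E. \<forall>e\<in>{0<..e2}.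
  integral I (\<lambda>t. integral {-R..X} (m (\<beta> R) e t)) \<le> C"
proof -
 obtain C where C: "C \<ge> 0" "\<And>X. X \<ge> 1 ==> integral I (\<lambda>t. integral {-R..X} (\<lambda>x. \<beta> R x * (\<Theta> 1 t x)^2)) \<le> C"
  using weighted_energy[OF R] unfolding \<beta>_def by blast
 show ?thesis
 proof (rule that[of "C + T * (1 + 1 / (2 * s'))"])
  show "C + T * (1 + 1 / (2 * s')) \<ge> 0" using C pos s' by (intro add_nonneg_nonneg mult_nonneg_nonneg) auto
  fix X :: real assume X: "X \<ge> 1"
  \<comment> \<open>\<beta> is largest at the right end, so an error with this square contributes at
    most 1 / (X + R) pointwise, and 1 over the whole interval.\<close>
  define \<eta> where "\<eta> = sqrt (1 / (\<beta> R X * (X + R)))"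
  have XR: "\<beta> R X * (X + R) > 0" using \<beta>_pos(2)[of R X] X R by (intro mult_pos_pos) auto
  have \<eta>: "\<eta> > 0" "\<eta>^2 = 1 / (\<beta> R X * (X + R))" using XR by (simp_all add: \<eta>_def)
  obtain e2 where e2: "e2 \<in> E" "\<And>e t x. e \<in> {0<..e2} ==> t \<in> I ==> \<bar>\<theta> e 1 t x - \<Theta> 1 t x\<bar> \<le> \<eta>"
   using \<Theta>_conv[OF _ \<eta>(1), of 1] by auto
  have "integral I (\<lambda>t. integral {-R..X} (m (\<beta> R) e t)) \<le> C + T * (1 + 1 / (2 * s'))" if e: "e \<in> {0<..e2}" for e
  proof -
   have e': "e \<in> E" using e e2 by auto
   have bC: "continuous_on S (\<lambda>y. 1 / \<beta> R y)" for S
   proof -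
    have "\<beta> R y \<noteq> 0" for y using \<beta>_pos(2)[of R y] by simp
    thus ?thesis by (intro continuous_intros \<beta>_cont) auto
   qed
   have gC: "C_strip 0 T (\<lambda>t x. \<beta> R x * (\<Theta> 1 t x)^2)" by (intro C0_intros C0_space \<beta>_cont \<Theta>_C0) simp
   have "integral {-R..X} (m (\<beta> R) e t) \<le> integral {-R..X} (\<lambda>x. \<beta> R x * (\<Theta> 1 t x)^2) + (1 + 1 / (2 * s'))" if t: "t \<in> I" for t
   proof -
    have "integral {-R..X} (m (\<beta> R) e t) \<le> integral {-R..X} (\<lambda>x. \<beta> R x * (\<Theta> 1 t x)^2 + (1 / (X + R) + 1 / 2 * (1 / \<beta> R x)))"
    proof (rule integral_mono_continuous)
     show "continuous_on {-R..X} (m (\<beta> R) e t)" by (rule C0_slice_x[OF m_C0[OF e' \<beta>_cont \<beta>_pos(2)] t])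
     show "continuous_on {-R..X} (\<lambda>x. \<beta> R x * (\<Theta> 1 t x)^2 + (1 / (X + R) + 1 / 2 * (1 / \<beta> R x)))"
      by (intro continuous_on_add continuous_on_mult_left continuous_on_const bC C0_slice_x[OF gC t])
     fix x assume x: "x \<in> {-R..X}"
     define d where "d = \<theta> e 1 t x - \<Theta> 1 t x"
     have d: "d^2 \<le> 1 / (\<beta> R X * (X + R))" unfolding \<eta>(2)[symmetric]
      by (rule square_mono_abs) (use e2(2)[OF e t, of x] in \<open>simp add: d_def\<close>)
     have "\<beta> R x \<le> \<beta> R X" unfolding \<beta>_def using x s' by (intro powr_mono2) auto
     hence "\<beta> R x * d^2 \<le> \<beta> R X * (1 / (\<beta> R X * (X + R)))" using d \<beta>_pos(2)[of R] by (intro mult_mono) (auto simp: less_imp_le)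
     also have "\<dots> = 1 / (X + R)" using \<beta>_pos(2)[of R X] by simp
     finally have 1: "\<beta> R x * d^2 \<le> 1 / (X + R)" .
     have "(\<theta> e 1 t x)^2 \<le> 2 * (\<Theta> 1 t x)^2 + 2 * d^2"
      using sum_squares_bound[of "\<Theta> 1 t x" d] by (simp add: d_def power2_eq_square algebra_simps)
     hence "\<beta> R x * (\<theta> e 1 t x)^2 \<le> \<beta> R x * (2 * (\<Theta> 1 t x)^2 + 2 * d^2)" using \<beta>_pos(2)[of R x] by (intro mult_left_mono) auto
     hence "1 / 2 * (\<beta> R x * (\<theta> e 1 t x)^2) \<le> \<beta> R x * (\<Theta> 1 t x)^2 + \<beta> R x * d^2" by (simp add: algebra_simps)
     thus "m (\<beta> R) e t x \<le> \<beta> R x * (\<Theta> 1 t x)^2 + (1 / (X + R) + 1 / 2 * (1 / \<beta> R x))"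
      unfolding m_def distrib_left using 1 by linarith
    qed
    also have "\<dots> = integral {-R..X} (\<lambda>x. \<beta> R x * (\<Theta> 1 t x)^2) + (integral {-R..X} (\<lambda>x. 1 / (X + R)) + 1 / 2 * integral {-R..X} (\<lambda>x. 1 / \<beta> R x))"
     by (subst integral_add, (intro integrable_continuous_real continuous_on_add continuous_on_mult_left continuous_on_const bC C0_slice_x[OF gC t])+)+ (simp only: integral_mult_right)
    also have "integral {-R..X} (\<lambda>x. 1 / (X + R)) = 1" using X R by simp
    finally show ?thesis using integral_inverse_\<beta>[of R X] R X by (simp add: field_simps)
   qed
   hence "integral I (\<lambda>t. integral {-R..X} (m (\<beta> R) e t)) \<le> integral I (\<lambda>t. integral {-R..X} (\<lambda>x. \<beta> R x * (\<Theta> 1 t x)^2) + (1 + 1 / (2 * s')))"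
    by (intro integral_mono_continuous continuous_on_add continuous_on_const C0_space_integral[OF gC] C0_space_integral[OF m_C0[OF e' \<beta>_cont \<beta>_pos(2)]])
   also have "\<dots> = integral I (\<lambda>t. integral {-R..X} (\<lambda>x. \<beta> R x * (\<Theta> 1 t x)^2)) + T * (1 + 1 / (2 * s'))"
    by (subst integral_add) (use pos in \<open>auto intro!: integrable_continuous_real C0_space_integral[OF gC]\<close>)
   finally show ?thesis using C(2)[OF X] by linarith
  qed
  thus "\<exists>e2\<in>E. \<forall>e\<in>{0<..e2}. integral I (\<lambda>t. integral {-R..X} (m (\<beta> R) e t)) \<le> C + T * (1 + 1 / (2 * s'))"
   using e2(1) by blast
 qed
qed

text \<open>The times are split according to whether the exponent J of the integrating factor
  exceeds L. L is chosen so large that, by the bound on the mean of J, the exceptional times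
  contribute at most \<eta>/3; then X so large that exp L T C / (X - R) \<le> \<eta>/3; and last e,
  because the constant K of the energy estimate depends on X.\<close>

lemma sidewise_decay:
 assumes R: "R \<ge> 0" and \<eta>: "\<eta> > 0"
 shows "\<exists>e2\<in>E. \<forall>e\<in>{0<..e2}. \<forall>x\<in>{-R..R}. integral I (\<lambda>t. q e t x) \<le> \<eta>"
proof -
 obtain C where C: "C > 0" "\<And>e t a b. e \<in> E ==> t \<in> I ==> integral {a..b} (q e t) \<le> C" using q_L2 by blast
 obtain Cq where Cq: "Cq > 0" "\<And>e t x. e \<in> E ==> t \<in> I ==> \<bar>q e t x\<bar> \<le> Cq" using UBE[OF UB_q] by blast
 obtain Cm where Cm: "Cm \<ge> 0" "\<And>X. X \<ge> 1 ==> \<exists>e2\<in>E. \<forall>e\<in>{0<..e2}. integral I (\<lambda>t. integral {-R..X} (m (\<beta> R) e t)) \<le> Cm"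
  using weighted_energy_family[OF R] by blast
 define L where "L = 3 * Cq * (Cm + 1) / \<eta>"
 have L: "L > 0" using Cq Cm \<eta> by (simp add: L_def)
 have L': "Cq / L * Cm \<le> \<eta> / 3"
 proof -
  have "Cq / L * Cm = \<eta> / 3 * (Cm / (Cm + 1))" using Cq(1) Cm(1) \<eta> unfolding L_def by (simp add: divide_simps)
  also have "\<dots> \<le> \<eta> / 3 * 1" using Cm(1) \<eta> by (intro mult_left_mono) auto
  finally show ?thesis by simp
 qed
 define X where "X = R + 1 + 3 * exp L * (T * C) / \<eta>"
 have pos': "3 * exp L * (T * C) / \<eta> > 0" using pos C \<eta> by (intro divide_pos_pos mult_pos_pos) auto
 have X: "X \<ge> 1" "R < X" using pos' R by (auto simp: X_def)
 have "3 * exp L * (T * C) / \<eta> \<le> X - R" by (simp add: X_def)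
 hence X': "exp L * (T * C / (X - R)) \<le> \<eta> / 3" using \<eta> X by (simp add: field_simps)
 obtain e3 where e3: "e3 \<in> E" "\<And>e. e \<in> {0<..e3} ==> integral I (\<lambda>t. integral {-R..X} (m (\<beta> R) e t)) \<le> Cm" using Cm(2)[OF X(1)] by blast
 obtain K where K: "K \<ge> 0" "\<And>e x. e \<in> E ==> x \<in> {-R..R} ==>
  integral I (\<lambda>t. exp (- integral {x..X} (m (\<beta> R) e t)) * q e t x) \<le> T * C / (X - R) + K * e"
  using sidewise_energy[OF _ X(2) \<beta>_cont \<beta>_pos(2) C(2), of "-R"] R by auto
 define e4 where "e4 = \<eta> / (3 * exp L * (K + 1))"
 have e4: "e4 > 0" using \<eta> K by (simp add: e4_def)
 show ?thesis
 proof (intro bexI[of _ "min e3 e4"] ballI)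
  fix e x assume e: "e \<in> {0<..min e3 e4}" and x: "x \<in> {-R..R}"
  have e1: "e \<in> E" "e \<in> {0<..e3}" "e \<le> e4" "e > 0" using e e3(1) by auto
  have mC: "C_strip 0 T (m (\<beta> R) e)" by (rule m_C0[OF e1(1) \<beta>_cont \<beta>_pos(2)])
  define J where "J t = integral {x..X} (m (\<beta> R) e t)" for t
  have JC: "continuous_on I J" unfolding J_def[abs_def] by (rule C0_space_integral[OF mC])
  have qC: "continuous_on I (\<lambda>t. q e t x)" by (rule C0_slice_t[OF q_C0[OF e1(1)]]) simp
  have m0: "m (\<beta> R) e t y \<ge> 0" for t y using m_ge[of "\<beta> R" y e t] \<beta>_pos(2)[of R y] by linarith
  have J: "0 \<le> J t" "J t \<le> integral {-R..X} (m (\<beta> R) e t)" if t: "t \<in> I" for t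
   unfolding J_def
   by (intro integral_nonneg integral_subset_le integrable_continuous_real C0_slice_x[OF mC t]; use m0 x X in auto)+
  \<comment> \<open>Both cases J \<le> L and J > L are covered by one pointwise inequality, so no
    measurable splitting of the time interval has to be made.\<close>
  have "integral I (\<lambda>t. q e t x) \<le> integral I (\<lambda>t. exp L * (exp (- J t) * q e t x) + Cq / L * J t)"
  proof (rule integral_mono_continuous[OF qC])
   show "continuous_on I (\<lambda>t. exp L * (exp (- J t) * q e t x) + Cq / L * J t)"
    by (intro continuous_on_add continuous_on_mult_left continuous_on_mult continuous_on_exp continuous_on_minus JC qC)
   fix t assume t: "t \<in> I"
   have q: "0 \<le> q e t x" "q e t x \<le> Cq" using q_nonneg[of e t x] Cq(2)[OF e1(1) t, of x] by auto
   show "q e t x \<le> exp L * (exp (- J t) * q e t x) + Cq / L * J t"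
   proof (cases "J t \<le> L")
    case True
    have "1 * q e t x \<le> exp (L - J t) * q e t x" using True q by (intro mult_right_mono) auto
    also have "\<dots> = exp L * (exp (- J t) * q e t x)" by (simp add: exp_diff exp_minus divide_inverse)
    also have "0 \<le> Cq / L * J t" using Cq L J(1)[OF t] by (intro mult_nonneg_nonneg) auto
    hence "exp L * (exp (- J t) * q e t x) \<le> exp L * (exp (- J t) * q e t x) + Cq / L * J t" by simp
    finally show ?thesis by simp
   next
    case False
    have "q e t x \<le> Cq / L * L" using q L by simp
    also have "\<dots> \<le> Cq / L * J t" using False Cq L by (intro mult_left_mono) auto
    finally show ?thesis using q by (simp add: add_increasing)
   qed
  qed
  also have "\<dots> = exp L * integral I (\<lambda>t. exp (- J t) * q e t x) + Cq / L * integral I J"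
   by (subst integral_add, (intro integrable_continuous_real continuous_on_mult_left continuous_on_mult continuous_on_exp continuous_on_minus JC qC)+) simp
  also have "\<dots> \<le> \<eta> / 3 + \<eta> / 3 + \<eta> / 3"
  proof -
   have "integral I J \<le> integral I (\<lambda>t. integral {-R..X} (m (\<beta> R) e t))"
    by (rule integral_mono_continuous[OF JC C0_space_integral[OF mC] J(2)])
   also have "\<dots> \<le> Cm" by (rule e3(2)[OF e1(2)])
   finally have "Cq / L * integral I J \<le> Cq / L * Cm" using Cq L by (intro mult_left_mono) auto
   moreover have "exp L * integral I (\<lambda>t. exp (- J t) * q e t x) \<le> exp L * (T * C / (X - R) + K * e)"
    using K(2)[OF e1(1) x] unfolding J_def by (intro mult_left_mono) auto
   moreover have "exp L * (K * e) \<le> \<eta> / 3"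
   proof -
    have "exp L * (K * e) \<le> exp L * ((K + 1) * e4)" using K e1 by (intro mult_left_mono mult_mono) auto
    also have "\<dots> = \<eta> / 3" using K by (simp add: e4_def)
    finally show ?thesis .
   qed
   ultimately show ?thesis using L' X' unfolding distrib_left by linarith
  qed
  finally show "integral I (\<lambda>t. q e t x) \<le> \<eta>" by simp
 qed (use e3 e4 in auto)
qed

text \<open>q dominates p^2 / 2 and, since a is bounded below, a multiple of v^2. Exchanging the
  integrals leaves the sideways energies, which are small uniformly in x \<in> [-R, R].\<close>

lemma local_L2_decay:
 assumes R: "R \<ge> 0"
 shows "((\<lambda>e. integral I (\<lambda>t. integral {-R..R} (\<lambda>x. (p e 0 t x)^2))) \<longlongrightarrow> 0) (at_right 0)"
  and "((\<lambda>e. integral I (\<lambda>t. integral {-R..R} (\<lambda>x. (v e t x)^2))) \<longlongrightarrow> 0) (at_right 0)"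
proof -
 have gen: "((\<lambda>e. integral I (\<lambda>t. integral {-R..R} (\<lambda>x. (f e t x)^2))) \<longlongrightarrow> 0) (at_right 0)"
  if f: "\<And>e. e \<in> E ==> C_strip 0 T (f e)" and K: "K > 0"
   and le: "\<And>e t x. e \<in> E ==> t \<in> I ==> (f e t x)^2 \<le> K * q e t x" for f K
 proof (rule tendstoI)
  fix \<eta> :: real assume \<eta>: "\<eta> > 0"
  have "\<eta> / (K * (2 * R + 1) * 2) > 0" using \<eta> K R by simp
  from sidewise_decay[OF R this]
  obtain e2 where e2: "e2 \<in> E" "\<And>e x. e \<in> {0<..e2} ==> x \<in> {-R..R} ==> integral I (\<lambda>t. q e t x) \<le> \<eta> / (K * (2 * R + 1) * 2)"
   by blast
  show "\<forall>\<^sub>F e in at_right 0. dist (integral I (\<lambda>t. integral {-R..R} (\<lambda>x. (f e t x)^2))) 0 < \<eta>"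
   unfolding eventually_at_right_field
  proof (intro exI[of _ e2] conjI allI impI)
   fix e assume "0 < e" "e < e2"
   hence e: "e \<in> {0<..e2}" "e \<in> E" using e2(1) by auto
   have fC: "C_strip 0 T (\<lambda>t x. (f e t x)^2)" by (intro C0_intros f e)
   have qC: "C_strip 0 T (\<lambda>t x. K * q e t x)" by (intro C0_intros q_C0 e)
   have "integral I (\<lambda>t. integral {-R..R} (\<lambda>x. (f e t x)^2)) = integral {-R..R} (\<lambda>x. integral I (\<lambda>t. (f e t x)^2))"
    by (rule integral_swap_strip[OF fC]) auto
   also have "\<dots> \<le> integral {-R..R} (\<lambda>x. K * (\<eta> / (K * (2 * R + 1) * 2)))"
   proof (rule integral_mono_continuous)
    show "continuous_on {-R..R} (\<lambda>x. integral I (\<lambda>t. (f e t x)^2))"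
     by (rule continuous_on_subset[OF C0_time_integral[OF fC]]) auto
    fix x assume x: "x \<in> {-R..R}"
    have "integral I (\<lambda>t. (f e t x)^2) \<le> integral I (\<lambda>t. K * q e t x)"
     by (intro integral_mono_continuous C0_slice_t[OF fC] C0_slice_t[OF qC] le e) auto
    also have "\<dots> = K * integral I (\<lambda>t. q e t x)" by simp
    also have "\<dots> \<le> K * (\<eta> / (K * (2 * R + 1) * 2))" using K by (intro mult_left_mono e2(2)[OF e(1) x]) auto
    finally show "integral I (\<lambda>t. (f e t x)^2) \<le> K * (\<eta> / (K * (2 * R + 1) * 2))" .
   qed simp
   also have "\<dots> = (2 * R) / (2 * R + 1) * (\<eta> / 2)" using K R by simp
   also have "\<dots> \<le> 1 * (\<eta> / 2)" using \<eta> R by (intro mult_right_mono) auto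
   also have "\<dots> < \<eta>" using \<eta> by simp
   finally have "integral I (\<lambda>t. integral {-R..R} (\<lambda>x. (f e t x)^2)) < \<eta>" .
   moreover have "0 \<le> integral I (\<lambda>t. integral {-R..R} (\<lambda>x. (f e t x)^2))"
   proof (rule integral_nonneg)
    show "(\<lambda>t. integral {-R..R} (\<lambda>x. (f e t x)^2)) integrable_on I"
     by (rule integrable_continuous_real[OF C0_space_integral[OF fC]])
    show "0 \<le> integral {-R..R} (\<lambda>x. (f e t x)^2)" if "t \<in> I" for t
     by (rule integral_nonneg) (auto intro: integrable_continuous_real C0_slice_x[OF fC that])
   qed
   ultimately show "dist (integral I (\<lambda>t. integral {-R..R} (\<lambda>x. (f e t x)^2))) 0 < \<eta>" by simp
  qed (use e2 in auto)
 qed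
 show "((\<lambda>e. integral I (\<lambda>t. integral {-R..R} (\<lambda>x. (p e 0 t x)^2))) \<longlongrightarrow> 0) (at_right 0)"
 proof (rule gen[of "\<lambda>e. p e 0" 2])
  show "(p e 0 t x)^2 \<le> 2 * q e t x" for e t x using a_pos[of e t x] by (simp add: q_def)
  show "C_strip 0 T (p e 0)" if "e \<in> E" for e by (rule p_C0[OF that]) simp
 qed simp
 show "((\<lambda>e. integral I (\<lambda>t. integral {-R..R} (\<lambda>x. (v e t x)^2))) \<longlongrightarrow> 0) (at_right 0)"
 proof (rule gen[of v "exp M"])
  fix e t x assume e: "e \<in> E" "t \<in> I"
  have "1 \<le> exp M * a e t x" using a_bounds(1)[OF e, of x] by (simp add: exp_minus field_simps)
  hence "1 * (v e t x)^2 \<le> exp M * a e t x * (v e t x)^2" by (intro mult_right_mono) auto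
  also have "\<dots> \<le> exp M * q e t x" unfolding q_def by (simp add: distrib_left mult.assoc)
  finally show "(v e t x)^2 \<le> exp M * q e t x" by simp
 next
  show "C_strip 0 T (v e)" if "e \<in> E" for e by (rule C0s[OF that])
 qed simp
qed

end

section \<open>Solutions of the compressible system\<close>

lemma converges_both_ends_bounded:
 fixes f :: "real \<Rightarrow> real"
 assumes c: "continuous_on UNIV f" and l: "(f \<longlongrightarrow> l) at_bot" "(f \<longlongrightarrow> r) at_top"
 obtains B where "B \<ge> 0" "\<And>x. \<bar>f x\<bar> \<le> B"
proof -
 have "\<forall>\<^sub>F x in at_bot. dist (f x) l < 1" "\<forall>\<^sub>F x in at_top. dist (f x) r < 1"
  using l by (auto dest: tendstoD[where e = 1])
 then obtain a b where ab: "\<And>x. x \<le> a ==> dist (f x) l < 1" "\<And>x. x \<ge> b ==> dist (f x) r < 1"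
  unfolding eventually_at_bot_linorder eventually_at_top_linorder by blast
 have "compact (f ` {a..b})" by (intro compact_continuous_image continuous_on_subset[OF c]) auto
 then obtain K where K: "\<And>x. x \<in> {a..b} ==> \<bar>f x\<bar> \<le> K"
  by (meson bounded_real compact_imp_bounded imageI)
 show ?thesis
 proof (rule that[of "\<bar>K\<bar> + \<bar>l\<bar> + \<bar>r\<bar> + 1"])
  fix x
  consider "x \<le> a" | "x \<ge> b" | "x \<in> {a..b}" by force
  thus "\<bar>f x\<bar> \<le> \<bar>K\<bar> + \<bar>l\<bar> + \<bar>r\<bar> + 1"
  proof cases
   case 1 thus ?thesis using ab(1)[of x] unfolding dist_real_def by linarith
  next
   case 2 thus ?thesis using ab(2)[of x] unfolding dist_real_def by linarith
  next
   case 3 thus ?thesis using K[of x] by linarith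
  qed
 qed simp
qed

lemma theta_wave_profile:
 assumes "self_similar_profile \<kappa> \<rho>m \<rho>p \<Xi>" "\<rho>m > 0" "\<rho>p > 0"
 shows "continuous_on UNIV (theta_wave \<Xi> t)" "\<exists>B\<ge>0. \<forall>t x. \<bar>theta_wave \<Xi> t x\<bar> \<le> B"
  "\<exists>f'. (\<forall>x. (theta_wave \<Xi> 0 has_real_derivative f' x) (at x)) \<and> continuous_on UNIV f'"
proof -
 define f where "f x = - ln (\<Xi> x)" for x
 have pos: "\<Xi> \<eta> > 0" for \<eta> using assms(1) by (simp add: self_similar_profile_def)
 have "smooth_upto (Suc (Suc 0)) \<Xi>" using assms(1) by (simp add: self_similar_profile_def C_line_iff_smooth_upto numeral_2_eq_2)
 then obtain g where g: "\<And>x. (\<Xi> has_real_derivative g x) (at x)" "smooth_upto (Suc 0) g" by auto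
 have \<Xi>0: "\<Xi> x \<noteq> 0" for x using pos[of x] by simp
 have f': "(f has_real_derivative - (g x / \<Xi> x)) (at x)" for x
  unfolding f_def[abs_def] using g(1)[of x] pos[of x] by (auto intro!: derivative_eq_intros simp: divide_inverse)
 have "continuous_on UNIV (\<lambda>x. - (g x / \<Xi> x))"
  using smooth_upto_continuous[OF g(2)] DERIV_continuous_UNIV[OF g(1)] \<Xi>0 by (intro continuous_intros) auto
 moreover have "theta_wave \<Xi> 0 = f" by (simp add: theta_wave_def f_def[abs_def])
 ultimately show "\<exists>f'. (\<forall>x. (theta_wave \<Xi> 0 has_real_derivative f' x) (at x)) \<and> continuous_on UNIV f'" using f' by metis
 have fc: "continuous_on UNIV f" by (rule DERIV_continuous_UNIV[OF f'])
 have tw: "theta_wave \<Xi> t = (\<lambda>x. f (x / sqrt (1 + t)))" for t by (simp add: theta_wave_def f_def)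
 show "continuous_on UNIV (theta_wave \<Xi> t)"
  unfolding tw divide_inverse by (intro continuous_on_compose2[OF fc] continuous_intros) auto
 have "(f \<longlongrightarrow> - ln \<rho>m) at_bot" "(f \<longlongrightarrow> - ln \<rho>p) at_top"
  unfolding f_def[abs_def] using assms by (auto intro!: tendsto_intros simp: self_similar_profile_def Let_def)
 then obtain B where "B \<ge> 0" "\<And>x. \<bar>f x\<bar> \<le> B" using converges_both_ends_bounded[OF fc] by metis
 thus "\<exists>B\<ge>0. \<forall>t x. \<bar>theta_wave \<Xi> t x\<bar> \<le> B" unfolding tw by blast
qed

text \<open>Only the indices (0, j) are extracted, for which the scaled derivative is a pure
  x-derivative; each term is bounded by the sum because all summands are nonnegative.\<close>

lemma Heps_sqD:
 assumes H: "Heps_sq s e T \<theta>w p u \<theta> t \<le> ennreal C"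
 shows "j \<le> s ==> L2sq ((dx ^^ j) p t) \<le> ennreal C"
  and "j \<le> s ==> L2sq ((dx ^^ j) u t) \<le> ennreal C"
  and "L2sq (\<lambda>x. \<theta> t x - \<theta>w t x) \<le> ennreal C"
  and "1 \<le> j ==> j \<le> s + 1 ==> L2sq ((dx ^^ j) \<theta> t) \<le> ennreal C"
  and "j \<le> s ==> (\<integral>\<^sup>+\<tau>\<in>{0..t}. (L2sq ((dx ^^ Suc j) p \<tau>) + L2sq ((dx ^^ Suc j) u \<tau>)) \<partial>lborel) \<le> ennreal C"
proof -
 have fin: "finite (orders m n)" for m n
  by (rule finite_subset[of _ "{..n} \<times> {..n}"]) (auto simp: orders_def)
 have mem: "f (0, j) \<le> sum f (orders m n)" if "m \<le> j" "j \<le> n" for f :: "nat \<times> nat \<Rightarrow> ennreal" and m n j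
  by (rule member_le_sum) (use that fin in \<open>auto simp: orders_def\<close>)
 have D0: "D e T (0, j) f \<tau> = (dx ^^ j) f \<tau>" for j f \<tau> by (auto simp: D_def)
 have DS: "(dx ^^ j) (dx f) = (dx ^^ Suc j) f" for j f by (simp add: funpow_swap1)
 note H' = H[unfolded Heps_sq_def]
 have add: "a \<le> c ==> a \<le> c + b" "b \<le> c ==> b \<le> a + c" for a b c :: ennreal
  by (simp_all add: add_increasing add_increasing2)
 show "L2sq ((dx ^^ j) p t) \<le> ennreal C" if "j \<le> s"
 proof -
  have "L2sq ((dx ^^ j) p t) \<le> L2sq (D e T (0, j) p t) + L2sq (D e T (0, j) u t)" by (simp add: D0)
  from order_trans[OF this mem[of 0 j s "\<lambda>\<alpha>. L2sq (D e T \<alpha> p t) + L2sq (D e T \<alpha> u t)"]] that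
  show ?thesis by (intro order_trans[OF _ H'] add(1)) auto
 qed
 show "L2sq ((dx ^^ j) u t) \<le> ennreal C" if "j \<le> s"
 proof -
  have "L2sq ((dx ^^ j) u t) \<le> L2sq (D e T (0, j) p t) + L2sq (D e T (0, j) u t)" by (simp add: D0)
  from order_trans[OF this mem[of 0 j s "\<lambda>\<alpha>. L2sq (D e T \<alpha> p t) + L2sq (D e T \<alpha> u t)"]] that
  show ?thesis by (intro order_trans[OF _ H'] add(1)) auto
 qed
 show "L2sq (\<lambda>x. \<theta> t x - \<theta>w t x) \<le> ennreal C"
  by (rule order_trans[OF _ H'], rule add(1), rule add(1), rule add(1), rule add(2), rule order_refl)
 show "L2sq ((dx ^^ j) \<theta> t) \<le> ennreal C" if "1 \<le> j" "j \<le> s + 1"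
  by (rule order_trans[OF _ H'], rule add(1), rule add(1), rule add(2))
   (use mem[OF that, of "\<lambda>\<alpha>. L2sq (D e T \<alpha> \<theta> t)"] in \<open>simp add: D0\<close>)
 show "(\<integral>\<^sup>+\<tau>\<in>{0..t}. (L2sq ((dx ^^ Suc j) p \<tau>) + L2sq ((dx ^^ Suc j) u \<tau>)) \<partial>lborel) \<le> ennreal C" if "j \<le> s"
  by (rule order_trans[OF _ H'], rule add(1), rule add(2))
   (use mem[of 0 j s "\<lambda>\<alpha>. \<integral>\<^sup>+\<tau>\<in>{0..t}. (L2sq (D e T \<alpha> (dx p) \<tau>) + L2sq (D e T \<alpha> (dx u) \<tau>)) \<partial>lborel"] that in \<open>simp only: D0 DS le0 simp_thms\<close>)
qed

text \<open>If f were too large at x, its Lipschitz bound would keep |f - g| above sqrt C on a unit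
  interval, against the L^2 bound. The derivative of g does not enter, so g may be the diffusion
  wave at any time.\<close>

lemma bounded_if_L2_close:
 fixes f g :: "real \<Rightarrow> real"
 assumes d: "\<And>x. (f has_real_derivative f' x) (at x)" and f': "\<And>x. \<bar>f' x\<bar> \<le> S"
  and g: "continuous_on UNIV g" "\<And>x. \<bar>g x\<bar> \<le> B" and L2: "L2sq (\<lambda>x. f x - g x) \<le> ennreal C" and C: "C \<ge> 0"
 shows "\<bar>f x\<bar> \<le> B + S + sqrt C"
proof (rule ccontr)
 assume n: "\<not> ?thesis"
 define D where "D = \<bar>f x\<bar> - B - S"
 have D: "D > sqrt C" using n by (simp add: D_def)
 have D0: "D \<ge> 0" using D C by (meson less_imp_le order_trans real_sqrt_ge_zero)
 have fc: "continuous_on UNIV (\<lambda>x. f x - g x)" by (intro continuous_on_diff g DERIV_continuous_UNIV[OF d])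
 have "D^2 = integral {x..x+1} (\<lambda>y. D^2)" by simp
 also have "\<dots> \<le> integral {x..x+1} (\<lambda>y. (f y - g y)^2)"
 proof (rule integral_mono_continuous)
  fix y assume y: "y \<in> {x..x+1}"
  have "\<bar>f x - f y\<bar> \<le> S * \<bar>x - y\<bar>"
   by (rule has_real_derivative_lipschitz[where S = UNIV and f' = f']) (use d f' in auto)
  also have "\<dots> \<le> S * 1" using y order_trans[OF abs_ge_zero f'] by (intro mult_left_mono) auto
  finally have "D \<le> \<bar>f y - g y\<bar>" using g(2)[of y] unfolding D_def by linarith
  thus "D^2 \<le> (f y - g y)^2" using D0 by (metis power2_abs power_mono)
 qed (auto intro!: continuous_on_power continuous_on_subset[OF fc])
 also have "\<dots> \<le> C" by (rule integral_square_le[OF fc L2 C])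
 finally have "D \<le> sqrt C" by (rule real_le_rsqrt)
 thus False using D by simp
qed

lemma C_strip_dx_pow_C0: "C_strip n T f ==> j \<le> n ==> C_strip 0 T ((dx ^^ j) f)"
 by (rule C_strip_dx_pow, rule C_strip_mono) auto

lemma C_strip_dx_pow_derivative:
 assumes "C_strip n T f" "j < n" "t \<in> {0..T}"
 shows "((dx ^^ j) f t has_real_derivative (dx ^^ Suc j) f t x) (at x)"
proof -
 have "C_strip (Suc 0) T ((dx ^^ j) f)" by (rule C_strip_dx_pow, rule C_strip_mono[OF assms(1)]) (use assms in simp)
 from C_strip_derivatives(1)[OF this assms(3)] show ?thesis by simp
qed

text \<open>A sup bound for one derivative uses the L^2 bounds of this and of the next one. For
  \<theta> these are available up to order s + 1, and s \<ge> 4 therefore gives bounds up to order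
  4.\<close>

lemma singular_family_of_solutions:
 assumes pos: "\<kappa> > 0" "\<mu> > 0" "T > 0" "0 < e1" "e1 \<le> 1" and s: "s \<ge> 4" and C: "C > 0"
  and cs: "\<And>e. e \<in> {0<..e1} ==> C_strip (s + 2) T (p e) \<and> C_strip (s + 2) T (u e) \<and> C_strip (s + 2) T (\<theta> e)"
  and sol: "\<And>e. e \<in> {0<..e1} ==> solves_system e \<kappa> \<mu> T (p e) (u e) (\<theta> e)"
  and H: "\<And>e t. e \<in> {0<..e1} ==> t \<in> {0..T} ==> Heps_sq s e T \<theta>w (p e) (u e) (\<theta> e) t \<le> ennreal C"
  and w: "\<And>t. continuous_on UNIV (\<theta>w t)" "\<And>t x. \<bar>\<theta>w t x\<bar> \<le> B" "B \<ge> 0"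
 shows "\<exists>M. singular_family \<kappa> \<mu> T e1 M (\<lambda>e j. (dx ^^ j) (p e)) (\<lambda>e j. (dx ^^ j) (u e)) (\<lambda>e j. (dx ^^ j) (\<theta> e))
  (\<lambda>e. dt T (p e)) (\<lambda>e. dt T (u e)) (\<lambda>e. dt T (\<theta> e))"
proof -
 have C0: "C_strip 0 T ((dx ^^ j) f)" if "C_strip (s + 2) T f" "j \<le> s + 2" for f j
  by (rule C_strip_dx_pow_C0[OF that])
 have dX: "((dx ^^ j) f t has_real_derivative (dx ^^ Suc j) f t x) (at x)" if "C_strip (s + 2) T f" "j \<le> s + 1" "t \<in> {0..T}" for f j t x
  by (rule C_strip_dx_pow_derivative[OF that(1) _ that(3)]) (use that in simp)
 have dT: "((\<lambda>\<tau>. f \<tau> x) has_real_derivative dt T f t x) (at t within {0..T})" if "C_strip (s + 2) T f" "t \<in> {0..T}" for f t x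
  using C_strip_derivatives(2)[of "s + 1" T f t x] that by simp
 have dT0: "C_strip 0 T (dt T f)" if "C_strip (s + 2) T f" for f
  using C_strip_mono[OF that, of "Suc 0"] by simp
 have cont: "continuous_on UNIV ((dx ^^ j) f t)" if "C_strip (s + 2) T f" "j \<le> s + 2" "t \<in> {0..T}" for f j t
  by (rule C0_slice_x[OF C0[OF that(1,2)] that(3)])
 have sup: "\<bar>(dx ^^ j) f t x\<bar> \<le> sqrt (3 * C)"
  if "C_strip (s + 2) T f" "j \<le> s + 1" "t \<in> {0..T}" "L2sq ((dx ^^ j) f t) \<le> ennreal C" "L2sq ((dx ^^ Suc j) f t) \<le> ennreal C" for f j t x
 proof (rule real_le_rsqrt)
  have "((dx ^^ j) f t x)^2 \<le> 2 * C + C"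
   by (rule sup_bound_from_L2[where f' = "(dx ^^ Suc j) f t"])
    (use that C in \<open>auto intro!: dX cont integral_square_le simp del: funpow.simps\<close>)
  thus "\<bar>(dx ^^ j) f t x\<bar>^2 \<le> 3 * C" by simp
 qed
 \<comment> \<open>sqrt (3 C) is the sup bound for quantities whose value and derivative have
   squared L^2 norm at most C; B + sqrt (3 C) + sqrt C serves the temperature itself, and C the
   integral bounds.\<close>
 define M where "M = B + sqrt (3 * C) + sqrt C + C"
 have M: "sqrt (3 * C) \<le> M" "C \<le> M" "B + sqrt (3 * C) + sqrt C \<le> M" using C w(3) by (auto simp: M_def)
 have one: "(dx ^^ 1) f = dx f" "(dx ^^ 0) f = f" "(dx ^^ 2) f = dx (dx f)" for f by (simp_all add: numeral_2_eq_2)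
 show ?thesis
 proof (intro exI[of _ M], unfold_locales)
  fix e assume e: "e \<in> {0<..e1}"
  have e0: "e \<noteq> 0" using e by auto
  note c = cs[OF e, THEN conjunct1] cs[OF e, THEN conjunct2, THEN conjunct1] cs[OF e, THEN conjunct2, THEN conjunct2]
  show "C_strip 0 T ((dx ^^ j) (p e))" "C_strip 0 T ((dx ^^ j) (u e))" "C_strip 0 T ((dx ^^ j) (\<theta> e))" if "j \<le> 4" for j
   by (rule C0[OF c(1)] C0[OF c(2)] C0[OF c(3)], use that s in simp)+
  show "C_strip 0 T (dt T (p e))" "C_strip 0 T (dt T (u e))" "C_strip 0 T (dt T (\<theta> e))"
   by (rule dT0[OF c(1)] dT0[OF c(2)] dT0[OF c(3)])+
  fix t x assume t: "t \<in> {0..T}"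
  note h = Heps_sqD[OF H[OF e t]]
  show "((dx ^^ j) (p e) t has_real_derivative (dx ^^ Suc j) (p e) t x) (at x)"
   "((dx ^^ j) (u e) t has_real_derivative (dx ^^ Suc j) (u e) t x) (at x)"
   "((dx ^^ j) (\<theta> e) t has_real_derivative (dx ^^ Suc j) (\<theta> e) t x) (at x)" if "j < 4" for j
   by (rule dX[OF c(1) _ t] dX[OF c(2) _ t] dX[OF c(3) _ t], use that s in simp)+
  show "((\<lambda>\<tau>. (dx ^^ 0) (p e) \<tau> x) has_real_derivative dt T (p e) t x) (at t within {0..T})"
   "((\<lambda>\<tau>. (dx ^^ 0) (u e) \<tau> x) has_real_derivative dt T (u e) t x) (at t within {0..T})"
   "((\<lambda>\<tau>. (dx ^^ 0) (\<theta> e) \<tau> x) has_real_derivative dt T (\<theta> e) t x) (at t within {0..T})"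
   unfolding one by (rule dT[OF c(1) t] dT[OF c(2) t] dT[OF c(3) t])+
  show "\<bar>(dx ^^ j) (p e) t x\<bar> \<le> M" if "j \<le> 2" for j
   by (rule order_trans[OF sup[OF c(1) _ t h(1) h(1)] M(1)]) (use that s in auto)
  show "\<bar>(dx ^^ j) (u e) t x\<bar> \<le> M" if "j \<le> 2" for j
   by (rule order_trans[OF sup[OF c(2) _ t h(2) h(2)] M(1)]) (use that s in auto)
  have \<theta>b: "\<bar>(dx ^^ j) (\<theta> e) t y\<bar> \<le> sqrt (3 * C)" if "1 \<le> j" "j \<le> 4" for j y
   by (rule sup[OF c(3) _ t h(4) h(4)]) (use that s in auto)
  show "\<bar>(dx ^^ j) (\<theta> e) t x\<bar> \<le> M" if "j \<le> 4" for j
  proof (cases "j = 0")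
   case True
   have "\<bar>\<theta> e t x\<bar> \<le> B + sqrt (3 * C) + sqrt C"
    by (rule bounded_if_L2_close[where f' = "(dx ^^ 1) (\<theta> e) t" and g = "\<theta>w t"])
     (use dX[OF c(3) _ t, of 0] \<theta>b[of 1] w h(3) C in auto)
   thus ?thesis using True M by simp
  next
   case False
   thus ?thesis using order_trans[OF \<theta>b[of j x] M(1)] that by simp
  qed
  show "integral {a..b} (\<lambda>x. ((dx ^^ 0) (p e) t x)^2) \<le> M" "integral {a..b} (\<lambda>x. ((dx ^^ 0) (u e) t x)^2) \<le> M"
   "integral {a..b} (\<lambda>x. ((dx ^^ 1) (\<theta> e) t x)^2) \<le> M" for a b
  proof -
   show "integral {a..b} (\<lambda>x. ((dx ^^ 0) (p e) t x)^2) \<le> M"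
    by (rule order_trans[OF integral_square_le[OF cont[OF c(1) _ t] h(1)] M(2)]) (use C in auto)
   show "integral {a..b} (\<lambda>x. ((dx ^^ 0) (u e) t x)^2) \<le> M"
    by (rule order_trans[OF integral_square_le[OF cont[OF c(2) _ t] h(2)] M(2)]) (use C in auto)
   show "integral {a..b} (\<lambda>x. ((dx ^^ 1) (\<theta> e) t x)^2) \<le> M"
    by (rule order_trans[OF integral_square_le[OF cont[OF c(3) _ t] h(4)] M(2)]) (use C in auto)
  qed
  note S = sol[OF e, unfolded solves_system_def, rule_format, OF t, of x]
  have d: "(p e t has_real_derivative dx (p e) t x) (at x)" "(u e t has_real_derivative dx (u e) t x) (at x)"
   "(\<theta> e t has_real_derivative dx (\<theta> e) t x) (at x)" "(dx (\<theta> e) t has_real_derivative dx (dx (\<theta> e)) t x) (at x)"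
   using dX[OF c(1) _ t, of 0] dX[OF c(2) _ t, of 0] dX[OF c(3) _ t, of 0] dX[OF c(3) _ t, of 1] by (simp_all add: one)
  have 1: "dx (\<lambda>t x. 2 * u e t x - \<kappa> * exp (- e * p e t x + \<theta> e t x) * dx (\<theta> e) t x) t x
   = 2 * dx (u e) t x - \<kappa> * exp (- e * p e t x + \<theta> e t x) * ((dx (\<theta> e) t x - e * dx (p e) t x) * dx (\<theta> e) t x + dx (dx (\<theta> e)) t x)"
   unfolding dx_def[of "\<lambda>t x. 2 * u e t x - \<kappa> * exp (- e * p e t x + \<theta> e t x) * dx (\<theta> e) t x"]
   by (rule DERIV_imp_deriv) (auto intro!: derivative_eq_intros d simp: algebra_simps)
  have 2: "dx (\<lambda>t x. exp (\<theta> e t x) * dx (\<theta> e) t x) t x = exp (\<theta> e t x) * ((dx (\<theta> e) t x)^2 + dx (dx (\<theta> e)) t x)"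
   unfolding dx_def[of "\<lambda>t x. exp (\<theta> e t x) * dx (\<theta> e) t x"]
   by (rule DERIV_imp_deriv) (auto intro!: derivative_eq_intros d simp: algebra_simps power2_eq_square)
  show "dt T (p e) t x + (dx ^^ 0) (u e) t x * (dx ^^ 1) (p e) t x
     + 1 / e * (2 * (dx ^^ 1) (u e) t x - \<kappa> * exp (- e * (dx ^^ 0) (p e) t x + (dx ^^ 0) (\<theta> e) t x) * (((dx ^^ 1) (\<theta> e) t x - e * (dx ^^ 1) (p e) t x) * (dx ^^ 1) (\<theta> e) t x + (dx ^^ 2) (\<theta> e) t x))
    = \<mu> * e * exp (- e * (dx ^^ 0) (p e) t x) * ((dx ^^ 1) (u e) t x)^2 + \<kappa> * exp (- e * (dx ^^ 0) (p e) t x + (dx ^^ 0) (\<theta> e) t x) * (dx ^^ 1) (p e) t x * (dx ^^ 1) (\<theta> e) t x"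
   unfolding one by (rule S[THEN conjunct1, unfolded 1])
  show "exp (- (dx ^^ 0) (\<theta> e) t x) * (dt T (u e) t x + (dx ^^ 0) (u e) t x * (dx ^^ 1) (u e) t x) + 1 / e * (dx ^^ 1) (p e) t x
    = \<mu> * exp (- e * (dx ^^ 0) (p e) t x) * (dx ^^ 2) (u e) t x"
   unfolding one by (rule S[THEN conjunct2, THEN conjunct1])
  show "dt T (\<theta> e) t x + (dx ^^ 0) (u e) t x * (dx ^^ 1) (\<theta> e) t x + (dx ^^ 1) (u e) t x
    = \<kappa> * exp (- e * (dx ^^ 0) (p e) t x) * (exp ((dx ^^ 0) (\<theta> e) t x) * (((dx ^^ 1) (\<theta> e) t x)^2 + (dx ^^ 2) (\<theta> e) t x))
     + \<mu> * e^2 * exp (- e * (dx ^^ 0) (p e) t x) * ((dx ^^ 1) (u e) t x)^2"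
   unfolding one by (rule S[THEN conjunct2, THEN conjunct2, unfolded 2])
 qed (use pos in auto)
qed

section \<open>From information in L^2 or almost everywhere to pointwise statements\<close>

lemma AE_dense:
 assumes "AE x in lborel. P (x :: real)" "a < b"
 obtains x where "a < x" "x < b" "P x"
proof -
 obtain N where N: "{x. \<not> P x} \<subseteq> N" "emeasure lborel N = 0" "N \<in> sets lborel"
  using AE_E[OF assms(1)] by (auto simp: space_lborel)
 have "\<not> {a<..<b} \<subseteq> N"
 proof
  assume "{a<..<b} \<subseteq> N"
  hence "emeasure lborel {a<..<b} \<le> emeasure lborel N" by (rule emeasure_mono) (use N in auto)
  thus False using N(2) assms(2) by simp
 qed
 then obtain x where "x \<in> {a<..<b}" "x \<notin> N" by blast
 thus ?thesis using N(1) that[of x] by auto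
qed

text \<open>A set of full measure contains points arbitrarily close to x on its right, which stay in
  the half-line, and continuity carries the inequality over to x.\<close>

lemma AE_imp_le_everywhere:
 fixes f g h :: "real \<Rightarrow> real"
 assumes ae: "AE x in lborel. f x = g x" and le: "\<And>x. x \<ge> c ==> g x \<le> h x"
  and cont: "continuous_on {c..} f" "continuous_on {c..} h" and x: "x \<ge> c"
 shows "f x \<le> h x"
proof -
 have "\<exists>y. x < y \<and> y < x + 1 / real (Suc n) \<and> f y = g y" for n
  using AE_dense[OF ae, of x "x + 1 / real (Suc n)"] by (metis less_add_same_cancel1 of_nat_0_less_iff zero_less_Suc zero_less_divide_1_iff)
 then obtain y where y: "\<And>n. x < y n" "\<And>n. y n < x + 1 / real (Suc n)" "\<And>n. f (y n) = g (y n)" by metis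
 have "(\<lambda>n. x + 1 / real (Suc n)) \<longlonglongrightarrow> x + 0" by (intro tendsto_intros LIMSEQ_Suc[OF lim_1_over_n])
 hence yx: "y \<longlonglongrightarrow> x"
  by (intro tendsto_sandwich[of "\<lambda>_. x" y sequentially "\<lambda>n. x + 1 / real (Suc n)" x]) (simp_all add: less_imp_le[OF y(1)] less_imp_le[OF y(2)] del: of_nat_Suc)
 have yc: "y n \<ge> c" for n using y(1)[of n] x by simp
 have "(\<lambda>n. f (y n)) \<longlonglongrightarrow> f x" "(\<lambda>n. h (y n)) \<longlonglongrightarrow> h x"
  by (rule continuous_on_tendsto_compose[OF cont(1) yx] continuous_on_tendsto_compose[OF cont(2) yx]; use yc x in auto)+
 thus ?thesis
  by (rule LIMSEQ_le) (use le yc y(3) in auto)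
qed

lemma L2sq_eq_0_imp_AE:
 assumes [measurable]: "f \<in> borel_measurable borel" and "L2sq f = 0" shows "AE x in lborel. f x = 0"
 using assms unfolding L2sq_def by (simp add: nn_integral_0_iff_AE)

text \<open>On the half-line g - c is square integrable, by its decay on [1, \<infinity>) and its
  boundedness on [0, 1], and so is g - f. Hence the profile f itself approaches c in L^2, which is
  how decay of the data becomes a property of the diffusion wave.\<close>

lemma half_line_L2:
 fixes f g :: "real \<Rightarrow> real"
 assumes f: "continuous_on UNIV f" and g: "continuous_on UNIV g" and L2: "L2sq (\<lambda>x. g x - f x) \<le> ennreal A"
  and K: "\<And>x. x \<in> {0..1} ==> \<bar>g x - c\<bar> \<le> K" and \<sigma>: "\<sigma> > 0"
  and D: "\<And>x. x \<ge> 1 ==> \<bar>g x - c\<bar> \<le> Cg * x powr (- 1 - \<sigma>)"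
 shows "L2sq (\<lambda>x. indicator {0..} x * (f x - c)) \<le> 2 * ennreal (K^2 + Cg^2) + 2 * ennreal A"
proof -
 have [measurable]: "f \<in> borel_measurable borel" "g \<in> borel_measurable borel"
  using f g by (auto intro: borel_measurable_continuous_onI)
 have gc: "continuous_on S (\<lambda>x. (g x - c)^2)" for S by (intro continuous_intros continuous_on_subset[OF g]) auto
 have "integral {0..1 + real n} (\<lambda>x. (g x - c)^2) \<le> K^2 + Cg^2" for n
 proof -
  have "integral {0..1 + real n} (\<lambda>x. (g x - c)^2) = integral {0..1} (\<lambda>x. (g x - c)^2) + integral {1..1 + real n} (\<lambda>x. (g x - c)^2)"
   by (rule Henstock_Kurzweil_Integration.integral_combine[symmetric]) (auto intro: integrable_continuous_real gc)
  also have "integral {0..1} (\<lambda>x. (g x - c)^2) \<le> integral {0..1} (\<lambda>x::real. K^2)"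
   by (rule integral_mono_continuous[OF gc]) (auto intro!: square_mono_abs K)
  also have "integral {1..1 + real n} (\<lambda>x. (g x - c)^2) \<le> integral {1..1 + real n} (\<lambda>x. Cg^2 * x powr (- 1 - 1))"
  proof (rule integral_mono_continuous[OF gc])
   fix x assume x: "x \<in> {1..1 + real n}"
   have "(g x - c)^2 \<le> (Cg * x powr (- 1 - \<sigma>))^2" by (rule square_mono_abs[OF D]) (use x in simp)
   also have "\<dots> = Cg^2 * x powr (2 * (- 1 - \<sigma>))"
    by (simp add: power_mult_distrib power2_eq_square powr_add[symmetric])
   \<comment> \<open>The exponent - 2 - 2 \<sigma> is weakened to - 2, written so as to match the
     tail integral with \<delta> = 1.\<close>
   also have "\<dots> \<le> Cg^2 * x powr (- 1 - 1)" using x \<sigma> by (intro mult_left_mono powr_mono) auto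
   finally show "(g x - c)^2 \<le> Cg^2 * x powr (- 1 - 1)" .
  qed (auto intro!: continuous_intros)
  also have "\<dots> = Cg^2 * integral {1..1 + real n} (\<lambda>x. x powr (- 1 - 1))" by simp
  also have "\<dots> \<le> Cg^2 * (1 / 1)" by (intro mult_left_mono integral_powr_bound) auto
  finally show ?thesis by simp
 qed
 note int = this
 have "L2sq (\<lambda>x. indicator {0..} x * (g x - c)) \<le> ennreal (K^2 + Cg^2)"
 proof (rule L2sq_tendsto_le[where N = 0 and f = "\<lambda>n x. indicator {0..1 + real n} x * (g x - c)"])
  show "AE x in lborel. (\<lambda>n. indicator {0..1 + real n} x * (g x - c)) \<longlonglongrightarrow> indicator {0..} x * (g x - c)"
  proof (rule AE_I2, rule tendsto_eventually)
   fix x :: real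
   obtain N :: nat where N: "\<bar>x\<bar> \<le> real N" using real_arch_simple by blast
   show "\<forall>\<^sub>F n in sequentially. indicator {0..1 + real n} x * (g x - c) = indicator {0..} x * (g x - c)"
    using eventually_ge_at_top[of N] by eventually_elim (use N in \<open>auto simp: indicator_def\<close>)
  qed
  fix n
  have "L2sq (\<lambda>x. indicator {0..1 + real n} x * (g x - c)) = (\<integral>\<^sup>+x\<in>{0..1 + real n}. ennreal ((g x - c)^2) \<partial>lborel)"
   unfolding L2sq_def by (rule nn_integral_cong) (auto simp: indicator_def)
  also have "\<dots> = ennreal (integral {0..1 + real n} (\<lambda>x. (g x - c)^2))"
   by (rule nn_integral_Icc_continuous[OF gc]) simp
  also have "\<dots> \<le> ennreal (K^2 + Cg^2)" by (rule ennreal_leI[OF int])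
  finally show "L2sq (\<lambda>x. indicator {0..1 + real n} x * (g x - c)) \<le> ennreal (K^2 + Cg^2)" .
 qed measurable
 moreover have "L2sq (\<lambda>x. indicator {0..} x * (g x - f x)) \<le> ennreal A"
  by (rule order_trans[OF _ L2]) (auto simp: L2sq_def indicator_def intro!: nn_integral_mono)
 moreover have "L2sq (\<lambda>x. indicator {0..} x * (f x - c)) \<le> 2 * L2sq (\<lambda>x. indicator {0..} x * (g x - c)) + 2 * L2sq (\<lambda>x. indicator {0..} x * (g x - f x))"
  using L2sq_diff_le[of "\<lambda>x. indicator {0..} x * (g x - c)" "\<lambda>x. indicator {0..} x * (g x - f x)"]
  by (simp add: algebra_simps)
 ultimately show ?thesis by (meson add_mono mult_left_mono order_trans zero_le)
qed

context singular_family
begin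

text \<open>A function with bounded slope that is large at one point is large on an interval of
  fixed length, hence has a large L^2 norm. So convergence in L^2 and the uniform bound on
  \<theta>_x together give the uniform Cauchy property.\<close>

lemma init_Cauchy_if_L2_convergent:
 assumes [measurable]: "g \<in> borel_measurable borel"
  and conv: "((\<lambda>e. L2sq (\<lambda>x. \<theta> e 0 0 x - g x)) \<longlongrightarrow> 0) (at_right 0)" and \<eta>: "\<eta> > 0"
 shows "\<exists>e2\<in>E. \<forall>e\<in>{0<..e2}. \<forall>e'\<in>{0<..e2}. \<forall>x. \<bar>\<theta> e 0 0 x - \<theta> e' 0 0 x\<bar> \<le> \<eta>"
proof -
 have M: "M \<ge> 0" using \<theta>_bound[of e1 0 0 0] pos by force
 \<comment> \<open>The difference of two initial temperatures has slope at most 2 M, so it stays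
   above \<eta>/2 on an interval of length d; its squared norm there is at least 8 \<delta>, while
   only 4 \<delta> is available.\<close>
 define d where "d = \<eta> / (4 * (M + 1))"
 have d: "d > 0" using \<eta> M by (simp add: d_def)
 define \<delta> where "\<delta> = (\<eta> / 2)^2 * d / 8"
 have \<delta>: "\<delta> > 0" using \<eta> d by (simp add: \<delta>_def)
 have "\<forall>\<^sub>F e in at_right 0. L2sq (\<lambda>x. \<theta> e 0 0 x - g x) < ennreal \<delta>"
  using order_tendstoD(2)[OF conv, of "ennreal \<delta>"] \<delta> by simp
 then obtain b where b: "b > 0" "\<And>e. 0 < e ==> e < b ==> L2sq (\<lambda>x. \<theta> e 0 0 x - g x) < ennreal \<delta>"
  unfolding eventually_at_right_field by auto
 show ?thesis
 proof (intro bexI[of _ "min e1 (b / 2)"] ballI allI)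
  fix e e' x assume e: "e \<in> {0<..min e1 (b / 2)}" "e' \<in> {0<..min e1 (b / 2)}"
  have e1: "e \<in> E" "e' \<in> E" and eb: "0 < e" "e < b" "0 < e'" "e' < b" using e b by auto
  have t0: "(0::real) \<in> I" using pos by simp
  define h where "h y = \<theta> e 0 0 y - \<theta> e' 0 0 y" for y
  have hd: "(h has_real_derivative \<theta> e 1 0 y - \<theta> e' 1 0 y) (at y)" for y
   unfolding h_def[abs_def] by (intro DERIV_diff dx012 e1 t0)
  have hc: "continuous_on UNIV h" by (rule DERIV_continuous_UNIV[OF hd])
  have c: "continuous_on UNIV (\<theta> e 0 0)" "continuous_on UNIV (\<theta> e' 0 0)" by (intro C0_slice_x[OF _ t0] \<theta>_C0 e1; simp)+
  have [measurable]: "\<theta> e 0 0 \<in> borel_measurable borel" "\<theta> e' 0 0 \<in> borel_measurable borel"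
   using c by (auto intro: borel_measurable_continuous_onI)
  have "L2sq h \<le> 2 * L2sq (\<lambda>x. \<theta> e 0 0 x - g x) + 2 * L2sq (\<lambda>x. \<theta> e' 0 0 x - g x)"
   using L2sq_diff_le[of "\<lambda>x. \<theta> e 0 0 x - g x" "\<lambda>x. \<theta> e' 0 0 x - g x"] by (simp add: h_def[abs_def])
  also have "\<dots> \<le> 2 * ennreal \<delta> + 2 * ennreal \<delta>"
   by (intro add_mono mult_left_mono less_imp_le b eb) auto
  also have "\<dots> = ennreal (2 * \<delta>) + ennreal (2 * \<delta>)" using \<delta> by (simp add: ennreal_mult)
  also have "\<dots> = ennreal (4 * \<delta>)" using \<delta> by (subst ennreal_plus[symmetric]) auto
  finally have L2: "L2sq h \<le> ennreal (4 * \<delta>)" .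
  show "\<bar>\<theta> e 0 0 x - \<theta> e' 0 0 x\<bar> \<le> \<eta>"
  proof (rule ccontr)
   assume "\<not> \<bar>\<theta> e 0 0 x - \<theta> e' 0 0 x\<bar> \<le> \<eta>"
   hence hx: "\<bar>h x\<bar> > \<eta>" by (simp add: h_def)
   have "(\<eta> / 2)^2 * d = integral {x..x+d} (\<lambda>y. (\<eta> / 2)^2)" using d by simp
   also have "\<dots> \<le> integral {x..x+d} (\<lambda>y. (h y)^2)"
   proof (rule integral_mono_continuous)
    fix y assume y: "y \<in> {x..x+d}"
    have "\<bar>h x - h y\<bar> \<le> (2 * M) * \<bar>x - y\<bar>"
    proof (rule has_real_derivative_lipschitz[where S = UNIV and f' = "\<lambda>y. \<theta> e 1 0 y - \<theta> e' 1 0 y"])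
     show "\<bar>\<theta> e 1 0 y - \<theta> e' 1 0 y\<bar> \<le> 2 * M" for y
      using \<theta>_bound[OF e1(1) _ t0, of 1 y] \<theta>_bound[OF e1(2) _ t0, of 1 y] by simp
    qed (use hd in auto)
    also have "\<dots> \<le> (2 * (M + 1)) * d" using y M by (intro mult_mono) auto
    also have "\<dots> = \<eta> / 2" using M by (simp add: d_def field_simps)
    finally have "\<eta> / 2 \<le> \<bar>h y\<bar>" using hx by linarith
    thus "(\<eta> / 2)^2 \<le> (h y)^2" using \<eta> by (metis power2_abs power_mono half_gt_zero less_imp_le)
   qed (auto intro!: continuous_on_power continuous_on_subset[OF hc])
   also have "\<dots> \<le> 4 * \<delta>" by (rule integral_square_le[OF hc L2]) (use \<delta> in simp)
   finally show False using \<eta> d by (simp add: \<delta>_def)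
  qed
 qed (use b pos in auto)
qed

end

context singular_limit
begin

lemma eps_seq: "e1 / real (Suc n) \<in> E" "filterlim (\<lambda>n. e1 / real (Suc n)) (at_right 0) sequentially"
proof -
 show e: "e1 / real (Suc n) \<in> E" for n using pos by (auto simp: field_simps)
 show "filterlim (\<lambda>n. e1 / real (Suc n)) (at_right 0) sequentially"
  unfolding filterlim_at
 proof (rule conjI)
  have "(\<lambda>n. e1 * (1 / real (Suc n))) \<longlonglongrightarrow> e1 * 0" by (rule tendsto_mult[OF tendsto_const LIMSEQ_Suc[OF lim_1_over_n]])
  thus "(\<lambda>n. e1 / real (Suc n)) \<longlonglongrightarrow> 0" by simp
  have "e1 / real (Suc n) \<in> {0<..} \<and> e1 / real (Suc n) \<noteq> 0" for n using e[of n] by simp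
  thus "\<forall>\<^sub>F n in sequentially. e1 / real (Suc n) \<in> {0<..} \<and> e1 / real (Suc n) \<noteq> 0" by simp
 qed
qed

lemma L2sq_limit:
 assumes t: "t \<in> I" and j: "j \<le> 3" and [measurable]: "g \<in> borel_measurable borel"
  and b: "\<forall>\<^sub>F e in at_right 0. L2sq (\<lambda>x. \<theta> e j t x - g x) \<le> K"
 shows "L2sq (\<lambda>x. \<Theta> j t x - g x) \<le> K"
proof -
 obtain N where N: "\<And>n. n \<ge> N ==> L2sq (\<lambda>x. \<theta> (e1 / real (Suc n)) j t x - g x) \<le> K"
  using eventually_compose_filterlim[OF b eps_seq(2)] unfolding eventually_sequentially by blast
 show ?thesis
 proof (rule L2sq_tendsto_le[where N = N and f = "\<lambda>n x. \<theta> (e1 / real (Suc n)) j t x - g x"])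
  have "\<theta> (e1 / real (Suc n)) j t \<in> borel_measurable borel" for n
   by (rule borel_measurable_continuous_onI[OF C0_slice_x[OF \<theta>_C0[OF eps_seq(1)] t]]) (use j in simp)
  thus "(\<lambda>x. \<theta> (e1 / real (Suc n)) j t x - g x) \<in> borel_measurable borel" for n by measurable
  show "AE x in lborel. (\<lambda>n. \<theta> (e1 / real (Suc n)) j t x - g x) \<longlonglongrightarrow> \<Theta> j t x - g x"
   by (intro AE_I2 tendsto_diff tendsto_const filterlim_compose[OF \<Theta>_tendsto[OF j t] eps_seq(2)])
 qed (rule N)
qed

text \<open>The L^2 distance is lower semicontinuous under pointwise convergence, so the distance of
  the limit to the prescribed data is 0. The data are a Sobolev class, whence equality only almost
  everywhere.\<close>

lemma \<Theta>_initial_AE: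
 assumes [measurable]: "g \<in> borel_measurable borel"
  and conv: "((\<lambda>e. L2sq (\<lambda>x. \<theta> e 0 0 x - g x)) \<longlongrightarrow> 0) (at_right 0)"
 shows "AE x in lborel. \<Theta> 0 0 x = g x"
proof -
 have t0: "(0::real) \<in> I" using pos by simp
 have [measurable]: "\<Theta> 0 0 \<in> borel_measurable borel"
  by (rule borel_measurable_continuous_onI[OF C0_slice_x[OF \<Theta>_C0 t0]]) simp
 have "L2sq (\<lambda>x. \<Theta> 0 0 x - g x) \<le> 0 + ennreal \<delta>" if \<delta>: "\<delta> > 0" for \<delta>
 proof -
  have "\<forall>\<^sub>F e in at_right 0. L2sq (\<lambda>x. \<theta> e 0 0 x - g x) < ennreal \<delta>"
   using order_tendstoD(2)[OF conv, of "ennreal \<delta>"] \<delta> by (simp only: ennreal_less_zero_iff)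
  hence "\<forall>\<^sub>F e in at_right 0. L2sq (\<lambda>x. \<theta> e 0 0 x - g x) \<le> ennreal \<delta>" by eventually_elim simp
  from L2sq_limit[OF t0 _ assms(1) this] show ?thesis by simp
 qed
 hence "L2sq (\<lambda>x. \<Theta> 0 0 x - g x) \<le> 0" by (rule ennreal_le_epsilon)
 hence "L2sq (\<lambda>x. \<Theta> 0 0 x - g x) = 0" by (rule antisym) (rule zero_le)
 hence "AE x in lborel. \<Theta> 0 0 x - g x = 0" by (rule L2sq_eq_0_imp_AE[rotated]) measurable
 thus ?thesis by simp
qed

end

section \<open>Sobolev regularity of the limit\<close>

lemma lborel_integral_Icc:
 fixes g :: "real \<Rightarrow> real"
 assumes c: "continuous_on UNIV g" and z: "\<And>x. \<bar>x\<bar> > R ==> g x = 0"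
 shows "(\<integral>x. g x \<partial>lborel) = integral {-R..R} g"
proof -
 have "(\<integral>x. g x \<partial>lborel) = (\<integral>x\<in>{-R..R}. g x \<partial>lborel)"
  unfolding set_lebesgue_integral_def
 proof (rule Bochner_Integration.integral_cong[OF refl])
  fix x show "g x = indicat_real {-R..R} x *\<^sub>R g x" using z[of x] by (cases "\<bar>x\<bar> > R") (auto simp: indicator_def)
 qed
 also have "\<dots> = integral {-R..R} g"
  by (rule set_borel_integral_eq_integral(2), rule borel_integrable_atLeastAtMost') (rule continuous_on_subset[OF c], simp)
 finally show ?thesis .
qed

lemma test_integral_tendsto:
 fixes g :: "nat \<Rightarrow> real \<Rightarrow> real"
 assumes c: "\<And>n. continuous_on UNIV (g n)" and f: "continuous_on UNIV f"
  and conv: "\<And>R. (\<lambda>n. integral {-R..R} (\<lambda>x. (g n x - f x)^2)) \<longlonglongrightarrow> 0" and t: "test_function \<phi>"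
 shows "(\<lambda>n. \<integral>x. g n x * \<phi> x \<partial>lborel) \<longlonglongrightarrow> (\<integral>x. f x * \<phi> x \<partial>lborel)"
proof -
 obtain R0 where R0: "\<And>x. \<bar>x\<bar> > R0 ==> \<phi> x = 0" using t unfolding test_function_iff by blast
 define R where "R = max R0 0"
 have R: "\<And>x. \<bar>x\<bar> > R ==> \<phi> x = 0" "R \<ge> 0" using R0 by (auto simp: R_def)
 have \<phi>c: "continuous_on S \<phi>" for S using continuous_on_subset[OF test_function_continuous[OF t]] by blast
 have "compact (\<phi> ` {-R..R})" by (intro compact_continuous_image \<phi>c) auto
 then obtain B where B: "\<And>x. x \<in> {-R..R} ==> \<bar>\<phi> x\<bar> \<le> B" by (meson bounded_real compact_imp_bounded imageI)
 have dc: "continuous_on S (\<lambda>x. g n x - f x)" for n S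
  by (rule continuous_on_subset[of UNIV]) (auto intro!: continuous_intros c f)
 have le: "\<bar>(\<integral>x. g n x * \<phi> x \<partial>lborel) - (\<integral>x. f x * \<phi> x \<partial>lborel)\<bar> \<le> sqrt (B^2 * integral {-R..R} (\<lambda>x. (g n x - f x)^2) * (R - (-R)))" for n
 proof -
  have "(\<integral>x. g n x * \<phi> x \<partial>lborel) - (\<integral>x. f x * \<phi> x \<partial>lborel) = (\<integral>x. (g n x - f x) * \<phi> x \<partial>lborel)"
   using integrable_mult_test[OF continuous_imp_locally_integrable[OF c] t, of n] integrable_mult_test[OF continuous_imp_locally_integrable[OF f] t]
   by (simp add: left_diff_distrib)
  also have "\<dots> = integral {-R..R} (\<lambda>x. (g n x - f x) * \<phi> x)"
   by (rule lborel_integral_Icc) (use R in \<open>auto intro!: continuous_on_mult dc \<phi>c\<close>)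
  also have "\<bar>\<dots>\<bar> \<le> sqrt (B^2 * integral {-R..R} (\<lambda>x. (g n x - f x)^2) * (R - (-R)))"
  proof (rule integral_Cauchy_Schwarz)
   have "integral {-R..R} (\<lambda>x. ((g n x - f x) * \<phi> x)^2) \<le> integral {-R..R} (\<lambda>x. B^2 * (g n x - f x)^2)"
   proof (rule integral_mono_continuous)
    fix x assume "x \<in> {-R..R}"
    from mult_right_mono[OF square_mono_abs[OF B[OF this]], of "(g n x - f x)^2"]
    show "((g n x - f x) * \<phi> x)^2 \<le> B^2 * (g n x - f x)^2" by (simp add: power_mult_distrib mult.commute)
   qed (intro continuous_on_power continuous_on_mult continuous_on_const dc \<phi>c)+
   thus "integral {-R..R} (\<lambda>x. ((g n x - f x) * \<phi> x)^2) \<le> B^2 * integral {-R..R} (\<lambda>x. (g n x - f x)^2)" by simp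
  qed (use R in \<open>auto intro!: continuous_on_mult dc \<phi>c\<close>)
  finally show ?thesis .
 qed
 have "(\<lambda>n. sqrt (B^2 * integral {-R..R} (\<lambda>x. (g n x - f x)^2) * (R - (-R)))) \<longlonglongrightarrow> sqrt (B^2 * 0 * (R - (-R)))"
  by (intro tendsto_real_sqrt tendsto_mult tendsto_const conv)
 hence "(\<lambda>n. sqrt (B^2 * integral {-R..R} (\<lambda>x. (g n x - f x)^2) * (R - (-R)))) \<longlonglongrightarrow> 0" by simp
 hence "(\<lambda>n. (\<integral>x. g n x * \<phi> x \<partial>lborel) - (\<integral>x. f x * \<phi> x \<partial>lborel)) \<longlonglongrightarrow> 0"
  by (rule Lim_null_comparison[rotated]) (use le in simp)
 thus ?thesis by (simp add: LIM_zero_iff)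
qed

lemma L2sq_scale':
 assumes [measurable]: "f \<in> borel_measurable borel" and a: "a > 0"
 shows "L2sq (\<lambda>x. f (a * x)) = ennreal (1 / a) * L2sq f"
 using L2sq_scale[of "\<lambda>x. f (a * x)" "1 / a"] a by simp

context singular_limit
begin

text \<open>At time 0 the wave profile is compared with c through the data. At time t the wave is a
  dilation of the profile, which multiplies the squared norm by sqrt (1 + t) \<le> sqrt (1 + T), and
  \<Theta> is within bounded L^2 distance of the wave.\<close>

lemma half_line_L2_bound:
 assumes f: "continuous_on UNIV f" and A: "A \<ge> 0" and \<sigma>: "\<sigma> > 0"
  and L2: "\<And>t. t \<in> I ==> L2sq (\<lambda>x. \<Theta> 0 t x - f (x / sqrt (1 + t))) \<le> ennreal A"
  and decay: "\<And>x. x \<ge> 1 ==> \<bar>\<Theta> 0 0 x - c\<bar> \<le> C * x powr (- 1 - \<sigma>)"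
 shows "\<exists>K. \<forall>t\<in>I. \<forall>b. integral {1..b} (\<lambda>x. (\<Theta> 0 t x - c)^2) \<le> K"
proof -
 have t0: "(0::real) \<in> I" using pos by simp
 have [measurable]: "f \<in> borel_measurable borel" by (rule borel_measurable_continuous_onI[OF f])
 define H where "H = 2 * ((M + \<bar>c\<bar>)^2 + C^2) + 2 * A"
 have H0: "H \<ge> 0" using A by (simp add: H_def)
 define h where "h x = indicator {0..} x * (f x - c)" for x :: real
 have [measurable]: "h \<in> borel_measurable borel" unfolding h_def[abs_def] by measurable
 have "L2sq h \<le> 2 * ennreal ((M + \<bar>c\<bar>)^2 + C^2) + 2 * ennreal A"
  unfolding h_def[abs_def]
 proof (rule half_line_L2[OF f _ _ _ \<sigma> decay])
  show "continuous_on UNIV (\<Theta> 0 0)" by (rule C0_slice_x[OF \<Theta>_C0 t0]) simp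
  show "L2sq (\<lambda>x. \<Theta> 0 0 x - f x) \<le> ennreal A" using L2[OF t0] by simp
  show "\<bar>\<Theta> 0 0 x - c\<bar> \<le> M + \<bar>c\<bar>" for x using \<Theta>_bound[OF _ t0, of 0 x] by simp
 qed
 also have "\<dots> = ennreal (2 * ((M + \<bar>c\<bar>)^2 + C^2)) + ennreal (2 * A)" using A by (simp add: ennreal_mult)
 also have "\<dots> = ennreal H" unfolding H_def by (rule ennreal_plus[symmetric]) (use A in auto)
 finally have H: "L2sq h \<le> ennreal H" .
 have "integral {1..b} (\<lambda>x. (\<Theta> 0 t x - c)^2) \<le> 2 * A + 2 * (sqrt (1 + T) * H)" if t: "t \<in> I" for t b
 proof -
  define a where "a = 1 / sqrt (1 + t)"
  have a: "a > 0" "1 / a = sqrt (1 + t)" "\<And>x. a * x = x / sqrt (1 + t)" using t by (auto simp: a_def)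
  have \<Theta>c: "continuous_on S (\<Theta> 0 t)" for S by (rule C0_slice_x[OF \<Theta>_C0 t]) simp
  have [measurable]: "\<Theta> 0 t \<in> borel_measurable borel" by (rule borel_measurable_continuous_onI[OF \<Theta>c])
  have "L2sq (\<lambda>x. h (a * x)) = ennreal (1 / a) * L2sq h" by (rule L2sq_scale'[OF _ a(1)]) measurable
  also have "\<dots> \<le> ennreal (sqrt (1 + T)) * ennreal H" unfolding a(2) by (intro mult_mono H ennreal_leI) (use t in auto)
  also have "\<dots> = ennreal (sqrt (1 + T) * H)" using H0 pos by (simp add: ennreal_mult)
  finally have 1: "L2sq (\<lambda>x. h (a * x)) \<le> ennreal (sqrt (1 + T) * H)" .
  have "ennreal (integral {1..b} (\<lambda>x. (\<Theta> 0 t x - c)^2)) = (\<integral>\<^sup>+x\<in>{1..b}. ennreal ((\<Theta> 0 t x - c)^2) \<partial>lborel)"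
   by (rule nn_integral_Icc_continuous[symmetric]) (auto intro!: continuous_on_power continuous_on_diff \<Theta>c)
  also have "\<dots> \<le> L2sq (\<lambda>x. (\<Theta> 0 t x - f (x / sqrt (1 + t))) + h (a * x))"
   unfolding L2sq_def using a(1) by (intro nn_integral_mono) (auto simp: indicator_def h_def a(3)[symmetric])
  also have "\<dots> \<le> 2 * L2sq (\<lambda>x. \<Theta> 0 t x - f (x / sqrt (1 + t))) + 2 * L2sq (\<lambda>x. h (a * x))"
   by (rule L2sq_add_le) measurable
  also have "\<dots> \<le> 2 * ennreal A + 2 * ennreal (sqrt (1 + T) * H)" by (intro add_mono mult_left_mono L2[OF t] 1) auto
  also have "\<dots> = ennreal (2 * A) + ennreal (2 * (sqrt (1 + T) * H))" using A H0 pos by (simp add: ennreal_mult)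
  also have "\<dots> = ennreal (2 * A + 2 * (sqrt (1 + T) * H))"
   by (rule ennreal_plus[symmetric]) (use A H0 pos in \<open>auto intro!: mult_nonneg_nonneg\<close>)
  finally show ?thesis using A H0 pos by (subst (asm) ennreal_le_iff) (auto intro!: add_nonneg_nonneg mult_nonneg_nonneg)
 qed
 thus ?thesis by blast
qed

end

section \<open>The limit velocity and the Sobolev bounds of the limit\<close>

text \<open>Adds the bounds up to order s + 1, for which s is arbitrary, to the setting above, which
  uses a fixed number of derivatives. The function f is the diffusion wave at time 0; at time t the
  wave is f (x / sqrt (1 + t)).\<close>

locale singular_solution = singular_decay +
 fixes s :: nat and C1 B :: real and f f' \<theta>_in :: "real \<Rightarrow> real"
 assumes s: "s \<ge> 1" and C1: "C1 \<ge> 0"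
  and p_C0s: "\<And>e j. e \<in> {0<..e1} ==> j \<le> s + 1 ==> C_strip 0 T (p e j)"
  and u_C0s: "\<And>e j. e \<in> {0<..e1} ==> j \<le> s + 1 ==> C_strip 0 T (u e j)"
  and \<theta>_C0s: "\<And>e j. e \<in> {0<..e1} ==> j \<le> s + 1 ==> C_strip 0 T (\<theta> e j)"
  and p_dxs: "\<And>e j t x. e \<in> {0<..e1} ==> j < s + 1 ==> t \<in> {0..T} ==> (p e j t has_real_derivative p e (Suc j) t x) (at x)"
  and u_dxs: "\<And>e j t x. e \<in> {0<..e1} ==> j < s + 1 ==> t \<in> {0..T} ==> (u e j t has_real_derivative u e (Suc j) t x) (at x)"
  and \<theta>_dxs: "\<And>e j t x. e \<in> {0<..e1} ==> j < s + 1 ==> t \<in> {0..T} ==> (\<theta> e j t has_real_derivative \<theta> e (Suc j) t x) (at x)"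
  and p_L2s: "\<And>e j t. e \<in> {0<..e1} ==> j \<le> s ==> t \<in> {0..T} ==> L2sq (p e j t) \<le> ennreal C1"
  and u_L2s: "\<And>e j t. e \<in> {0<..e1} ==> j \<le> s ==> t \<in> {0..T} ==> L2sq (u e j t) \<le> ennreal C1"
  and \<theta>_L2s: "\<And>e j t. e \<in> {0<..e1} ==> 1 \<le> j ==> j \<le> s + 1 ==> t \<in> {0..T} ==> L2sq (\<theta> e j t) \<le> ennreal C1"
  and dissipation: "\<And>e. e \<in> {0<..e1} ==> (\<integral>\<^sup>+t\<in>{0..T}. (L2sq (p e (s + 1) t) + L2sq (u e (s + 1) t)) \<partial>lborel) \<le> ennreal C1"
  and f_dx: "\<And>x. (f has_real_derivative f' x) (at x)" and f'_cont: "continuous_on UNIV f'" and f_bound: "\<And>x. \<bar>f x\<bar> \<le> B"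
  and \<theta>_f: "\<And>e t. e \<in> {0<..e1} ==> t \<in> {0..T} ==> L2sq (\<lambda>x. \<theta> e 0 t x - f (x / sqrt (1 + t))) \<le> ennreal C1"
  and \<theta>_in_meas: "locally_integrable \<theta>_in" and \<theta>_in_f: "Hsq s (\<lambda>x. \<theta>_in x - f x) < \<infinity>"
  and \<theta>_in_conv: "((\<lambda>e. L2sq (\<lambda>x. \<theta> e 0 0 x - \<theta>_in x)) \<longlongrightarrow> 0) (at_right 0)"
begin

lemma f_cont: "continuous_on UNIV f" by (rule DERIV_continuous_UNIV[OF f_dx])

text \<open>The velocity without acoustic part: the first limit equation integrated in x, with
  integration constant 0.\<close>

definition U :: field where "U t x = \<kappa> / 2 * (exp (\<Theta> 0 t x) * \<Theta> 1 t x)"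

lemma U_C0: "C_strip 0 T U" unfolding U_def[abs_def] by (intro C0_intros \<Theta>_C0) auto

lemma M_nonneg: "M \<ge> 0" using \<theta>_bound[of e1 0 0 0] pos by force

lemma u_minus_v_conv:
 assumes \<eta>: "\<eta> > 0"
 shows "\<exists>e2\<in>E. \<forall>e\<in>{0<..e2}. \<forall>t\<in>I. \<forall>x. \<bar>u e 0 t x - v e t x - U t x\<bar> \<le> \<eta>"
proof -
 define K where "K = \<kappa> / 2 * (exp (2 * M) * (M + 1) * M + exp M)"
 have K: "K \<ge> 0" unfolding K_def using M_nonneg pos by (intro mult_nonneg_nonneg add_nonneg_nonneg) auto
 define \<delta> where "\<delta> = \<eta> / (K + 1)"
 have \<delta>: "\<delta> > 0" using \<eta> K by (simp add: \<delta>_def)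
 obtain a where a: "a \<in> E" "\<And>e t x. e \<in> {0<..a} ==> t \<in> I ==> \<bar>\<theta> e 0 t x - \<Theta> 0 t x\<bar> \<le> \<delta>" using \<Theta>_conv[OF _ \<delta>, of 0] by auto
 obtain b where b: "b \<in> E" "\<And>e t x. e \<in> {0<..b} ==> t \<in> I ==> \<bar>\<theta> e 1 t x - \<Theta> 1 t x\<bar> \<le> \<delta>" using \<Theta>_conv[OF _ \<delta>, of 1] by auto
 show ?thesis
 proof (intro bexI[of _ "min \<delta> (min a b)"] ballI allI)
  fix e t x assume e: "e \<in> {0<..min \<delta> (min a b)}" and t: "t \<in> I"
  have e1: "e \<in> E" "e \<in> {0<..a}" "e \<in> {0<..b}" "e \<le> \<delta>" "0 < e" "e \<le> 1" using e a b pos by auto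
  have bd: "\<bar>p e 0 t x\<bar> \<le> M" "\<bar>\<theta> e 0 t x\<bar> \<le> M" "\<bar>\<theta> e 1 t x\<bar> \<le> M" "\<bar>\<Theta> 0 t x\<bar> \<le> M"
   using p_bound[OF e1(1) _ t, of 0 x] \<theta>_bound[OF e1(1) _ t, of 0 x] \<theta>_bound[OF e1(1) _ t, of 1 x] \<Theta>_bound[OF _ t, of 0 x] by auto
  have ep: "\<bar>e * p e 0 t x\<bar> \<le> \<delta> * M" "\<bar>e * p e 0 t x\<bar> \<le> 1 * M" unfolding abs_mult using bd e1 by (intro mult_mono; auto)+
  have "\<bar>Q e t x - exp (\<Theta> 0 t x)\<bar> \<le> exp (2 * M) * \<bar>(- e * p e 0 t x + \<theta> e 0 t x) - \<Theta> 0 t x\<bar>"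
   unfolding Q_def by (rule exp_diff_bound) (use bd ep M_nonneg in auto)
  also have "\<dots> \<le> exp (2 * M) * ((M + 1) * \<delta>)"
   using ep(1) a(2)[OF e1(2) t, of x] by (intro mult_left_mono) (auto simp: algebra_simps)
  finally have Q: "\<bar>Q e t x - exp (\<Theta> 0 t x)\<bar> \<le> exp (2 * M) * ((M + 1) * \<delta>)" .
  have "u e 0 t x - v e t x - U t x = \<kappa> / 2 * ((Q e t x - exp (\<Theta> 0 t x)) * \<theta> e 1 t x + exp (\<Theta> 0 t x) * (\<theta> e 1 t x - \<Theta> 1 t x))"
   unfolding v_def U_def by (simp add: algebra_simps)
  also have "\<bar>\<dots>\<bar> \<le> \<kappa> / 2 * (exp (2 * M) * ((M + 1) * \<delta>) * M + exp M * \<delta>)"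
  proof -
   have "\<bar>(Q e t x - exp (\<Theta> 0 t x)) * \<theta> e 1 t x\<bar> \<le> exp (2 * M) * ((M + 1) * \<delta>) * M"
    unfolding abs_mult by (intro mult_mono Q bd) (use M_nonneg \<delta> in auto)
   moreover have "\<bar>exp (\<Theta> 0 t x) * (\<theta> e 1 t x - \<Theta> 1 t x)\<bar> \<le> exp M * \<delta>"
    unfolding abs_mult by (intro mult_mono b(2) e1 t) (use bd \<delta> in auto)
   ultimately show ?thesis unfolding abs_mult[of "\<kappa> / 2"] using pos
    by (intro mult_mono order_trans[OF abs_triangle_ineq] add_mono) auto
  qed
  also have "\<dots> = K * \<delta>" by (simp add: K_def algebra_simps)
  also have "\<dots> \<le> (K + 1) * \<delta>" using \<delta> by (intro mult_right_mono) auto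
  also have "\<dots> = \<eta>" using K by (simp add: \<delta>_def)
  finally show "\<bar>u e 0 t x - v e t x - U t x\<bar> \<le> \<eta>" .
 qed (use a b \<delta> in auto)
qed

text \<open>Since v tends to 0 only in the mean over time, the approximating times \<open>\<tau>\<close> must be allowed to vary.\<close>

lemma U_approximation:
 assumes t: "t \<in> I" and R: "R \<ge> 0" and \<delta>: "\<delta> > 0"
 obtains e \<tau> where "e \<in> E" "\<tau> \<in> I" "integral {-R..R} (\<lambda>x. (u e 0 \<tau> x - U t x)^2) \<le> \<delta>"
proof -
 \<comment> \<open>Two errors of size \<eta> are allowed, from u - v and from the change of time.
   They contribute 6 \<eta>^2 per unit length, in total at most \<delta>/2; the other half is left
   to 3 v^2.\<close>
 define \<eta> where "\<eta> = sqrt (\<delta> / (12 * (2 * R + 1)))"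
 have \<eta>: "\<eta> > 0" "\<eta>^2 = \<delta> / (12 * (2 * R + 1))" using \<delta> R by (auto simp: \<eta>_def)
 have "uniformly_continuous_on (I \<times> {-R..R}) (\<lambda>q. U (fst q) (snd q))"
  by (intro compact_uniformly_continuous compact_Times continuous_on_subset[OF U_C0[unfolded C0_iff]]) auto
 then obtain d where d: "d > 0" "\<And>q q'. q \<in> I \<times> {-R..R} ==> q' \<in> I \<times> {-R..R} ==> dist q' q < d ==> dist (U (fst q') (snd q')) (U (fst q) (snd q)) < \<eta>"
  unfolding uniformly_continuous_on_def using \<eta>(1) by metis
 have Ud: "\<bar>U \<tau> x - U t x\<bar> \<le> \<eta>" if "\<tau> \<in> I" "\<bar>\<tau> - t\<bar> < d" "x \<in> {-R..R}" for \<tau> x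
  using d(2)[of "(t, x)" "(\<tau>, x)"] that t by (auto simp: dist_prod_def dist_real_def)
 define l where "l = max 0 (t - d / 2)"
 define r where "r = min T (t + d / 2)"
 have lr: "l < r" "l \<le> t" "t \<le> r" "0 \<le> l" "r \<le> T" using d t pos by (auto simp: l_def r_def)
 have near: "\<bar>\<tau> - t\<bar> < d" if "\<tau> \<in> {l..r}" for \<tau> using that d by (auto simp: l_def r_def)
 obtain e2 where e2: "e2 \<in> E" "\<And>e t x. e \<in> {0<..e2} ==> t \<in> I ==> \<bar>u e 0 t x - v e t x - U t x\<bar> \<le> \<eta>"
  using u_minus_v_conv[OF \<eta>(1)] by blast
 define w where "w e t = integral {-R..R} (\<lambda>x. (v e t x)^2)" for e t
 have "\<forall>\<^sub>F e in at_right 0. integral I (w e) < (r - l) * (\<delta> / 6)"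
  unfolding w_def[abs_def] using order_tendstoD(2)[OF local_L2_decay(2)[OF R], of "(r - l) * (\<delta> / 6)"] lr \<delta> by simp
 moreover have "\<forall>\<^sub>F e in at_right 0. e \<in> {0<..e2}"
  unfolding eventually_at_right_field using e2 by (intro exI[of _ e2]) auto
 ultimately have "\<forall>\<^sub>F e in at_right 0. integral I (w e) < (r - l) * (\<delta> / 6) \<and> e \<in> {0<..e2}" by (rule eventually_conj)
 then obtain e where small: "integral I (w e) < (r - l) * (\<delta> / 6)" "e \<in> {0<..e2}"
  using eventually_happens[of _ "at_right (0::real)"] by (auto simp: trivial_limit_at_right_real)
 have e: "e \<in> E" using small e2 by auto
 have vC: "C_strip 0 T (\<lambda>t x. (v e t x)^2)" by (intro C0_intros C0s e)
 have wc: "continuous_on I (w e)" unfolding w_def[abs_def] by (rule C0_space_integral[OF vC])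
 have w0: "w e \<tau> \<ge> 0" if "\<tau> \<in> I" for \<tau>
  unfolding w_def by (rule integral_nonneg) (auto intro: integrable_continuous_real C0_slice_x[OF vC that])
 \<comment> \<open>A mean value argument: if w exceeded \<delta>/6 throughout [l, r], its time
   integral would be too large. Nothing is known about the time t itself.\<close>
 have "\<exists>\<tau>\<in>{l..r}. w e \<tau> \<le> \<delta> / 6"
 proof (rule ccontr)
  assume "\<not> (\<exists>\<tau>\<in>{l..r}. w e \<tau> \<le> \<delta> / 6)"
  hence big: "\<delta> / 6 \<le> w e \<tau>" if "\<tau> \<in> {l..r}" for \<tau> using that by force
  have sub: "{l..r} \<subseteq> I" using lr by auto
  have "(r - l) * (\<delta> / 6) = integral {l..r} (\<lambda>\<tau>. \<delta> / 6)" using lr by simp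
  also have "\<dots> \<le> integral {l..r} (w e)" by (rule integral_mono_continuous) (use big continuous_on_subset[OF wc sub] in auto)
  also have "\<dots> \<le> integral I (w e)"
   by (rule integral_subset_le[OF sub]) (use w0 wc continuous_on_subset[OF wc sub] in \<open>auto intro: integrable_continuous_real\<close>)
  finally show False using small(1) by simp
 qed
 then obtain \<tau> where \<tau>: "\<tau> \<in> {l..r}" "w e \<tau> \<le> \<delta> / 6" by blast
 have \<tau>T: "\<tau> \<in> I" using \<tau> lr by auto
 have vc: "continuous_on {-R..R} (\<lambda>x. (v e \<tau> x)^2)" by (rule C0_slice_x[OF vC \<tau>T])
 have "integral {-R..R} (\<lambda>x. (u e 0 \<tau> x - U t x)^2) \<le> integral {-R..R} (\<lambda>x. 3 * (v e \<tau> x)^2 + 6 * \<eta>^2 / 2 + 6 * \<eta>^2 / 2)"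
 proof (rule integral_mono_continuous)
  show "continuous_on {-R..R} (\<lambda>x. (u e 0 \<tau> x - U t x)^2)"
   by (intro continuous_intros C0_slice_x[OF u_C0 \<tau>T] C0_slice_x[OF U_C0 t] e) simp
  fix x assume x: "x \<in> {-R..R}"
  define A where "A = u e 0 \<tau> x - v e \<tau> x - U \<tau> x"
  define A' where "A' = U \<tau> x - U t x"
  have A: "A^2 \<le> \<eta>^2" by (rule square_mono_abs) (use e2(2)[OF small(2) \<tau>T, of x] in \<open>simp add: A_def\<close>)
  have A': "A'^2 \<le> \<eta>^2" by (rule square_mono_abs) (use Ud[OF \<tau>T near[OF \<tau>(1)] x] in \<open>simp add: A'_def\<close>)
  have "(v e \<tau> x + A + A')^2 \<le> 3 * (v e \<tau> x)^2 + 3 * A^2 + 3 * A'^2"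
   using zero_le_power2[of "v e \<tau> x - A"] zero_le_power2[of "v e \<tau> x - A'"] zero_le_power2[of "A - A'"]
   by (simp add: power2_eq_square algebra_simps)
  moreover have "u e 0 \<tau> x - U t x = v e \<tau> x + A + A'" by (simp add: A_def A'_def)
  ultimately show "(u e 0 \<tau> x - U t x)^2 \<le> 3 * (v e \<tau> x)^2 + 6 * \<eta>^2 / 2 + 6 * \<eta>^2 / 2" using A A' by simp
 qed (intro continuous_intros vc)
 also have "\<dots> = integral {-R..R} (\<lambda>x. 3 * (v e \<tau> x)^2 + 6 * \<eta>^2)"
  by (rule Henstock_Kurzweil_Integration.integral_cong) simp
 also have "\<dots> = 3 * w e \<tau> + 2 * R * (6 * \<eta>^2)" unfolding w_def
  by (subst integral_add) (use R in \<open>auto intro!: integrable_continuous_real continuous_on_mult_left vc\<close>)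
 also have "2 * R * (6 * \<eta>^2) \<le> \<delta> / 2"
 proof -
  have "2 * R * (6 * \<eta>^2) = \<delta> / 2 * (2 * R / (2 * R + 1))" unfolding \<eta>(2) using R by (simp add: field_simps)
  also have "\<dots> \<le> \<delta> / 2 * 1" using \<delta> R by (intro mult_left_mono) auto
  finally show ?thesis by simp
 qed
 also have "3 * w e \<tau> + \<delta> / 2 \<le> \<delta>" using \<tau>(2) by simp
 finally show ?thesis using that[OF e \<tau>T] by simp
qed

lemma \<Theta>1_L2: assumes t: "t \<in> I" shows "L2sq (\<Theta> 1 t) \<le> ennreal C1"
 using L2sq_limit[OF t, of 1 "\<lambda>x. 0" "ennreal C1"] eventually_mono[OF eventually_in \<theta>_L2s[OF _ _ _ t, of _ 1]] by simp

text \<open>Classical derivatives of the limit are available only up to order 3, whereas s is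
  arbitrary; the higher ones exist as weak limits of the derivatives of the family at the same
  time.\<close>

lemma \<Theta>_chain:
 assumes t: "t \<in> I"
 obtains h where "h 0 = \<Theta> 0 t" "\<And>j. j < s ==> has_weak_deriv (h j) (h (Suc j))"
  "\<And>j. 1 \<le> j ==> j \<le> s ==> L2sq (h j) \<le> ennreal C1"
proof (rule weak_chain_limit[where G = "\<lambda>n j. \<theta> (e1 / real (Suc n)) j t" and f = "\<Theta> 0 t" and m = s and M = C1])
 have \<Theta>c: "continuous_on S (\<Theta> 0 t)" for S by (rule C0_slice_x[OF \<Theta>_C0 t]) simp
 have \<theta>c: "continuous_on S (\<theta> (e1 / real (Suc n)) j t)" if "j \<le> s + 1" for S j n by (rule C0_slice_x[OF \<theta>_C0s[OF eps_seq(1) that] t])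
 show "locally_integrable (\<Theta> 0 t)" by (rule continuous_imp_locally_integrable[OF \<Theta>c])
 fix n
 show "has_weak_deriv (\<theta> (e1 / real (Suc n)) j t) (\<theta> (e1 / real (Suc n)) (Suc j) t)" if "j < s" for j
  by (rule has_weak_deriv_classical[OF \<theta>_dxs[OF eps_seq(1) _ t] \<theta>c]) (use that in auto)
 show "L2sq (\<theta> (e1 / real (Suc n)) j t) \<le> ennreal C1" if "1 \<le> j" "j \<le> s" for j
  by (rule \<theta>_L2s[OF eps_seq(1) _ _ t]) (use that in auto)
next
 fix \<phi> assume \<phi>: "test_function \<phi>"
 have \<Theta>c: "continuous_on S (\<Theta> 0 t)" for S by (rule C0_slice_x[OF \<Theta>_C0 t]) simp
 have \<theta>c: "continuous_on S (\<theta> (e1 / real (Suc n)) 0 t)" for S n by (rule C0_slice_x[OF \<theta>_C0s[OF eps_seq(1)] t]) simp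
 show "(\<lambda>n. \<integral>x. \<theta> (e1 / real (Suc n)) 0 t x * \<phi> x \<partial>lborel) \<longlonglongrightarrow> (\<integral>x. \<Theta> 0 t x * \<phi> x \<partial>lborel)"
 proof (rule test_integral_tendsto[OF \<theta>c \<Theta>c _ \<phi>])
  fix R :: real
  show "(\<lambda>n. integral {-R..R} (\<lambda>x. (\<theta> (e1 / real (Suc n)) 0 t x - \<Theta> 0 t x)^2)) \<longlonglongrightarrow> 0"
  proof (rule LIMSEQ_I)
   fix r :: real assume r: "r > 0"
   define \<eta> where "\<eta> = sqrt (r / (2 * (2 * \<bar>R\<bar> + 1)))"
   have \<eta>: "\<eta> > 0" "\<eta>^2 = r / (2 * (2 * \<bar>R\<bar> + 1))" using r by (auto simp: \<eta>_def)
   obtain e2 where e2: "e2 \<in> E" "\<And>e t x. e \<in> {0<..e2} ==> t \<in> I ==> \<bar>\<theta> e 0 t x - \<Theta> 0 t x\<bar> \<le> \<eta>" using \<Theta>_conv[OF _ \<eta>(1), of 0] by auto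
   have "\<forall>\<^sub>F e in at_right 0. e \<in> {0<..e2}" unfolding eventually_at_right_field using e2 by (intro exI[of _ e2]) auto
   from eventually_compose_filterlim[OF this eps_seq(2)]
   obtain N where N: "\<And>n. n \<ge> N ==> e1 / real (Suc n) \<in> {0<..e2}" unfolding eventually_sequentially by blast
   have "norm (integral {-R..R} (\<lambda>x. (\<theta> (e1 / real (Suc n)) 0 t x - \<Theta> 0 t x)^2) - 0) < r" if "n \<ge> N" for n
   proof -
    have "integral {-R..R} (\<lambda>x. (\<theta> (e1 / real (Suc n)) 0 t x - \<Theta> 0 t x)^2) \<le> integral {-R..R} (\<lambda>x. \<eta>^2)"
    proof (rule integral_mono_continuous[OF _ continuous_on_const])
     show "continuous_on {-R..R} (\<lambda>x. (\<theta> (e1 / real (Suc n)) 0 t x - \<Theta> 0 t x)^2)"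
      by (intro continuous_on_power continuous_on_diff \<theta>c \<Theta>c)
    qed (rule square_mono_abs[OF e2(2)[OF N[OF that] t]])
    also have "\<dots> = max 0 (2 * R) * \<eta>^2" by (cases "R \<ge> 0") auto
    also have "\<dots> \<le> 2 * \<bar>R\<bar> * \<eta>^2" by (intro mult_right_mono) auto
    also have "\<dots> = r * (\<bar>R\<bar> / (2 * \<bar>R\<bar> + 1))" unfolding \<eta>(2) by (simp add: field_simps)
    also have "\<dots> < r * 1" using r by (intro mult_strict_left_mono) (auto simp: field_simps)
    finally have "integral {-R..R} (\<lambda>x. (\<theta> (e1 / real (Suc n)) 0 t x - \<Theta> 0 t x)^2) < r" by simp
    moreover have "0 \<le> integral {-R..R} (\<lambda>x. (\<theta> (e1 / real (Suc n)) 0 t x - \<Theta> 0 t x)^2)"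
     by (intro integral_nonneg integrable_continuous_real continuous_on_power continuous_on_diff \<theta>c \<Theta>c) simp
    ultimately show ?thesis by simp
   qed
   thus "\<exists>N. \<forall>n\<ge>N. norm (integral {-R..R} (\<lambda>x. (\<theta> (e1 / real (Suc n)) 0 t x - \<Theta> 0 t x)^2) - 0) < r" by blast
  qed
 qed
next
 fix h :: "nat \<Rightarrow> real \<Rightarrow> real"
 assume "h 0 = \<Theta> 0 t" "\<And>j. j < s ==> has_weak_deriv (h j) (h (Suc j))" "\<And>j. 1 \<le> j ==> j \<le> s ==> L2sq (h j) \<le> ennreal C1"
 thus thesis by (rule that)
qed

lemma Hsq_chain_bound:
 assumes l: "locally_integrable (h 0)" and h: "\<And>j. j < s ==> has_weak_deriv (h j) (h (Suc j))"
  and b: "L2sq (h 0) \<le> ennreal A" "\<And>j. 1 \<le> j ==> j \<le> s ==> L2sq (h j) \<le> ennreal A" and A: "A \<ge> 0"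
 shows "Hsq s (h 0) \<le> ennreal (real (s + 1) * A)"
proof -
 have "Hsq s (h 0) = (\<Sum>j\<le>s. L2sq (h j))" by (rule Hsq_weak_chain[OF l h])
 also have "\<dots> \<le> (\<Sum>j\<le>s. ennreal A)"
 proof (rule sum_mono)
  show "L2sq (h j) \<le> ennreal A" if "j \<in> {..s}" for j using b(1) b(2)[of j] that by (cases "j = 0") auto
 qed
 also have "\<dots> = ennreal (\<Sum>j\<le>s. A)" by (rule sum_ennreal) (rule A)
 finally show ?thesis by (simp add: add.commute)
qed

text \<open>At the given t the velocities need not converge, so U t is approximated by u at varying
  times \<tau> n on the growing intervals [-n, n]; the uniform Sobolev bound then passes to the weak
  limit at every t. Order 0 is estimated through |U| \<le> const |\<Theta>_x|, as the chain lemma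
  bounds only the orders from 1 on.\<close>

lemma Hsq_U:
 assumes t: "t \<in> I"
 shows "Hsq s (U t) \<le> ennreal (real (s + 1) * (C1 + (\<kappa> / 2 * exp M)^2 * C1))"
proof -
 have Uc: "continuous_on S (U t)" for S by (rule C0_slice_x[OF U_C0 t])
 have "\<exists>e \<tau>. e \<in> E \<and> \<tau> \<in> I \<and> integral {-real n..real n} (\<lambda>x. (u e 0 \<tau> x - U t x)^2) \<le> 1 / real (Suc n)" for n
  using U_approximation[OF t, of "real n" "1 / real (Suc n)"] by (metis of_nat_0_le_iff of_nat_0_less_iff zero_less_Suc zero_less_divide_1_iff)
 then obtain e \<tau> where *: "\<And>n. e n \<in> E" "\<And>n. \<tau> n \<in> I"
  "\<And>n. integral {-real n..real n} (\<lambda>x. (u (e n) 0 (\<tau> n) x - U t x)^2) \<le> 1 / real (Suc n)" by metis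
 have uc: "continuous_on S (u (e n) j (\<tau> n))" if "j \<le> s + 1" for S j n by (rule C0_slice_x[OF u_C0s[OF *(1) that] *(2)])
 obtain h where h: "h 0 = U t" "\<And>j. j < s ==> has_weak_deriv (h j) (h (Suc j))"
  "\<And>j. 1 \<le> j ==> j \<le> s ==> L2sq (h j) \<le> ennreal C1"
 proof (rule weak_chain_limit[where G = "\<lambda>n j. u (e n) j (\<tau> n)" and f = "U t" and m = s and M = C1])
  show "locally_integrable (U t)" by (rule continuous_imp_locally_integrable[OF Uc])
  show "has_weak_deriv (u (e n) j (\<tau> n)) (u (e n) (Suc j) (\<tau> n))" if "j < s" for n j
   by (rule has_weak_deriv_classical[OF u_dxs[OF *(1) _ *(2)] uc]) (use that in auto)
  show "L2sq (u (e n) j (\<tau> n)) \<le> ennreal C1" if "1 \<le> j" "j \<le> s" for n j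
   by (rule u_L2s[OF *(1) _ *(2)]) (use that in auto)
  fix \<phi> assume \<phi>: "test_function \<phi>"
  show "(\<lambda>n. \<integral>x. u (e n) 0 (\<tau> n) x * \<phi> x \<partial>lborel) \<longlonglongrightarrow> (\<integral>x. U t x * \<phi> x \<partial>lborel)"
  proof (rule test_integral_tendsto[OF uc Uc _ \<phi>])
   fix R :: real
   obtain N :: nat where N: "R \<le> real N" using real_arch_simple by blast
   have dc: "continuous_on S (\<lambda>x. (u (e n) 0 (\<tau> n) x - U t x)^2)" for n S
    by (intro continuous_on_power continuous_on_diff uc Uc) simp
   show "(\<lambda>n. integral {-R..R} (\<lambda>x. (u (e n) 0 (\<tau> n) x - U t x)^2)) \<longlonglongrightarrow> 0"
   proof (rule tendsto_sandwich[OF _ _ tendsto_const LIMSEQ_Suc[OF lim_1_over_n]])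
    show "\<forall>\<^sub>F n in sequentially. 0 \<le> integral {-R..R} (\<lambda>x. (u (e n) 0 (\<tau> n) x - U t x)^2)"
     by (intro always_eventually allI integral_nonneg integrable_continuous_real dc) auto
    show "\<forall>\<^sub>F n in sequentially. integral {-R..R} (\<lambda>x. (u (e n) 0 (\<tau> n) x - U t x)^2) \<le> 1 / real (Suc n)"
     using eventually_ge_at_top[of N]
    proof eventually_elim
     case (elim n)
     have "integral {-R..R} (\<lambda>x. (u (e n) 0 (\<tau> n) x - U t x)^2) \<le> integral {-real n..real n} (\<lambda>x. (u (e n) 0 (\<tau> n) x - U t x)^2)"
      by (rule integral_subset_le) (use N elim in \<open>auto intro!: integrable_continuous_real dc\<close>)
     thus ?case using *(3)[of n] by linarith
    qed
   qed
  qed simp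
 qed blast
 have "L2sq (U t) \<le> L2sq (\<lambda>x. \<kappa> / 2 * exp M * \<Theta> 1 t x)"
  unfolding L2sq_def
 proof (intro nn_integral_mono ennreal_leI)
  fix x
  have "\<bar>U t x\<bar> \<le> \<bar>\<kappa> / 2 * exp M * \<Theta> 1 t x\<bar>"
   using \<Theta>_bound[OF _ t, of 0 x] pos by (simp add: U_def abs_mult mult_right_mono)
  thus "(U t x)^2 \<le> (\<kappa> / 2 * exp M * \<Theta> 1 t x)^2" by (metis abs_ge_zero power2_abs power_mono)
 qed
 also have "\<dots> = ennreal ((\<kappa> / 2 * exp M)^2) * L2sq (\<Theta> 1 t)"
  by (rule L2sq_cmult) (rule borel_measurable_continuous_onI, rule C0_slice_x[OF \<Theta>_C0 t], simp)
 also have "\<dots> \<le> ennreal ((\<kappa> / 2 * exp M)^2) * ennreal C1" by (intro mult_left_mono \<Theta>1_L2[OF t]) simp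
 also have "\<dots> = ennreal ((\<kappa> / 2 * exp M)^2 * C1)" using C1 by (simp add: ennreal_mult)
 also have "\<dots> \<le> ennreal (C1 + (\<kappa> / 2 * exp M)^2 * C1)" using C1 by (intro ennreal_leI) simp
 finally have L0: "L2sq (U t) \<le> ennreal (C1 + (\<kappa> / 2 * exp M)^2 * C1)" .
 have "Hsq s (h 0) \<le> ennreal (real (s + 1) * (C1 + (\<kappa> / 2 * exp M)^2 * C1))"
 proof (rule Hsq_chain_bound)
  show "L2sq (h j) \<le> ennreal (C1 + (\<kappa> / 2 * exp M)^2 * C1)" if "1 \<le> j" "j \<le> s" for j
   by (rule order_trans[OF h(3)[OF that]]) (use C1 in \<open>auto intro!: ennreal_leI\<close>)
 qed (use h(1,2) L0 C1 in \<open>auto intro!: continuous_imp_locally_integrable Uc\<close>)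
 thus ?thesis unfolding h(1) .
qed

text \<open>The derivatives of \<Theta> are bounded by weak limits, but those of the wave up to
  order s must also be found, and the profile is known to be only finitely smooth. At time 0 the
  wave is \<Theta> minus a function of class H^s almost everywhere, so its weak derivatives are
  differences of known ones; dilation carries them to time t.\<close>

lemma Hsq_\<Theta>: "\<exists>K. \<forall>t\<in>I. Hsq s (\<lambda>x. \<Theta> 0 t x - f (x / sqrt (1 + t))) \<le> ennreal K"
proof -
 have t0: "(0::real) \<in> I" using pos by simp
 obtain d where d: "d 0 = (\<lambda>x. \<theta>_in x - f x)" "\<And>j. j < s ==> has_weak_deriv (d j) (d (Suc j))"
  "\<And>j. j \<le> s ==> L2sq (d j) \<le> Hsq s (\<lambda>x. \<theta>_in x - f x)" "\<And>j. j \<le> s ==> locally_integrable (d j)"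
  by (rule Hsq_finiteD[OF \<theta>_in_f]) (rule that; assumption)
 obtain D0 where D0: "D0 \<ge> 0" "Hsq s (\<lambda>x. \<theta>_in x - f x) = ennreal D0"
  using \<theta>_in_f by (cases "Hsq s (\<lambda>x. \<theta>_in x - f x)") auto
 obtain h where h: "h 0 = \<Theta> 0 0" "\<And>j. j < s ==> has_weak_deriv (h j) (h (Suc j))"
  "\<And>j. 1 \<le> j ==> j \<le> s ==> L2sq (h j) \<le> ennreal C1"
  by (rule \<Theta>_chain[OF t0]) (rule that; assumption)
 have li: "locally_integrable (h j)" if "j \<le> s" for j
  using that h(2)[of j] h(2)[of "j - 1"] s by (cases j) (auto simp: has_weak_deriv_def)
 \<comment> \<open>The chain of the profile f: order 0 is f itself, and from order 1 on the
   derivatives of the data minus those of their deviation from f.\<close>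
 define k where "k j = (if j = 0 then f else (\<lambda>x. h j x - d j x))" for j
 have kd: "has_weak_deriv (k j) (k (Suc j))" if j: "j < s" for j
 proof (cases "j = 0")
  case True
  have w: "has_weak_deriv (\<lambda>x. h 0 x - d 0 x) (\<lambda>x. h (Suc 0) x - d (Suc 0) x)"
   by (rule has_weak_deriv_diff[OF h(2) d(2)]) (use s in auto)
  have "has_weak_deriv f (\<lambda>x. h (Suc 0) x - d (Suc 0) x)"
  proof (rule has_weak_deriv_cong_AE[OF w])
   show "AE x in lborel. h 0 x - d 0 x = f x"
    using \<Theta>_initial_AE[OF locally_integrable_measurable[OF \<theta>_in_meas] \<theta>_in_conv] by eventually_elim (simp add: h d)
   show "locally_integrable f" by (rule continuous_imp_locally_integrable[OF f_cont])
   show "locally_integrable (\<lambda>x. h (Suc 0) x - d (Suc 0) x)" using w by (simp add: has_weak_deriv_def)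
  qed simp
  thus ?thesis using True by (simp add: k_def)
 next
  case False
  thus ?thesis using has_weak_deriv_diff[OF h(2) d(2), of j] j by (simp add: k_def)
 qed
 have km: "k j \<in> borel_measurable borel" if "j \<le> s" for j
 proof (cases "j = 0")
  case False
  have "locally_integrable (k j)" using kd[of "j - 1"] that False by (simp add: has_weak_deriv_def)
  thus ?thesis by (rule locally_integrable_measurable)
 qed (use borel_measurable_continuous_onI[OF f_cont] in \<open>simp add: k_def\<close>)
 have kL: "L2sq (k j) \<le> ennreal (2 * C1 + 2 * D0)" if j: "1 \<le> j" "j \<le> s" for j
 proof -
  have "L2sq (k j) \<le> 2 * L2sq (h j) + 2 * L2sq (d j)" unfolding k_def using j
   by (simp add: L2sq_diff_le locally_integrable_measurable li d(4))
  also have "\<dots> \<le> 2 * ennreal C1 + 2 * ennreal D0"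
   using h(3)[OF j] d(3)[OF j(2)] D0 by (intro add_mono mult_left_mono) auto
  also have "\<dots> = ennreal (2 * C1) + ennreal (2 * D0)" using C1 D0(1) by (simp add: ennreal_mult)
  also have "\<dots> = ennreal (2 * C1 + 2 * D0)" by (rule ennreal_plus[symmetric]) (use C1 D0(1) in auto)
  finally show ?thesis .
 qed
 define K where "K = 2 * C1 + 2 * (sqrt (1 + T) * (2 * C1 + 2 * D0))"
 have sT: "sqrt (1 + T) * (2 * C1 + 2 * D0) \<ge> 0" using C1 D0 pos by (intro mult_nonneg_nonneg) auto
 have K: "K \<ge> C1" "K \<ge> 0" using C1 sT by (auto simp: K_def)
 have "Hsq s (\<lambda>x. \<Theta> 0 t x - f (x / sqrt (1 + t))) \<le> ennreal (real (s + 1) * K)" if t: "t \<in> I" for t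
 proof -
  define a where "a = 1 / sqrt (1 + t)"
  have a: "a > 0" "a \<le> 1" "1 / a = sqrt (1 + t)" "\<And>x. a * x = x / sqrt (1 + t)" using t by (auto simp: a_def)
  define m where "m j x = a ^ j * k j (a * x)" for j x
  have md: "has_weak_deriv (m j) (m (Suc j))" if "j < s" for j
  proof -
   have "has_weak_deriv (\<lambda>x. k j (a * x)) (\<lambda>x. a * k (Suc j) (a * x))" by (rule has_weak_deriv_scale[OF kd[OF that]]) (use a in simp)
   from has_weak_deriv_cmult[OF this, of "a ^ j"] show ?thesis unfolding m_def[abs_def] by (simp add: mult_ac)
  qed
  have mm: "m j \<in> borel_measurable borel" if "j \<le> s" for j
   unfolding m_def[abs_def] using km[OF that] by measurable
  have mL: "L2sq (m j) \<le> ennreal (sqrt (1 + T) * (2 * C1 + 2 * D0))" if j: "1 \<le> j" "j \<le> s" for j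
  proof -
   have "L2sq (m j) = ennreal ((a ^ j)^2) * L2sq (\<lambda>x. k j (a * x))"
    unfolding m_def[abs_def] by (rule L2sq_cmult) (use km[OF j(2)] in measurable)
   also have "L2sq (\<lambda>x. k j (a * x)) = ennreal (1 / a) * L2sq (k j)" by (rule L2sq_scale'[OF km[OF j(2)] a(1)])
   also have "ennreal ((a ^ j)^2) * (ennreal (1 / a) * L2sq (k j)) \<le> ennreal 1 * (ennreal (sqrt (1 + T)) * ennreal (2 * C1 + 2 * D0))"
   proof (intro mult_mono kL j ennreal_leI)
    show "(a ^ j)^2 \<le> 1" using a by (simp add: power_le_one)
    show "1 / a \<le> sqrt (1 + T)" unfolding a(3) using t by simp
   qed auto
   also have "\<dots> = ennreal (sqrt (1 + T) * (2 * C1 + 2 * D0))" using C1 D0(1) pos by (simp add: ennreal_mult)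
   finally show ?thesis .
  qed
  obtain g where g: "g 0 = \<Theta> 0 t" "\<And>j. j < s ==> has_weak_deriv (g j) (g (Suc j))"
   "\<And>j. 1 \<le> j ==> j \<le> s ==> L2sq (g j) \<le> ennreal C1"
   by (rule \<Theta>_chain[OF t]) (rule that; assumption)
  have gm: "g j \<in> borel_measurable borel" if "j \<le> s" for j
   using that g(2)[of j] g(2)[of "j - 1"] s by (cases j) (auto simp: has_weak_deriv_def intro: locally_integrable_measurable)
  have "Hsq s ((\<lambda>j x. g j x - m j x) 0) \<le> ennreal (real (s + 1) * K)"
  proof (rule Hsq_chain_bound)
   have w: "has_weak_deriv (\<lambda>x. g j x - m j x) (\<lambda>x. g (Suc j) x - m (Suc j) x)" if "j < s" for j
    by (rule has_weak_deriv_diff[OF g(2) md]) (use that in auto)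
   thus "has_weak_deriv (\<lambda>x. g j x - m j x) (\<lambda>x. g (Suc j) x - m (Suc j) x)" if "j < s" for j using that .
   show "locally_integrable (\<lambda>x. g 0 x - m 0 x)" using w[of 0] s by (simp add: has_weak_deriv_def)
   have "L2sq (\<lambda>x. \<Theta> 0 t x - f (x / sqrt (1 + t))) \<le> ennreal C1"
   proof (rule L2sq_limit[OF t _ _ eventually_mono[OF eventually_in \<theta>_f[OF _ t]]])
    show "(\<lambda>x. f (x / sqrt (1 + t))) \<in> borel_measurable borel"
     using borel_measurable_continuous_onI[OF f_cont] by measurable
   qed auto
   also have "\<dots> \<le> ennreal K" by (rule ennreal_leI[OF K(1)])
   finally show "L2sq (\<lambda>x. g 0 x - m 0 x) \<le> ennreal K" by (simp add: g m_def k_def a(4))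
   show "L2sq (\<lambda>x. g j x - m j x) \<le> ennreal K" if j: "1 \<le> j" "j \<le> s" for j
   proof -
    have "L2sq (\<lambda>x. g j x - m j x) \<le> 2 * L2sq (g j) + 2 * L2sq (m j)" by (rule L2sq_diff_le[OF gm mm]) (use j in auto)
    also have "\<dots> \<le> 2 * ennreal C1 + 2 * ennreal (sqrt (1 + T) * (2 * C1 + 2 * D0))"
     by (intro add_mono mult_left_mono g mL j) auto
    also have "\<dots> = ennreal (2 * C1) + ennreal (2 * (sqrt (1 + T) * (2 * C1 + 2 * D0)))" using C1 sT by (simp add: ennreal_mult)
    also have "\<dots> = ennreal K" unfolding K_def by (rule ennreal_plus[symmetric]) (use C1 sT in auto)
    finally show ?thesis .
   qed
  qed (rule K)
  thus ?thesis by (simp add: g m_def k_def a(4))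
 qed
 thus ?thesis by blast
qed

end

section \<open>The limit system\<close>

lemma dt_eq:
 assumes "((\<lambda>\<tau>. f \<tau> x) has_real_derivative ft) (at t within {0..T})" "t \<in> {0..T}" "T > 0"
 shows "dt T f t x = ft"
 unfolding dt_def using assms
 by (intro vector_derivative_within_closed_interval) (auto simp: has_real_derivative_iff_has_vector_derivative)

lemma C12_stripI:
 assumes T: "T > 0" and c: "C_strip 0 T f" "C_strip 0 T f1" "C_strip 0 T f2" "C_strip 0 T ft"
  and d: "\<And>t x. t \<in> {0..T} ==> (f t has_real_derivative f1 t x) (at x)"
   "\<And>t x. t \<in> {0..T} ==> (f1 t has_real_derivative f2 t x) (at x)"
   "\<And>t x. t \<in> {0..T} ==> ((\<lambda>\<tau>. f \<tau> x) has_real_derivative ft t x) (at t within {0..T})"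
 shows "C12_strip T f" "t \<in> {0..T} ==> dx f t x = f1 t x" "t \<in> {0..T} ==> dt T f t x = ft t x" "t \<in> {0..T} ==> dx (dx f) t x = f2 t x"
proof -
 have 1: "dx f t = f1 t" if "t \<in> {0..T}" for t
  unfolding dx_def using DERIV_imp_deriv[OF d(1)[OF that]] by blast
 have 2: "dt T f t x = ft t x" if "t \<in> {0..T}" for t x by (rule dt_eq[OF d(3)[OF that] that T])
 have 3: "dx (dx f) t = f2 t" if "t \<in> {0..T}" for t
  unfolding dx_def[of "dx f"] 1[OF that] using DERIV_imp_deriv[OF d(2)[OF that]] by blast
 show "C12_strip T f"
  unfolding C12_strip_def One_nat_def C_strip.simps(2)
 proof (intro conjI ballI allI)
  show "continuous_on ({0..T} \<times> UNIV) (\<lambda>(t, x). f t x)" using c(1) by simp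
  show "C_strip 0 T (dx f)" by (rule C0_cong[OF c(2)]) (simp add: 1)
  show "C_strip 0 T (dt T f)" by (rule C0_cong[OF c(4)]) (simp add: 2)
  show "C_strip 0 T (dx (dx f))" by (rule C0_cong[OF c(3)]) (simp add: 3)
  fix t x assume t: "t \<in> {0..T}"
  show "f t differentiable at x" "dx f t differentiable at x" "(\<lambda>\<tau>. f \<tau> x) differentiable at t within {0..T}"
   using d(1)[OF t] d(2)[OF t] d(3)[OF t] by (auto simp: real_differentiable_def 1[OF t])
 qed
 show "t \<in> {0..T} ==> dx f t x = f1 t x" "t \<in> {0..T} ==> dt T f t x = ft t x" "t \<in> {0..T} ==> dx (dx f) t x = f2 t x"
  by (simp_all add: 1 2 3)
qed

lemma C12_stripD:
 assumes "C12_strip T f"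
 shows "C_strip 0 T f" "C_strip 0 T (dx f)" "C_strip 0 T (dt T f)" "C_strip 0 T (dx (dx f))"
  "t \<in> {0..T} ==> (f t has_real_derivative dx f t x) (at x)"
  "t \<in> {0..T} ==> (dx f t has_real_derivative dx (dx f) t x) (at x)"
  "t \<in> {0..T} ==> ((\<lambda>\<tau>. f \<tau> x) has_real_derivative dt T f t x) (at t within {0..T})"
proof -
 have c: "C_strip (Suc 0) T f" "C_strip 0 T (dx (dx f))" "\<And>t x. t \<in> {0..T} ==> dx f t differentiable at x"
  using assms by (auto simp: C12_strip_def)
 thus "C_strip 0 T f" "C_strip 0 T (dx f)" "C_strip 0 T (dt T f)" "C_strip 0 T (dx (dx f))" by simp_all
 show "t \<in> {0..T} ==> (dx f t has_real_derivative dx (dx f) t x) (at x)"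
  using c(3)[of t x] by (simp add: dx_def[of "dx f"] DERIV_deriv_iff_real_differentiable)
 show "t \<in> {0..T} ==> (f t has_real_derivative dx f t x) (at x)"
  "t \<in> {0..T} ==> ((\<lambda>\<tau>. f \<tau> x) has_real_derivative dt T f t x) (at t within {0..T})"
  by (rule C_strip_derivatives[OF c(1)]; assumption)+
qed

lemma continuous_antiderivative:
 fixes g :: "real \<Rightarrow> real"
 assumes "continuous_on UNIV g" obtains G where "\<And>x. (G has_real_derivative g x) (at x)"
proof -
 have "isCont g x" for x using assms by (simp add: continuous_on_eq_continuous_at)
 hence "\<exists>G. \<forall>x::real. - \<infinity> < ereal x \<longrightarrow> ereal x < \<infinity> \<longrightarrow> (G has_vector_derivative g x) (at x)"
  by (intro einterval_antiderivative) auto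
 thus ?thesis using that by (auto simp: has_real_derivative_iff_has_vector_derivative)
qed

text \<open>The first equation only says that \<open>2 u - \<kappa> exp \<theta> \<theta>\<^sub>x\<close> is constant in x; its averages over \<open>[0, n^2]\<close> tend to 0.\<close>

lemma limit_solution_properties:
 assumes T: "T > 0" and s: "s \<ge> 1" and \<kappa>: "\<kappa> > 0"
  and w: "\<And>t x. (\<theta>w t has_real_derivative \<theta>w' t x) (at x)" "\<And>t. continuous_on UNIV (\<theta>w' t)" "\<And>t x. \<bar>\<theta>w t x\<bar> \<le> B"
  and sol: "limit_solution s \<kappa> \<mu> T \<theta>w w_in \<theta>_in u \<theta>"
 shows "\<exists>K. \<forall>t\<in>{0..T}. \<forall>x. \<bar>\<theta> t x\<bar> \<le> K"
  and "t \<in> {0..T} ==> u t x = \<kappa> / 2 * (exp (\<theta> t x) * dx \<theta> t x)"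
  and "t \<in> {0..T} ==> dt T \<theta> t x = \<kappa> / 2 * exp (\<theta> t x) * dx (dx \<theta>) t x"
proof -
 obtain q M0 where *: "C12_strip T u" "C12_strip T \<theta>" "solves_limit_system \<kappa> \<mu> T u \<theta> q"
  and M0: "\<And>t. t \<in> {0..T} ==> Hsq s (u t) \<le> ennreal M0" "\<And>t. t \<in> {0..T} ==> Hsq s (\<lambda>x. \<theta> t x - \<theta>w t x) \<le> ennreal M0"
  using sol unfolding limit_solution_def by blast
 define C where "C = max M0 0"
 have C: "C \<ge> 0" "ennreal M0 = ennreal C" by (auto simp: C_def max_def ennreal_neg)
 note uD = C12_stripD[OF *(1)] and \<theta>D = C12_stripD[OF *(2)]
 define K where "K = B + sqrt (3 * C)"
 have bd: "\<bar>\<theta> t x\<bar> \<le> K" if t: "t \<in> {0..T}" for t x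
 proof -
  have fin: "Hsq s (\<lambda>x. \<theta> t x - \<theta>w t x) < \<infinity>" using M0(2)[OF t] by (rule le_less_trans) simp
  obtain g where g: "g 0 = (\<lambda>x. \<theta> t x - \<theta>w t x)" "\<And>j. j < s ==> has_weak_deriv (g j) (g (Suc j))"
   "\<And>j. j \<le> s ==> L2sq (g j) \<le> Hsq s (\<lambda>x. \<theta> t x - \<theta>w t x)"
   by (rule Hsq_finiteD[OF fin]) (rule that; assumption)
  define h where "h x = \<theta> t x - \<theta>w t x" for x
  define h' where "h' x = dx \<theta> t x - \<theta>w' t x" for x
  have h: "(h has_real_derivative h' x) (at x)" for x
   unfolding h_def[abs_def] h'_def by (intro DERIV_diff w(1) \<theta>D(5) t)
  have h'c: "continuous_on UNIV h'" unfolding h'_def[abs_def] by (intro continuous_on_diff w C0_slice_x[OF \<theta>D(2) t])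
  have "has_weak_deriv h (g (Suc 0))" using g(2)[of 0] s unfolding g(1) h_def[abs_def] by simp
  from weak_deriv_unique[OF this has_weak_deriv_classical[OF h h'c]]
  have "L2sq (g (Suc 0)) = L2sq h'" unfolding L2sq_def by (intro nn_integral_cong_AE) (auto elim: eventually_mono)
  hence L: "L2sq h' \<le> ennreal C" "L2sq h \<le> ennreal C"
   using order_trans[OF g(3) M0(2)[OF t], of "Suc 0"] order_trans[OF g(3) M0(2)[OF t], of 0] s C(2)
   by (auto simp: g(1) h_def[abs_def])
  have "(h x)^2 \<le> 2 * C + C"
   by (rule sup_bound_from_L2[OF h h'c integral_square_le[OF DERIV_continuous_UNIV[OF h] L(2) C(1)] integral_square_le[OF h'c L(1) C(1)]])
  hence "\<bar>h x\<bar> \<le> sqrt (3 * C)" by (intro real_le_rsqrt) simp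
  thus ?thesis using w(3)[of t x] unfolding h_def K_def by linarith
 qed
 thus "\<exists>K. \<forall>t\<in>{0..T}. \<forall>x. \<bar>\<theta> t x\<bar> \<le> K" by blast
 have eq2: "u t x = \<kappa> / 2 * (exp (\<theta> t x) * dx \<theta> t x)" if t: "t \<in> {0..T}" for t x
 proof -
  define F where "F x = 2 * u t x - \<kappa> * exp (\<theta> t x) * dx \<theta> t x" for x
  have "(F has_real_derivative 2 * dx u t x - \<kappa> * exp (\<theta> t x) * ((dx \<theta> t x)^2 + dx (dx \<theta>) t x)) (at x)" for x
   unfolding F_def[abs_def] using uD(5)[OF t] \<theta>D(5,6)[OF t]
   by (auto intro!: derivative_eq_intros simp: algebra_simps power2_eq_square)
  moreover have "deriv F x = 0" for x
   using *(3) t unfolding solves_limit_system_def F_def[abs_def] dx_def[of "\<lambda>t x. 2 * u t x - \<kappa> * exp (\<theta> t x) * dx \<theta> t x"] by blast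
  ultimately have "(F has_real_derivative 0) (at x)" for x by (metis DERIV_imp_deriv)
  hence "\<And>x y. F x = F y" by (intro DERIV_isconst_all) auto
  then obtain c where c: "\<And>x. F x = c" by metis
  have K0: "K \<ge> 0" using bd[OF t, of 0] by linarith
  have uc: "continuous_on S (u t)" for S by (rule C0_slice_x[OF uD(1) t])
  have L2: "integral {0..R} (\<lambda>x. (u t x)^2) \<le> C" for R
  proof (rule integral_square_le[OF uc _ C(1)])
   show "L2sq (u t) \<le> ennreal C" using order_trans[OF L2sq_le_Hsq M0(1)[OF t]] C(2) by simp
  qed
  \<comment> \<open>With R = n^2, Cauchy-Schwarz bounds the integral of u by sqrt C n, the
    exponential term integrates to a bounded quantity, and the constant contributes |c| n^2:
    quadratic growth against linear growth.\<close>
  have bound: "\<bar>c\<bar> * (real n * real n) \<le> 2 * (sqrt C * real n) + \<kappa> * (2 * exp K)" for n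
  proof -
   define R where "R = real n * real n"
   have R: "R \<ge> 0" by (simp add: R_def)
   have u0: "\<bar>integral {0..R} (u t)\<bar> \<le> sqrt C * real n"
   proof -
    have "\<bar>integral {0..R} (u t)\<bar> \<le> sqrt (C * (R - 0))" by (rule integral_Cauchy_Schwarz[OF uc R L2])
    also have "\<dots> = sqrt C * real n" by (simp add: R_def real_sqrt_mult)
    finally show ?thesis .
   qed
   have "integral {0..R} (\<lambda>x. \<kappa> * (exp (\<theta> t x) * dx \<theta> t x)) = \<kappa> * exp (\<theta> t R) - \<kappa> * exp (\<theta> t 0)"
   proof (rule FTC_integral[where S = UNIV])
    fix x
    show "((\<lambda>x. \<kappa> * exp (\<theta> t x)) has_real_derivative \<kappa> * (exp (\<theta> t x) * dx \<theta> t x)) (at x within UNIV)"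
     using \<theta>D(5)[OF t] by (auto intro!: derivative_eq_intros)
   qed (use R in auto)
   moreover have "c * R = integral {0..R} (\<lambda>x. 2 * u t x - \<kappa> * (exp (\<theta> t x) * dx \<theta> t x))"
   proof -
    have "c * R = integral {0..R} (\<lambda>x. c)" using R by simp
    also have "\<dots> = integral {0..R} (\<lambda>x. 2 * u t x - \<kappa> * (exp (\<theta> t x) * dx \<theta> t x))"
    proof (rule Henstock_Kurzweil_Integration.integral_cong)
     show "c = 2 * u t x - \<kappa> * (exp (\<theta> t x) * dx \<theta> t x)" for x using c[of x] by (simp add: F_def mult.assoc)
    qed
    finally show ?thesis .
   qed
   moreover have "integral {0..R} (\<lambda>x. 2 * u t x - \<kappa> * (exp (\<theta> t x) * dx \<theta> t x))
    = 2 * integral {0..R} (u t) - integral {0..R} (\<lambda>x. \<kappa> * (exp (\<theta> t x) * dx \<theta> t x))"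
   proof (subst integral_diff)
    show "(\<lambda>x. \<kappa> * (exp (\<theta> t x) * dx \<theta> t x)) integrable_on {0..R}"
     by (intro integrable_continuous_real continuous_intros C0_slice_x[OF \<theta>D(1) t] C0_slice_x[OF \<theta>D(2) t])
   qed (auto intro!: integrable_continuous_real continuous_on_mult_left uc)
   moreover have "\<bar>\<kappa> * exp (\<theta> t R) - \<kappa> * exp (\<theta> t 0)\<bar> \<le> \<kappa> * (2 * exp K)"
   proof -
    have "exp (\<theta> t y) \<le> exp K \<and> exp (\<theta> t y) > 0" for y using bd[OF t, of y] by simp
    from this[of R] this[of 0] have "\<bar>exp (\<theta> t R) - exp (\<theta> t 0)\<bar> \<le> 2 * exp K" by linarith
    thus ?thesis using \<kappa> by (simp add: right_diff_distrib[symmetric] abs_mult)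
   qed
   ultimately have "\<bar>c * R\<bar> \<le> 2 * (sqrt C * real n) + \<kappa> * (2 * exp K)" using u0 by linarith
   thus ?thesis using R by (simp add: abs_mult R_def)
  qed
  have "\<bar>c\<bar> * real n \<le> 2 * sqrt C + \<kappa> * (2 * exp K)" if n: "n \<ge> 1" for n :: nat
  proof -
   have "\<kappa> * (2 * exp K) * 1 \<le> \<kappa> * (2 * exp K) * real n" using n \<kappa> by (intro mult_left_mono) auto
   hence "(\<bar>c\<bar> * real n) * real n \<le> (2 * sqrt C + \<kappa> * (2 * exp K)) * real n" using bound[of n] by (simp add: algebra_simps)
   thus ?thesis using n by simp
  qed
  hence "\<bar>c\<bar> = 0"
  proof (intro antisym[OF _ abs_ge_zero] leI notI)
   assume le: "\<And>n::nat. n \<ge> 1 ==> \<bar>c\<bar> * real n \<le> 2 * sqrt C + \<kappa> * (2 * exp K)" and pos: "0 < \<bar>c\<bar>"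
   obtain n :: nat where "2 * sqrt C + \<kappa> * (2 * exp K) < real n * \<bar>c\<bar>" using reals_Archimedean3[OF pos] by blast
   also have "\<dots> \<le> real (Suc n) * \<bar>c\<bar>" using pos by (intro mult_right_mono) auto
   finally show False using le[of "Suc n"] by (simp add: mult.commute del: of_nat_Suc)
  qed
  thus ?thesis using c[of x] by (simp add: F_def)
 qed
 thus "t \<in> {0..T} ==> u t x = \<kappa> / 2 * (exp (\<theta> t x) * dx \<theta> t x)" .
 show "dt T \<theta> t x = \<kappa> / 2 * exp (\<theta> t x) * dx (dx \<theta>) t x" if t: "t \<in> {0..T}"
 proof -
  have d1: "dx u t x = \<kappa> / 2 * (exp (\<theta> t x) * ((dx \<theta> t x)^2 + dx (dx \<theta>) t x))"
  proof -
   have "((\<lambda>x. \<kappa> / 2 * (exp (\<theta> t x) * dx \<theta> t x)) has_real_derivative \<kappa> / 2 * (exp (\<theta> t x) * ((dx \<theta> t x)^2 + dx (dx \<theta>) t x))) (at x)"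
    using \<theta>D(5,6)[OF t] by (auto intro!: derivative_eq_intros simp: field_simps power2_eq_square)
   moreover have "u t = (\<lambda>x. \<kappa> / 2 * (exp (\<theta> t x) * dx \<theta> t x))" using eq2[OF t] by blast
   ultimately show ?thesis unfolding dx_def[of u] by (simp only: DERIV_imp_deriv)
  qed
  have d2: "dx (\<lambda>t x. \<kappa> * exp (\<theta> t x) * dx \<theta> t x) t x = \<kappa> * (exp (\<theta> t x) * ((dx \<theta> t x)^2 + dx (dx \<theta>) t x))"
   unfolding dx_def[of "\<lambda>t x. \<kappa> * exp (\<theta> t x) * dx \<theta> t x"] using \<theta>D(5,6)[OF t]
   by (intro DERIV_imp_deriv) (auto intro!: derivative_eq_intros simp: algebra_simps power2_eq_square)
  have "dt T \<theta> t x + u t x * dx \<theta> t x + dx u t x = dx (\<lambda>t x. \<kappa> * exp (\<theta> t x) * dx \<theta> t x) t x"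
   using *(3) t unfolding solves_limit_system_def by blast
  thus ?thesis unfolding d1 d2 eq2[OF t] by (simp add: field_simps power2_eq_square)
 qed
qed

section \<open>Existence and uniqueness for the limit system\<close>

context singular_solution
begin

lemma \<Theta>_C12: "C12_strip T (\<Theta> 0)"
 and \<Theta>_derivs: "t \<in> I ==> dx (\<Theta> 0) t x = \<Theta> 1 t x" "t \<in> I ==> dt T (\<Theta> 0) t x = \<Theta>t t x"
  "t \<in> I ==> dx (dx (\<Theta> 0)) t x = \<Theta> 2 t x"
proof -
 have c: "C_strip 0 T (\<Theta> 0)" "C_strip 0 T (\<Theta> 1)" "C_strip 0 T (\<Theta> 2)" by (rule \<Theta>_C0, simp)+
 note * = C12_stripI[OF pos(3) c \<Theta>t_C0(1) \<Theta>_dx012(1,2) \<Theta>_dt]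
 show "C12_strip T (\<Theta> 0)" by (rule *(1))
 show "t \<in> I ==> dx (\<Theta> 0) t x = \<Theta> 1 t x" by (rule *(2))
 show "t \<in> I ==> dt T (\<Theta> 0) t x = \<Theta>t t x" by (rule *(3))
 show "t \<in> I ==> dx (dx (\<Theta> 0)) t x = \<Theta> 2 t x" by (rule *(4))
qed

definition Ux where "Ux t x = \<kappa> / 2 * (exp (\<Theta> 0 t x) * ((\<Theta> 1 t x)^2 + \<Theta> 2 t x))"
definition Uxx where "Uxx t x = \<kappa> / 2 * (exp (\<Theta> 0 t x) * (\<Theta> 1 t x * ((\<Theta> 1 t x)^2 + \<Theta> 2 t x) + (2 * \<Theta> 1 t x * \<Theta> 2 t x + \<Theta> 3 t x)))"
definition Ut where "Ut t x = \<kappa> / 2 * (exp (\<Theta> 0 t x) * (\<Theta>t t x * \<Theta> 1 t x + \<Theta>tx t x))"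

lemma U_dx: "t \<in> I ==> (U t has_real_derivative Ux t x) (at x)"
 unfolding U_def[abs_def] Ux_def by (auto intro!: derivative_eq_intros \<Theta>_dx012 simp: field_simps power2_eq_square)

lemma Ux_dx: "t \<in> I ==> (Ux t has_real_derivative Uxx t x) (at x)"
 unfolding Ux_def[abs_def] Uxx_def by (auto intro!: derivative_eq_intros \<Theta>_dx012 simp: field_simps power2_eq_square)

lemma U_dt: "t \<in> I ==> ((\<lambda>\<tau>. U \<tau> x) has_real_derivative Ut t x) (at t within I)"
 unfolding U_def[abs_def] Ut_def using \<Theta>_dt[of t x] \<Theta>1_dt[of t x]
 by (auto intro!: derivative_eq_intros simp: field_simps)

lemma U_C12: "C12_strip T U"
 and U_derivs: "t \<in> I ==> dx U t x = Ux t x" "t \<in> I ==> dt T U t x = Ut t x" "t \<in> I ==> dx (dx U) t x = Uxx t x"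
proof -
 have c: "C_strip 0 T Ux" "C_strip 0 T Uxx" "C_strip 0 T Ut"
  unfolding Ux_def[abs_def] Uxx_def[abs_def] Ut_def[abs_def] by (intro C0_intros \<Theta>_C0 \<Theta>t_C0; simp)+
 note * = C12_stripI[OF pos(3) U_C0 c U_dx Ux_dx U_dt]
 show "C12_strip T U" by (rule *(1))
 show "t \<in> I ==> dx U t x = Ux t x" by (rule *(2))
 show "t \<in> I ==> dt T U t x = Ut t x" by (rule *(3))
 show "t \<in> I ==> dx (dx U) t x = Uxx t x" by (rule *(4))
qed

text \<open>The momentum equation is solved by the choice of the pressure: at each time it is an
  antiderivative in x of the continuous remainder of the other terms. The third equation is the
  scalar equation for \<Theta> with U inserted.\<close>

lemma limit_system: "\<exists>q. solves_limit_system \<kappa> \<mu> T U (\<Theta> 0) q"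
proof -
 define g where "g t x = \<mu> * dx (dx U) t x - exp (- \<Theta> 0 t x) * (dt T U t x + U t x * dx U t x)" for t x
 have "\<forall>t\<in>I. \<exists>q. \<forall>x. (q has_real_derivative g t x) (at x)"
 proof
  fix t assume t: "t \<in> I"
  have "continuous_on UNIV (g t)" unfolding g_def[abs_def]
   by (intro continuous_intros C0_slice_x[OF _ t] U_C0 \<Theta>_C0 C12_stripD(2-4)[OF U_C12]) simp
  thus "\<exists>q. \<forall>x. (q has_real_derivative g t x) (at x)" by (rule continuous_antiderivative) blast
 qed
 then obtain q where q: "\<And>t x. t \<in> I ==> (q t has_real_derivative g t x) (at x)" by metis
 have "solves_limit_system \<kappa> \<mu> T U (\<Theta> 0) q"
  unfolding solves_limit_system_def
 proof (intro ballI allI conjI)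
  fix t x assume t: "t \<in> I"
  show "q t differentiable at x" using q[OF t] by (auto simp: real_differentiable_def)
  have "(\<lambda>x. 2 * U t x - \<kappa> * exp (\<Theta> 0 t x) * dx (\<Theta> 0) t x) = (\<lambda>x. 0)"
   by (simp add: U_def \<Theta>_derivs(1)[OF t])
  thus "dx (\<lambda>t x. 2 * U t x - \<kappa> * exp (\<Theta> 0 t x) * dx (\<Theta> 0) t x) t x = 0" unfolding dx_def[of "\<lambda>t x. 2 * U t x - \<kappa> * exp (\<Theta> 0 t x) * dx (\<Theta> 0) t x"] by simp
  have 1: "dx (\<lambda>t x. \<mu> * dx U t x) t x = \<mu> * dx (dx U) t x"
   unfolding dx_def[of "\<lambda>t x. \<mu> * dx U t x"] by (intro DERIV_imp_deriv DERIV_cmult C12_stripD(6)[OF U_C12] t)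
  have 2: "dx q t x = g t x" unfolding dx_def by (rule DERIV_imp_deriv[OF q[OF t]])
  show "exp (- \<Theta> 0 t x) * (dt T U t x + U t x * dx U t x) + dx q t x = dx (\<lambda>t x. \<mu> * dx U t x) t x"
   unfolding 1 2 g_def by simp
  have "((\<lambda>x. \<kappa> * exp (\<Theta> 0 t x) * \<Theta> 1 t x) has_real_derivative \<kappa> * (exp (\<Theta> 0 t x) * ((\<Theta> 1 t x)^2 + \<Theta> 2 t x))) (at x)"
   using \<Theta>_dx012[OF t] by (auto intro!: derivative_eq_intros simp: algebra_simps power2_eq_square)
  moreover have "(\<lambda>x. \<kappa> * exp (\<Theta> 0 t x) * dx (\<Theta> 0) t x) = (\<lambda>x. \<kappa> * exp (\<Theta> 0 t x) * \<Theta> 1 t x)" by (simp add: \<Theta>_derivs(1)[OF t])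
  ultimately have 3: "dx (\<lambda>t x. \<kappa> * exp (\<Theta> 0 t x) * dx (\<Theta> 0) t x) t x = \<kappa> * (exp (\<Theta> 0 t x) * ((\<Theta> 1 t x)^2 + \<Theta> 2 t x))"
   unfolding dx_def[of "\<lambda>t x. \<kappa> * exp (\<Theta> 0 t x) * dx (\<Theta> 0) t x"] by (simp add: DERIV_imp_deriv)
  show "dt T (\<Theta> 0) t x + U t x * dx (\<Theta> 0) t x + dx U t x = dx (\<lambda>t x. \<kappa> * exp (\<Theta> 0 t x) * dx (\<Theta> 0) t x) t x"
   unfolding 3 \<Theta>_derivs[OF t] U_derivs[OF t] U_def Ux_def \<Theta>t_def by (simp add: field_simps power2_eq_square)
 qed
 thus ?thesis by blast
qed

text \<open>The data agree almost everywhere with the continuously differentiable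
  \<open>\<Theta> 0 0\<close>, hence have its classical derivative as weak derivative, and the
  chosen representative differs from it on a null set only.\<close>

lemma initial_AE: "AE x in lborel. U 0 x = 1 / 2 * \<kappa> * exp (\<theta>_in x) * weak_deriv \<theta>_in x \<and> \<Theta> 0 0 x = \<theta>_in x"
proof -
 have t0: "(0::real) \<in> I" using pos by simp
 have ae: "AE x in lborel. \<Theta> 0 0 x = \<theta>_in x" by (rule \<Theta>_initial_AE[OF locally_integrable_measurable[OF \<theta>_in_meas] \<theta>_in_conv])
 have c: "continuous_on UNIV (\<Theta> 1 0)" by (rule C0_slice_x[OF \<Theta>_C0 t0]) simp
 have w: "has_weak_deriv \<theta>_in (\<Theta> 1 0)"
  by (rule has_weak_deriv_cong_AE[OF has_weak_deriv_classical[OF \<Theta>_dx012(1)[OF t0] c] ae _ \<theta>_in_meas continuous_imp_locally_integrable[OF c]]) simp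
 hence "has_weak_deriv \<theta>_in (weak_deriv \<theta>_in)" unfolding weak_deriv_def by (rule someI[of "has_weak_deriv \<theta>_in"])
 from weak_deriv_unique[OF this w] ae show ?thesis by eventually_elim (simp add: U_def)
qed

lemma limit_solution: "limit_solution s \<kappa> \<mu> T (\<lambda>t x. f (x / sqrt (1 + t))) (\<lambda>x. 1 / 2 * \<kappa> * exp (\<theta>_in x) * weak_deriv \<theta>_in x) \<theta>_in U (\<Theta> 0)"
proof -
 obtain K where K: "\<And>t. t \<in> I ==> Hsq s (\<lambda>x. \<Theta> 0 t x - f (x / sqrt (1 + t))) \<le> ennreal K" using Hsq_\<Theta> by blast
 define K1 where "K1 = real (s + 1) * (C1 + (\<kappa> / 2 * exp M)^2 * C1)"
 have "Hsq s (U t) \<le> ennreal (max K K1) \<and> Hsq s (\<lambda>x. \<Theta> 0 t x - f (x / sqrt (1 + t))) \<le> ennreal (max K K1)" if t: "t \<in> I" for t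
  using order_trans[OF Hsq_U[OF t] ennreal_leI[of K1 "max K K1", unfolded K1_def]] order_trans[OF K[OF t] ennreal_leI[of K "max K K1"]]
  by (simp add: K1_def)
 thus ?thesis unfolding limit_solution_def using U_C12 \<Theta>_C12 limit_system initial_AE by blast
qed

text \<open>In any solution the velocity is determined by the temperature, and the temperature
  solves a scalar parabolic equation. Two temperatures with the same data agree at time 0 everywhere
  by continuity, and afterwards by the maximum principle with \<delta> = 0.\<close>

lemma limit_solution_unique:
 assumes sol: "limit_solution s \<kappa> \<mu> T (\<lambda>t x. f (x / sqrt (1 + t))) w_in \<theta>_in u' \<theta>'" and t: "t \<in> I"
 shows "\<theta>' t x = \<Theta> 0 t x" "u' t x = U t x"
proof -
 have fw: "((\<lambda>x. f (x / sqrt (1 + t))) has_real_derivative f' (x / sqrt (1 + t)) * (1 / sqrt (1 + t))) (at x)" for t x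
  by (rule DERIV_chain2[OF f_dx]) (rule DERIV_cdivide[OF DERIV_ident])
 have fw': "continuous_on UNIV (\<lambda>x. f' (x / sqrt (1 + t)) * (1 / sqrt (1 + t)))" for t
  unfolding divide_inverse by (intro continuous_on_compose2[OF f'_cont] continuous_intros) auto
 note props = limit_solution_properties[OF pos(3) s pos(1) fw fw' f_bound sol]
 obtain K where K: "\<And>t x. t \<in> I ==> \<bar>\<theta>' t x\<bar> \<le> K" using props(1) by blast
 have *: "C12_strip T \<theta>'" "AE x in lborel. \<theta>' 0 x = \<theta>_in x" using sol unfolding limit_solution_def by auto
 note \<theta>D = C12_stripD[OF *(1)]
 have t0: "(0::real) \<in> I" using pos by simp
 have c0: "continuous_on S (\<theta>' 0)" "continuous_on S (\<Theta> 0 0)" for S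
  by (rule C0_slice_x[OF \<theta>D(1) t0], rule C0_slice_x[OF \<Theta>_C0 t0], simp)
 have "AE x in lborel. \<theta>' 0 x = \<Theta> 0 0 x" using *(2) initial_AE by eventually_elim simp
 hence ae: "AE x in lborel. \<theta>' 0 x - \<Theta> 0 0 x = 0" by eventually_elim simp
 have init: "\<theta>' 0 x - \<Theta> 0 0 x = 0" for x
 proof -
  have "\<bar>\<theta>' 0 x - \<Theta> 0 0 x\<bar> \<le> 0"
   by (rule AE_imp_le_everywhere[where g = "\<lambda>x. 0" and c = x and f = "\<lambda>x. \<bar>\<theta>' 0 x - \<Theta> 0 0 x\<bar>" and h = "\<lambda>x. 0"])
    (use ae in \<open>auto intro!: continuous_intros c0\<close>)
  thus ?thesis by simp
 qed
 define K2 where "K2 = max K M"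
 have b1: "\<bar>\<theta>' t x\<bar> \<le> K2" "\<bar>\<Theta> 0 t x\<bar> \<le> K2" if "t \<in> I" for t x
  using K[OF that, of x] \<Theta>_bound[OF _ that, of 0 x] by (auto simp: K2_def)
 define z where "z t x = \<theta>' t x - \<Theta> 0 t x" for t x
 define A where "A t x = \<kappa> / 2 * exp (\<theta>' t x)" for t x
 \<comment> \<open>Where z vanishes the quotient is 0 by the convention for division, so that b
   stays bounded and the product b z has the right value.\<close>
 define b where "b t x = \<kappa> / 2 * ((exp (\<theta>' t x) - exp (\<Theta> 0 t x)) / z t x) * \<Theta> 2 t x" for t x
 have c: "continuous_on (I \<times> UNIV) (\<lambda>(t, x). z t x)"
   using C0_diff[OF \<theta>D(1) \<Theta>_C0[of 0]] unfolding z_def[abs_def] by simp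
 have bdz: "\<bar>z t x\<bar> \<le> 2 * K2" if "t \<in> I" for t x using b1[OF that, of x] unfolding z_def by linarith
 have ztd: "((\<lambda>\<tau>. z \<tau> x) has_real_derivative dt T \<theta>' t x - \<Theta>t t x) (at t within I)" if "t \<in> I" for t x
   unfolding z_def by (intro DERIV_diff \<theta>D(7) \<Theta>_dt that)
 have zxd: "(z t has_real_derivative dx \<theta>' t x - \<Theta> 1 t x) (at x)" if "t \<in> I" for t x
   unfolding z_def[abs_def] by (intro DERIV_diff \<theta>D(5) \<Theta>_dx012 that)
 have zxxd: "((\<lambda>x. dx \<theta>' t x - \<Theta> 1 t x) has_real_derivative dx (dx \<theta>') t x - \<Theta> 2 t x) (at x)" if "t \<in> I" for t x
   by (intro DERIV_diff \<theta>D(6) \<Theta>_dx012 that)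
 have eqz: "dt T \<theta>' t x - \<Theta>t t x = A t x * (dx (dx \<theta>') t x - \<Theta> 2 t x) + b t x * z t x + 0" if t: "t \<in> I" for t x
  proof -
   have "b t x * z t x = \<kappa> / 2 * (exp (\<theta>' t x) - exp (\<Theta> 0 t x)) * \<Theta> 2 t x"
   proof (cases "z t x = 0")
    case True
    thus ?thesis by (simp add: z_def)
   qed (simp add: b_def)
   thus ?thesis unfolding props(3)[OF t] \<Theta>t_def A_def by (simp add: field_simps)
  qed
 have Ab: "0 \<le> A t x \<and> A t x \<le> \<kappa> / 2 * exp K2" if "t \<in> I" for t x
   using b1(1)[OF that, of x] pos unfolding A_def by (auto intro!: mult_left_mono)
 have bb: "\<bar>b t x\<bar> \<le> \<kappa> / 2 * exp K2 * M" if t: "t \<in> I" for t x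
  proof -
   have "\<bar>exp (\<theta>' t x) - exp (\<Theta> 0 t x)\<bar> \<le> exp K2 * \<bar>z t x\<bar>" unfolding z_def by (rule exp_diff_bound[OF b1[OF t]])
   hence "\<bar>(exp (\<theta>' t x) - exp (\<Theta> 0 t x)) / z t x\<bar> \<le> exp K2" by (cases "z t x = 0") (auto simp: field_simps)
   thus ?thesis unfolding b_def abs_mult using \<Theta>_bound[OF _ t, of 2 x] pos
    by (intro mult_mono) auto
  qed
 have z0: "\<bar>z 0 x\<bar> \<le> 0" for x using init[of x] by (simp add: z_def)
 have main: "\<bar>z t x\<bar> \<le> 0 * exp ((\<kappa> / 2 * exp K2 * M + 1) * t)" for x
  by (rule maximum_principle[OF c bdz ztd zxd zxxd eqz Ab bb _ z0 t]) auto
 have eq: "\<theta>' t = \<Theta> 0 t"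
 proof
  show "\<theta>' t x = \<Theta> 0 t x" for x using main[of x] by (simp add: z_def)
 qed
 show "\<theta>' t x = \<Theta> 0 t x" by (simp add: eq)
 have "dx \<theta>' t x = \<Theta> 1 t x" using \<Theta>_derivs(1)[OF t, of x] by (simp add: dx_def eq)
 thus "u' t x = U t x" unfolding props(2)[OF t] U_def by (simp add: eq)
qed

section \<open>Strong convergence of the three unknowns\<close>

text \<open>Up to order s the bounds hold at each time; the derivative of order s + 1 is controlled
  only in the mean over time. This additional order compensates the one that the Fourier criterion
  loses, so that every exponent below s is reached.\<close>

lemma local_bound_criterion:
 assumes g: "\<And>e j. e \<in> E ==> j \<le> s + 1 ==> C_strip 0 T (g e j)"
  and b: "\<And>e j t R. e \<in> E ==> j \<le> s ==> t \<in> I ==> integral {-R..R} (\<lambda>x. (g e j t x)^2) \<le> A R"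
  and d: "\<And>e R. e \<in> E ==> integral I (\<lambda>t. integral {-R..R} (\<lambda>x. (g e (s + 1) t x)^2)) \<le> A' R"
 shows "\<exists>C. \<forall>e\<in>E. \<forall>j\<le>s + 1. integral I (\<lambda>t. integral {-R..R} (\<lambda>x. (g e j t x)^2)) \<le> C"
proof (intro exI[of _ "max (T * A R) (A' R)"] ballI allI impI)
 fix e j assume e: "e \<in> E" and j: "j \<le> s + 1"
 show "integral I (\<lambda>t. integral {-R..R} (\<lambda>x. (g e j t x)^2)) \<le> max (T * A R) (A' R)"
 proof (cases "j = s + 1")
  case True
  thus ?thesis using d[OF e, of R] by simp
 next
  case False
  have gC: "C_strip 0 T (\<lambda>t x. (g e j t x)^2)" by (intro C0_intros g e j)
  have "integral I (\<lambda>t. integral {-R..R} (\<lambda>x. (g e j t x)^2)) \<le> integral I (\<lambda>t. A R)"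
   by (rule integral_mono_continuous[OF C0_space_integral[OF gC] continuous_on_const b[OF e]]) (use False j in auto)
  thus ?thesis using pos by simp
 qed
qed

text \<open>The dissipation integral of the norm controls the derivatives of order s + 1 of p and u;
  the hypothesis on g lets one proof serve both.\<close>

lemma dissipation_bound:
 assumes e: "e \<in> E" and g: "C_strip 0 T (g e)"
  and le: "\<And>t. L2sq (g e t) \<le> L2sq (p e (s + 1) t) + L2sq (u e (s + 1) t)"
 shows "integral I (\<lambda>t. integral {-R..R} (\<lambda>x. (g e t x)^2)) \<le> C1"
proof -
 have gC: "C_strip 0 T (\<lambda>t x. (g e t x)^2)" by (intro C0_intros g)
 have "ennreal (integral I (\<lambda>t. integral {-R..R} (\<lambda>x. (g e t x)^2))) = (\<integral>\<^sup>+t\<in>I. ennreal (integral {-R..R} (\<lambda>x. (g e t x)^2)) \<partial>lborel)"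
 proof (rule nn_integral_Icc_continuous[symmetric, OF C0_space_integral[OF gC]])
  show "0 \<le> integral {-R..R} (\<lambda>x. (g e t x)^2)" if "t \<in> I" for t
   by (rule integral_nonneg) (auto intro: integrable_continuous_real C0_slice_x[OF gC that])
 qed
 also have "\<dots> \<le> (\<integral>\<^sup>+t\<in>I. (L2sq (p e (s + 1) t) + L2sq (u e (s + 1) t)) \<partial>lborel)"
 proof (rule nn_integral_mono)
  fix t
  show "ennreal (integral {-R..R} (\<lambda>x. (g e t x)^2)) * indicator I t \<le> (L2sq (p e (s + 1) t) + L2sq (u e (s + 1) t)) * indicator I t"
  proof (cases "t \<in> I")
   case True
   thus ?thesis using order_trans[OF integral_square_le_L2sq[OF C0_slice_x[OF g True]] le[of t], of "-R" R] by simp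
  qed simp
 qed
 also have "\<dots> \<le> ennreal C1" by (rule dissipation[OF e])
 finally show ?thesis using C1 by (simp add: ennreal_le_iff)
qed

lemma convergence_p: assumes "r < real s" shows "converges_L2_Hloc r T (\<lambda>e. p e 0) (\<lambda>t x. 0)"
proof (rule converges_L2_Hloc_criterion[where G = p and m = "s + 1" and ?e1.0 = e1])
 fix R :: real
 show "\<exists>C. \<forall>e\<in>E. \<forall>j\<le>s + 1. integral I (\<lambda>t. integral {-R..R} (\<lambda>x. (p e j t x)^2)) \<le> C"
 proof (rule local_bound_criterion[OF p_C0s])
  show "integral {-R..R} (\<lambda>x. (p e j t x)^2) \<le> C1" if "e \<in> E" "j \<le> s" "t \<in> I" for e j t R
   by (rule integral_square_le[OF C0_slice_x[OF p_C0s[OF that(1)] that(3)] p_L2s[OF that] C1]) (use that in simp)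
  show "integral I (\<lambda>t. integral {-R..R} (\<lambda>x. (p e (s + 1) t x)^2)) \<le> C1" if "e \<in> E" for e R
   by (rule dissipation_bound[where g = "\<lambda>e. p e (s + 1)", OF that p_C0s[OF that]]) auto
 qed
 have "((\<lambda>e. integral I (\<lambda>t. integral {- \<bar>R\<bar>..\<bar>R\<bar>} (\<lambda>x. (p e 0 t x)^2))) \<longlongrightarrow> 0) (at_right 0)" by (rule local_L2_decay(1)) simp
 thus "((\<lambda>e. integral I (\<lambda>t. integral {-R..R} (\<lambda>x. (p e 0 t x - 0)^2))) \<longlongrightarrow> 0) (at_right 0)"
  by (cases "R \<ge> 0") auto
qed (use assms pos p_dxs p_C0s C0_const in auto)

lemma local_L2_conv_if_uniform:
 assumes g: "\<And>e. e \<in> E ==> C_strip 0 T (g e)"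
  and u: "\<And>\<eta>. \<eta> > 0 ==> \<exists>e2\<in>E. \<forall>e\<in>{0<..e2}. \<forall>t\<in>I. \<forall>x. \<bar>g e t x\<bar> \<le> \<eta>"
 shows "((\<lambda>e. integral I (\<lambda>t. integral {-R..R} (\<lambda>x. (g e t x)^2))) \<longlongrightarrow> 0) (at_right 0)"
proof (rule tendstoI)
 fix r :: real assume r: "r > 0"
 define \<eta> where "\<eta> = sqrt (r / (T * (2 * \<bar>R\<bar> + 1)))"
 have \<eta>: "\<eta> > 0" "\<eta>^2 = r / (T * (2 * \<bar>R\<bar> + 1))" using r pos by (auto simp: \<eta>_def)
 obtain e2 where e2: "e2 \<in> E" "\<And>e t x. e \<in> {0<..e2} ==> t \<in> I ==> \<bar>g e t x\<bar> \<le> \<eta>" using u[OF \<eta>(1)] by blast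
 show "\<forall>\<^sub>F e in at_right 0. dist (integral I (\<lambda>t. integral {-R..R} (\<lambda>x. (g e t x)^2))) 0 < r"
  unfolding eventually_at_right_field
 proof (intro exI[of _ e2] conjI allI impI)
  fix e assume "0 < e" "e < e2"
  hence e: "e \<in> {0<..e2}" "e \<in> E" using e2(1) by auto
  have gC: "C_strip 0 T (\<lambda>t x. (g e t x)^2)" by (intro C0_intros g e)
  have nn: "0 \<le> integral {-R..R} (\<lambda>x. (g e t x)^2)" if "t \<in> I" for t
   by (rule integral_nonneg) (auto intro: integrable_continuous_real C0_slice_x[OF gC that])
  have "integral I (\<lambda>t. integral {-R..R} (\<lambda>x. (g e t x)^2)) \<le> integral I (\<lambda>t. 2 * \<bar>R\<bar> * \<eta>^2)"
  proof (rule integral_mono_continuous[OF C0_space_integral[OF gC] continuous_on_const])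
   fix t assume t: "t \<in> I"
   have "integral {-R..R} (\<lambda>x. (g e t x)^2) \<le> integral {-R..R} (\<lambda>x. \<eta>^2)"
    by (rule integral_mono_continuous[OF C0_slice_x[OF gC t] continuous_on_const square_mono_abs[OF e2(2)[OF e(1) t]]])
   also have "\<dots> = max 0 (2 * R) * \<eta>^2" by (cases "R \<ge> 0") auto
   also have "\<dots> \<le> 2 * \<bar>R\<bar> * \<eta>^2" by (intro mult_right_mono) auto
   finally show "integral {-R..R} (\<lambda>x. (g e t x)^2) \<le> 2 * \<bar>R\<bar> * \<eta>^2" .
  qed
  also have "\<dots> = r * (2 * \<bar>R\<bar> / (2 * \<bar>R\<bar> + 1))" unfolding \<eta>(2) using pos by simp
  also have "\<dots> < r * 1" using r by (intro mult_strict_left_mono) (auto simp: field_simps)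
  finally have "integral I (\<lambda>t. integral {-R..R} (\<lambda>x. (g e t x)^2)) < r" by simp
  moreover have "0 \<le> integral I (\<lambda>t. integral {-R..R} (\<lambda>x. (g e t x)^2))"
   by (rule integral_nonneg[OF integrable_continuous_real[OF C0_space_integral[OF gC]] nn])
  ultimately show "dist (integral I (\<lambda>t. integral {-R..R} (\<lambda>x. (g e t x)^2))) 0 < r" by simp
 qed (use e2 in auto)
qed

lemma convergence_\<theta>: assumes "r < real s" shows "converges_L2_Hloc r T (\<lambda>e. \<theta> e 0) (\<Theta> 0)"
proof (rule converges_L2_Hloc_criterion[where G = \<theta> and m = "s + 1" and ?e1.0 = e1])
 have b: "integral {-R..R} (\<lambda>x. (\<theta> e j t x)^2) \<le> C1 + 2 * \<bar>R\<bar> * M^2" if e: "e \<in> E" and j: "j \<le> s + 1" and t: "t \<in> I" for e j t R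
 proof (cases "j = 0")
  case True
  have "integral {-R..R} (\<lambda>x. (\<theta> e 0 t x)^2) \<le> integral {-R..R} (\<lambda>x. M^2)"
   by (rule integral_mono_continuous[OF _ continuous_on_const square_mono_abs[OF \<theta>_bound[OF e _ t]]])
    (auto intro!: continuous_on_power C0_slice_x[OF \<theta>_C0[OF e] t])
  also have "\<dots> = max 0 (2 * R) * M^2" by (cases "R \<ge> 0") auto
  also have "\<dots> \<le> 2 * \<bar>R\<bar> * M^2" by (intro mult_right_mono) auto
  finally show ?thesis using True C1 by simp
 next
  case False
  have "integral {-R..R} (\<lambda>x. (\<theta> e j t x)^2) \<le> C1"
   by (rule integral_square_le[OF C0_slice_x[OF \<theta>_C0s[OF e j] t] \<theta>_L2s[OF e _ j t] C1]) (use False in simp)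
  moreover have "0 \<le> 2 * \<bar>R\<bar> * M^2" by simp
  ultimately show ?thesis by linarith
 qed
 fix R :: real
 show "\<exists>C. \<forall>e\<in>E. \<forall>j\<le>s + 1. integral I (\<lambda>t. integral {-R..R} (\<lambda>x. (\<theta> e j t x)^2)) \<le> C"
 proof (rule local_bound_criterion[OF \<theta>_C0s])
  show "integral {-R..R} (\<lambda>x. (\<theta> e j t x)^2) \<le> C1 + 2 * \<bar>R\<bar> * M^2" if "e \<in> E" "j \<le> s" "t \<in> I" for e j t R
   by (rule b) (use that in auto)
  show "integral I (\<lambda>t. integral {-R..R} (\<lambda>x. (\<theta> e (s + 1) t x)^2)) \<le> T * (C1 + 2 * \<bar>R\<bar> * M^2)" if e: "e \<in> E" for e R
  proof -
   have gC: "C_strip 0 T (\<lambda>t x. (\<theta> e (s + 1) t x)^2)" by (intro C0_intros \<theta>_C0s e) simp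
   have "integral I (\<lambda>t. integral {-R..R} (\<lambda>x. (\<theta> e (s + 1) t x)^2)) \<le> integral I (\<lambda>t. C1 + 2 * \<bar>R\<bar> * M^2)"
    by (rule integral_mono_continuous[OF C0_space_integral[OF gC] continuous_on_const b[OF e]]) auto
   thus ?thesis using pos by simp
  qed
 qed
 show "((\<lambda>e. integral I (\<lambda>t. integral {-R..R} (\<lambda>x. (\<theta> e 0 t x - \<Theta> 0 t x)^2))) \<longlongrightarrow> 0) (at_right 0)"
 proof (rule local_L2_conv_if_uniform)
  show "C_strip 0 T (\<lambda>t x. \<theta> e 0 t x - \<Theta> 0 t x)" if "e \<in> E" for e
   by (rule C0_diff[OF \<theta>_C0[OF that] \<Theta>_C0]) auto
  show "\<exists>e2\<in>E. \<forall>e\<in>{0<..e2}. \<forall>t\<in>I. \<forall>x. \<bar>\<theta> e 0 t x - \<Theta> 0 t x\<bar> \<le> \<eta>" if "\<eta> > 0" for \<eta>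
   by (rule \<Theta>_conv[OF _ that, of 0]) (simp, blast)
 qed
 show "C_strip 0 T (\<Theta> 0)" by (rule \<Theta>_C0) simp
qed (use assms pos \<theta>_dxs \<theta>_C0s in auto)

text \<open>The error u - U is the sum of v, which tends to 0 in local L^2 by the sideways estimate,
  and of u - v - U, which tends to 0 uniformly.\<close>

lemma convergence_u: assumes "r < real s" shows "converges_L2_Hloc r T (\<lambda>e. u e 0) U"
proof (rule converges_L2_Hloc_criterion[where G = u and m = "s + 1" and ?e1.0 = e1])
 fix R :: real
 show "\<exists>C. \<forall>e\<in>E. \<forall>j\<le>s + 1. integral I (\<lambda>t. integral {-R..R} (\<lambda>x. (u e j t x)^2)) \<le> C"
 proof (rule local_bound_criterion[OF u_C0s])
  show "integral {-R..R} (\<lambda>x. (u e j t x)^2) \<le> C1" if "e \<in> E" "j \<le> s" "t \<in> I" for e j t R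
   by (rule integral_square_le[OF C0_slice_x[OF u_C0s[OF that(1)] that(3)] u_L2s[OF that] C1]) (use that in simp)
  show "integral I (\<lambda>t. integral {-R..R} (\<lambda>x. (u e (s + 1) t x)^2)) \<le> C1" if "e \<in> E" for e R
   by (rule dissipation_bound[where g = "\<lambda>e. u e (s + 1)", OF that u_C0s[OF that]]) auto
 qed
 define w where "w e t x = u e 0 t x - v e t x - U t x" for e t x
 define L where "L g = integral I (\<lambda>t. integral {-R..R} (\<lambda>x. (g t x)^2))" for g :: field
 have wC: "C_strip 0 T (w e)" if "e \<in> E" for e unfolding w_def[abs_def] by (intro C0_intros u_C0 C0s U_C0 that) simp
 have 1: "((\<lambda>e. L (w e)) \<longlongrightarrow> 0) (at_right 0)" unfolding L_def
  by (rule local_L2_conv_if_uniform[OF wC]) (use u_minus_v_conv in \<open>auto simp: w_def\<close>)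
 have "((\<lambda>e. integral I (\<lambda>t. integral {- \<bar>R\<bar>..\<bar>R\<bar>} (\<lambda>x. (v e t x)^2))) \<longlongrightarrow> 0) (at_right 0)" by (rule local_L2_decay(2)) simp
 hence 2: "((\<lambda>e. L (v e)) \<longlongrightarrow> 0) (at_right 0)" unfolding L_def by (cases "R \<ge> 0") auto
 have "((\<lambda>e. 2 * L (v e) + 2 * L (w e)) \<longlongrightarrow> 2 * 0 + 2 * 0) (at_right 0)" by (intro tendsto_intros 1 2)
 hence lim: "((\<lambda>e. 2 * L (v e) + 2 * L (w e)) \<longlongrightarrow> 0) (at_right 0)" by simp
 show "((\<lambda>e. integral I (\<lambda>t. integral {-R..R} (\<lambda>x. (u e 0 t x - U t x)^2))) \<longlongrightarrow> 0) (at_right 0)"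
 proof (rule tendsto_sandwich[OF _ _ tendsto_const lim])
  show "\<forall>\<^sub>F e in at_right 0. 0 \<le> integral I (\<lambda>t. integral {-R..R} (\<lambda>x. (u e 0 t x - U t x)^2))"
   using eventually_in
  proof eventually_elim
   case (elim e)
   have c: "C_strip 0 T (\<lambda>t x. (u e 0 t x - U t x)^2)" by (intro C0_intros u_C0 U_C0 elim) simp
   show ?case
    by (intro integral_nonneg integrable_continuous_real C0_space_integral[OF c] C0_slice_x[OF c]) auto
  qed
  show "\<forall>\<^sub>F e in at_right 0. integral I (\<lambda>t. integral {-R..R} (\<lambda>x. (u e 0 t x - U t x)^2)) \<le> 2 * L (v e) + 2 * L (w e)"
   using eventually_in
  proof eventually_elim
   case (elim e)
   have c: "C_strip 0 T (\<lambda>t x. (u e 0 t x - U t x)^2)" "C_strip 0 T (\<lambda>t x. (v e t x)^2)" "C_strip 0 T (\<lambda>t x. (w e t x)^2)"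
    by (intro C0_intros u_C0 U_C0 C0s wC elim; simp)+
   have "integral I (\<lambda>t. integral {-R..R} (\<lambda>x. (u e 0 t x - U t x)^2))
    \<le> integral I (\<lambda>t. 2 * integral {-R..R} (\<lambda>x. (v e t x)^2) + 2 * integral {-R..R} (\<lambda>x. (w e t x)^2))"
   proof (rule integral_mono_continuous)
    fix t assume t: "t \<in> I"
    have "integral {-R..R} (\<lambda>x. (u e 0 t x - U t x)^2) \<le> integral {-R..R} (\<lambda>x. 2 * (v e t x)^2 + 2 * (w e t x)^2)"
    proof (rule integral_mono_continuous[OF C0_slice_x[OF c(1) t]])
     show "continuous_on {-R..R} (\<lambda>x. 2 * (v e t x)^2 + 2 * (w e t x)^2)"
      by (intro continuous_on_add continuous_on_mult_left C0_slice_x[OF c(2) t] C0_slice_x[OF c(3) t])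
     fix x
     have "u e 0 t x - U t x = v e t x + w e t x" by (simp add: w_def)
     thus "(u e 0 t x - U t x)^2 \<le> 2 * (v e t x)^2 + 2 * (w e t x)^2"
      using sum_squares_bound[of "v e t x" "w e t x"] by (simp add: power2_sum)
    qed
    also have "\<dots> = 2 * integral {-R..R} (\<lambda>x. (v e t x)^2) + 2 * integral {-R..R} (\<lambda>x. (w e t x)^2)"
     by (subst integral_add, (intro integrable_continuous_real continuous_on_mult_left C0_slice_x[OF c(2) t] C0_slice_x[OF c(3) t])+) (simp only: integral_mult_right)
    finally show "integral {-R..R} (\<lambda>x. (u e 0 t x - U t x)^2) \<le> 2 * integral {-R..R} (\<lambda>x. (v e t x)^2) + 2 * integral {-R..R} (\<lambda>x. (w e t x)^2)" .
   qed (intro continuous_on_add continuous_on_mult_left C0_space_integral c)+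
   also have "\<dots> = 2 * L (v e) + 2 * L (w e)" unfolding L_def
    by (subst integral_add, (intro integrable_continuous_real continuous_on_mult_left C0_space_integral c)+) (simp only: integral_mult_right)
   finally show ?case .
  qed
 qed
qed (use assms pos u_dxs u_C0s U_C0 in auto)

end

section \<open>From the hypotheses on solutions and data to the limit\<close>

theorem theorem1p9:
  fixes \<kappa> \<mu> \<theta>m \<theta>p a_lo a_hi b_lo b_hi C\<^sub>0 T\<^sub>0 \<epsilon>\<^sub>0 C\<^sub>1 \<sigma> C :: real
    and s :: nat
    and \<Xi> :: "real \<Rightarrow> real"
    and pe_in ue_in \<theta>e_in :: "real \<Rightarrow> real \<Rightarrow> real"
    and pe ue \<theta>e :: "real \<Rightarrow> real \<Rightarrow> real \<Rightarrow> real"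
    and p_in u_in \<theta>_in w_in :: "real \<Rightarrow> real"
  assumes "\<kappa> > 0" and "\<mu> > 0" and "s \<ge> 4"
    and "a_lo > 0" and "a_hi > 0" and "b_lo > 0" and "b_hi > 0"
    and profile: "self_similar_profile \<kappa> (exp (- \<theta>m)) (exp (- \<theta>p)) \<Xi>"
    and data_p: "\<And>\<epsilon> x. \<epsilon> \<in> {0<..1} \<Longrightarrow>
          a_lo \<le> exp (- \<epsilon> * pe_in \<epsilon> x) \<and> exp (- \<epsilon> * pe_in \<epsilon> x) \<le> a_hi"
    and data_\<theta>: "\<And>\<epsilon> x. \<epsilon> \<in> {0<..1} \<Longrightarrow> b_lo \<le> exp (\<theta>e_in \<epsilon> x) \<and> exp (\<theta>e_in \<epsilon> x) \<le> b_hi"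
    and data_bound: "\<And>\<epsilon>. \<epsilon> \<in> {0<..1} \<Longrightarrow>
          initial_bound s \<epsilon> \<kappa> \<mu> (theta_wave \<Xi>) (pe_in \<epsilon>) (ue_in \<epsilon>) (\<theta>e_in \<epsilon>) C\<^sub>0"
    and "T\<^sub>0 > 0" and "\<epsilon>\<^sub>0 > 0" and "C\<^sub>1 > 0"
    and solution: "\<And>\<epsilon>. \<epsilon> \<in> {0<..\<epsilon>\<^sub>0} \<Longrightarrow>
          smooth_solution s \<epsilon> \<kappa> \<mu> \<theta>m \<theta>p T\<^sub>0 (pe_in \<epsilon>) (ue_in \<epsilon>) (\<theta>e_in \<epsilon>) (pe \<epsilon>) (ue \<epsilon>) (\<theta>e \<epsilon>) \<and>
          (\<forall>t\<in>{0..T\<^sub>0}. Heps_sq s \<epsilon> T\<^sub>0 (theta_wave \<Xi>) (pe \<epsilon>) (ue \<epsilon>) (\<theta>e \<epsilon>) t \<le> ennreal C\<^sub>1)"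
    and solution_unique: "\<And>\<epsilon> p u \<theta>. \<epsilon> \<in> {0<..\<epsilon>\<^sub>0} \<Longrightarrow>
          smooth_solution s \<epsilon> \<kappa> \<mu> \<theta>m \<theta>p T\<^sub>0 (pe_in \<epsilon>) (ue_in \<epsilon>) (\<theta>e_in \<epsilon>) p u \<theta> \<Longrightarrow>
          \<forall>t\<in>{0..T\<^sub>0}. Heps_sq s \<epsilon> T\<^sub>0 (theta_wave \<Xi>) p u \<theta> t \<le> ennreal C\<^sub>1 \<Longrightarrow>
          \<forall>t\<in>{0..T\<^sub>0}. \<forall>x. p t x = pe \<epsilon> t x \<and> u t x = ue \<epsilon> t x \<and> \<theta> t x = \<theta>e \<epsilon> t x"
    and conv_p: "converges_H s pe_in p_in"
    and conv_u: "converges_H s ue_in u_in"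
    and conv_\<theta>: "converges_H s (\<lambda>\<epsilon> x. \<theta>e_in \<epsilon> x - theta_wave \<Xi> 0 x) (\<lambda>x. \<theta>_in x - theta_wave \<Xi> 0 x)"
    and "\<sigma> > 0" and "C > 0"
    and decay: "\<And>x. x \<ge> 1 \<Longrightarrow> \<bar>\<theta>_in x - \<theta>p\<bar> \<le> C * x powr (- 1 - \<sigma>)"
    and w_in: "w_in = (\<lambda>x. 1 / 2 * \<kappa> * exp (\<theta>_in x) * weak_deriv \<theta>_in x)"
  shows "\<exists>u \<theta>.
           limit_solution s \<kappa> \<mu> T\<^sub>0 (theta_wave \<Xi>) w_in \<theta>_in u \<theta> \<and>
           (\<forall>u' \<theta>'. limit_solution s \<kappa> \<mu> T\<^sub>0 (theta_wave \<Xi>) w_in \<theta>_in u' \<theta>' \<longrightarrow>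
              (\<forall>t\<in>{0..T\<^sub>0}. \<forall>x. u' t x = u t x \<and> \<theta>' t x = \<theta> t x)) \<and>
           (\<forall>s'. s' < real s \<longrightarrow>
              converges_L2_Hloc s' T\<^sub>0 pe (\<lambda>t x. 0) \<and>
              converges_L2_Hloc s' T\<^sub>0 ue u \<and>
              converges_L2_Hloc s' T\<^sub>0 \<theta>e \<theta>)"
proof -
 \<comment> \<open>The estimates of the family use e \<le> 1 throughout, while
   \<open>\<epsilon>\<^sub>0\<close> may be larger.\<close>
 define e1 where "e1 = min 1 \<epsilon>\<^sub>0"
 have e1: "0 < e1" "e1 \<le> 1" "\<And>\<epsilon>. \<epsilon> \<in> {0<..e1} \<Longrightarrow> \<epsilon> \<in> {0<..\<epsilon>\<^sub>0}" using \<open>\<epsilon>\<^sub>0 > 0\<close> by (auto simp: e1_def)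
 define f where "f = theta_wave \<Xi> 0"
 \<comment> \<open>Self-similarity: the wave at time t is the dilation of the wave at time 0, which
   is the form in which all later estimates use it.\<close>
 have tw: "theta_wave \<Xi> = (\<lambda>t x. f (x / sqrt (1 + t)))" by (simp add: f_def theta_wave_def)
 have twc: "continuous_on UNIV (theta_wave \<Xi> t)" for t by (rule theta_wave_profile(1)[OF profile]) auto
 obtain B where B: "B \<ge> 0" "\<And>t x. \<bar>theta_wave \<Xi> t x\<bar> \<le> B" using theta_wave_profile(2)[OF profile] by auto
 obtain f' where f': "\<And>x. (f has_real_derivative f' x) (at x)" "continuous_on UNIV f'"
  using theta_wave_profile(3)[OF profile] unfolding f_def by auto
 have sm: "C_strip (s + 2) T\<^sub>0 (pe \<epsilon>)" "C_strip (s + 2) T\<^sub>0 (ue \<epsilon>)" "C_strip (s + 2) T\<^sub>0 (\<theta>e \<epsilon>)"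
  "solves_system \<epsilon> \<kappa> \<mu> T\<^sub>0 (pe \<epsilon>) (ue \<epsilon>) (\<theta>e \<epsilon>)" "\<And>x. \<theta>e \<epsilon> 0 x = \<theta>e_in \<epsilon> x"
  if "\<epsilon> \<in> {0<..e1}" for \<epsilon>
  using solution[OF e1(3)[OF that]] by (auto simp: smooth_solution_def)
 have H: "Heps_sq s \<epsilon> T\<^sub>0 (theta_wave \<Xi>) (pe \<epsilon>) (ue \<epsilon>) (\<theta>e \<epsilon>) t \<le> ennreal C\<^sub>1" if "\<epsilon> \<in> {0<..e1}" "t \<in> {0..T\<^sub>0}" for \<epsilon> t
  using solution[OF e1(3)[OF that(1)]] that(2) by blast
 note L2 = Heps_sqD[OF H]
 let ?p = "\<lambda>\<epsilon> j. (dx ^^ j) (pe \<epsilon>)" and ?u = "\<lambda>\<epsilon> j. (dx ^^ j) (ue \<epsilon>)" and ?\<theta> = "\<lambda>\<epsilon> j. (dx ^^ j) (\<theta>e \<epsilon>)"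
 obtain M where "singular_family \<kappa> \<mu> T\<^sub>0 e1 M ?p ?u ?\<theta> (\<lambda>\<epsilon>. dt T\<^sub>0 (pe \<epsilon>)) (\<lambda>\<epsilon>. dt T\<^sub>0 (ue \<epsilon>)) (\<lambda>\<epsilon>. dt T\<^sub>0 (\<theta>e \<epsilon>))"
  using singular_family_of_solutions[OF \<open>\<kappa> > 0\<close> \<open>\<mu> > 0\<close> \<open>T\<^sub>0 > 0\<close> e1(1,2) \<open>s \<ge> 4\<close> \<open>C\<^sub>1 > 0\<close> _ sm(4) H twc B(2) B(1)] sm(1-3)
  by blast
 then interpret family: singular_family \<kappa> \<mu> T\<^sub>0 e1 M ?p ?u ?\<theta> "\<lambda>\<epsilon>. dt T\<^sub>0 (pe \<epsilon>)" "\<lambda>\<epsilon>. dt T\<^sub>0 (ue \<epsilon>)" "\<lambda>\<epsilon>. dt T\<^sub>0 (\<theta>e \<epsilon>)" .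
 have d: "Hsq s (\<lambda>x. \<theta>_in x - f x) < \<infinity>" using conv_\<theta> by (simp add: converges_H_def f_def)
 have "locally_integrable (\<lambda>x. \<theta>_in x - f x)" using d by (auto simp: Hsq_def split: if_splits)
 from locally_integrable_add[OF this continuous_imp_locally_integrable[OF twc[of 0]]]
 have in_li: "locally_integrable \<theta>_in" by (simp add: f_def)
 have ev: "\<forall>\<^sub>F \<epsilon> in at_right 0. \<epsilon> \<in> {0<..e1}"
  unfolding eventually_at_right_field using e1 by (intro exI[of _ e1]) auto
 have in_conv: "((\<lambda>\<epsilon>. L2sq (\<lambda>x. ?\<theta> \<epsilon> 0 0 x - \<theta>_in x)) \<longlongrightarrow> 0) (at_right 0)"
 proof (rule tendsto_sandwich[OF _ _ tendsto_const])
  show "((\<lambda>\<epsilon>. Hsq s (\<lambda>x. (\<theta>e_in \<epsilon> x - theta_wave \<Xi> 0 x) - (\<theta>_in x - theta_wave \<Xi> 0 x))) \<longlongrightarrow> 0) (at_right 0)"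
   using conv_\<theta> by (simp add: converges_H_def)
  show "\<forall>\<^sub>F \<epsilon> in at_right 0. L2sq (\<lambda>x. ?\<theta> \<epsilon> 0 0 x - \<theta>_in x) \<le> Hsq s (\<lambda>x. (\<theta>e_in \<epsilon> x - theta_wave \<Xi> 0 x) - (\<theta>_in x - theta_wave \<Xi> 0 x))"
   using ev
  proof eventually_elim
   case (elim \<epsilon>)
   show ?case using L2sq_le_Hsq[of "\<lambda>x. \<theta>e_in \<epsilon> x - \<theta>_in x" s] by (simp add: sm(5)[OF elim])
  qed
 qed simp
 \<comment> \<open>The Cauchy property of the initial temperatures comes from the L^2 part of the
   assumed Sobolev convergence; the wave cancels in the difference.\<close>
 interpret limit: singular_limit \<kappa> \<mu> T\<^sub>0 e1 M ?p ?u ?\<theta> "\<lambda>\<epsilon>. dt T\<^sub>0 (pe \<epsilon>)" "\<lambda>\<epsilon>. dt T\<^sub>0 (ue \<epsilon>)" "\<lambda>\<epsilon>. dt T\<^sub>0 (\<theta>e \<epsilon>)"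
  by unfold_locales (rule family.init_Cauchy_if_L2_convergent[OF locally_integrable_measurable[OF in_li] in_conv])
 have t0: "(0::real) \<in> {0..T\<^sub>0}" using \<open>T\<^sub>0 > 0\<close> by simp
 have \<Theta>_f: "L2sq (\<lambda>x. limit.\<Theta> 0 t x - f (x / sqrt (1 + t))) \<le> ennreal C\<^sub>1" if t: "t \<in> {0..T\<^sub>0}" for t
 proof (rule limit.L2sq_limit[OF t _ _ eventually_mono[OF ev]])
  show "(\<lambda>x. f (x / sqrt (1 + t))) \<in> borel_measurable borel"
   using borel_measurable_continuous_onI[OF twc[of t]] by (simp add: tw)
  show "L2sq (\<lambda>x. ?\<theta> \<epsilon> 0 t x - f (x / sqrt (1 + t))) \<le> ennreal C\<^sub>1" if "\<epsilon> \<in> {0<..e1}" for \<epsilon>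
   using L2(3)[OF that t] by (simp add: tw)
 qed simp
 \<comment> \<open>The decay is assumed for \<open>\<theta>_in\<close>, with which the continuous
   limit agrees only almost everywhere at time 0; continuity carries the inequality to every x \<ge>
   1.\<close>
 have dec: "\<bar>limit.\<Theta> 0 0 x - \<theta>p\<bar> \<le> C * x powr (- 1 - \<sigma>)" if "x \<ge> 1" for x
 proof (rule AE_imp_le_everywhere[where f = "\<lambda>x. \<bar>limit.\<Theta> 0 0 x - \<theta>p\<bar>" and g = "\<lambda>x. \<bar>\<theta>_in x - \<theta>p\<bar>" and h = "\<lambda>x. C * x powr (- 1 - \<sigma>)", OF _ decay])
  show "AE x in lborel. \<bar>limit.\<Theta> 0 0 x - \<theta>p\<bar> = \<bar>\<theta>_in x - \<theta>p\<bar>"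
   using limit.\<Theta>_initial_AE[OF locally_integrable_measurable[OF in_li] in_conv] by eventually_elim simp
  show "continuous_on {1..} (\<lambda>x. \<bar>limit.\<Theta> 0 0 x - \<theta>p\<bar>)"
   by (intro continuous_on_rabs continuous_on_diff continuous_on_const C0_slice_x[OF limit.\<Theta>_C0 t0]) simp
  show "continuous_on {1..} (\<lambda>x. C * x powr (- 1 - \<sigma>))" by (intro continuous_intros) auto
 qed (use that in auto)
 obtain K where K: "\<And>t b. t \<in> {0..T\<^sub>0} \<Longrightarrow> integral {1..b} (\<lambda>x. (limit.\<Theta> 0 t x - \<theta>p)^2) \<le> K"
  using limit.half_line_L2_bound[OF twc[of 0, folded f_def] less_imp_le[OF \<open>C\<^sub>1 > 0\<close>] \<open>\<sigma> > 0\<close> \<Theta>_f dec] by blast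
 \<comment> \<open>One constant serves the pointwise decay and the L^2 bound, hence the maximum of C
   and K.\<close>
 interpret decaying: singular_decay \<kappa> \<mu> T\<^sub>0 e1 M ?p ?u ?\<theta> "\<lambda>\<epsilon>. dt T\<^sub>0 (pe \<epsilon>)" "\<lambda>\<epsilon>. dt T\<^sub>0 (ue \<epsilon>)" "\<lambda>\<epsilon>. dt T\<^sub>0 (\<theta>e \<epsilon>)" \<theta>p \<sigma> "max C K"
 proof unfold_locales
  show "\<bar>limit.\<Theta> 0 0 x - \<theta>p\<bar> \<le> max C K * x powr (- 1 - \<sigma>)" if "x \<ge> 1" for x
   by (rule order_trans[OF dec[OF that]]) (intro mult_right_mono, auto)
  show "integral {1..b} (\<lambda>x. (limit.\<Theta> 0 t x - \<theta>p)^2) \<le> max C K" if "t \<in> {0..T\<^sub>0}" for t b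
   using K[OF that, of b] by simp
 qed (rule \<open>\<sigma> > 0\<close>)
 interpret sol: singular_solution \<kappa> \<mu> T\<^sub>0 e1 M ?p ?u ?\<theta> "\<lambda>\<epsilon>. dt T\<^sub>0 (pe \<epsilon>)" "\<lambda>\<epsilon>. dt T\<^sub>0 (ue \<epsilon>)" "\<lambda>\<epsilon>. dt T\<^sub>0 (\<theta>e \<epsilon>)" \<theta>p \<sigma> "max C K"
  s "C\<^sub>1" B f f' \<theta>_in
 proof unfold_locales
  show "1 \<le> s" using \<open>s \<ge> 4\<close> by simp
  show "C\<^sub>1 \<ge> 0" using \<open>C\<^sub>1 > 0\<close> by simp
  fix \<epsilon> assume e: "\<epsilon> \<in> {0<..e1}"
  show "C_strip 0 T\<^sub>0 (?p \<epsilon> j)" "C_strip 0 T\<^sub>0 (?u \<epsilon> j)" "C_strip 0 T\<^sub>0 (?\<theta> \<epsilon> j)" if "j \<le> s + 1" for j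
   by (rule C_strip_dx_pow_C0[OF sm(1)[OF e]] C_strip_dx_pow_C0[OF sm(2)[OF e]] C_strip_dx_pow_C0[OF sm(3)[OF e]], use that in simp)+
  \<comment> \<open>Evaluating the norm at the final time yields the dissipation over the whole
    interval.\<close>
  show "(\<integral>\<^sup>+t\<in>{0..T\<^sub>0}. (L2sq (?p \<epsilon> (s + 1) t) + L2sq (?u \<epsilon> (s + 1) t)) \<partial>lborel) \<le> ennreal C\<^sub>1"
   using L2(5)[OF e, of T\<^sub>0 s] \<open>T\<^sub>0 > 0\<close> unfolding Suc_eq_plus1[symmetric] by simp
  fix t assume t: "t \<in> {0..T\<^sub>0}"
  show "(?p \<epsilon> j t has_real_derivative ?p \<epsilon> (Suc j) t x) (at x)" "(?u \<epsilon> j t has_real_derivative ?u \<epsilon> (Suc j) t x) (at x)"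
   "(?\<theta> \<epsilon> j t has_real_derivative ?\<theta> \<epsilon> (Suc j) t x) (at x)" if "j < s + 1" for j x
   by (rule C_strip_dx_pow_derivative[OF sm(1)[OF e] _ t] C_strip_dx_pow_derivative[OF sm(2)[OF e] _ t] C_strip_dx_pow_derivative[OF sm(3)[OF e] _ t], use that in simp)+
  show "L2sq (?p \<epsilon> j t) \<le> ennreal C\<^sub>1" "L2sq (?u \<epsilon> j t) \<le> ennreal C\<^sub>1" if "j \<le> s" for j
   by (rule L2(1)[OF e t that], rule L2(2)[OF e t that])
  show "L2sq (?\<theta> \<epsilon> j t) \<le> ennreal C\<^sub>1" if "1 \<le> j" "j \<le> s + 1" for j by (rule L2(4)[OF e t that])
  show "L2sq (\<lambda>x. ?\<theta> \<epsilon> 0 t x - f (x / sqrt (1 + t))) \<le> ennreal C\<^sub>1" using L2(3)[OF e t] by (simp add: tw)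
 next
  show "(f has_real_derivative f' x) (at x)" for x by (rule f')
  show "\<bar>f x\<bar> \<le> B" for x unfolding f_def by (rule B)
 qed (rule in_li d in_conv f')+
 show ?thesis
 proof (rule exI[of _ sol.U], rule exI[of _ "limit.\<Theta> 0"], intro conjI allI impI ballI)
  show "limit_solution s \<kappa> \<mu> T\<^sub>0 (theta_wave \<Xi>) w_in \<theta>_in sol.U (limit.\<Theta> 0)"
   unfolding tw w_in by (rule sol.limit_solution)
 next
  fix u' \<theta>' t x assume "limit_solution s \<kappa> \<mu> T\<^sub>0 (theta_wave \<Xi>) w_in \<theta>_in u' \<theta>'" "t \<in> {0..T\<^sub>0}"
  from sol.limit_solution_unique[OF this[unfolded tw], of x]
  show "u' t x = sol.U t x" "\<theta>' t x = limit.\<Theta> 0 t x" by simp_all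
 next
  fix r assume r: "r < real s"
  show "converges_L2_Hloc r T\<^sub>0 pe (\<lambda>t x. 0)" "converges_L2_Hloc r T\<^sub>0 ue sol.U" "converges_L2_Hloc r T\<^sub>0 \<theta>e (limit.\<Theta> 0)"
   using sol.convergence_p[OF r] sol.convergence_u[OF r] sol.convergence_\<theta>[OF r] by simp_all
 qed
qed

end
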